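(* Let $A_2$ denote the path algebra of the quiver $\bullet_1\to\bullet_2$ over a field $\mathbb{K}$. If $\mathcal{D}^{\leq 0}\subset\mathcal{D}^b(A_2)$ is the aisle of a t-structure which is compatible with the recollement $\mathcal{R}_1$ or with the recollement $\mathcal{R}_2$, then it can be described by one of the following types: (1) it is trivial (i.e., equal to $0$ or to $\mathcal{D}^b(A_2)$); (2) it is a shift of the standard aisle; (3) its indecomposable objects are (some or all) shifts of $P_1$; (4) its indecomposable objects are (some or all) shifts of $S_2$; (5) its indecomposable objects are (some or all) shifts of $P_2$; (6) its indecomposable objects are the union of the indecomposable objects of a shift of the standard aisle with (some or all) shifts of $P_1$; (7) its indecomposable objects are the union of the indecomposable objects of a shift of the standard aisle with (some or all) shifts of $S_2$; (8) its indecomposable objects are the union of the indecomposable objects of a shift of the standard aisle with (some or all) shifts of $P_2$ and exactly one extra shift of $S_2$ (i.e. exactly one shift of $S_2$ not already in that shift of the standard aisle). Furthermore these are all the aisles of $\mathcal{D}^b(A_2)$: every aisle of a t-structure in $\mathcal{D}^b(A_2)$ is of one of the types (1)–(8).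
   Context: $\mathcal{D}^b(A)$ is the bounded derived category of finite dimensional right $A$-modules. Conventions for $A_2$: $P_r=e_rA_2$ is the indecomposable projective module at vertex $r$; paths are composed so that there is a non-split short exact sequence $0\to P_1\to P_2\to S_2\to 0$, where $P_1$ is simple projective and $S_2$ is the simple top of $P_2$. The indecomposable objects of $\mathcal{D}^b(A_2)$ are, up to isomorphism, the shifts of $P_1$, $P_2$, $S_2$. The phrase "some or all shifts of $M$" means the objects $M[k]$ with $k$ in some subset of $\mathbb{Z}$ (possibly all of $\mathbb{Z}$). Indecomposable objects are taken up to isomorphism. t-structure in a triangulated category $\mathcal{D}$: a pair $(\mathcal{D}^{\leq 0},\mathcal{D}^{\geq 0})$ of strictly full subcategories such that, with $\mathcal{D}^{\leq n}=\mathcal{D}^{\leq 0}[-n]$ and $\mathcal{D}^{\geq n}=\mathcal{D}^{\geq 0}[-n]$: $\mathcal{D}^{\leq 0}\subset\mathcal{D}^{\leq 1}$, $\mathcal{D}^{\geq 1}\subset\mathcal{D}^{\geq 0}$; $\mathrm{Hom}(X,Y)=0$ for $X\in\mathcal{D}^{\leq 0}$, $Y\in\mathcal{D}^{\geq 1}$; each $Z\in\mathcal{D}$ lies in a triangle $X\to Z\to Y\to X[1]$ with $X\in\mathcal{D}^{\leq 0}$, $Y\in\mathcal{D}^{\geq 1}$. $\mathcal{D}^{\leq 0}$ is called the aisle. The standard aisle $\mathcal{D}_0^{\leq 0}$ of $\mathcal{D}^b(A_2)$ consists of the complexes with zero cohomology in positive degrees. Recollement: a recollement of a triangulated category $\mathcal{D}$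 by triangulated categories $\mathcal{Y}$ and $\mathcal{X}$ consists of triangle functors $i_*=i_!:\mathcal{Y}\to\mathcal{D}$, $i^*,i^!:\mathcal{D}\to\mathcal{Y}$, $j^*=j^!:\mathcal{D}\to\mathcal{X}$, $j_!,j_*:\mathcal{X}\to\mathcal{D}$ such that (1) $(i^*,i_* )$, $(i_!,i^!)$, $(j_!,j^!)$, $(j^*,j_* )$ are adjoint pairs; (2) $i_*,j_*,j_!$ are full embeddings; (3) $i^!\circ j_*=0$; (4) for each $Z\in\mathcal{D}$ there are triangles $i_!i^!Z\to Z\to j_*j^*Z\to i_!i^!Z[1]$ and $j_!j^!Z\to Z\to i_*i^*Z\to j_!j^!Z[1]$. For $A=A_2$ and the vertex idempotent $e=e_r$ ($r=1,2$), $\mathcal{R}_r$ is the recollement of $\mathcal{D}^b(A)$ by $\mathcal{Y}=\mathcal{D}^b(A/AeA)$ and $\mathcal{X}=\mathcal{D}^b(eAe)$ with $j^*=-\otimes^L_AAe$, $j_!=-\otimes^L_{eAe}eA$, and $i_*$ induced by the projection $A\to A/AeA$. A t-structure is compatible with a recollement if $j_!j^*\mathcal{D}^{\leq 0}\subset\mathcal{D}^{\leq 0}$. *)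

theory Defs
  imports "Jordan_Normal_Form.Matrix"
begin

section \<open>Finite dimensional right modules over an algebra\<close>

text \<open>
  The ground field is the type \<open>'k::field\<close>, and a \<open>'k\<close>-algebra is given by a record
  of type \<open>('k, 'a) module\<close> (a ring together with a scalar multiplication by \<open>'k\<close>).

  The underlying space of a finite dimensional module is taken to be \<open>'k\<^sup>n\<close> (column vectors), so
  that every finite dimensional module is isomorphic to one of these.  The matrix \<open>act M a\<close> is the
  operator \<open>x \<mapsto> x \<cdot> a\<close>; for a \<^emph>\<open>right\<close> module it reverses products.
\<close>

record ('a, 'k) rmod =
  mdim :: nat
  act :: "'a \<Rightarrow> 'k mat"

definition right_module :: "('k::field, 'a) module \<Rightarrow> ('a, 'k) rmod \<Rightarrow> bool" where
  "right_module A M \<longleftrightarrow>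
     (\<forall>a\<in>carrier A. act M a \<in> carrier_mat (mdim M) (mdim M)) \<and>
     act M \<one>\<^bsub>A\<^esub> = 1\<^sub>m (mdim M) \<and>
     (\<forall>a\<in>carrier A. \<forall>b\<in>carrier A. act M (a \<otimes>\<^bsub>A\<^esub> b) = act M b * act M a) \<and>
     (\<forall>a\<in>carrier A. \<forall>b\<in>carrier A. act M (a \<oplus>\<^bsub>A\<^esub> b) = act M a + act M b) \<and>
     (\<forall>c. \<forall>a\<in>carrier A. act M (c \<odot>\<^bsub>A\<^esub> a) = c \<cdot>\<^sub>m act M a)"

definition mod_hom :: "('k::field, 'a) module \<Rightarrow> ('a, 'k) rmod \<Rightarrow> ('a, 'k) rmod \<Rightarrow> 'k mat set" where
  "mod_hom A M N =
     {f \<in> carrier_mat (mdim N) (mdim M). \<forall>a\<in>carrier A. f * act M a = act N a * f}"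

definition zero_mod :: "('a, 'k::field) rmod" where
  "zero_mod = \<lparr>mdim = 0, act = (\<lambda>_. 0\<^sub>m 0 0)\<rparr>"

definition sum_mod :: "('a, 'k::field) rmod \<Rightarrow> ('a, 'k) rmod \<Rightarrow> ('a, 'k) rmod" where
  "sum_mod M N = \<lparr>mdim = mdim M + mdim N,
     act = (\<lambda>a. four_block_mat (act M a) (0\<^sub>m (mdim M) (mdim N)) (0\<^sub>m (mdim N) (mdim M)) (act N a))\<rparr>"

definition projective :: "('k::field, 'a) module \<Rightarrow> ('a, 'k) rmod \<Rightarrow> bool" where
  "projective A P \<longleftrightarrow> right_module A P \<and>
     (\<forall>M N g f. right_module A M \<and> right_module A N \<and> g \<in> mod_hom A M N \<and> f \<in> mod_hom A P N \<and>
        (\<forall>y\<in>carrier_vec (mdim N). \<exists>x\<in>carrier_vec (mdim M). g *\<^sub>v x = y)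
        \<longrightarrow> (\<exists>h\<in>mod_hom A P M. g * h = f))"

section \<open>Bounded complexes\<close>

text \<open>Cochain complexes: \<open>cdif X i\<close> is the differential from degree \<open>i\<close> to degree \<open>i + 1\<close>.\<close>

record ('a, 'k) cpx =
  cobj :: "int \<Rightarrow> ('a, 'k) rmod"
  cdif :: "int \<Rightarrow> 'k mat"

abbreviation cdim :: "('a, 'k) cpx \<Rightarrow> int \<Rightarrow> nat" where
  "cdim X i \<equiv> mdim (cobj X i)"

definition cpxs :: "('k::field, 'a) module \<Rightarrow> ('a, 'k) cpx set" where
  "cpxs A = {X. (\<forall>i. right_module A (cobj X i)) \<and>
     (\<forall>i. cdif X i \<in> mod_hom A (cobj X i) (cobj X (i + 1))) \<and>
     (\<forall>i. cdif X (i + 1) * cdif X i = 0\<^sub>m (cdim X (i + 2)) (cdim X i)) \<and>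
     (\<exists>N. \<forall>i. \<bar>i\<bar> > N \<longrightarrow> cdim X i = 0)}"

definition chain_maps ::
    "('k::field, 'a) module \<Rightarrow> ('a, 'k) cpx \<Rightarrow> ('a, 'k) cpx \<Rightarrow> (int \<Rightarrow> 'k mat) set" where
  "chain_maps A X Y = {f. (\<forall>i. f i \<in> mod_hom A (cobj X i) (cobj Y i)) \<and>
     (\<forall>i. cdif Y i * f i = f (i + 1) * cdif X i)}"

definition chain_id :: "('a, 'k::field) cpx \<Rightarrow> int \<Rightarrow> 'k mat" where
  "chain_id X = (\<lambda>i. 1\<^sub>m (cdim X i))"

definition chain_zero :: "('a, 'k::field) cpx \<Rightarrow> ('a, 'k) cpx \<Rightarrow> int \<Rightarrow> 'k mat" where
  "chain_zero X Y = (\<lambda>i. 0\<^sub>m (cdim Y i) (cdim X i))"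

definition chain_comp :: "(int \<Rightarrow> 'k::field mat) \<Rightarrow> (int \<Rightarrow> 'k mat) \<Rightarrow> int \<Rightarrow> 'k mat"
    (infixl "\<circ>\<^sub>c" 70) where
  "g \<circ>\<^sub>c f = (\<lambda>i. g i * f i)"

definition homotopic ::
    "('k::field, 'a) module \<Rightarrow> ('a, 'k) cpx \<Rightarrow> ('a, 'k) cpx \<Rightarrow>
      (int \<Rightarrow> 'k mat) \<Rightarrow> (int \<Rightarrow> 'k mat) \<Rightarrow> bool" where
  "homotopic A X Y f g \<longleftrightarrow>
     (\<exists>h. (\<forall>i. h i \<in> mod_hom A (cobj X i) (cobj Y (i - 1))) \<and>
          (\<forall>i. f i - g i = cdif Y (i - 1) * h i + h (i + 1) * cdif X i))"

text \<open>The cohomology in degree \<open>i\<close> is the quotient of \<open>cocycles X i\<close> by \<open>coboundaries X i\<close>.\<close>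

definition cocycles :: "('a, 'k::field) cpx \<Rightarrow> int \<Rightarrow> 'k vec set" where
  "cocycles X i = {x \<in> carrier_vec (cdim X i). cdif X i *\<^sub>v x = 0\<^sub>v (cdim X (i + 1))}"

definition coboundaries :: "('a, 'k::field) cpx \<Rightarrow> int \<Rightarrow> 'k vec set" where
  "coboundaries X i = (\<lambda>y. cdif X (i - 1) *\<^sub>v y) ` carrier_vec (cdim X (i - 1))"

definition cohomology_zero :: "('a, 'k::field) cpx \<Rightarrow> int \<Rightarrow> bool" where
  "cohomology_zero X i \<longleftrightarrow> cocycles X i = coboundaries X i"

text \<open>The two clauses are injectivity and surjectivity of the induced map on cohomology.\<close>

definition quasi_isos ::
    "('k::field, 'a) module \<Rightarrow> ('a, 'k) cpx \<Rightarrow> ('a, 'k) cpx \<Rightarrow> (int \<Rightarrow> 'k mat) set" where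
  "quasi_isos A X Y = {f \<in> chain_maps A X Y. \<forall>i.
     (\<forall>z\<in>cocycles X i. f i *\<^sub>v z \<in> coboundaries Y i \<longrightarrow> z \<in> coboundaries X i) \<and>
     (\<forall>w\<in>cocycles Y i. \<exists>z\<in>cocycles X i. w - f i *\<^sub>v z \<in> coboundaries Y i)}"

definition shift :: "int \<Rightarrow> ('a, 'k::field) cpx \<Rightarrow> ('a, 'k) cpx" where
  "shift n X = \<lparr>cobj = (\<lambda>i. cobj X (i + n)),
     cdif = (\<lambda>i. if even n then cdif X (i + n) else - cdif X (i + n))\<rparr>"

definition zero_cpx :: "('a, 'k::field) cpx" where
  "zero_cpx = \<lparr>cobj = (\<lambda>_. zero_mod), cdif = (\<lambda>_. 0\<^sub>m 0 0)\<rparr>"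

definition stalk :: "('a, 'k::field) rmod \<Rightarrow> ('a, 'k) cpx" where
  "stalk M = \<lparr>cobj = (\<lambda>i. if i = 0 then M else zero_mod),
     cdif = (\<lambda>i. 0\<^sub>m (if i + 1 = 0 then mdim M else 0) (if i = 0 then mdim M else 0))\<rparr>"

definition sum_cpx :: "('a, 'k::field) cpx \<Rightarrow> ('a, 'k) cpx \<Rightarrow> ('a, 'k) cpx" where
  "sum_cpx X Y = \<lparr>cobj = (\<lambda>i. sum_mod (cobj X i) (cobj Y i)),
     cdif = (\<lambda>i. four_block_mat
       (cdif X i) (0\<^sub>m (cdim X (i + 1)) (cdim Y i))
       (0\<^sub>m (cdim Y (i + 1)) (cdim X i)) (cdif Y i))\<rparr>"

text \<open>The mapping cone of \<open>f : X \<rightarrow> Y\<close>, with differential \<open>(x, y) \<mapsto> (- d x, f x + d y)\<close>,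
  and the chain maps \<open>Y \<rightarrow> cone f \<rightarrow> X[1]\<close>.\<close>

definition cone :: "('a, 'k::field) cpx \<Rightarrow> ('a, 'k) cpx \<Rightarrow> (int \<Rightarrow> 'k mat) \<Rightarrow> ('a, 'k) cpx" where
  "cone X Y f = \<lparr>cobj = (\<lambda>i. sum_mod (cobj X (i + 1)) (cobj Y i)),
     cdif = (\<lambda>i. four_block_mat
       (- cdif X (i + 1)) (0\<^sub>m (cdim X (i + 2)) (cdim Y i))
       (f (i + 1)) (cdif Y i))\<rparr>"

definition cone_in :: "('a, 'k::field) cpx \<Rightarrow> ('a, 'k) cpx \<Rightarrow> int \<Rightarrow> 'k mat" where
  "cone_in X Y = (\<lambda>i. mat (cdim X (i + 1) + cdim Y i) (cdim Y i)
     (\<lambda>(r, c). if r = cdim X (i + 1) + c then 1 else 0))"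

definition cone_out :: "('a, 'k::field) cpx \<Rightarrow> ('a, 'k) cpx \<Rightarrow> int \<Rightarrow> 'k mat" where
  "cone_out X Y = (\<lambda>i. mat (cdim X (i + 1)) (cdim X (i + 1) + cdim Y i)
     (\<lambda>(r, c). if r = c then 1 else 0))"

section \<open>The bounded derived category\<close>

text \<open>
  \<open>D\<^sup>b(A)\<close> is the localisation of the homotopy category of bounded complexes at the
  quasi-isomorphisms.  Its objects are the elements of \<open>cpxs A\<close>; morphisms \<open>X \<rightarrow> Y\<close> are
  classes of roofs \<open>X \<leftarrow> Z \<rightarrow> Y\<close> whose left leg is a quasi-isomorphism, two roofs
  being identified if they are dominated by a third one (up to homotopy).
\<close>

type_synonym ('a, 'k) roof = "('a, 'k) cpx \<times> (int \<Rightarrow> 'k mat) \<times> (int \<Rightarrow> 'k mat)"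

definition roofs :: "('k::field, 'a) module \<Rightarrow> ('a, 'k) cpx \<Rightarrow> ('a, 'k) cpx \<Rightarrow> ('a, 'k) roof set" where
  "roofs A X Y = {(Z, s, f). Z \<in> cpxs A \<and> s \<in> quasi_isos A Z X \<and> f \<in> chain_maps A Z Y}"

definition roof_rel ::
    "('k::field, 'a) module \<Rightarrow> ('a, 'k) cpx \<Rightarrow> ('a, 'k) cpx \<Rightarrow> ('a, 'k) roof rel" where
  "roof_rel A X Y = {((Z, s, f), (Z', s', f')).
     (Z, s, f) \<in> roofs A X Y \<and> (Z', s', f') \<in> roofs A X Y \<and>
     (\<exists>W\<in>cpxs A. \<exists>u\<in>chain_maps A W Z. \<exists>u'\<in>chain_maps A W Z'.
        s \<circ>\<^sub>c u \<in> quasi_isos A W X \<and>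
        homotopic A W X (s \<circ>\<^sub>c u) (s' \<circ>\<^sub>c u') \<and>
        homotopic A W Y (f \<circ>\<^sub>c u) (f' \<circ>\<^sub>c u'))}"

definition dhom ::
    "('k::field, 'a) module \<Rightarrow> ('a, 'k) cpx \<Rightarrow> ('a, 'k) cpx \<Rightarrow> ('a, 'k) roof set set" where
  "dhom A X Y = roofs A X Y // roof_rel A X Y"

definition loc ::
    "('k::field, 'a) module \<Rightarrow> ('a, 'k) cpx \<Rightarrow> ('a, 'k) cpx \<Rightarrow> (int \<Rightarrow> 'k mat) \<Rightarrow> ('a, 'k) roof set" where
  "loc A X Y f = roof_rel A X Y `` {(X, chain_id X, f)}"

definition did :: "('k::field, 'a) module \<Rightarrow> ('a, 'k) cpx \<Rightarrow> ('a, 'k) roof set" where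
  "did A X = loc A X X (chain_id X)"

definition dzero :: "('k::field, 'a) module \<Rightarrow> ('a, 'k) cpx \<Rightarrow> ('a, 'k) cpx \<Rightarrow> ('a, 'k) roof set" where
  "dzero A X Y = loc A X Y (chain_zero X Y)"

text \<open>\<open>dcomp A X Y V G F\<close> is \<open>G \<circ> F\<close> for \<open>F : X \<rightarrow> Y\<close> and \<open>G : Y \<rightarrow> V\<close>: roofs
  \<open>X \<leftarrow> Z \<rightarrow> Y\<close> and \<open>Y \<leftarrow> W \<rightarrow> V\<close> are composed by completing
  \<open>Z \<rightarrow> Y \<leftarrow> W\<close> to a square \<open>Z \<leftarrow> U \<rightarrow> W\<close> commuting up to homotopy.
  The union is over all choices; they all give the same class.\<close>

definition dcomp ::
    "('k::field, 'a) module \<Rightarrow> ('a, 'k) cpx \<Rightarrow> ('a, 'k) cpx \<Rightarrow> ('a, 'k) cpx \<Rightarrow>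
      ('a, 'k) roof set \<Rightarrow> ('a, 'k) roof set \<Rightarrow> ('a, 'k) roof set" where
  "dcomp A X Y V G F = \<Union> {roof_rel A X V `` {(U, s \<circ>\<^sub>c t', g \<circ>\<^sub>c f')} | Z s f W t g U t' f'.
     (Z, s, f) \<in> F \<and> (W, t, g) \<in> G \<and> U \<in> cpxs A \<and>
     t' \<in> quasi_isos A U Z \<and> f' \<in> chain_maps A U W \<and> homotopic A U Y (f \<circ>\<^sub>c t') (t \<circ>\<^sub>c f')}"

definition diso ::
    "('k::field, 'a) module \<Rightarrow> ('a, 'k) cpx \<Rightarrow> ('a, 'k) cpx \<Rightarrow> ('a, 'k) roof set \<Rightarrow> bool" where
  "diso A X Y F \<longleftrightarrow> F \<in> dhom A X Y \<and>
     (\<exists>G\<in>dhom A Y X. dcomp A X Y X G F = did A X \<and> dcomp A Y X Y F G = did A Y)"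

definition isomorphic :: "('k::field, 'a) module \<Rightarrow> ('a, 'k) cpx \<Rightarrow> ('a, 'k) cpx \<Rightarrow> bool" where
  "isomorphic A X Y \<longleftrightarrow> X \<in> cpxs A \<and> Y \<in> cpxs A \<and> (\<exists>F. diso A X Y F)"

definition hom_vanishes :: "('k::field, 'a) module \<Rightarrow> ('a, 'k) cpx \<Rightarrow> ('a, 'k) cpx \<Rightarrow> bool" where
  "hom_vanishes A X Y \<longleftrightarrow> dhom A X Y = {dzero A X Y}"

definition zero_object :: "('k::field, 'a) module \<Rightarrow> ('a, 'k) cpx \<Rightarrow> bool" where
  "zero_object A X \<longleftrightarrow> isomorphic A X zero_cpx"

definition indecomposable :: "('k::field, 'a) module \<Rightarrow> ('a, 'k) cpx \<Rightarrow> bool" where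
  "indecomposable A X \<longleftrightarrow> X \<in> cpxs A \<and> \<not> zero_object A X \<and>
     (\<forall>Y\<in>cpxs A. \<forall>Z\<in>cpxs A. isomorphic A X (sum_cpx Y Z) \<longrightarrow> zero_object A Y \<or> zero_object A Z)"

definition dshift :: "('a, 'k::field) roof set \<Rightarrow> ('a, 'k) roof set" where
  "dshift F = (\<lambda>(Z, s, f). (shift 1 Z, (\<lambda>i. s (i + 1)), (\<lambda>i. f (i + 1)))) ` F"

text \<open>\<open>X \<rightarrow> Y \<rightarrow> Z \<rightarrow> X[1]\<close> with maps \<open>F, G, H\<close> is a (distinguished) triangle if it is
  isomorphic to the triangle \<open>X' \<rightarrow> Y' \<rightarrow> cone f \<rightarrow> X'[1]\<close> of a chain map \<open>f\<close>.\<close>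

definition triangle ::
    "('k::field, 'a) module \<Rightarrow> ('a, 'k) cpx \<Rightarrow> ('a, 'k) cpx \<Rightarrow> ('a, 'k) cpx \<Rightarrow>
      ('a, 'k) roof set \<Rightarrow> ('a, 'k) roof set \<Rightarrow> ('a, 'k) roof set \<Rightarrow> bool" where
  "triangle A X Y Z F G H \<longleftrightarrow>
     F \<in> dhom A X Y \<and> G \<in> dhom A Y Z \<and> H \<in> dhom A Z (shift 1 X) \<and>
     (\<exists>X'\<in>cpxs A. \<exists>Y'\<in>cpxs A. \<exists>f\<in>chain_maps A X' Y'. \<exists>\<alpha> \<beta> \<gamma>.
        diso A X X' \<alpha> \<and> diso A Y Y' \<beta> \<and> diso A Z (cone X' Y' f) \<gamma> \<and>
        dcomp A X Y Y' \<beta> F = dcomp A X X' Y' (loc A X' Y' f) \<alpha> \<and>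
        dcomp A Y Z (cone X' Y' f) \<gamma> G =
          dcomp A Y Y' (cone X' Y' f) (loc A Y' (cone X' Y' f) (cone_in X' Y')) \<beta> \<and>
        dcomp A Z (shift 1 X) (shift 1 X') (dshift \<alpha>) H =
          dcomp A Z (cone X' Y' f) (shift 1 X')
            (loc A (cone X' Y' f) (shift 1 X') (cone_out X' Y')) \<gamma>)"

section \<open>t-structures\<close>

text \<open>Full subcategories are given by their classes of objects.\<close>

definition strict_subcat :: "('k::field, 'a) module \<Rightarrow> ('a, 'k) cpx set \<Rightarrow> bool" where
  "strict_subcat A U \<longleftrightarrow> U \<subseteq> cpxs A \<and> (\<forall>X\<in>U. \<forall>Y. isomorphic A X Y \<longrightarrow> Y \<in> U)"

text \<open>\<open>U\<close> and \<open>V\<close> are the subcategories \<open>D\<^sup>\<le>\<^sup>0\<close> and \<open>D\<^sup>\<ge>\<^sup>0\<close>;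
  \<open>shift (- 1) ` U\<close> and \<open>shift (- 1) ` V\<close> are \<open>D\<^sup>\<le>\<^sup>1\<close> and \<open>D\<^sup>\<ge>\<^sup>1\<close>.\<close>

definition t_structure ::
    "('k::field, 'a) module \<Rightarrow> ('a, 'k) cpx set \<Rightarrow> ('a, 'k) cpx set \<Rightarrow> bool" where
  "t_structure A U V \<longleftrightarrow>
     strict_subcat A U \<and> strict_subcat A V \<and>
     U \<subseteq> shift (- 1) ` U \<and> shift (- 1) ` V \<subseteq> V \<and>
     (\<forall>X\<in>U. \<forall>Y\<in>shift (- 1) ` V. hom_vanishes A X Y) \<and>
     (\<forall>Z\<in>cpxs A. \<exists>X\<in>U. \<exists>Y\<in>shift (- 1) ` V. \<exists>F G H. triangle A X Z Y F G H)"

definition aisle :: "('k::field, 'a) module \<Rightarrow> ('a, 'k) cpx set \<Rightarrow> bool" where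
  "aisle A U \<longleftrightarrow> (\<exists>V. t_structure A U V)"

definition standard_aisle :: "('k::field, 'a) module \<Rightarrow> ('a, 'k) cpx set" where
  "standard_aisle A = {X \<in> cpxs A. \<forall>i>0. cohomology_zero X i}"

section \<open>Derived tensor products and compatibility with a recollement\<close>

text \<open>
  Below, \<open>A\<close> is an ambient algebra, and \<open>L\<close>, \<open>R\<close> are algebras whose elements lie in \<open>A\<close>
  and which act on \<open>N \<subseteq> carrier A\<close> from the left and from the right by the multiplication of \<open>A\<close>.
  (Used for the bimodules \<open>Ae\<close> and \<open>eA\<close>.)
\<close>

definition balanced_bilinear ::
    "('k::field, 'a) module \<Rightarrow> ('k, 'a) module \<Rightarrow> ('a, 'k) rmod \<Rightarrow> 'a set \<Rightarrow> nat \<Rightarrow>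
      ('k vec \<Rightarrow> 'a \<Rightarrow> 'k vec) \<Rightarrow> bool" where
  "balanced_bilinear A L M N p \<beta> \<longleftrightarrow>
     (\<forall>x\<in>carrier_vec (mdim M). \<forall>y\<in>N. \<beta> x y \<in> carrier_vec p) \<and>
     (\<forall>x\<in>carrier_vec (mdim M). \<forall>x'\<in>carrier_vec (mdim M). \<forall>y\<in>N. \<beta> (x + x') y = \<beta> x y + \<beta> x' y) \<and>
     (\<forall>x\<in>carrier_vec (mdim M). \<forall>y\<in>N. \<forall>y'\<in>N. \<beta> x (y \<oplus>\<^bsub>A\<^esub> y') = \<beta> x y + \<beta> x y') \<and>
     (\<forall>c. \<forall>x\<in>carrier_vec (mdim M). \<forall>y\<in>N.
        \<beta> (c \<cdot>\<^sub>v x) y = c \<cdot>\<^sub>v \<beta> x y \<and> \<beta> x (c \<odot>\<^bsub>A\<^esub> y) = c \<cdot>\<^sub>v \<beta> x y) \<and>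
     (\<forall>x\<in>carrier_vec (mdim M). \<forall>y\<in>N. \<forall>l\<in>carrier L. \<beta> (act M l *\<^sub>v x) y = \<beta> x (l \<otimes>\<^bsub>A\<^esub> y))"

text \<open>The right \<open>R\<close>-module \<open>T\<close> together with \<open>\<tau>\<close> is a tensor product of \<open>M\<close> and \<open>N\<close> over \<open>L\<close>.\<close>

definition is_tensor ::
    "('k::field, 'a) module \<Rightarrow> ('k, 'a) module \<Rightarrow> ('k, 'a) module \<Rightarrow>
      ('a, 'k) rmod \<Rightarrow> 'a set \<Rightarrow> ('a, 'k) rmod \<Rightarrow> ('k vec \<Rightarrow> 'a \<Rightarrow> 'k vec) \<Rightarrow> bool" where
  "is_tensor A L R M N T \<tau> \<longleftrightarrow>
     right_module R T \<and> balanced_bilinear A L M N (mdim T) \<tau> \<and>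
     (\<forall>x\<in>carrier_vec (mdim M). \<forall>y\<in>N. \<forall>r\<in>carrier R. act T r *\<^sub>v \<tau> x y = \<tau> x (y \<otimes>\<^bsub>A\<^esub> r)) \<and>
     (\<forall>p \<beta>. balanced_bilinear A L M N p \<beta> \<longrightarrow>
        (\<exists>!F. F \<in> carrier_mat p (mdim T) \<and>
              (\<forall>x\<in>carrier_vec (mdim M). \<forall>y\<in>N. F *\<^sub>v \<tau> x y = \<beta> x y)))"

definition is_tensor_cpx ::
    "('k::field, 'a) module \<Rightarrow> ('k, 'a) module \<Rightarrow> ('k, 'a) module \<Rightarrow>
      ('a, 'k) cpx \<Rightarrow> 'a set \<Rightarrow> ('a, 'k) cpx \<Rightarrow> bool" where
  "is_tensor_cpx A L R P N T \<longleftrightarrow> T \<in> cpxs R \<and>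
     (\<exists>\<tau>. (\<forall>i. is_tensor A L R (cobj P i) N (cobj T i) (\<tau> i)) \<and>
        (\<forall>i. \<forall>x\<in>carrier_vec (cdim P i). \<forall>y\<in>N.
           cdif T i *\<^sub>v \<tau> i x y = \<tau> (i + 1) (cdif P i *\<^sub>v x) y))"

text \<open>\<open>T\<close> is isomorphic in \<open>D\<^sup>b(R)\<close> to the derived tensor product of \<open>X\<close> and \<open>N\<close> over \<open>L\<close>,
  computed from a projective resolution of \<open>X\<close>.  Bounded resolutions exist for the algebras
  considered here, which have finite global dimension.\<close>

definition is_derived_tensor ::
    "('k::field, 'a) module \<Rightarrow> ('k, 'a) module \<Rightarrow> ('k, 'a) module \<Rightarrow>
      ('a, 'k) cpx \<Rightarrow> 'a set \<Rightarrow> ('a, 'k) cpx \<Rightarrow> bool" where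
  "is_derived_tensor A L R X N T \<longleftrightarrow>
     (\<exists>P\<in>cpxs L. \<exists>q\<in>quasi_isos L P X. \<exists>T'. (\<forall>i. projective L (cobj P i)) \<and>
        is_tensor_cpx A L R P N T' \<and> isomorphic R T' T)"

definition corner :: "('k, 'a) module \<Rightarrow> 'a \<Rightarrow> ('k, 'a) module" where
  "corner A e = A\<lparr>carrier := {e \<otimes>\<^bsub>A\<^esub> a \<otimes>\<^bsub>A\<^esub> e | a. a \<in> carrier A}, one := e\<rparr>"

text \<open>The functors \<open>j\<^sup>*\<close> and \<open>j\<^sub>!\<close> between \<open>D\<^sup>b(A)\<close> and \<open>D\<^sup>b(eAe)\<close> in the recollement
  defined by the idempotent \<open>e\<close>, as relations between an object and
  the objects isomorphic to its image.  Compatibility involves no other part of the recollement.\<close>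

definition j_upper_star ::
    "('k::field, 'a) module \<Rightarrow> 'a \<Rightarrow> ('a, 'k) cpx \<Rightarrow> ('a, 'k) cpx \<Rightarrow> bool" where
  "j_upper_star A e X V \<longleftrightarrow>
     is_derived_tensor A A (corner A e) X {a \<otimes>\<^bsub>A\<^esub> e | a. a \<in> carrier A} V"

definition j_lower_shriek ::
    "('k::field, 'a) module \<Rightarrow> 'a \<Rightarrow> ('a, 'k) cpx \<Rightarrow> ('a, 'k) cpx \<Rightarrow> bool" where
  "j_lower_shriek A e V W \<longleftrightarrow>
     is_derived_tensor A (corner A e) A V {e \<otimes>\<^bsub>A\<^esub> a | a. a \<in> carrier A} W"

definition compatible :: "('k::field, 'a) module \<Rightarrow> 'a \<Rightarrow> ('a, 'k) cpx set \<Rightarrow> bool" where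
  "compatible A e U \<longleftrightarrow>
     (\<forall>X\<in>U. \<forall>V W. j_upper_star A e X V \<and> j_lower_shriek A e V W \<longrightarrow> W \<in> U)"

section \<open>The path algebra of type \<open>A\<^sub>2\<close>\<close>

text \<open>The paths of the quiver \<open>1 \<rightarrow> 2\<close>.  Paths are composed like functions
  (\<open>p q\<close> means first \<open>q\<close>, then \<open>p\<close>), so the arrow is \<open>\<alpha> = e\<^sub>2 \<alpha> e\<^sub>1\<close>.\<close>

datatype a2_path = E1 | E2 | Alpha

fun path_comp :: "a2_path \<Rightarrow> a2_path \<Rightarrow> a2_path option" where
  "path_comp E1 E1 = Some E1"
| "path_comp E2 E2 = Some E2"
| "path_comp E2 Alpha = Some Alpha"
| "path_comp Alpha E1 = Some Alpha"
| "path_comp _ _ = None"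

type_synonym 'k a2 = "a2_path \<Rightarrow> 'k"

definition A2 :: "('k::field, 'k a2) module" where
  "A2 = \<lparr>carrier = UNIV,
     monoid.mult = (\<lambda>a b p. \<Sum>(q, r) | path_comp q r = Some p. a q * b r),
     one = (\<lambda>p. if p \<in> {E1, E2} then 1 else 0),
     zero = (\<lambda>_. 0),
     add = (\<lambda>a b p. a p + b p),
     smult = (\<lambda>c a p. c * a p)\<rparr>"

definition path_elem :: "a2_path \<Rightarrow> 'k::field a2" where
  "path_elem p = (\<lambda>q. if q = p then 1 else 0)"

text \<open>The module with basis the paths in the list \<open>ps\<close>, on which \<open>A2\<close> acts by right
  multiplication, discarding the coefficients of paths outside \<open>ps\<close>.\<close>

definition path_module :: "a2_path list \<Rightarrow> ('k::field a2, 'k) rmod" where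
  "path_module ps = \<lparr>mdim = length ps,
     act = (\<lambda>a. mat (length ps) (length ps)
       (\<lambda>(i, j). (path_elem (ps ! j) \<otimes>\<^bsub>A2\<^esub> a) (ps ! i)))\<rparr>"

text \<open>\<open>e\<^sub>1 A2\<close> has basis \<open>e\<^sub>1\<close> and \<open>e\<^sub>2 A2\<close> has basis \<open>e\<^sub>2, \<alpha>\<close>; the span of \<open>\<alpha>\<close> is a
  submodule of \<open>e\<^sub>2 A2\<close> isomorphic to \<open>e\<^sub>1 A2\<close>, and \<open>S\<^sub>2\<close> is the quotient.\<close>

definition P1 :: "('k::field a2, 'k) cpx" where "P1 = stalk (path_module [E1])"
definition P2 :: "('k::field a2, 'k) cpx" where "P2 = stalk (path_module [E2, Alpha])"
definition S2 :: "('k::field a2, 'k) cpx" where "S2 = stalk (path_module [E2])"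

lemma A2_mult:
  fixes a b :: "'k::field a2"
  shows "(a \<otimes>\<^bsub>A2\<^esub> b) E1 = a E1 * b E1"
    and "(a \<otimes>\<^bsub>A2\<^esub> b) E2 = a E2 * b E2"
    and "(a \<otimes>\<^bsub>A2\<^esub> b) Alpha = a E2 * b Alpha + a Alpha * b E1"
proof -
  have "{(q, r). path_comp q r = Some E1} = {(E1, E1)}"
    and "{(q, r). path_comp q r = Some E2} = {(E2, E2)}"
    and "{(q, r). path_comp q r = Some Alpha} = {(E2, Alpha), (Alpha, E1)}"
    by (auto elim!: path_comp.elims)
  then show "(a \<otimes>\<^bsub>A2\<^esub> b) E1 = a E1 * b E1"
    and "(a \<otimes>\<^bsub>A2\<^esub> b) E2 = a E2 * b E2"
    and "(a \<otimes>\<^bsub>A2\<^esub> b) Alpha = a E2 * b Alpha + a Alpha * b E1"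
    by (simp_all add: A2_def)
qed

section \<open>The list of aisles\<close>

text \<open>``Some or all shifts of \<open>M\<close>'' are the \<open>M[k]\<close> with \<open>k\<close> in an arbitrary set of integers.\<close>

definition indecs :: "('k::field, 'a) module \<Rightarrow> ('a, 'k) cpx set \<Rightarrow> ('a, 'k) cpx set" where
  "indecs A U = {X \<in> U. indecomposable A X}"

definition shifts_of ::
    "('k::field, 'a) module \<Rightarrow> ('a, 'k) cpx \<Rightarrow> int set \<Rightarrow> ('a, 'k) cpx set" where
  "shifts_of A M K = {X. \<exists>k\<in>K. isomorphic A X (shift k M)}"

definition listed_aisle :: "('k::field a2, 'k) cpx set \<Rightarrow> bool" where
  "listed_aisle U \<longleftrightarrow>
     (U = {X. zero_object A2 X} \<or> U = cpxs A2) \<or>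
     (\<exists>n. U = shift n ` standard_aisle A2) \<or>
     (\<exists>K. indecs A2 U = shifts_of A2 P1 K) \<or>
     (\<exists>K. indecs A2 U = shifts_of A2 S2 K) \<or>
     (\<exists>K. indecs A2 U = shifts_of A2 P2 K) \<or>
     (\<exists>n K. indecs A2 U = indecs A2 (shift n ` standard_aisle A2) \<union> shifts_of A2 P1 K) \<or>
     (\<exists>n K. indecs A2 U = indecs A2 (shift n ` standard_aisle A2) \<union> shifts_of A2 S2 K) \<or>
     (\<exists>n K m. shift m S2 \<notin> shift n ` (standard_aisle A2 :: ('k a2, 'k) cpx set) \<and>
        indecs A2 U = indecs A2 (shift n ` standard_aisle A2) \<union> shifts_of A2 P2 K \<union>
                      shifts_of A2 S2 {m})"

end

theory Submission
  imports Defs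
begin

text \<open>
  The path algebra of \<open>A\<^sub>2\<close> is hereditary and of finite type, so up to isomorphism the indecomposable
  objects of the derived category form a line
  \<open>\<dots>, P\<^sub>1, P\<^sub>2, S\<^sub>2, P\<^sub>1[1], P\<^sub>2[1], S\<^sub>2[1], P\<^sub>1[2], \<dots>\<close>
  in which any three consecutive objects form a triangle.  The second half of the claim, that every aisle
  is on the list, implies the first half, and it reduces to counting on this line.

  An aisle is closed under \<open>[1]\<close> and under extensions (\<open>t_shift\<close>, \<open>aisle_cone\<close>, \<open>aisle_cone_rotated\<close>).  Hence
  the \<open>k\<close> with \<open>P\<^sub>1[k]\<close> in the aisle form an upward closed set of integers, likewise for \<open>P\<^sub>2\<close> and \<open>S\<^sub>2\<close>, and an
  object whose two neighbours on the line lie in the aisle lies in it too (\<open>aisle_between\<close>).  Three upward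
  closed sets with this property are easily listed (\<open>three_up_closed_sets\<close>): two of them are empty, which
  are the types given by shifts of a single module and include the zero aisle; or all are everything; or
  the two largest of the three thresholds are those of neighbours on the line, and the third set is
  arbitrary subject to containing the standard part.  According to the missing neighbour
  the last case gives the union of a shifted standard aisle with shifts of \<open>P\<^sub>1\<close>, of \<open>S\<^sub>2\<close>, or of \<open>P\<^sub>2\<close>; in the
  latter case the threshold of \<open>S\<^sub>2\<close> is one lower than that of \<open>P\<^sub>1\<close>, which accounts for the extra shift
  of \<open>S\<^sub>2\<close>.  The shifted standard aisles themselves are special cases.

  The listed types describe an aisle by its indecomposable objects, except that an aisle containing
  all of them must be shown to be everything.  For both purposes the basic fact is \<open>A2_summand\<close>: every
  complex with nonzero cohomology has a shift of \<open>P\<^sub>1\<close>, \<open>P\<^sub>2\<close> or \<open>S\<^sub>2\<close> as a direct summand in the derived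
  category.  The summand is split off by hand: a cohomology class, decomposed by the idempotents of the two
  vertices, gives a map from (a projective resolution of) one of the three modules, and a linear
  functional detecting the class gives a map back to (an injective resolution of) it.  Consequently an
  indecomposable object is one of these shifts, and an object receiving no nonzero maps from
  any of them is zero.

  All this requires some control over the derived category, whose morphisms are classes of roofs.  The
  calculus of fractions (\<open>ore_right\<close>, \<open>ore_left\<close>, \<open>cancel_left\<close>, \<open>cancel_right\<close>) yields that isomorphic
  objects are those joined by a roof of quasi-isomorphisms (\<open>isomorphic_iff\<close>), that the
  vanishing of a morphism can be tested on representatives (\<open>hom_vanishes_iff\<close>), and the exactness
  needed for truncation triangles (\<open>hom_vanishes_cone\<close>).
\<close>

section \<open>Matrices up to dimensions\<close>

text \<open>The ring laws for rectangular matrices, with side conditions that mention only \<open>dim_row\<close> and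
  \<open>dim_col\<close>; unlike conditions on \<open>carrier_mat\<close> these contain no parameters that a rewriter would
  have to guess.  The rules that reintroduce such carrier conditions are switched off.\<close>

declare carrier_matD [simp del] carrier_vecD [simp del] carrier_matI [rule del]

lemma mat_assoc:
  "dim_col A = dim_row B \<Longrightarrow> dim_col B = dim_row C \<Longrightarrow> (A * B) * C = A * (B * C :: 'k::comm_ring_1 mat)"
  by (rule assoc_mult_mat[of _ "dim_row A" "dim_col A" _ "dim_col B" _ "dim_col C"]) (intro carrier_matI; simp)+

lemma mat_distrib:
  "dim_row A = dim_row B \<Longrightarrow> dim_col A = dim_col B \<Longrightarrow> dim_col B = dim_row C \<Longrightarrow>
    (A + B) * C = A * C + (B * C :: 'k::comm_ring_1 mat)"
  "dim_row B = dim_row C \<Longrightarrow> dim_col B = dim_col C \<Longrightarrow> dim_col A = dim_row B \<Longrightarrow>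
    A * (B + C) = A * B + (A * C :: 'k::comm_ring_1 mat)"
  by (rule add_mult_distrib_mat[of _ "dim_row A" "dim_col A" _ _ "dim_col C"]; intro carrier_matI; simp)
     (rule mult_add_distrib_mat[of _ "dim_row A" "dim_col A" _ "dim_col C"]; intro carrier_matI; simp)

lemma mat_uminus:
  "dim_col A = dim_row B \<Longrightarrow> (- A) * B = - (A * B :: 'k::comm_ring_1 mat)"
  "dim_col A = dim_row B \<Longrightarrow> A * (- B) = - (A * B :: 'k::comm_ring_1 mat)"
  "dim_row A = dim_row B \<Longrightarrow> dim_col A = dim_col B \<Longrightarrow> - (A + B) = - A + (- B :: 'k::comm_ring_1 mat)"
  "- (- A) = (A :: 'k::comm_ring_1 mat)"
  "- (0\<^sub>m n m) = (0\<^sub>m n m :: 'k::comm_ring_1 mat)"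
  "dim_row A = dim_row B \<Longrightarrow> dim_col A = dim_col B \<Longrightarrow> A - B = A + (- B :: 'k::comm_ring_1 mat)"
  by (auto intro!: eq_matI simp: scalar_prod_def sum_negf)

lemma mat_add_ac:
  "dim_row A = dim_row B \<Longrightarrow> dim_col A = dim_col B \<Longrightarrow> A + B = B + (A :: 'k::comm_ring_1 mat)"
  "dim_row B = dim_row C \<Longrightarrow> dim_col B = dim_col C \<Longrightarrow> (A + B) + C = A + (B + C :: 'k::comm_ring_1 mat)"
  "dim_row A = dim_row B \<Longrightarrow> dim_col A = dim_col B \<Longrightarrow> dim_row C = dim_row B \<Longrightarrow> dim_col C = dim_col B \<Longrightarrow>
    A + (B + C) = B + (A + C :: 'k::comm_ring_1 mat)"
  by (auto intro!: eq_matI simp: add.assoc add.commute add.left_commute)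

lemma mat_cancel:
  "A + - A = (0\<^sub>m (dim_row A) (dim_col A) :: 'k::comm_ring_1 mat)"
  "- A + A = (0\<^sub>m (dim_row A) (dim_col A) :: 'k::comm_ring_1 mat)"
  "dim_row A = dim_row B \<Longrightarrow> dim_col A = dim_col B \<Longrightarrow> A + (- A + B) = (B :: 'k::comm_ring_1 mat)"
  "dim_row A = dim_row B \<Longrightarrow> dim_col A = dim_col B \<Longrightarrow> - A + (A + B) = (B :: 'k::comm_ring_1 mat)"
  "dim_row A = n \<Longrightarrow> dim_col A = m \<Longrightarrow> A + 0\<^sub>m n m = (A :: 'k::comm_ring_1 mat)"
  "dim_row A = n \<Longrightarrow> dim_col A = m \<Longrightarrow> 0\<^sub>m n m + A = (A :: 'k::comm_ring_1 mat)"
  by (auto intro!: eq_matI)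

lemma mat_cancel_far:
  "dim_row A = dim_row B \<Longrightarrow> dim_col A = dim_col B \<Longrightarrow> A + (B + - A) = (B :: 'k::comm_ring_1 mat)"
  "dim_row A = dim_row B \<Longrightarrow> dim_col A = dim_col B \<Longrightarrow> - A + (B + A) = (B :: 'k::comm_ring_1 mat)"
  "dim_row A = dim_row B \<Longrightarrow> dim_col A = dim_col B \<Longrightarrow> dim_row C = dim_row B \<Longrightarrow> dim_col C = dim_col B \<Longrightarrow>
    A + (B + (- A + C)) = B + (C :: 'k::comm_ring_1 mat)"
  "dim_row A = dim_row B \<Longrightarrow> dim_col A = dim_col B \<Longrightarrow> dim_row C = dim_row B \<Longrightarrow> dim_col C = dim_col B \<Longrightarrow>
    - A + (B + (A + C)) = B + (C :: 'k::comm_ring_1 mat)"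
  by (auto intro!: eq_matI)

lemmas mat_ring = mat_distrib mat_uminus mat_add_ac mat_cancel
lemmas mat_ring_r = mat_ring mat_assoc

lemma mat_vec_assoc:
  "dim_col A = dim_row B \<Longrightarrow> dim_col B = dim_vec v \<Longrightarrow> (A * B) *\<^sub>v v = A *\<^sub>v (B *\<^sub>v (v :: 'k::comm_ring_1 vec))"
  by (rule assoc_mult_mat_vec[of _ "dim_row A" "dim_col A" _ "dim_col B"]) (intro carrier_matI carrier_vecI; simp)+

lemma mat_vec_distrib:
  "dim_row A = dim_row B \<Longrightarrow> dim_col A = dim_vec v \<Longrightarrow> dim_col B = dim_vec v \<Longrightarrow>
    (A + B) *\<^sub>v v = A *\<^sub>v v + B *\<^sub>v (v :: 'k::comm_ring_1 vec)"
  "dim_vec v = dim_vec w \<Longrightarrow> dim_col A = dim_vec w \<Longrightarrow>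
    A *\<^sub>v (v + w) = A *\<^sub>v v + A *\<^sub>v (w :: 'k::comm_ring_1 vec)"
  by (rule add_mult_distrib_mat_vec[of _ "dim_row A" "dim_col A"]; intro carrier_matI carrier_vecI; simp)
     (rule mult_add_distrib_mat_vec[of _ "dim_row A" "dim_col A"]; intro carrier_matI carrier_vecI; simp)

lemma mat_vec_uminus:
  "dim_col A = dim_vec v \<Longrightarrow> (- A) *\<^sub>v v = - (A *\<^sub>v (v :: 'k::comm_ring_1 vec))"
  "dim_col A = dim_vec v \<Longrightarrow> A *\<^sub>v (- v) = - (A *\<^sub>v (v :: 'k::comm_ring_1 vec))"
  "dim_vec w = dim_vec v \<Longrightarrow> w - v = w + - (v :: 'k::comm_ring_1 vec)"
  "dim_vec w = dim_vec v \<Longrightarrow> - (w + v) = - w + - (v :: 'k::comm_ring_1 vec)"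
  "- (- v) = (v :: 'k::comm_ring_1 vec)"
  "- 0\<^sub>v n = (0\<^sub>v n :: 'k::comm_ring_1 vec)"
  by (auto intro!: eq_vecI simp: scalar_prod_def sum_negf)

lemma vec_add_ac:
  "dim_vec v = dim_vec w \<Longrightarrow> v + w = w + (v :: 'k::comm_ring_1 vec)"
  "dim_vec v = dim_vec w \<Longrightarrow> (u + v) + w = u + (v + w :: 'k::comm_ring_1 vec)"
  "dim_vec u = dim_vec v \<Longrightarrow> dim_vec v = dim_vec w \<Longrightarrow> u + (v + w) = v + (u + w :: 'k::comm_ring_1 vec)"
  by (auto intro!: eq_vecI simp: add.assoc add.commute add.left_commute)

lemma vec_cancel:
  "v + - v = (0\<^sub>v (dim_vec v) :: 'k::comm_ring_1 vec)"
  "- v + v = (0\<^sub>v (dim_vec v) :: 'k::comm_ring_1 vec)"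
  "dim_vec v = dim_vec w \<Longrightarrow> v + (- v + w) = (w :: 'k::comm_ring_1 vec)"
  "dim_vec v = dim_vec w \<Longrightarrow> - v + (v + w) = (w :: 'k::comm_ring_1 vec)"
  "dim_vec v = n \<Longrightarrow> v + 0\<^sub>v n = (v :: 'k::comm_ring_1 vec)"
  "dim_vec v = n \<Longrightarrow> 0\<^sub>v n + v = (v :: 'k::comm_ring_1 vec)"
  by (auto intro!: eq_vecI)

lemma mat_vec_zero:
  "dim_vec v = m \<Longrightarrow> 0\<^sub>m n m *\<^sub>v v = (0\<^sub>v n :: 'k::comm_ring_1 vec)"
  "dim_col A = m \<Longrightarrow> A *\<^sub>v 0\<^sub>v m = (0\<^sub>v (dim_row A) :: 'k::comm_ring_1 vec)"
  "dim_vec v = m \<Longrightarrow> 1\<^sub>m m *\<^sub>v v = (v :: 'k::comm_ring_1 vec)"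
proof -
  show "dim_vec v = m \<Longrightarrow> 1\<^sub>m m *\<^sub>v v = v" by (rule one_mult_mat_vec, rule carrier_vecI)
qed (auto intro!: eq_vecI simp: scalar_prod_def)

lemmas vec_ring = mat_vec_assoc mat_vec_distrib mat_vec_uminus vec_add_ac vec_cancel mat_vec_zero

text \<open>Block rows and block columns are degenerate four-block matrices.\<close>

definition rowb :: "'k::comm_ring_1 mat \<Rightarrow> 'k mat \<Rightarrow> 'k mat" where
  "rowb h g = four_block_mat h g (0\<^sub>m 0 (dim_col h)) (0\<^sub>m 0 (dim_col g))"

definition colb :: "'k::comm_ring_1 mat \<Rightarrow> 'k mat \<Rightarrow> 'k mat" where
  "colb p q = four_block_mat p (0\<^sub>m (dim_row p) 0) q (0\<^sub>m (dim_row q) 0)"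

lemma dim_rowb [simp]: "dim_row (rowb h g) = dim_row h" "dim_col (rowb h g) = dim_col h + dim_col g"
  and dim_colb [simp]: "dim_row (colb p q) = dim_row p + dim_row q" "dim_col (colb p q) = dim_col p"
  by (auto simp: rowb_def colb_def)

lemma four_block_mult:
  fixes a b c d :: "'k::comm_ring_1 mat"
  assumes "dim_row b = dim_row a" "dim_col b = dim_col d" "dim_row c = dim_row d" "dim_col c = dim_col a"
    "dim_row b' = dim_row a'" "dim_col b' = dim_col d'" "dim_row c' = dim_row d'" "dim_col c' = dim_col a'"
    "dim_col a = dim_row a'" "dim_col d = dim_row d'"
  shows "four_block_mat a b c d * four_block_mat a' b' c' d' =
    four_block_mat (a * a' + b * c') (a * b' + b * d') (c * a' + d * c') (c * b' + d * d')"
  by (rule mult_four_block_mat[of _ "dim_row a" "dim_col a" _ "dim_col d" _ "dim_row d" _ _ "dim_col a'" _ "dim_col d'"])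
    (rule carrier_matI; simp add: assms)+

lemma block_mult:
  fixes a b c d h g p q :: "'k::comm_ring_1 mat"
  shows "\<lbrakk>dim_row g = dim_row h; dim_col q = dim_col p; dim_col h = dim_row p; dim_col g = dim_row q\<rbrakk>
      \<Longrightarrow> rowb h g * colb p q = h * p + g * q"
    and "\<lbrakk>dim_col q = dim_col p; dim_col p = dim_row x\<rbrakk> \<Longrightarrow> colb p q * x = colb (p * x) (q * x)"
    and "\<lbrakk>dim_row g = dim_row h; dim_col x = dim_row h\<rbrakk> \<Longrightarrow> x * rowb h g = rowb (x * h) (x * g)"
    and "\<lbrakk>dim_row b = dim_row a; dim_col b = dim_col d; dim_row c = dim_row d; dim_col c = dim_col a;
       dim_row g = dim_row h; dim_col h = dim_row a; dim_col g = dim_row d\<rbrakk>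
      \<Longrightarrow> rowb h g * four_block_mat a b c d = rowb (h * a + g * c) (h * b + g * d)"
    and "\<lbrakk>dim_row b = dim_row a; dim_col b = dim_col d; dim_row c = dim_row d; dim_col c = dim_col a;
       dim_col q = dim_col p; dim_row p = dim_col a; dim_row q = dim_col d\<rbrakk>
      \<Longrightarrow> four_block_mat a b c d * colb p q = colb (a * p + b * q) (c * p + d * q)"
    and "\<lbrakk>dim_col q = dim_col p; dim_row g = dim_row h; dim_col p = dim_row h\<rbrakk>
      \<Longrightarrow> colb p q * rowb h g = four_block_mat (p * h) (p * g) (q * h) (q * g)"
proof -
  have row0: "rowb h g = four_block_mat h g (0\<^sub>m 0 (dim_col h)) (0\<^sub>m 0 (dim_col g))" for h g :: "'k mat"
    by (rule rowb_def)
  have col0: "colb p q = four_block_mat p (0\<^sub>m (dim_row p) 0) q (0\<^sub>m (dim_row q) 0)" for p q :: "'k mat"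
    by (rule colb_def)
  have plain: "four_block_mat x (0\<^sub>m (dim_row x) 0) (0\<^sub>m 0 (dim_col x)) (0\<^sub>m 0 0) = x" for x :: "'k mat"
    by (auto intro!: eq_matI)
  have z: "z = 0\<^sub>m 0 (dim_col z)" if "dim_row z = 0" for z :: "'k mat" using that by (auto intro!: eq_matI)
  have z': "z = 0\<^sub>m (dim_row z) 0" if "dim_col z = 0" for z :: "'k mat" using that by (auto intro!: eq_matI)
  show "\<lbrakk>dim_row g = dim_row h; dim_col q = dim_col p; dim_col h = dim_row p; dim_col g = dim_row q\<rbrakk>
      \<Longrightarrow> rowb h g * colb p q = h * p + g * q"
    unfolding row0 col0 by (subst four_block_mult) (auto intro!: eq_matI)
  show "\<lbrakk>dim_col q = dim_col p; dim_col p = dim_row x\<rbrakk> \<Longrightarrow> colb p q * x = colb (p * x) (q * x)"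
    unfolding row0 col0 by (subst plain[symmetric, of x], subst four_block_mult) (auto intro!: eq_matI)
  show "\<lbrakk>dim_row g = dim_row h; dim_col x = dim_row h\<rbrakk> \<Longrightarrow> x * rowb h g = rowb (x * h) (x * g)"
    unfolding row0 col0 by (subst plain[symmetric, of x], subst four_block_mult) (auto intro!: eq_matI)
  show "\<lbrakk>dim_row b = dim_row a; dim_col b = dim_col d; dim_row c = dim_row d; dim_col c = dim_col a;
       dim_row g = dim_row h; dim_col h = dim_row a; dim_col g = dim_row d\<rbrakk>
      \<Longrightarrow> rowb h g * four_block_mat a b c d = rowb (h * a + g * c) (h * b + g * d)"
    unfolding row0 col0 by (subst four_block_mult) (auto intro!: eq_matI)
  show "\<lbrakk>dim_row b = dim_row a; dim_col b = dim_col d; dim_row c = dim_row d; dim_col c = dim_col a;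
       dim_col q = dim_col p; dim_row p = dim_col a; dim_row q = dim_col d\<rbrakk>
      \<Longrightarrow> four_block_mat a b c d * colb p q = colb (a * p + b * q) (c * p + d * q)"
    unfolding row0 col0 by (subst four_block_mult) (auto intro!: eq_matI)
  show "\<lbrakk>dim_col q = dim_col p; dim_row g = dim_row h; dim_col p = dim_row h\<rbrakk>
      \<Longrightarrow> colb p q * rowb h g = four_block_mat (p * h) (p * g) (q * h) (q * g)"
    unfolding row0 col0 by (subst four_block_mult) (auto intro!: eq_matI)
qed

lemma block_add:
  fixes a b c d h g p q :: "'k::comm_ring_1 mat"
  shows "\<lbrakk>dim_row g = dim_row h; dim_row g' = dim_row h; dim_row h' = dim_row h;
      dim_col h' = dim_col h; dim_col g' = dim_col g\<rbrakk>
      \<Longrightarrow> rowb h g + rowb h' g' = rowb (h + h') (g + g')"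
    and "\<lbrakk>dim_col q = dim_col p; dim_col q' = dim_col p; dim_col p' = dim_col p;
      dim_row p' = dim_row p; dim_row q' = dim_row q\<rbrakk>
      \<Longrightarrow> colb p q + colb p' q' = colb (p + p') (q + q')"
    and "\<lbrakk>dim_row g = dim_row h\<rbrakk> \<Longrightarrow> - rowb h g = rowb (- h) (- g)"
    and "\<lbrakk>dim_col q = dim_col p\<rbrakk> \<Longrightarrow> - colb p q = colb (- p) (- q)"
    and "\<lbrakk>dim_row a' = dim_row a; dim_col a' = dim_col a; dim_row d' = dim_row d; dim_col d' = dim_col d;
      dim_row b = dim_row a; dim_col b = dim_col d; dim_row c = dim_row d; dim_col c = dim_col a;
      dim_row b' = dim_row a; dim_col b' = dim_col d; dim_row c' = dim_row d; dim_col c' = dim_col a\<rbrakk> \<Longrightarrow>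
      four_block_mat a b c d + four_block_mat a' b' c' d' = four_block_mat (a + a') (b + b') (c + c') (d + d')"
    and "\<lbrakk>dim_row b = dim_row a; dim_col b = dim_col d; dim_row c = dim_row d; dim_col c = dim_col a\<rbrakk> \<Longrightarrow>
      - four_block_mat a b c d = four_block_mat (- a) (- b) (- c) (- d)"
  by (auto intro!: eq_matI simp: rowb_def colb_def)

lemma block_zero:
  "rowb (0\<^sub>m n m) (0\<^sub>m n l) = 0\<^sub>m n (m + l)"
  "colb (0\<^sub>m m n) (0\<^sub>m l n) = 0\<^sub>m (m + l) n"
  "four_block_mat (0\<^sub>m n m) (0\<^sub>m n m') (0\<^sub>m n' m) (0\<^sub>m n' m') = 0\<^sub>m (n + n') (m + m')"
  "four_block_mat (1\<^sub>m n) (0\<^sub>m n m) (0\<^sub>m m n) (1\<^sub>m m) = 1\<^sub>m (n + m)"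
  by (auto intro!: eq_matI simp: rowb_def colb_def)

lemma block_eq:
  fixes a b c d h g p q :: "'k::comm_ring_1 mat"
  shows "\<lbrakk>dim_col q = dim_col p; dim_col q' = dim_col p; dim_col p' = dim_col p;
      dim_row p' = dim_row p; dim_row q' = dim_row q\<rbrakk>
      \<Longrightarrow> colb p q = colb p' q' \<longleftrightarrow> p = p' \<and> q = q'"
    and "\<lbrakk>dim_row g = dim_row h; dim_row g' = dim_row h; dim_row h' = dim_row h;
      dim_col h' = dim_col h; dim_col g' = dim_col g\<rbrakk>
      \<Longrightarrow> rowb h g = rowb h' g' \<longleftrightarrow> h = h' \<and> g = g'"
proof -
  assume d: "dim_col q = dim_col p" "dim_col q' = dim_col p" "dim_col p' = dim_col p"
      "dim_row p' = dim_row p" "dim_row q' = dim_row q"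
  let ?s = "rowb (1\<^sub>m (dim_row p)) (0\<^sub>m (dim_row p) (dim_row q))"
  let ?t = "rowb (0\<^sub>m (dim_row q) (dim_row p)) (1\<^sub>m (dim_row q))"
  have "?s * colb p q = p" "?s * colb p' q' = p'" "?t * colb p q = q" "?t * colb p' q' = q'"
    using d by (simp_all add: block_mult mat_cancel)
  then show "colb p q = colb p' q' \<longleftrightarrow> p = p' \<and> q = q'" by metis
next
  assume d: "dim_row g = dim_row h" "dim_row g' = dim_row h" "dim_row h' = dim_row h"
      "dim_col h' = dim_col h" "dim_col g' = dim_col g"
  let ?s = "colb (1\<^sub>m (dim_col h)) (0\<^sub>m (dim_col g) (dim_col h))"
  let ?t = "colb (0\<^sub>m (dim_col h) (dim_col g)) (1\<^sub>m (dim_col g))"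
  have "rowb h g * ?s = h" "rowb h' g' * ?s = h'" "rowb h g * ?t = g" "rowb h' g' * ?t = g'"
    using d by (simp_all add: block_mult mat_cancel)
  then show "rowb h g = rowb h' g' \<longleftrightarrow> h = h' \<and> g = g'" by metis
qed

lemma block_vec:
  fixes a b c d h g p q :: "'k::comm_ring_1 mat"
  shows "\<lbrakk>dim_row g = dim_row h; dim_vec v = dim_col h; dim_vec w = dim_col g\<rbrakk>
      \<Longrightarrow> rowb h g *\<^sub>v (v @\<^sub>v w) = h *\<^sub>v v + g *\<^sub>v w"
    and "\<lbrakk>dim_col q = dim_col p; dim_vec x = dim_col p\<rbrakk> \<Longrightarrow> colb p q *\<^sub>v x = (p *\<^sub>v x) @\<^sub>v (q *\<^sub>v x)"
    and "\<lbrakk>dim_row b = dim_row a; dim_col b = dim_col d; dim_row c = dim_row d; dim_col c = dim_col a;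
       dim_vec v = dim_col a; dim_vec w = dim_col d\<rbrakk>
      \<Longrightarrow> four_block_mat a b c d *\<^sub>v (v @\<^sub>v w) = (a *\<^sub>v v + b *\<^sub>v w) @\<^sub>v (c *\<^sub>v v + d *\<^sub>v w)"
proof -
  show fb: "\<lbrakk>dim_row b = dim_row a; dim_col b = dim_col d; dim_row c = dim_row d; dim_col c = dim_col a;
       dim_vec v = dim_col a; dim_vec w = dim_col d\<rbrakk>
      \<Longrightarrow> four_block_mat a b c d *\<^sub>v (v @\<^sub>v w) = (a *\<^sub>v v + b *\<^sub>v w) @\<^sub>v (c *\<^sub>v v + d *\<^sub>v w)" for a b c d :: "'k mat" and v w
    by (rule four_block_mat_mult_vec[of _ "dim_row a" "dim_col a" _ "dim_col d" _ "dim_row d"])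
      (intro carrier_matI carrier_vecI; simp)+
  show "\<lbrakk>dim_row g = dim_row h; dim_vec v = dim_col h; dim_vec w = dim_col g\<rbrakk>
      \<Longrightarrow> rowb h g *\<^sub>v (v @\<^sub>v w) = h *\<^sub>v v + g *\<^sub>v w"
    unfolding rowb_def by (subst fb) (auto intro!: eq_vecI)
  show "\<lbrakk>dim_col q = dim_col p; dim_vec x = dim_col p\<rbrakk> \<Longrightarrow> colb p q *\<^sub>v x = (p *\<^sub>v x) @\<^sub>v (q *\<^sub>v x)"
  proof -
    assume d: "dim_col q = dim_col p" "dim_vec x = dim_col p"
    have "x = x @\<^sub>v 0\<^sub>v 0" by (auto intro!: eq_vecI)
    then have "colb p q *\<^sub>v x = colb p q *\<^sub>v (x @\<^sub>v 0\<^sub>v 0)" by simp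
    also have "\<dots> = (p *\<^sub>v x) @\<^sub>v (q *\<^sub>v x)"
      unfolding colb_def using d by (subst fb) (auto simp: vec_ring)
    finally show ?thesis .
  qed
qed

lemma append_vec_simps:
  fixes v w :: "'k::comm_ring_1 vec"
  shows "dim_vec v = dim_vec v' \<Longrightarrow> (v @\<^sub>v w = v' @\<^sub>v w') \<longleftrightarrow> v = v' \<and> w = w'"
    and "dim_vec v = dim_vec v' \<Longrightarrow> dim_vec w = dim_vec w' \<Longrightarrow> (v @\<^sub>v w) + (v' @\<^sub>v w') = (v + v') @\<^sub>v (w + w')"
    and "- (v @\<^sub>v w) = (- v) @\<^sub>v (- w)"
    and "dim_vec v = dim_vec v' \<Longrightarrow> dim_vec w = dim_vec w' \<Longrightarrow> (v @\<^sub>v w) - (v' @\<^sub>v w') = (v - v') @\<^sub>v (w - w')"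
    and "0\<^sub>v (n + m) = 0\<^sub>v n @\<^sub>v (0\<^sub>v m :: 'k vec)"
proof -
  show "dim_vec v = dim_vec v' \<Longrightarrow> (v @\<^sub>v w = v' @\<^sub>v w') \<longleftrightarrow> v = v' \<and> w = w'"
    using append_vec_eq[of v "dim_vec v" v'] by (metis carrier_vec_dim_vec)
qed (auto intro!: eq_vecI)

lemma vec_appendE:
  fixes x :: "'k vec"
  assumes "dim_vec x = n + m"
  obtains v w where "x = v @\<^sub>v w" "dim_vec v = n" "dim_vec w = m"
proof -
  have "x = vec_first x n @\<^sub>v vec_last x m" using vec_first_last_append[OF carrier_vecI[OF assms]] by simp
  then show ?thesis using that by force
qed

section \<open>Modules and twisted sums of complexes\<close>

lemma right_module_dims:
  assumes "right_module A M" "a \<in> carrier A"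
  shows "dim_row (act M a) = mdim M" "dim_col (act M a) = mdim M"
proof -
  have "act M a \<in> carrier_mat (mdim M) (mdim M)" using assms by (simp add: right_module_def)
  then show "dim_row (act M a) = mdim M" "dim_col (act M a) = mdim M" by (rule carrier_matD)+
qed

lemma mod_hom_dims:
  assumes "f \<in> mod_hom A M N"
  shows "dim_row f = mdim N" "dim_col f = mdim M"
  using assms by (auto simp: mod_hom_def dest: carrier_matD)

lemma mod_hom_comm: "f \<in> mod_hom A M N \<Longrightarrow> a \<in> carrier A \<Longrightarrow> f * act M a = act N a * f"
  by (simp add: mod_hom_def)

lemma mod_homI:
  assumes "dim_row f = mdim N" "dim_col f = mdim M"
    and "\<And>a. a \<in> carrier A \<Longrightarrow> f * act M a = act N a * f"
  shows "f \<in> mod_hom A M N"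
  using assms unfolding mod_hom_def by (simp add: carrier_matI)

lemma mdim_sum_mod [simp]: "mdim (sum_mod M N) = mdim M + mdim N"
  and mdim_zero_mod [simp]: "mdim zero_mod = 0"
  by (simp_all add: sum_mod_def zero_mod_def)

lemma right_module_zero_mod [simp]: "right_module A zero_mod"
  by (auto simp: right_module_def zero_mod_def intro!: eq_matI carrier_matI)

lemma right_module_sum_mod:
  fixes A :: "('a::field, 'b) module"
  assumes M: "right_module A M" and N: "right_module A N"
  shows "right_module A (sum_mod M N)"
proof -
  note d = right_module_dims[OF M] right_module_dims[OF N]
  have smult: "c \<cdot>\<^sub>m four_block_mat x (0\<^sub>m n m) (0\<^sub>m m n) y
      = four_block_mat (c \<cdot>\<^sub>m x) (0\<^sub>m n m) (0\<^sub>m m n) (c \<cdot>\<^sub>m y)"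
    if "dim_row x = n" "dim_col x = n" "dim_row y = m" "dim_col y = m" for c and x y :: "'a mat" and n m
    using that by (auto intro!: eq_matI)
  show ?thesis
    using M N unfolding right_module_def
    by (auto simp: sum_mod_def d smult four_block_mult mat_cancel block_add block_zero intro!: carrier_matI)
qed

lemma mod_hom_zero:
  assumes "right_module A M" "right_module A N"
  shows "0\<^sub>m (mdim N) (mdim M) \<in> mod_hom A M N"
  by (rule mod_homI) (simp_all add: right_module_dims[OF assms(1)] right_module_dims[OF assms(2)])

lemma mod_hom_one: "right_module A M \<Longrightarrow> 1\<^sub>m (mdim M) \<in> mod_hom A M M"
  by (rule mod_homI) (simp_all add: right_module_dims)

lemma mod_hom_mult:
  assumes M: "right_module A M" and N: "right_module A N" and L: "right_module A L"
    and f: "f \<in> mod_hom A M N" and g: "g \<in> mod_hom A N L"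
  shows "g * f \<in> mod_hom A M L"
proof (rule mod_homI)
  note [simp] = right_module_dims[OF M] right_module_dims[OF N] right_module_dims[OF L]
    mod_hom_dims[OF f] mod_hom_dims[OF g]
  fix a assume a [simp]: "a \<in> carrier A"
  have "(g * f) * act M a = g * (act N a * f)"
    by (simp add: mat_assoc mod_hom_comm[OF f])
  also have "\<dots> = (g * act N a) * f" by (simp add: mat_assoc)
  also have "\<dots> = act L a * (g * f)" by (simp add: mod_hom_comm[OF g] mat_assoc)
  finally show "(g * f) * act M a = act L a * (g * f)" .
qed (simp_all add: mod_hom_dims[OF f] mod_hom_dims[OF g])

lemma mod_hom_add:
  assumes M: "right_module A M" and N: "right_module A N"
    and f: "f \<in> mod_hom A M N" and g: "g \<in> mod_hom A M N"
  shows "f + g \<in> mod_hom A M N"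
  by (rule mod_homI) (simp_all add: mat_distrib right_module_dims[OF M] right_module_dims[OF N]
    mod_hom_dims[OF f] mod_hom_dims[OF g] mod_hom_comm[OF f] mod_hom_comm[OF g])

lemma mod_hom_uminus:
  assumes M: "right_module A M" and N: "right_module A N" and f: "f \<in> mod_hom A M N"
  shows "- f \<in> mod_hom A M N"
  by (rule mod_homI) (simp_all add: mat_uminus right_module_dims[OF M] right_module_dims[OF N]
    mod_hom_dims[OF f] mod_hom_comm[OF f])

lemma mod_hom_rowb:
  assumes M: "right_module A M" and M': "right_module A M'" and N: "right_module A N"
    and f: "f \<in> mod_hom A M N" and g: "g \<in> mod_hom A M' N"
  shows "rowb f g \<in> mod_hom A (sum_mod M M') N"
  by (rule mod_homI) (simp_all add: sum_mod_def block_mult mat_cancel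
    right_module_dims[OF M] right_module_dims[OF M'] right_module_dims[OF N]
    mod_hom_dims[OF f] mod_hom_dims[OF g] mod_hom_comm[OF f] mod_hom_comm[OF g])

lemma mod_hom_colb:
  assumes M: "right_module A M" and N: "right_module A N" and N': "right_module A N'"
    and f: "f \<in> mod_hom A M N" and g: "g \<in> mod_hom A M N'"
  shows "colb f g \<in> mod_hom A M (sum_mod N N')"
  by (rule mod_homI) (simp_all add: sum_mod_def block_mult mat_cancel
    right_module_dims[OF M] right_module_dims[OF N'] right_module_dims[OF N]
    mod_hom_dims[OF f] mod_hom_dims[OF g] mod_hom_comm[OF f] mod_hom_comm[OF g])

lemma mod_hom_four_block:
  assumes M: "right_module A M" "right_module A M'" and N: "right_module A N" "right_module A N'"
    and f: "a \<in> mod_hom A M N" "b \<in> mod_hom A M' N" "c \<in> mod_hom A M N'" "d \<in> mod_hom A M' N'"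
  shows "four_block_mat a b c d \<in> mod_hom A (sum_mod M M') (sum_mod N N')"
  by (rule mod_homI) (simp_all add: sum_mod_def four_block_mult mat_cancel M[THEN right_module_dims(1)]
    M[THEN right_module_dims(2)] N[THEN right_module_dims(1)] N[THEN right_module_dims(2)]
    f[THEN mod_hom_dims(1)] f[THEN mod_hom_dims(2)] f[THEN mod_hom_comm])

lemma cpxs_mod: "X \<in> cpxs A \<Longrightarrow> right_module A (cobj X i)"
  and cpxs_dif: "X \<in> cpxs A \<Longrightarrow> cdif X i \<in> mod_hom A (cobj X i) (cobj X (i + 1))"
  by (simp_all add: cpxs_def)

lemma cpxs_dims:
  assumes "X \<in> cpxs A"
  shows "dim_row (cdif X i) = cdim X (i + 1)" "dim_col (cdif X i) = cdim X i"
  using mod_hom_dims[OF cpxs_dif[OF assms]] by auto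

lemma cpxs_dd:
  assumes X: "X \<in> cpxs A"
  shows "cdif X (i + 1) * cdif X i = 0\<^sub>m (cdim X (i + 2)) (cdim X i)"
    and "cdif X (i + 2) * cdif X (i + 1) = 0\<^sub>m (cdim X (i + 3)) (cdim X (i + 1))"
    and "cdif X i * cdif X (i - 1) = 0\<^sub>m (cdim X (i + 1)) (cdim X (i - 1))"
    and "dim_vec v = cdim X i \<Longrightarrow> cdif X (i + 1) *\<^sub>v (cdif X i *\<^sub>v v) = 0\<^sub>v (cdim X (i + 2))"
    and "dim_vec w = cdim X (i - 1) \<Longrightarrow> cdif X i *\<^sub>v (cdif X (i - 1) *\<^sub>v w) = 0\<^sub>v (cdim X (i + 1))"
proof -
  have *: "cdif X (i + 1) * cdif X i = 0\<^sub>m (cdim X (i + 2)) (cdim X i)" for i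
    using X by (simp add: cpxs_def)
  show "cdif X (i + 1) * cdif X i = 0\<^sub>m (cdim X (i + 2)) (cdim X i)" by (rule *)
  show "cdif X (i + 2) * cdif X (i + 1) = 0\<^sub>m (cdim X (i + 3)) (cdim X (i + 1))"
    using *[of "i + 1"] by (simp add: algebra_simps)
  show 1: "cdif X i * cdif X (i - 1) = 0\<^sub>m (cdim X (i + 1)) (cdim X (i - 1))"
    using *[of "i - 1"] by (simp add: algebra_simps)
  note [simp] = cpxs_dims[OF X]
  show "dim_vec v = cdim X i \<Longrightarrow> cdif X (i + 1) *\<^sub>v (cdif X i *\<^sub>v v) = 0\<^sub>v (cdim X (i + 2))"
    by (simp add: mat_vec_assoc[symmetric] * mat_vec_zero)
  show "dim_vec w = cdim X (i - 1) \<Longrightarrow> cdif X i *\<^sub>v (cdif X (i - 1) *\<^sub>v w) = 0\<^sub>v (cdim X (i + 1))"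
    by (simp add: mat_vec_assoc[symmetric] 1 mat_vec_zero)
qed

lemma chain_map_mod: "f \<in> chain_maps A X Y \<Longrightarrow> f i \<in> mod_hom A (cobj X i) (cobj Y i)"
  and chain_map_comm: "f \<in> chain_maps A X Y \<Longrightarrow> cdif Y i * f i = f (i + 1) * cdif X i"
  by (simp_all add: chain_maps_def)

lemma chain_map_dims:
  assumes "f \<in> chain_maps A X Y"
  shows "dim_row (f i) = cdim Y i" "dim_col (f i) = cdim X i"
  using mod_hom_dims[OF chain_map_mod[OF assms]] by auto

lemma chain_mapsI:
  assumes "\<And>i. f i \<in> mod_hom A (cobj X i) (cobj Y i)"
    and "\<And>i. cdif Y i * f i = f (i + 1) * cdif X i"
  shows "f \<in> chain_maps A X Y"
  using assms by (simp add: chain_maps_def)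

lemma chain_map_comm':
  assumes f: "f \<in> chain_maps A X Y" and X: "X \<in> cpxs A" and Y: "Y \<in> cpxs A"
  shows "dim_row m = cdim X i \<Longrightarrow> cdif Y i * (f i * m) = f (i + 1) * (cdif X i * m)"
    and "dim_vec v = cdim X i \<Longrightarrow> cdif Y i *\<^sub>v (f i *\<^sub>v v) = f (i + 1) *\<^sub>v (cdif X i *\<^sub>v v)"
    and "dim_vec w = cdim X (i - 1) \<Longrightarrow> cdif Y (i - 1) *\<^sub>v (f (i - 1) *\<^sub>v w) = f i *\<^sub>v (cdif X (i - 1) *\<^sub>v w)"
proof -
  note [simp] = chain_map_dims[OF f] cpxs_dims[OF X] cpxs_dims[OF Y]
  show "dim_row m = cdim X i \<Longrightarrow> cdif Y i * (f i * m) = f (i + 1) * (cdif X i * m)"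
    by (simp add: mat_assoc[symmetric] chain_map_comm[OF f])
  show *: "dim_vec v = cdim X i \<Longrightarrow> cdif Y i *\<^sub>v (f i *\<^sub>v v) = f (i + 1) *\<^sub>v (cdif X i *\<^sub>v v)" for i v
    by (simp add: mat_vec_assoc[symmetric] chain_map_comm[OF f])
  show "dim_vec w = cdim X (i - 1) \<Longrightarrow> cdif Y (i - 1) *\<^sub>v (f (i - 1) *\<^sub>v w) = f i *\<^sub>v (cdif X (i - 1) *\<^sub>v w)"
    using *[of w "i - 1"] by simp
qed

text \<open>A complex that is, degreewise, a direct sum with a lower triangular differential.  All complexes
  constructed below (sums, cones, fibres and the squares completing two roofs) have this form, with
  the off-diagonal entry \<open>w\<close> playing the role of the connecting map.\<close>

definition tw :: "('a, 'k::field) cpx \<Rightarrow> ('a, 'k) cpx \<Rightarrow> (int \<Rightarrow> 'k mat) \<Rightarrow> ('a, 'k) cpx" where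
  "tw X Y w = \<lparr>cobj = (\<lambda>i. sum_mod (cobj X i) (cobj Y i)),
     cdif = (\<lambda>i. four_block_mat (cdif X i) (0\<^sub>m (cdim X (i + 1)) (cdim Y i)) (w i) (cdif Y i))\<rparr>"

lemma tw_simps [simp]:
  "cobj (tw X Y w) i = sum_mod (cobj X i) (cobj Y i)"
  "cdif (tw X Y w) i = four_block_mat (cdif X i) (0\<^sub>m (cdim X (i + 1)) (cdim Y i)) (w i) (cdif Y i)"
  by (simp_all add: tw_def)

definition twist :: "('k::field, 'a) module \<Rightarrow> ('a, 'k) cpx \<Rightarrow> ('a, 'k) cpx \<Rightarrow> (int \<Rightarrow> 'k mat) \<Rightarrow> bool" where
  "twist A X Y w \<longleftrightarrow> X \<in> cpxs A \<and> Y \<in> cpxs A \<and> (\<forall>i. w i \<in> mod_hom A (cobj X i) (cobj Y (i + 1))) \<and>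
     (\<forall>i. cdif Y (i + 1) * w i = - (w (i + 1) * cdif X i))"

lemma twistI:
  assumes "X \<in> cpxs A" "Y \<in> cpxs A" "\<And>i. w i \<in> mod_hom A (cobj X i) (cobj Y (i + 1))"
    and "\<And>i. cdif Y (i + 1) * w i = - (w (i + 1) * cdif X i)"
  shows "twist A X Y w"
  using assms by (simp add: twist_def)

lemma twistD:
  assumes "twist A X Y w"
  shows "X \<in> cpxs A" "Y \<in> cpxs A" "w i \<in> mod_hom A (cobj X i) (cobj Y (i + 1))"
    and "cdif Y (i + 1) * w i = - (w (i + 1) * cdif X i)"
    and "dim_row (w i) = cdim Y (i + 1)" "dim_col (w i) = cdim X i"
  using assms mod_hom_dims[of "w i" A "cobj X i" "cobj Y (i + 1)"] by (auto simp: twist_def)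

lemma twist_vec:
  assumes t: "twist A X Y w" and v: "dim_vec v = cdim X i"
  shows "cdif Y (i + 1) *\<^sub>v (w i *\<^sub>v v) = - (w (i + 1) *\<^sub>v (cdif X i *\<^sub>v v))"
proof -
  note [simp] = cpxs_dims[OF twistD(1)[OF t]] cpxs_dims[OF twistD(2)[OF t]] twistD(5,6)[OF t] v
  show ?thesis by (simp add: mat_vec_assoc[symmetric] twistD(4)[OF t] mat_vec_uminus)
qed

lemma bounded_union:
  fixes P Q :: "int \<Rightarrow> bool"
  assumes "\<exists>N. \<forall>i. \<bar>i\<bar> > N \<longrightarrow> P i" "\<exists>N. \<forall>i. \<bar>i\<bar> > N \<longrightarrow> Q i"
  shows "\<exists>N. \<forall>i. \<bar>i\<bar> > N \<longrightarrow> P i \<and> Q i"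
proof -
  obtain N N' where "\<forall>i. \<bar>i\<bar> > N \<longrightarrow> P i" "\<forall>i. \<bar>i\<bar> > N' \<longrightarrow> Q i" using assms by blast
  then have "\<forall>i. \<bar>i\<bar> > max N N' \<longrightarrow> P i \<and> Q i" by simp
  then show ?thesis by blast
qed

lemma cpxs_bounded: "X \<in> cpxs A \<Longrightarrow> \<exists>N. \<forall>i. \<bar>i\<bar> > N \<longrightarrow> cdim X i = 0"
  by (simp add: cpxs_def)

lemma cpxsI:
  assumes "\<And>i. right_module A (cobj X i)" "\<And>i. cdif X i \<in> mod_hom A (cobj X i) (cobj X (i + 1))"
    and "\<And>i. cdif X (i + 1) * cdif X i = 0\<^sub>m (cdim X (i + 2)) (cdim X i)"
    and "\<exists>N. \<forall>i. \<bar>i\<bar> > N \<longrightarrow> cdim X i = 0"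
  shows "X \<in> cpxs A"
  using assms by (simp add: cpxs_def)

lemma tw_cpxs:
  assumes t: "twist A X Y w"
  shows "tw X Y w \<in> cpxs A"
proof (rule cpxsI)
  note X = twistD(1)[OF t] and Y = twistD(2)[OF t]
  note [simp] = cpxs_dims[OF X] cpxs_dims[OF Y] twistD(5,6)[OF t]
  fix i
  show "right_module A (cobj (tw X Y w) i)"
    by (simp add: right_module_sum_mod cpxs_mod[OF X] cpxs_mod[OF Y])
  show "cdif (tw X Y w) i \<in> mod_hom A (cobj (tw X Y w) i) (cobj (tw X Y w) (i + 1))"
    by (simp, intro mod_hom_four_block mod_hom_zero cpxs_mod[OF X] cpxs_mod[OF Y] cpxs_dif[OF X]
      cpxs_dif[OF Y] twistD(3)[OF t])
  show "cdif (tw X Y w) (i + 1) * cdif (tw X Y w) i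
      = 0\<^sub>m (cdim (tw X Y w) (i + 2)) (cdim (tw X Y w) i)"
    by (simp add: add.commute[of 2 i] four_block_mult cpxs_dd[OF X] cpxs_dd[OF Y] mat_cancel twistD(4)[OF t] block_zero)
  show "\<exists>N. \<forall>i. \<bar>i\<bar> > N \<longrightarrow> cdim (tw X Y w) i = 0"
    using bounded_union[OF cpxs_bounded[OF X] cpxs_bounded[OF Y]] by simp
qed

subsection \<open>Shifts, sums, cones and fibres\<close>

lemma shift_simps [simp]:
  "cobj (shift n X) i = cobj X (i + n)"
  "cdif (shift n X) i = (if even n then cdif X (i + n) else - cdif X (i + n))"
  by (simp_all add: shift_def)

lemma cpx_eqI:
  assumes "\<And>i. cobj X i = cobj Y i" "\<And>i. cdif X i = cdif Y i"
  shows "X = (Y :: ('a, 'k) cpx)"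
  using assms by (cases X; cases Y) (auto intro: ext)

lemma shift_shift: "shift n (shift m X) = shift (n + m) X"
  by (rule cpx_eqI) (auto simp: mat_uminus ac_simps)

lemma shift_0: "shift 0 X = X"
  by (rule cpx_eqI) auto

lemma shift_cpxs:
  assumes X: "X \<in> cpxs A"
  shows "shift n X \<in> cpxs A"
proof (rule cpxsI)
  note [simp] = cpxs_dims[OF X]
  fix i
  have e: "i + 1 + n = i + n + 1" "i + 2 + n = i + n + 2" by simp_all
  show "right_module A (cobj (shift n X) i)" by (simp add: cpxs_mod[OF X])
  show "cdif (shift n X) i \<in> mod_hom A (cobj (shift n X) i) (cobj (shift n X) (i + 1))"
    unfolding shift_simps e
    by (auto intro!: mod_hom_uminus cpxs_mod[OF X] cpxs_dif[OF X])
  show "cdif (shift n X) (i + 1) * cdif (shift n X) i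
      = 0\<^sub>m (cdim (shift n X) (i + 2)) (cdim (shift n X) i)"
    unfolding shift_simps e by (simp add: mat_uminus cpxs_dd[OF X])
  obtain N where "\<forall>i. \<bar>i\<bar> > N \<longrightarrow> cdim X i = 0" using cpxs_bounded[OF X] by blast
  then show "\<exists>N. \<forall>i. \<bar>i\<bar> > N \<longrightarrow> cdim (shift n X) i = 0"
    by (intro exI[of _ "N + \<bar>n\<bar>"]) auto
qed

lemma cone_eq_tw: "cone X Y f = tw (shift 1 X) Y (\<lambda>i. f (i + 1))"
  by (rule cpx_eqI) (simp_all add: cone_def add.commute)

lemma sum_cpx_eq_tw: "sum_cpx X Y = tw X Y (\<lambda>i. 0\<^sub>m (cdim Y (i + 1)) (cdim X i))"
  by (rule cpx_eqI) (simp_all add: sum_cpx_def)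

text \<open>The fibre of \<open>t\<close>, that is, the cone shifted back by one.\<close>

definition fib :: "('a, 'k::field) cpx \<Rightarrow> ('a, 'k) cpx \<Rightarrow> (int \<Rightarrow> 'k mat) \<Rightarrow> ('a, 'k) cpx" where
  "fib X Y t = tw X (shift (- 1) Y) (\<lambda>i. - t i)"

lemma twist_cone:
  assumes X: "X \<in> cpxs A" and Y: "Y \<in> cpxs A" and f: "f \<in> chain_maps A X Y"
  shows "twist A (shift 1 X) Y (\<lambda>i. f (i + 1))"
  by (rule twistI) (simp_all add: shift_cpxs[OF X] Y chain_map_mod[OF f] chain_map_comm[OF f]
     mat_uminus chain_map_dims[OF f] cpxs_dims[OF X])

lemma cone_cpxs: "X \<in> cpxs A \<Longrightarrow> Y \<in> cpxs A \<Longrightarrow> f \<in> chain_maps A X Y \<Longrightarrow> cone X Y f \<in> cpxs A"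
  unfolding cone_eq_tw by (rule tw_cpxs[OF twist_cone])

lemma twist_zero:
  assumes X: "X \<in> cpxs A" and Y: "Y \<in> cpxs A"
  shows "twist A X Y (\<lambda>i. 0\<^sub>m (cdim Y (i + 1)) (cdim X i))"
  by (rule twistI) (simp_all add: X Y mod_hom_zero cpxs_mod[OF X] cpxs_mod[OF Y] mat_uminus
     cpxs_dims[OF X] cpxs_dims[OF Y])

lemma sum_cpxs: "X \<in> cpxs A \<Longrightarrow> Y \<in> cpxs A \<Longrightarrow> sum_cpx X Y \<in> cpxs A"
  unfolding sum_cpx_eq_tw by (rule tw_cpxs[OF twist_zero])

lemma twist_fib:
  assumes X: "X \<in> cpxs A" and Y: "Y \<in> cpxs A" and f: "f \<in> chain_maps A X Y"
  shows "twist A X (shift (- 1) Y) (\<lambda>i. - f i)"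
  by (rule twistI) (simp_all add: shift_cpxs[OF Y] X mod_hom_uminus cpxs_mod[OF X] cpxs_mod[OF Y]
     chain_map_mod[OF f] chain_map_comm[OF f]
     mat_uminus chain_map_dims[OF f] cpxs_dims[OF X] cpxs_dims[OF Y])

lemma fib_cpxs: "X \<in> cpxs A \<Longrightarrow> Y \<in> cpxs A \<Longrightarrow> f \<in> chain_maps A X Y \<Longrightarrow> fib X Y f \<in> cpxs A"
  unfolding fib_def by (rule tw_cpxs[OF twist_fib])

lemma shift_fib:
  assumes X: "X \<in> cpxs A" and Y: "Y \<in> cpxs A" and f: "f \<in> chain_maps A X Y"
  shows "shift 1 (fib X Y f) = cone X Y f"
  by (rule cpx_eqI) (simp_all add: fib_def cone_eq_tw block_add mat_uminus cpxs_dims[OF X] cpxs_dims[OF Y]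
     chain_map_dims[OF f] add.commute)

section \<open>Cohomology and quasi-isomorphisms\<close>

lemma cocycles_iff: "z \<in> cocycles X i \<longleftrightarrow> dim_vec z = cdim X i \<and> cdif X i *\<^sub>v z = 0\<^sub>v (cdim X (i + 1))"
  unfolding cocycles_def by (auto intro: carrier_vecI dest: carrier_vecD)

lemma coboundaries_iff:
  "b \<in> coboundaries X i \<longleftrightarrow> (\<exists>y. dim_vec y = cdim X (i - 1) \<and> b = cdif X (i - 1) *\<^sub>v y)"
  unfolding coboundaries_def by (auto intro: carrier_vecI dest: carrier_vecD)

lemma coboundariesI: "dim_vec y = cdim X (i - 1) \<Longrightarrow> b = cdif X (i - 1) *\<^sub>v y \<Longrightarrow> b \<in> coboundaries X i"
  by (auto simp: coboundaries_iff)

lemma coboundary_is_cocycle: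
  assumes X: "X \<in> cpxs A" and b: "b \<in> coboundaries X i"
  shows "b \<in> cocycles X i"
proof -
  obtain y where y: "dim_vec y = cdim X (i - 1)" "b = cdif X (i - 1) *\<^sub>v y"
    using b by (auto simp: coboundaries_iff)
  then show ?thesis using cpxs_dd(5)[OF X y(1)] by (simp add: cocycles_iff cpxs_dims[OF X])
qed

lemma coboundary_dim: "X \<in> cpxs A \<Longrightarrow> b \<in> coboundaries X i \<Longrightarrow> dim_vec b = cdim X i"
  using coboundary_is_cocycle by (auto simp: cocycles_iff)

lemma coboundary_zero:
  assumes X: "X \<in> cpxs A"
  shows "0\<^sub>v (cdim X i) \<in> coboundaries X i"
  by (rule coboundariesI[of "0\<^sub>v (cdim X (i - 1))"]) (simp_all add: cpxs_dims[OF X] mat_vec_zero)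

lemma coboundary_add:
  assumes X: "X \<in> cpxs A" and b: "b \<in> coboundaries X i" "c \<in> coboundaries X i"
  shows "b + c \<in> coboundaries X i"
proof -
  note [simp] = cpxs_dims[OF X]
  obtain y z where "dim_vec y = cdim X (i - 1)" "b = cdif X (i - 1) *\<^sub>v y"
    "dim_vec z = cdim X (i - 1)" "c = cdif X (i - 1) *\<^sub>v z"
    using b by (auto simp: coboundaries_iff)
  then show ?thesis by (intro coboundariesI[of "y + z"]) (simp_all add: mat_vec_distrib)
qed

lemma coboundary_uminus:
  assumes X: "X \<in> cpxs A" and b: "b \<in> coboundaries X i"
  shows "- b \<in> coboundaries X i"
proof -
  note [simp] = cpxs_dims[OF X]
  obtain y where "dim_vec y = cdim X (i - 1)" "b = cdif X (i - 1) *\<^sub>v y"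
    using b by (auto simp: coboundaries_iff)
  then show ?thesis by (intro coboundariesI[of "- y"]) (simp_all add: mat_vec_uminus)
qed

lemma coboundary_diff:
  assumes X: "X \<in> cpxs A" and b: "b \<in> coboundaries X i" "c \<in> coboundaries X i"
  shows "b - c \<in> coboundaries X i"
  using coboundary_add[OF X b(1) coboundary_uminus[OF X b(2)]] coboundary_dim[OF X b(1)] coboundary_dim[OF X b(2)]
  by (simp add: mat_vec_uminus)

lemma cocycle_diff:
  assumes X: "X \<in> cpxs A" and b: "b \<in> cocycles X i" "c \<in> cocycles X i"
  shows "b - c \<in> cocycles X i" "b + c \<in> cocycles X i" "- b \<in> cocycles X i"
  using b by (auto simp: cocycles_iff cpxs_dims[OF X] mat_vec_uminus mat_vec_distrib vec_cancel)

lemma chain_map_cocycle: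
  assumes X: "X \<in> cpxs A" and Y: "Y \<in> cpxs A" and f: "f \<in> chain_maps A X Y" and z: "z \<in> cocycles X i"
  shows "f i *\<^sub>v z \<in> cocycles Y i"
  using z chain_map_comm'(2)[OF f X Y, of z i] by (auto simp: cocycles_iff chain_map_dims[OF f] mat_vec_zero)

lemma chain_map_coboundary:
  assumes X: "X \<in> cpxs A" and Y: "Y \<in> cpxs A" and f: "f \<in> chain_maps A X Y" and z: "z \<in> coboundaries X i"
  shows "f i *\<^sub>v z \<in> coboundaries Y i"
proof -
  obtain y where y: "dim_vec y = cdim X (i - 1)" "z = cdif X (i - 1) *\<^sub>v y"
    using z by (auto simp: coboundaries_iff)
  show ?thesis
    by (rule coboundariesI[of "f (i - 1) *\<^sub>v y"])
      (simp_all add: chain_map_dims[OF f] chain_map_comm'(3)[OF f X Y y(1)] y(2))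
qed

text \<open>The two halves of being a quasi-isomorphism are separated because a map with inverses only up to
  roofs is shown to be injective and surjective on cohomology by two different composites.\<close>

definition coh_inj :: "('a, 'k::field) cpx \<Rightarrow> ('a, 'k) cpx \<Rightarrow> (int \<Rightarrow> 'k mat) \<Rightarrow> bool" where
  "coh_inj X Y f \<longleftrightarrow> (\<forall>i. \<forall>z\<in>cocycles X i. f i *\<^sub>v z \<in> coboundaries Y i \<longrightarrow> z \<in> coboundaries X i)"

definition coh_surj :: "('a, 'k::field) cpx \<Rightarrow> ('a, 'k) cpx \<Rightarrow> (int \<Rightarrow> 'k mat) \<Rightarrow> bool" where
  "coh_surj X Y f \<longleftrightarrow> (\<forall>i. \<forall>w\<in>cocycles Y i. \<exists>z\<in>cocycles X i. w - f i *\<^sub>v z \<in> coboundaries Y i)"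

lemma quasi_isos_iff: "f \<in> quasi_isos A X Y \<longleftrightarrow> f \<in> chain_maps A X Y \<and> coh_inj X Y f \<and> coh_surj X Y f"
  unfolding quasi_isos_def coh_inj_def coh_surj_def by blast

lemma quasi_iso_chain: "f \<in> quasi_isos A X Y \<Longrightarrow> f \<in> chain_maps A X Y"
  by (simp add: quasi_isos_def)

definition acyclic_cpx :: "('a, 'k::field) cpx \<Rightarrow> bool" where
  "acyclic_cpx X \<longleftrightarrow> (\<forall>i. cohomology_zero X i)"

lemma acyclic_cpx_iff:
  assumes X: "X \<in> cpxs A"
  shows "acyclic_cpx X \<longleftrightarrow> (\<forall>i. cocycles X i \<subseteq> coboundaries X i)"
  using coboundary_is_cocycle[OF X] unfolding acyclic_cpx_def cohomology_zero_def by blast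

lemma acyclicD:
  assumes "X \<in> cpxs A" "acyclic_cpx X" "dim_vec z = cdim X i" "cdif X i *\<^sub>v z = 0\<^sub>v (cdim X (i + 1))"
  obtains y where "dim_vec y = cdim X (i - 1)" "z = cdif X (i - 1) *\<^sub>v y"
proof -
  have "z \<in> cocycles X i" using assms(3,4) by (simp add: cocycles_iff)
  then have "z \<in> coboundaries X i" using assms(2) acyclic_cpx_iff[OF assms(1)] by blast
  then show ?thesis using that by (auto simp: coboundaries_iff)
qed

lemma chain_comp_chain_map:
  assumes X: "X \<in> cpxs A" and Y: "Y \<in> cpxs A" and Z: "Z \<in> cpxs A"
    and f: "f \<in> chain_maps A X Y" and g: "g \<in> chain_maps A Y Z"
  shows "g \<circ>\<^sub>c f \<in> chain_maps A X Z"
proof (rule chain_mapsI)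
  fix i
  note [simp] = chain_map_dims[OF f] chain_map_dims[OF g] cpxs_dims[OF X] cpxs_dims[OF Y] cpxs_dims[OF Z]
  show "(g \<circ>\<^sub>c f) i \<in> mod_hom A (cobj X i) (cobj Z i)"
    unfolding chain_comp_def
    by (rule mod_hom_mult[OF cpxs_mod[OF X] cpxs_mod[OF Y] cpxs_mod[OF Z] chain_map_mod[OF f] chain_map_mod[OF g]])
  show "cdif Z i * (g \<circ>\<^sub>c f) i = (g \<circ>\<^sub>c f) (i + 1) * cdif X i"
    by (simp add: chain_comp_def chain_map_comm'(1)[OF g Y Z] mat_assoc chain_map_comm[OF f])
qed

lemma chain_id_chain_map: "X \<in> cpxs A \<Longrightarrow> chain_id X \<in> chain_maps A X X"
  by (rule chain_mapsI) (simp_all add: chain_id_def mod_hom_one cpxs_mod cpxs_dims)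

lemma chain_zero_chain_map:
  assumes X: "X \<in> cpxs A" and Y: "Y \<in> cpxs A"
  shows "chain_zero X Y \<in> chain_maps A X Y"
  by (rule chain_mapsI) (simp_all add: chain_zero_def mod_hom_zero cpxs_mod[OF X] cpxs_mod[OF Y] cpxs_dims[OF X] cpxs_dims[OF Y])

lemma chain_comp_simps:
  assumes f: "f \<in> chain_maps A X Y"
  shows "chain_id Y \<circ>\<^sub>c f = f" "f \<circ>\<^sub>c chain_id X = f"
    "chain_zero Y Z \<circ>\<^sub>c f = chain_zero X Z" "f \<circ>\<^sub>c chain_zero Z X = chain_zero Z Y"
  by (auto simp: chain_comp_def chain_id_def chain_zero_def chain_map_dims[OF f])

lemma chain_comp_assoc:
  assumes f: "f \<in> chain_maps A X Y" and g: "g \<in> chain_maps A Y Z" and h: "h \<in> chain_maps A Z W"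
  shows "(h \<circ>\<^sub>c g) \<circ>\<^sub>c f = h \<circ>\<^sub>c (g \<circ>\<^sub>c f)"
  by (auto simp: chain_comp_def mat_assoc chain_map_dims[OF f] chain_map_dims[OF g] chain_map_dims[OF h])

subsection \<open>Homotopies\<close>

lemma homotopicI:
  assumes "\<And>i. h i \<in> mod_hom A (cobj X i) (cobj Y (i - 1))"
    and "\<And>i. f i - g i = cdif Y (i - 1) * h i + h (i + 1) * cdif X i"
  shows "homotopic A X Y f g"
  using assms unfolding homotopic_def by blast

lemma homotopicE:
  assumes "homotopic A X Y f g"
  obtains h where "\<And>i. h i \<in> mod_hom A (cobj X i) (cobj Y (i - 1))"
    "\<And>i. f i - g i = cdif Y (i - 1) * h i + h (i + 1) * cdif X i"
    "\<And>i. dim_row (h i) = cdim Y (i - 1)" "\<And>i. dim_col (h i) = cdim X i"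
  using assms mod_hom_dims unfolding homotopic_def by blast

text \<open>Null-homotopies without the subtraction of the zero map, so that the equation can be used for rewriting.\<close>

lemma homotopic_zeroE:
  assumes Y: "Y \<in> cpxs A" and f: "f \<in> chain_maps A X Y" and "homotopic A X Y f (chain_zero X Y)"
  obtains h where "\<And>i. h i \<in> mod_hom A (cobj X i) (cobj Y (i - 1))"
    "\<And>i. f i = cdif Y (i - 1) * h i + h (i + 1) * cdif X i"
    "\<And>i. dim_row (h i) = cdim Y (i - 1)" "\<And>i. dim_col (h i) = cdim X i"
proof -
  from homotopicE[OF assms(3)] obtain h where h: "\<And>i. h i \<in> mod_hom A (cobj X i) (cobj Y (i - 1))"
    "\<And>i. f i - chain_zero X Y i = cdif Y (i - 1) * h i + h (i + 1) * cdif X i"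
    "\<And>i. dim_row (h i) = cdim Y (i - 1)" "\<And>i. dim_col (h i) = cdim X i" by blast
  have "f i - chain_zero X Y i = f i" for i
    by (simp add: chain_zero_def mat_uminus chain_map_dims[OF f] mat_cancel)
  then show ?thesis by (intro that[of h] h) (simp add: h(2)[symmetric])
qed

lemma homotopic_zeroI:
  assumes f: "f \<in> chain_maps A X Y" and h: "\<And>i. h i \<in> mod_hom A (cobj X i) (cobj Y (i - 1))"
    and e: "\<And>i. f i = cdif Y (i - 1) * h i + h (i + 1) * cdif X i"
  shows "homotopic A X Y f (chain_zero X Y)"
proof (rule homotopicI)
  fix i show "h i \<in> mod_hom A (cobj X i) (cobj Y (i - 1))" by (rule h)
  have "f i - chain_zero X Y i = f i"
    by (simp add: chain_zero_def mat_uminus chain_map_dims[OF f] mat_cancel)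
  then show "f i - chain_zero X Y i = cdif Y (i - 1) * h i + h (i + 1) * cdif X i" using e by simp
qed

lemma homotopic_refl:
  assumes X: "X \<in> cpxs A" and Y: "Y \<in> cpxs A" and f: "f \<in> chain_maps A X Y"
  shows "homotopic A X Y f f"
  by (rule homotopicI[of "\<lambda>i. 0\<^sub>m (cdim Y (i - 1)) (cdim X i)"])
   (simp_all add: mod_hom_zero cpxs_mod[OF X] cpxs_mod[OF Y] cpxs_dims[OF X] cpxs_dims[OF Y] chain_map_dims[OF f]
     mat_uminus mat_cancel)

lemma homotopic_sym:
  assumes X: "X \<in> cpxs A" and Y: "Y \<in> cpxs A" and f: "f \<in> chain_maps A X Y" and g: "g \<in> chain_maps A X Y"
    and "homotopic A X Y f g"
  shows "homotopic A X Y g f"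
proof -
  note [simp] = cpxs_dims[OF X] cpxs_dims[OF Y] chain_map_dims[OF f] chain_map_dims[OF g]
  from homotopicE[OF assms(5)] obtain h where h: "\<And>i. h i \<in> mod_hom A (cobj X i) (cobj Y (i - 1))"
    "\<And>i. f i - g i = cdif Y (i - 1) * h i + h (i + 1) * cdif X i"
    and [simp]: "\<And>i. dim_row (h i) = cdim Y (i - 1)" "\<And>i. dim_col (h i) = cdim X i" by blast
  show ?thesis
  proof (rule homotopicI[of "\<lambda>i. - h i"])
    fix i show "- h i \<in> mod_hom A (cobj X i) (cobj Y (i - 1))"
      by (rule mod_hom_uminus[OF cpxs_mod[OF X] cpxs_mod[OF Y] h(1)])
    have "g i - f i = - (f i - g i)" by (simp add: mat_uminus mat_add_ac)
    then show "g i - f i = cdif Y (i - 1) * - h i + - h (i + 1) * cdif X i"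
      by (simp add: h(2) mat_uminus)
  qed
qed

lemma homotopic_trans:
  assumes X: "X \<in> cpxs A" and Y: "Y \<in> cpxs A" and f: "f \<in> chain_maps A X Y" and g: "g \<in> chain_maps A X Y"
    and h: "h \<in> chain_maps A X Y" and "homotopic A X Y f g" "homotopic A X Y g h"
  shows "homotopic A X Y f h"
proof -
  note [simp] = cpxs_dims[OF X] cpxs_dims[OF Y] chain_map_dims[OF f] chain_map_dims[OF g] chain_map_dims[OF h]
  from homotopicE[OF assms(6)] obtain k where k: "\<And>i. k i \<in> mod_hom A (cobj X i) (cobj Y (i - 1))"
    "\<And>i. f i - g i = cdif Y (i - 1) * k i + k (i + 1) * cdif X i"
    and [simp]: "\<And>i. dim_row (k i) = cdim Y (i - 1)" "\<And>i. dim_col (k i) = cdim X i" by blast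
  from homotopicE[OF assms(7)] obtain l where l: "\<And>i. l i \<in> mod_hom A (cobj X i) (cobj Y (i - 1))"
    "\<And>i. g i - h i = cdif Y (i - 1) * l i + l (i + 1) * cdif X i"
    and [simp]: "\<And>i. dim_row (l i) = cdim Y (i - 1)" "\<And>i. dim_col (l i) = cdim X i" by blast
  show ?thesis
  proof (rule homotopicI[of "\<lambda>i. k i + l i"])
    fix i show "k i + l i \<in> mod_hom A (cobj X i) (cobj Y (i - 1))"
      by (rule mod_hom_add[OF cpxs_mod[OF X] cpxs_mod[OF Y] k(1) l(1)])
    have "f i - h i = (f i - g i) + (g i - h i)" by (simp add: mat_uminus mat_add_ac mat_cancel)
    then show "f i - h i = cdif Y (i - 1) * (k i + l i) + (k (i + 1) + l (i + 1)) * cdif X i"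
      by (simp add: k(2) l(2) mat_ring)
  qed
qed

lemma homotopic_comp_left:
  assumes X: "X \<in> cpxs A" and Y: "Y \<in> cpxs A" and Z: "Z \<in> cpxs A"
    and f: "f \<in> chain_maps A X Y" and f': "f' \<in> chain_maps A X Y" and g: "g \<in> chain_maps A Y Z"
    and "homotopic A X Y f f'"
  shows "homotopic A X Z (g \<circ>\<^sub>c f) (g \<circ>\<^sub>c f')"
proof -
  note [simp] = cpxs_dims[OF X] cpxs_dims[OF Y] cpxs_dims[OF Z] chain_map_dims[OF f] chain_map_dims[OF f'] chain_map_dims[OF g]
  from homotopicE[OF assms(7)] obtain k where k: "\<And>i. k i \<in> mod_hom A (cobj X i) (cobj Y (i - 1))"
    "\<And>i. f i - f' i = cdif Y (i - 1) * k i + k (i + 1) * cdif X i"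
    and [simp]: "\<And>i. dim_row (k i) = cdim Y (i - 1)" "\<And>i. dim_col (k i) = cdim X i" by blast
  show ?thesis
  proof (rule homotopicI[of "\<lambda>i. g (i - 1) * k i"])
    fix i show "g (i - 1) * k i \<in> mod_hom A (cobj X i) (cobj Z (i - 1))"
      by (rule mod_hom_mult[OF cpxs_mod[OF X] cpxs_mod[OF Y] cpxs_mod[OF Z] k(1) chain_map_mod[OF g]])
    have "(g \<circ>\<^sub>c f) i - (g \<circ>\<^sub>c f') i = g i * (f i - f' i)" by (simp add: chain_comp_def mat_ring)
    then show "(g \<circ>\<^sub>c f) i - (g \<circ>\<^sub>c f') i = cdif Z (i - 1) * (g (i - 1) * k i) + g (i + 1 - 1) * k (i + 1) * cdif X i"
      using chain_map_comm'(1)[OF g Y Z, of "k i" "i - 1"] by (simp add: k(2) mat_distrib mat_assoc)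
  qed
qed

lemma homotopic_comp_right:
  assumes X: "X \<in> cpxs A" and Y: "Y \<in> cpxs A" and Z: "Z \<in> cpxs A"
    and f: "f \<in> chain_maps A X Y" and g: "g \<in> chain_maps A Y Z" and g': "g' \<in> chain_maps A Y Z"
    and "homotopic A Y Z g g'"
  shows "homotopic A X Z (g \<circ>\<^sub>c f) (g' \<circ>\<^sub>c f)"
proof -
  note [simp] = cpxs_dims[OF X] cpxs_dims[OF Y] cpxs_dims[OF Z] chain_map_dims[OF f] chain_map_dims[OF g'] chain_map_dims[OF g]
  from homotopicE[OF assms(7)] obtain k where k: "\<And>i. k i \<in> mod_hom A (cobj Y i) (cobj Z (i - 1))"
    "\<And>i. g i - g' i = cdif Z (i - 1) * k i + k (i + 1) * cdif Y i"
    and [simp]: "\<And>i. dim_row (k i) = cdim Z (i - 1)" "\<And>i. dim_col (k i) = cdim Y i" by blast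
  show ?thesis
  proof (rule homotopicI[of "\<lambda>i. k i * f i"])
    fix i show "k i * f i \<in> mod_hom A (cobj X i) (cobj Z (i - 1))"
      by (rule mod_hom_mult[OF cpxs_mod[OF X] cpxs_mod[OF Y] cpxs_mod[OF Z] chain_map_mod[OF f] k(1)])
    have "(g \<circ>\<^sub>c f) i - (g' \<circ>\<^sub>c f) i = (g i - g' i) * f i" by (simp add: chain_comp_def mat_ring)
    then show "(g \<circ>\<^sub>c f) i - (g' \<circ>\<^sub>c f) i = cdif Z (i - 1) * (k i * f i) + k (i + 1) * f (i + 1) * cdif X i"
      by (simp add: k(2) mat_distrib mat_assoc chain_map_comm[OF f])
  qed
qed

lemma homotopic_cohomology:
  assumes X: "X \<in> cpxs A" and Y: "Y \<in> cpxs A" and f: "f \<in> chain_maps A X Y" and g: "g \<in> chain_maps A X Y"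
    and "homotopic A X Y f g" and z: "z \<in> cocycles X i"
  shows "f i *\<^sub>v z - g i *\<^sub>v z \<in> coboundaries Y i"
proof -
  note [simp] = cpxs_dims[OF X] cpxs_dims[OF Y] chain_map_dims[OF f] chain_map_dims[OF g]
  from homotopicE[OF assms(5)] obtain k where k: "\<And>i. k i \<in> mod_hom A (cobj X i) (cobj Y (i - 1))"
    "\<And>i. f i - g i = cdif Y (i - 1) * k i + k (i + 1) * cdif X i"
    and [simp]: "\<And>i. dim_row (k i) = cdim Y (i - 1)" "\<And>i. dim_col (k i) = cdim X i" by blast
  have [simp]: "dim_vec z = cdim X i" "cdif X i *\<^sub>v z = 0\<^sub>v (cdim X (i + 1))" using z by (auto simp: cocycles_iff)
  have "f i *\<^sub>v z - g i *\<^sub>v z = (f i - g i) *\<^sub>v z" by (simp add: mat_uminus vec_ring)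
  also have "\<dots> = cdif Y (i - 1) *\<^sub>v (k i *\<^sub>v z)" by (simp add: k(2) vec_ring)
  finally show ?thesis by (intro coboundariesI[of "k i *\<^sub>v z"]) simp_all
qed

lemma coh_homotopic:
  assumes X: "X \<in> cpxs A" and Y: "Y \<in> cpxs A" and f: "f \<in> chain_maps A X Y" and g: "g \<in> chain_maps A X Y"
    and h: "homotopic A X Y f g"
  shows "coh_inj X Y f \<Longrightarrow> coh_inj X Y g" "coh_surj X Y f \<Longrightarrow> coh_surj X Y g"
proof -
  note [simp] = cpxs_dims[OF X] cpxs_dims[OF Y] chain_map_dims[OF f] chain_map_dims[OF g]
  show "coh_inj X Y g" if i: "coh_inj X Y f"
    unfolding coh_inj_def
  proof (intro allI ballI impI)
    fix i z assume z: "z \<in> cocycles X i" "g i *\<^sub>v z \<in> coboundaries Y i"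
    have "(f i *\<^sub>v z - g i *\<^sub>v z) + g i *\<^sub>v z \<in> coboundaries Y i"
      by (rule coboundary_add[OF Y homotopic_cohomology[OF X Y f g h z(1)] z(2)])
    moreover have "(f i *\<^sub>v z - g i *\<^sub>v z) + g i *\<^sub>v z = f i *\<^sub>v z" by (simp add: vec_ring)
    ultimately show "z \<in> coboundaries X i" using i z(1) by (auto simp: coh_inj_def)
  qed
  show "coh_surj X Y g" if i: "coh_surj X Y f"
    unfolding coh_surj_def
  proof (intro allI ballI)
    fix i w assume w: "w \<in> cocycles Y i"
    then obtain z where z: "z \<in> cocycles X i" "w - f i *\<^sub>v z \<in> coboundaries Y i" using i by (auto simp: coh_surj_def)
    have [simp]: "dim_vec w = cdim Y i" using w by (simp add: cocycles_iff)
    have "(w - f i *\<^sub>v z) + (f i *\<^sub>v z - g i *\<^sub>v z) \<in> coboundaries Y i"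
      by (rule coboundary_add[OF Y z(2) homotopic_cohomology[OF X Y f g h z(1)]])
    moreover have "(w - f i *\<^sub>v z) + (f i *\<^sub>v z - g i *\<^sub>v z) = w - g i *\<^sub>v z" by (simp add: vec_ring)
    ultimately show "\<exists>z\<in>cocycles X i. w - g i *\<^sub>v z \<in> coboundaries Y i" using z(1) by auto
  qed
qed

lemma quasi_iso_homotopic:
  assumes "X \<in> cpxs A" "Y \<in> cpxs A" "f \<in> quasi_isos A X Y" "g \<in> chain_maps A X Y" "homotopic A X Y f g"
  shows "g \<in> quasi_isos A X Y"
  using coh_homotopic[OF assms(1,2) _ assms(4,5)] assms(3,4) by (simp add: quasi_isos_iff)

text \<open>Two out of three, for each half of being a quasi-isomorphism.\<close>

lemma coh_comp:
  assumes X: "X \<in> cpxs A" and Y: "Y \<in> cpxs A" and Z: "Z \<in> cpxs A"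
    and f: "f \<in> chain_maps A X Y" and g: "g \<in> chain_maps A Y Z"
  shows "coh_inj X Y f \<Longrightarrow> coh_inj Y Z g \<Longrightarrow> coh_inj X Z (g \<circ>\<^sub>c f)"
    and "coh_surj X Y f \<Longrightarrow> coh_surj Y Z g \<Longrightarrow> coh_surj X Z (g \<circ>\<^sub>c f)"
    and "coh_inj X Z (g \<circ>\<^sub>c f) \<Longrightarrow> coh_inj X Y f"
    and "coh_surj X Z (g \<circ>\<^sub>c f) \<Longrightarrow> coh_surj Y Z g"
    and "coh_inj X Z (g \<circ>\<^sub>c f) \<Longrightarrow> coh_surj X Y f \<Longrightarrow> coh_inj Y Z g"
    and "coh_surj X Z (g \<circ>\<^sub>c f) \<Longrightarrow> coh_inj Y Z g \<Longrightarrow> coh_surj X Y f"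
proof -
  note [simp] = cpxs_dims[OF X] cpxs_dims[OF Y] cpxs_dims[OF Z] chain_map_dims[OF f] chain_map_dims[OF g]
  have c: "(g \<circ>\<^sub>c f) i *\<^sub>v z = g i *\<^sub>v (f i *\<^sub>v z)" if "z \<in> cocycles X i" for i z
    using that by (simp add: chain_comp_def mat_vec_assoc cocycles_iff)
  have fz: "f i *\<^sub>v z \<in> cocycles Y i" if "z \<in> cocycles X i" for i z
    using chain_map_cocycle[OF X Y f that] .
  have gz: "g i *\<^sub>v z \<in> cocycles Z i" if "z \<in> cocycles Y i" for i z
    using chain_map_cocycle[OF Y Z g that] .
  have gb: "g i *\<^sub>v z \<in> coboundaries Z i" if "z \<in> coboundaries Y i" for i z
    using chain_map_coboundary[OF Y Z g that] .
  show "coh_inj X Z (g \<circ>\<^sub>c f)" if "coh_inj X Y f" "coh_inj Y Z g"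
    using that fz unfolding coh_inj_def by (simp add: c)
  show "coh_inj X Y f" if "coh_inj X Z (g \<circ>\<^sub>c f)"
    using that gb unfolding coh_inj_def by (simp add: c)
  show "coh_surj X Z (g \<circ>\<^sub>c f)" if s: "coh_surj X Y f" "coh_surj Y Z g"
    unfolding coh_surj_def
  proof (intro allI ballI)
    fix i w assume w: "w \<in> cocycles Z i"
    obtain y where y: "y \<in> cocycles Y i" "w - g i *\<^sub>v y \<in> coboundaries Z i" using s(2) w by (auto simp: coh_surj_def)
    obtain x where x: "x \<in> cocycles X i" "y - f i *\<^sub>v x \<in> coboundaries Y i" using s(1) y(1) by (auto simp: coh_surj_def)
    have [simp]: "dim_vec w = cdim Z i" "dim_vec y = cdim Y i" "dim_vec x = cdim X i"
      using w y x by (auto simp: cocycles_iff)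
    have "(w - g i *\<^sub>v y) + g i *\<^sub>v (y - f i *\<^sub>v x) \<in> coboundaries Z i"
      by (rule coboundary_add[OF Z y(2) gb[OF x(2)]])
    moreover have "(w - g i *\<^sub>v y) + g i *\<^sub>v (y - f i *\<^sub>v x) = w - (g \<circ>\<^sub>c f) i *\<^sub>v x"
      using x(1) by (simp add: c vec_ring)
    ultimately show "\<exists>z\<in>cocycles X i. w - (g \<circ>\<^sub>c f) i *\<^sub>v z \<in> coboundaries Z i" using x(1) by auto
  qed
  show "coh_surj Y Z g" if "coh_surj X Z (g \<circ>\<^sub>c f)"
    using that fz unfolding coh_surj_def by (metis c)
  show "coh_inj Y Z g" if s: "coh_inj X Z (g \<circ>\<^sub>c f)" "coh_surj X Y f"
    unfolding coh_inj_def
  proof (intro allI ballI impI)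
    fix i y assume y: "y \<in> cocycles Y i" "g i *\<^sub>v y \<in> coboundaries Z i"
    obtain x where x: "x \<in> cocycles X i" "y - f i *\<^sub>v x \<in> coboundaries Y i" using s(2) y(1) by (auto simp: coh_surj_def)
    have [simp]: "dim_vec y = cdim Y i" "dim_vec x = cdim X i"
      using y x by (auto simp: cocycles_iff)
    have "g i *\<^sub>v y - g i *\<^sub>v (y - f i *\<^sub>v x) \<in> coboundaries Z i"
      by (rule coboundary_diff[OF Z y(2) gb[OF x(2)]])
    moreover have "g i *\<^sub>v y - g i *\<^sub>v (y - f i *\<^sub>v x) = (g \<circ>\<^sub>c f) i *\<^sub>v x"
      using x(1) by (simp add: c vec_ring)
    ultimately have "x \<in> coboundaries X i" using s(1) x(1) by (auto simp: coh_inj_def)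
    then have "(y - f i *\<^sub>v x) + f i *\<^sub>v x \<in> coboundaries Y i"
      by (intro coboundary_add[OF Y x(2)] chain_map_coboundary[OF X Y f])
    then show "y \<in> coboundaries Y i" by (simp add: vec_ring)
  qed
  show "coh_surj X Y f" if s: "coh_surj X Z (g \<circ>\<^sub>c f)" "coh_inj Y Z g"
    unfolding coh_surj_def
  proof (intro allI ballI)
    fix i y assume y: "y \<in> cocycles Y i"
    obtain x where x: "x \<in> cocycles X i" "g i *\<^sub>v y - (g \<circ>\<^sub>c f) i *\<^sub>v x \<in> coboundaries Z i"
      using s(1) gz[OF y] by (auto simp: coh_surj_def)
    have [simp]: "dim_vec y = cdim Y i" "dim_vec x = cdim X i"
      using y x by (auto simp: cocycles_iff)
    have "g i *\<^sub>v (y - f i *\<^sub>v x) = g i *\<^sub>v y - (g \<circ>\<^sub>c f) i *\<^sub>v x"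
      using x(1) by (simp add: c vec_ring)
    then have "y - f i *\<^sub>v x \<in> coboundaries Y i"
      using s(2) x cocycle_diff(1)[OF Y y fz[OF x(1)]] by (auto simp: coh_inj_def)
    then show "\<exists>z\<in>cocycles X i. y - f i *\<^sub>v z \<in> coboundaries Y i" using x(1) by auto
  qed
qed

lemma quasi_iso_comp:
  assumes "X \<in> cpxs A" "Y \<in> cpxs A" "Z \<in> cpxs A" "f \<in> quasi_isos A X Y" "g \<in> quasi_isos A Y Z"
  shows "g \<circ>\<^sub>c f \<in> quasi_isos A X Z"
  using coh_comp(1,2)[OF assms(1-3)] chain_comp_chain_map[OF assms(1-3)] assms(4,5) by (simp add: quasi_isos_iff)

lemma quasi_iso_cancel_left:
  assumes "X \<in> cpxs A" "Y \<in> cpxs A" "Z \<in> cpxs A" "f \<in> chain_maps A X Y" "g \<in> quasi_isos A Y Z"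
    and "g \<circ>\<^sub>c f \<in> quasi_isos A X Z"
  shows "f \<in> quasi_isos A X Y"
  using coh_comp(3,6)[OF assms(1-4) quasi_iso_chain[OF assms(5)]] assms(4-) unfolding quasi_isos_iff by blast

lemma quasi_iso_cancel_right:
  assumes "X \<in> cpxs A" "Y \<in> cpxs A" "Z \<in> cpxs A" "f \<in> quasi_isos A X Y" "g \<in> chain_maps A Y Z"
    and "g \<circ>\<^sub>c f \<in> quasi_isos A X Z"
  shows "g \<in> quasi_isos A Y Z"
  using coh_comp(4,5)[OF assms(1-3) quasi_iso_chain[OF assms(4)] assms(5)] assms(4-) unfolding quasi_isos_iff by blast

lemma quasi_iso_id:
  assumes X: "X \<in> cpxs A"
  shows "chain_id X \<in> quasi_isos A X X"
proof -
  have "chain_id X i *\<^sub>v z = z" if "z \<in> cocycles X i" for i z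
    using that by (simp add: chain_id_def cocycles_iff mat_vec_zero)
  moreover have "z - z \<in> coboundaries X i" if "z \<in> cocycles X i" for i z
    using that coboundary_zero[OF X, of i] by (simp add: cocycles_iff vec_ring)
  ultimately show ?thesis
    unfolding quasi_isos_iff coh_inj_def coh_surj_def using chain_id_chain_map[OF X]
    by (metis (full_types))
qed

subsection \<open>The long exact sequence of a twisted sum\<close>

definition tw_in :: "('a, 'k::field) cpx \<Rightarrow> ('a, 'k) cpx \<Rightarrow> int \<Rightarrow> 'k mat" where
  "tw_in X Y = (\<lambda>i. colb (0\<^sub>m (cdim X i) (cdim Y i)) (1\<^sub>m (cdim Y i)))"

definition tw_out :: "('a, 'k::field) cpx \<Rightarrow> ('a, 'k) cpx \<Rightarrow> int \<Rightarrow> 'k mat" where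
  "tw_out X Y = (\<lambda>i. rowb (1\<^sub>m (cdim X i)) (0\<^sub>m (cdim X i) (cdim Y i)))"

lemma tw_in_chain_map:
  assumes t: "twist A X Y w"
  shows "tw_in X Y \<in> chain_maps A Y (tw X Y w)"
proof (rule chain_mapsI)
  note X = twistD(1)[OF t] and Y = twistD(2)[OF t]
  note [simp] = cpxs_dims[OF X] cpxs_dims[OF Y] twistD(5,6)[OF t]
  fix i
  show "tw_in X Y i \<in> mod_hom A (cobj Y i) (cobj (tw X Y w) i)"
    by (simp add: tw_in_def mod_hom_colb mod_hom_zero mod_hom_one cpxs_mod[OF X] cpxs_mod[OF Y])
  show "cdif (tw X Y w) i * tw_in X Y i = tw_in X Y (i + 1) * cdif Y i"
    by (simp add: tw_in_def block_mult mat_cancel)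
qed

lemma tw_out_chain_map:
  assumes t: "twist A X Y w"
  shows "tw_out X Y \<in> chain_maps A (tw X Y w) X"
proof (rule chain_mapsI)
  note X = twistD(1)[OF t] and Y = twistD(2)[OF t]
  note [simp] = cpxs_dims[OF X] cpxs_dims[OF Y] twistD(5,6)[OF t]
  fix i
  show "tw_out X Y i \<in> mod_hom A (cobj (tw X Y w) i) (cobj X i)"
    by (simp add: tw_out_def mod_hom_rowb mod_hom_zero mod_hom_one cpxs_mod[OF X] cpxs_mod[OF Y])
  show "cdif X i * tw_out X Y i = tw_out X Y (i + 1) * cdif (tw X Y w) i"
    by (simp add: tw_out_def block_mult mat_cancel)
qed

lemma tw_cocycle:
  assumes t: "twist A X Y w" and x: "dim_vec x = cdim X i" and y: "dim_vec y = cdim Y i"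
  shows "x @\<^sub>v y \<in> cocycles (tw X Y w) i \<longleftrightarrow>
     cdif X i *\<^sub>v x = 0\<^sub>v (cdim X (i + 1)) \<and> w i *\<^sub>v x + cdif Y i *\<^sub>v y = 0\<^sub>v (cdim Y (i + 1))"
proof -
  note [simp] = cpxs_dims[OF twistD(1)[OF t]] cpxs_dims[OF twistD(2)[OF t]] twistD(5,6)[OF t] x y
  show ?thesis by (simp add: cocycles_iff block_vec vec_ring append_vec_simps)
qed

lemma tw_coboundaryI:
  assumes t: "twist A X Y w" and x: "dim_vec x = cdim X (i - 1)" and y: "dim_vec y = cdim Y (i - 1)"
    and "x' = cdif X (i - 1) *\<^sub>v x" "y' = w (i - 1) *\<^sub>v x + cdif Y (i - 1) *\<^sub>v y"
  shows "x' @\<^sub>v y' \<in> coboundaries (tw X Y w) i"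
proof -
  note [simp] = cpxs_dims[OF twistD(1)[OF t]] cpxs_dims[OF twistD(2)[OF t]] twistD(5,6)[OF t] x y
  show ?thesis by (rule coboundariesI[of "x @\<^sub>v y"]) (simp_all add: assms block_vec vec_ring)
qed

lemma tw_coboundaryE:
  assumes t: "twist A X Y w" and b: "x' @\<^sub>v y' \<in> coboundaries (tw X Y w) i" and d: "dim_vec x' = cdim X i"
  obtains x y where "dim_vec x = cdim X (i - 1)" "dim_vec y = cdim Y (i - 1)"
    "x' = cdif X (i - 1) *\<^sub>v x" "y' = w (i - 1) *\<^sub>v x + cdif Y (i - 1) *\<^sub>v y"
proof -
  note [simp] = cpxs_dims[OF twistD(1)[OF t]] cpxs_dims[OF twistD(2)[OF t]] twistD(5,6)[OF t] d
  obtain v where v: "dim_vec v = cdim X (i - 1) + cdim Y (i - 1)" "x' @\<^sub>v y' = cdif (tw X Y w) (i - 1) *\<^sub>v v"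
    using b by (auto simp: coboundaries_iff)
  obtain x y where xy: "v = x @\<^sub>v y" "dim_vec x = cdim X (i - 1)" "dim_vec y = cdim Y (i - 1)"
    using vec_appendE[OF v(1)] by blast
  from v(2) have "x' = cdif X (i - 1) *\<^sub>v x" "y' = w (i - 1) *\<^sub>v x + cdif Y (i - 1) *\<^sub>v y"
    using xy(2,3) by (simp_all add: xy(1) block_vec vec_ring append_vec_simps)
  then show ?thesis using that xy by blast
qed

text \<open>If one end of the exact sequence \<open>0 \<rightarrow> Y \<rightarrow> tw X Y w \<rightarrow> X \<rightarrow> 0\<close> is acyclic, the map at the other end is
  a quasi-isomorphism.  The missing leg of a square of roofs is always constructed in this way, by
  twisting with the acyclic cone or fibre of the given quasi-isomorphism.\<close>

lemma tw_in_quasi_iso: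
  assumes t: "twist A X Y w" and a: "acyclic_cpx X"
  shows "tw_in X Y \<in> quasi_isos A Y (tw X Y w)"
  unfolding quasi_isos_iff
proof (intro conjI)
  note X = twistD(1)[OF t] and Y = twistD(2)[OF t]
  note [simp] = cpxs_dims[OF X] cpxs_dims[OF Y] twistD(5,6)[OF t]
  have v: "tw_in X Y i *\<^sub>v z = 0\<^sub>v (cdim X i) @\<^sub>v z" if "dim_vec z = cdim Y i" for i z
    using that by (simp add: tw_in_def block_vec mat_vec_zero)
  show "tw_in X Y \<in> chain_maps A Y (tw X Y w)" by (rule tw_in_chain_map[OF t])
  show "coh_inj Y (tw X Y w) (tw_in X Y)"
    unfolding coh_inj_def
  proof (intro allI ballI impI)
    fix i z assume z: "z \<in> cocycles Y i" "tw_in X Y i *\<^sub>v z \<in> coboundaries (tw X Y w) i"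
    then have d [simp]: "dim_vec z = cdim Y i" by (simp add: cocycles_iff)
    obtain x y where xy: "dim_vec x = cdim X (i - 1)" "dim_vec y = cdim Y (i - 1)"
      "0\<^sub>v (cdim X i) = cdif X (i - 1) *\<^sub>v x" "z = w (i - 1) *\<^sub>v x + cdif Y (i - 1) *\<^sub>v y"
      by (rule tw_coboundaryE[OF t z(2)[unfolded v[OF d]]]) simp_all
    obtain x' where x': "dim_vec x' = cdim X (i - 2)" "x = cdif X (i - 2) *\<^sub>v x'"
      by (rule acyclicD[OF X a xy(1)]) (use xy(3) in simp_all)
    have tv: "cdif Y (i - 1) *\<^sub>v (w (i - 2) *\<^sub>v x') = - (w (i - 1) *\<^sub>v (cdif X (i - 2) *\<^sub>v x'))"
      using twist_vec[OF t x'(1)] by simp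
    show "z \<in> coboundaries Y i"
      by (rule coboundariesI[of "y - w (i - 2) *\<^sub>v x'"]) (simp_all add: xy x' vec_ring tv)
  qed
  show "coh_surj Y (tw X Y w) (tw_in X Y)"
    unfolding coh_surj_def
  proof (intro allI ballI)
    fix i u assume u: "u \<in> cocycles (tw X Y w) i"
    then have "dim_vec u = cdim X i + cdim Y i" by (simp add: cocycles_iff)
    then obtain x y where xy: "u = x @\<^sub>v y" "dim_vec x = cdim X i" "dim_vec y = cdim Y i"
      by (rule vec_appendE)
    have uu: "cdif X i *\<^sub>v x = 0\<^sub>v (cdim X (i + 1))" "w i *\<^sub>v x + cdif Y i *\<^sub>v y = 0\<^sub>v (cdim Y (i + 1))"
      using u tw_cocycle[OF t xy(2,3)] xy(1) by auto
    obtain x' where x': "dim_vec x' = cdim X (i - 1)" "x = cdif X (i - 1) *\<^sub>v x'"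
      by (rule acyclicD[OF X a xy(2) uu(1)])
    note [simp] = xy(2,3) x'(1)
    have tv: "cdif Y i *\<^sub>v (w (i - 1) *\<^sub>v x') = - (w i *\<^sub>v (cdif X (i - 1) *\<^sub>v x'))"
      using twist_vec[OF t x'(1)] by simp
    have z: "y - w (i - 1) *\<^sub>v x' \<in> cocycles Y i"
      using uu(2) by (simp add: cocycles_iff vec_ring tv x'(2))
    have "u - tw_in X Y i *\<^sub>v (y - w (i - 1) *\<^sub>v x') = x @\<^sub>v (w (i - 1) *\<^sub>v x')"
      by (simp add: v xy(1) append_vec_simps vec_ring)
    moreover have "\<dots> \<in> coboundaries (tw X Y w) i"
      by (rule tw_coboundaryI[OF t x'(1), of "0\<^sub>v (cdim Y (i - 1))"]) (simp_all add: x'(2) vec_ring)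
    ultimately have "u - tw_in X Y i *\<^sub>v (y - w (i - 1) *\<^sub>v x') \<in> coboundaries (tw X Y w) i" by (simp only:)
    then show "\<exists>z\<in>cocycles Y i. u - tw_in X Y i *\<^sub>v z \<in> coboundaries (tw X Y w) i"
      using z by blast
  qed
qed

lemma tw_out_quasi_iso:
  assumes t: "twist A X Y w" and a: "acyclic_cpx Y"
  shows "tw_out X Y \<in> quasi_isos A (tw X Y w) X"
  unfolding quasi_isos_iff
proof (intro conjI)
  note X = twistD(1)[OF t] and Y = twistD(2)[OF t]
  note [simp] = cpxs_dims[OF X] cpxs_dims[OF Y] twistD(5,6)[OF t]
  have v: "tw_out X Y i *\<^sub>v (x @\<^sub>v y) = x" if "dim_vec x = cdim X i" "dim_vec y = cdim Y i" for i x y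
    using that by (simp add: tw_out_def block_vec vec_ring)
  show "tw_out X Y \<in> chain_maps A (tw X Y w) X" by (rule tw_out_chain_map[OF t])
  show "coh_inj (tw X Y w) X (tw_out X Y)"
    unfolding coh_inj_def
  proof (intro allI ballI impI)
    fix i u assume u: "u \<in> cocycles (tw X Y w) i" "tw_out X Y i *\<^sub>v u \<in> coboundaries X i"
    then have "dim_vec u = cdim X i + cdim Y i" by (simp add: cocycles_iff)
    then obtain x y where xy: "u = x @\<^sub>v y" and [simp]: "dim_vec x = cdim X i" "dim_vec y = cdim Y i"
      by (rule vec_appendE)
    have uu: "w i *\<^sub>v x + cdif Y i *\<^sub>v y = 0\<^sub>v (cdim Y (i + 1))"
      using u(1) tw_cocycle[OF t] xy(1) by auto
    obtain x' where [simp]: "dim_vec x' = cdim X (i - 1)" and x': "x = cdif X (i - 1) *\<^sub>v x'"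
      using u(2) by (auto simp: xy v coboundaries_iff)
    have tv: "cdif Y i *\<^sub>v (w (i - 1) *\<^sub>v x') = - (w i *\<^sub>v x)"
      using twist_vec[OF t, of x' "i - 1"] by (simp add: x')
    have "cdif Y i *\<^sub>v (y - w (i - 1) *\<^sub>v x') = 0\<^sub>v (cdim Y (i + 1))"
      using uu by (simp add: vec_ring tv)
    then obtain y' where [simp]: "dim_vec y' = cdim Y (i - 1)" and y': "y - w (i - 1) *\<^sub>v x' = cdif Y (i - 1) *\<^sub>v y'"
      by (rule acyclicD[OF Y a, rotated]) simp_all
    have "y = w (i - 1) *\<^sub>v x' + (y - w (i - 1) *\<^sub>v x')" by (simp add: vec_ring)
    then show "u \<in> coboundaries (tw X Y w) i"
      unfolding xy y' by (intro tw_coboundaryI[OF t, of x' i y']) (simp_all add: x')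
  qed
  show "coh_surj (tw X Y w) X (tw_out X Y)"
    unfolding coh_surj_def
  proof (intro allI ballI)
    fix i x assume x: "x \<in> cocycles X i"
    then have [simp]: "dim_vec x = cdim X i" and dx: "cdif X i *\<^sub>v x = 0\<^sub>v (cdim X (i + 1))"
      by (auto simp: cocycles_iff)
    have "cdif Y (i + 1) *\<^sub>v (w i *\<^sub>v x) = 0\<^sub>v (cdim Y (i + 2))"
      using twist_vec[OF t, of x i] by (simp add: dx vec_ring add.commute[of 2 i])
    then obtain y where [simp]: "dim_vec y = cdim Y i" and y: "w i *\<^sub>v x = cdif Y i *\<^sub>v y"
      using acyclicD[OF Y a, of "w i *\<^sub>v x" "i + 1"] by (auto simp: add.commute[of 2 i])
    have "x @\<^sub>v (- y) \<in> cocycles (tw X Y w) i"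
      by (subst tw_cocycle[OF t]) (simp_all add: dx y vec_ring)
    moreover have "x - tw_out X Y i *\<^sub>v (x @\<^sub>v (- y)) \<in> coboundaries X i"
      using coboundary_zero[OF X, of i] by (simp add: v vec_ring)
    ultimately show "\<exists>z\<in>cocycles (tw X Y w) i. x - tw_out X Y i *\<^sub>v z \<in> coboundaries X i" by blast
  qed
qed

lemma cohomology_shift:
  assumes X: "X \<in> cpxs A"
  shows "cocycles (shift n X) i = cocycles X (i + n)" "coboundaries (shift n X) i = coboundaries X (i + n)"
proof -
  note [simp] = cpxs_dims[OF X]
  have e: "i + 1 + n = i + n + 1" "i - 1 + n = i + n - 1" by simp_all
  show "cocycles (shift n X) i = cocycles X (i + n)"
  proof (cases "even n")
    case False
    have "- x = 0\<^sub>v m \<longleftrightarrow> x = 0\<^sub>v m" for x :: "'b vec" and m by (metis mat_vec_uminus(5,6))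
    then show ?thesis using False by (auto simp: set_eq_iff cocycles_iff e mat_vec_uminus)
  qed (auto simp: set_eq_iff cocycles_iff e)
  show "coboundaries (shift n X) i = coboundaries X (i + n)"
  proof (cases "even n")
    case False
    have "b \<in> coboundaries (shift n X) i \<longleftrightarrow> - b \<in> coboundaries X (i + n)" for b
      using False by (auto simp: coboundaries_iff e mat_vec_uminus) (metis mat_vec_uminus(1,5) cpxs_dims(2)[OF X])
    then show ?thesis using coboundary_uminus[OF X] by (metis mat_vec_uminus(5) subsetI subset_antisym)
  qed (auto simp: set_eq_iff coboundaries_iff e)
qed

lemma acyclic_shift:
  assumes X: "X \<in> cpxs A"
  shows "acyclic_cpx (shift n X) \<longleftrightarrow> acyclic_cpx X"
proof -
  have "cohomology_zero X j" if "\<forall>i. cohomology_zero X (i + n)" for j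
    using spec[OF that, of "j - n"] by simp
  then show ?thesis
    unfolding acyclic_cpx_def cohomology_zero_def by (auto simp: cohomology_shift[OF X])
qed

lemma acyclic_cone_iff:
  assumes X: "X \<in> cpxs A" and Y: "Y \<in> cpxs A" and f: "f \<in> chain_maps A X Y"
  shows "acyclic_cpx (cone X Y f) \<longleftrightarrow> f \<in> quasi_isos A X Y"
proof
  note t = twist_cone[OF X Y f]
  note [simp] = cpxs_dims[OF X] cpxs_dims[OF Y] chain_map_dims[OF f]
  note C = cone_cpxs[OF X Y f]
  {
    assume a: "acyclic_cpx (cone X Y f)"
    have co: "cocycles (cone X Y f) i \<subseteq> coboundaries (cone X Y f) i" for i
      using a acyclic_cpx_iff[OF C] by blast
    show "f \<in> quasi_isos A X Y"
      unfolding quasi_isos_iff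
    proof (intro conjI f)
      show "coh_inj X Y f"
        unfolding coh_inj_def
      proof (intro allI ballI impI)
        fix i z assume z: "z \<in> cocycles X i" "f i *\<^sub>v z \<in> coboundaries Y i"
        have [simp]: "dim_vec z = cdim X i" and dz: "cdif X i *\<^sub>v z = 0\<^sub>v (cdim X (i + 1))"
          using z(1) by (auto simp: cocycles_iff)
        obtain y where [simp]: "dim_vec y = cdim Y (i - 1)" and y: "f i *\<^sub>v z = cdif Y (i - 1) *\<^sub>v y"
          using z(2) by (auto simp: coboundaries_iff)
        have "z @\<^sub>v (- y) \<in> cocycles (cone X Y f) (i - 1)"
          unfolding cone_eq_tw by (subst tw_cocycle[OF t]) (simp_all add: dz y vec_ring)
        then have "z @\<^sub>v (- y) \<in> coboundaries (cone X Y f) (i - 1)" using co by blast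
        then obtain x where "dim_vec x = cdim X (i - 1)" "z = - (cdif X (i - 1)) *\<^sub>v x"
          unfolding cone_eq_tw by (rule tw_coboundaryE[OF t]) simp_all
        then show "z \<in> coboundaries X i"
          by (intro coboundariesI[of "- x"]) (simp_all add: vec_ring)
      qed
      show "coh_surj X Y f"
        unfolding coh_surj_def
      proof (intro allI ballI)
        fix i u assume u: "u \<in> cocycles Y i"
        have [simp]: "dim_vec u = cdim Y i" and du: "cdif Y i *\<^sub>v u = 0\<^sub>v (cdim Y (i + 1))"
          using u by (auto simp: cocycles_iff)
        have "0\<^sub>v (cdim X (i + 1)) @\<^sub>v u \<in> cocycles (cone X Y f) i"
          unfolding cone_eq_tw by (subst tw_cocycle[OF t]) (simp_all add: du vec_ring)
        then have "0\<^sub>v (cdim X (i + 1)) @\<^sub>v u \<in> coboundaries (cone X Y f) i" using co by blast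
        then obtain x y where xy: "dim_vec x = cdim X i" "dim_vec y = cdim Y (i - 1)"
          "0\<^sub>v (cdim X (i + 1)) = - cdif X i *\<^sub>v x" "u = f i *\<^sub>v x + cdif Y (i - 1) *\<^sub>v y"
          unfolding cone_eq_tw by (rule tw_coboundaryE[OF t]) simp_all
        have "cdif X i *\<^sub>v x = - (- cdif X i *\<^sub>v x)" using xy(1) by (simp add: vec_ring)
        also have "\<dots> = 0\<^sub>v (cdim X (i + 1))" unfolding xy(3)[symmetric] by (simp add: mat_vec_uminus)
        finally have "x \<in> cocycles X i" using xy(1) by (simp add: cocycles_iff)
        moreover have "u - f i *\<^sub>v x \<in> coboundaries Y i"
          by (rule coboundariesI[of y]) (use xy(1,2) in \<open>simp_all add: xy(4) vec_ring\<close>)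
        ultimately show "\<exists>z\<in>cocycles X i. u - f i *\<^sub>v z \<in> coboundaries Y i" by blast
      qed
    qed
  }
  assume q: "f \<in> quasi_isos A X Y"
  show "acyclic_cpx (cone X Y f)"
    unfolding acyclic_cpx_iff[OF C]
  proof (intro allI subsetI)
    fix i u assume u: "u \<in> cocycles (cone X Y f) i"
    then have "dim_vec u = cdim X (i + 1) + cdim Y i" by (simp add: cocycles_iff cone_eq_tw)
    then obtain a b where ab: "u = a @\<^sub>v b" and [simp]: "dim_vec a = cdim X (i + 1)" "dim_vec b = cdim Y i"
      by (rule vec_appendE)
    have uu: "- cdif X (i + 1) *\<^sub>v a = 0\<^sub>v (cdim X (i + 2))" "f (i + 1) *\<^sub>v a + cdif Y i *\<^sub>v b = 0\<^sub>v (cdim Y (i + 1))"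
      using u tw_cocycle[OF t, of a i b] unfolding ab cone_eq_tw by (auto simp: add.commute[of 2 i])
    have "cdif X (i + 1) *\<^sub>v a = - (- cdif X (i + 1) *\<^sub>v a)" by (simp add: vec_ring)
    also have "\<dots> = 0\<^sub>v (cdim X (i + 2))" unfolding uu(1) by (simp add: mat_vec_uminus)
    finally have a: "a \<in> cocycles X (i + 1)" by (simp add: cocycles_iff add.commute[of 2 i])
    have "f (i + 1) *\<^sub>v a = (f (i + 1) *\<^sub>v a + cdif Y i *\<^sub>v b) + cdif Y i *\<^sub>v (- b)" by (simp add: vec_ring)
    also have "\<dots> = cdif Y i *\<^sub>v (- b)" unfolding uu(2) by (simp add: vec_ring)
    finally have fa: "f (i + 1) *\<^sub>v a = cdif Y i *\<^sub>v (- b)" .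
    then have "f (i + 1) *\<^sub>v a \<in> coboundaries Y (i + 1)" by (intro coboundariesI[of "- b"]) simp_all
    then have "a \<in> coboundaries X (i + 1)" using a q by (auto simp: quasi_isos_iff coh_inj_def)
    then obtain a' where [simp]: "dim_vec a' = cdim X i" and a': "a = cdif X i *\<^sub>v a'"
      by (auto simp: coboundaries_iff)
    have "b + f i *\<^sub>v a' \<in> cocycles Y i"
      using fa by (simp add: cocycles_iff vec_ring chain_map_comm'(2)[OF f X Y] a')
    then obtain z where z: "z \<in> cocycles X i" "(b + f i *\<^sub>v a') - f i *\<^sub>v z \<in> coboundaries Y i"
      using q by (auto simp: quasi_isos_iff coh_surj_def)
    have [simp]: "dim_vec z = cdim X i" and dz: "cdif X i *\<^sub>v z = 0\<^sub>v (cdim X (i + 1))"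
      using z(1) by (auto simp: cocycles_iff)
    obtain y where [simp]: "dim_vec y = cdim Y (i - 1)" and y: "(b + f i *\<^sub>v a') - f i *\<^sub>v z = cdif Y (i - 1) *\<^sub>v y"
      using z(2) by (auto simp: coboundaries_iff)
    have b: "b = f i *\<^sub>v (z - a') + ((b + f i *\<^sub>v a') - f i *\<^sub>v z)"
      by (simp add: vec_ring)
    show "u \<in> coboundaries (cone X Y f) i"
      unfolding ab cone_eq_tw
      by (rule tw_coboundaryI[OF t, of "z - a'" i y]) (simp_all add: a' dz b[unfolded y] vec_ring)
  qed
qed

lemma acyclic_fib_iff:
  assumes X: "X \<in> cpxs A" and Y: "Y \<in> cpxs A" and f: "f \<in> chain_maps A X Y"
  shows "acyclic_cpx (fib X Y f) \<longleftrightarrow> f \<in> quasi_isos A X Y"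
  using acyclic_shift[OF fib_cpxs[OF X Y f], of 1] shift_fib[OF X Y f] acyclic_cone_iff[OF X Y f] by simp

section \<open>Calculus of fractions\<close>

text \<open>A null-homotopy of \<open>P \<rightarrow> B \<rightarrow> Y\<close> extends \<open>B \<rightarrow> Y\<close> to the cone of \<open>P \<rightarrow> B\<close>; a null-homotopy of
  \<open>W \<rightarrow> X \<rightarrow> Y\<close> lifts \<open>W \<rightarrow> X\<close> to the fibre of \<open>X \<rightarrow> Y\<close>.\<close>

lemma cone_map:
  assumes P: "P \<in> cpxs A" and B: "B \<in> cpxs A" and Y: "Y \<in> cpxs A"
    and f: "f \<in> chain_maps A P B" and g: "g \<in> chain_maps A B Y"
    and h: "\<And>i. h i \<in> mod_hom A (cobj P i) (cobj Y (i - 1))"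
    and e: "\<And>i. g i * f i = cdif Y (i - 1) * h i + h (i + 1) * cdif P i"
  shows "(\<lambda>i. rowb (h (i + 1)) (g i)) \<in> chain_maps A (cone P B f) Y"
proof (rule chain_mapsI)
  note [simp] = cpxs_dims[OF P] cpxs_dims[OF B] cpxs_dims[OF Y] chain_map_dims[OF f] chain_map_dims[OF g] mod_hom_dims[OF h]
  fix i
  have "h (i + 1) \<in> mod_hom A (cobj P (i + 1)) (cobj Y i)" using h[of "i + 1"] by simp
  then have "rowb (h (i + 1)) (g i) \<in> mod_hom A (sum_mod (cobj P (i + 1)) (cobj B i)) (cobj Y i)"
    by (intro mod_hom_rowb cpxs_mod[OF P] cpxs_mod[OF B] cpxs_mod[OF Y] chain_map_mod[OF g])
  then show "rowb (h (i + 1)) (g i) \<in> mod_hom A (cobj (cone P B f) i) (cobj Y i)" by (simp add: cone_def)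
  have "g (i + 1) * f (i + 1) = cdif Y i * h (i + 1) + h (i + 2) * cdif P (i + 1)"
    using e[of "i + 1"] by (simp add: add.commute[of 2 i])
  then show "cdif Y i * rowb (h (i + 1)) (g i) = rowb (h (i + 1 + 1)) (g (i + 1)) * cdif (cone P B f) i"
    by (simp add: cone_def block_mult mat_ring chain_map_comm[OF g] add.commute[of 2 i] add.commute[of 1 i])
qed

lemma fib_map:
  assumes W: "W \<in> cpxs A" and X: "X \<in> cpxs A" and Y: "Y \<in> cpxs A"
    and f: "f \<in> chain_maps A W X" and g: "g \<in> chain_maps A X Y"
    and h: "\<And>i. h i \<in> mod_hom A (cobj W i) (cobj Y (i - 1))"
    and e: "\<And>i. g i * f i = cdif Y (i - 1) * h i + h (i + 1) * cdif W i"
  shows "(\<lambda>i. colb (f i) (- h i)) \<in> chain_maps A W (fib X Y g)"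
proof (rule chain_mapsI)
  note [simp] = cpxs_dims[OF W] cpxs_dims[OF X] cpxs_dims[OF Y] chain_map_dims[OF f] chain_map_dims[OF g] mod_hom_dims[OF h]
  fix i
  have "colb (f i) (- h i) \<in> mod_hom A (cobj W i) (sum_mod (cobj X i) (cobj Y (i - 1)))"
    by (intro mod_hom_colb mod_hom_uminus cpxs_mod[OF W] cpxs_mod[OF X] cpxs_mod[OF Y] chain_map_mod[OF f] h)
  then show "colb (f i) (- h i) \<in> mod_hom A (cobj W i) (cobj (fib X Y g) i)" by (simp add: fib_def)
  show "cdif (fib X Y g) i * colb (f i) (- h i) = colb (f (i + 1)) (- h (i + 1)) * cdif W i"
    by (simp add: fib_def block_mult mat_ring mat_cancel_far e chain_map_comm[OF f])
qed

text \<open>The square is completed by the homotopy pullback of \<open>f\<close> and \<open>t\<close>, realised as the twisted sum of \<open>Z\<close> with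
  the acyclic fibre of \<open>t\<close>; its component in \<open>Y\<close> is the homotopy.\<close>

theorem ore_right:
  fixes A :: "('k::field, 'a) module"
  assumes Z: "Z \<in> cpxs A" and W: "W \<in> cpxs A" and Y: "Y \<in> cpxs A"
    and f: "f \<in> chain_maps A Z Y" and tq: "t \<in> quasi_isos A W Y"
  obtains U t' f' where "U \<in> cpxs A" "t' \<in> quasi_isos A U Z" "f' \<in> chain_maps A U W"
    "homotopic A U Y (f \<circ>\<^sub>c t') (t \<circ>\<^sub>c f')"
proof -
  note t = quasi_iso_chain[OF tq]
  note [simp] = cpxs_dims[OF Z] cpxs_dims[OF W] cpxs_dims[OF Y] chain_map_dims[OF f] chain_map_dims[OF t]
  define F where "F = fib W Y t"
  have F: "F \<in> cpxs A" unfolding F_def by (rule fib_cpxs[OF W Y t])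
  have Fs [simp]: "cobj F i = sum_mod (cobj W i) (cobj Y (i - 1))"
    "cdif F i = four_block_mat (cdif W i) (0\<^sub>m (cdim W (i + 1)) (cdim Y (i - 1))) (- t i) (- cdif Y (i - 1))" for i
    by (simp_all add: F_def fib_def)
  have Fa: "acyclic_cpx F" unfolding F_def using acyclic_fib_iff[OF W Y t] tq by simp
  define w where "w = (\<lambda>i. colb (0\<^sub>m (cdim W (i + 1)) (cdim Z i)) (f i))"
  have tw: "twist A Z F w"
  proof (rule twistI[OF Z F])
    fix i
    have "w i \<in> mod_hom A (cobj Z i) (sum_mod (cobj W (i + 1)) (cobj Y i))"
      unfolding w_def by (intro mod_hom_colb mod_hom_zero cpxs_mod[OF Z] cpxs_mod[OF W] cpxs_mod[OF Y] chain_map_mod[OF f])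
    then show "w i \<in> mod_hom A (cobj Z i) (cobj F (i + 1))" by simp
    show "cdif F (i + 1) * w i = - (w (i + 1) * cdif Z i)"
      by (simp add: w_def block_mult block_add mat_ring chain_map_comm[OF f])
  qed
  define U where "U = tw Z F w"
  have U: "U \<in> cpxs A" unfolding U_def by (rule tw_cpxs[OF tw])
  define f' :: "int \<Rightarrow> 'k mat" where "f' = (\<lambda>i. rowb (0\<^sub>m (cdim W i) (cdim Z i)) (rowb (1\<^sub>m (cdim W i)) (0\<^sub>m (cdim W i) (cdim Y (i - 1)))))"
  have f': "f' \<in> chain_maps A U W"
  proof (rule chain_mapsI)
    fix i
    have "f' i \<in> mod_hom A (sum_mod (cobj Z i) (sum_mod (cobj W i) (cobj Y (i - 1)))) (cobj W i)"
      unfolding f'_def by (intro mod_hom_rowb mod_hom_zero mod_hom_one right_module_sum_mod cpxs_mod[OF Z] cpxs_mod[OF W] cpxs_mod[OF Y])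
    then show "f' i \<in> mod_hom A (cobj U i) (cobj W i)" by (simp add: U_def)
    show "cdif W i * f' i = f' (i + 1) * cdif U i"
      by (simp add: U_def f'_def w_def block_mult mat_ring block_zero)
  qed
  have t': "tw_out Z F \<in> quasi_isos A U Z"
    unfolding U_def by (rule tw_out_quasi_iso[OF tw Fa])
  have "homotopic A U Y (f \<circ>\<^sub>c tw_out Z F) (t \<circ>\<^sub>c f')"
  proof (rule homotopicI)
    fix i
    let ?k = "\<lambda>i. rowb (0\<^sub>m (cdim Y (i - 1)) (cdim Z i)) (rowb (0\<^sub>m (cdim Y (i - 1)) (cdim W i)) (1\<^sub>m (cdim Y (i - 1)))) :: 'k mat"
    have "?k i \<in> mod_hom A (sum_mod (cobj Z i) (sum_mod (cobj W i) (cobj Y (i - 1)))) (cobj Y (i - 1))"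
      by (intro mod_hom_rowb mod_hom_zero mod_hom_one right_module_sum_mod cpxs_mod[OF Z] cpxs_mod[OF W] cpxs_mod[OF Y])
    then show "?k i \<in> mod_hom A (cobj U i) (cobj Y (i - 1))" by (simp add: U_def)
    show "(f \<circ>\<^sub>c tw_out Z F) i - (t \<circ>\<^sub>c f') i = cdif Y (i - 1) * ?k i + ?k (i + 1) * cdif U i"
      by (simp add: U_def chain_comp_def tw_out_def f'_def w_def block_mult block_add mat_ring block_zero)
  qed
  then show ?thesis using that U t' f' by blast
qed

text \<open>Dually, the square is completed by the homotopy pushout of \<open>g\<close> and \<open>s\<close>, the twisted sum of the acyclic
  cone of \<open>s\<close> with \<open>Y\<close>.\<close>

theorem ore_left:
  fixes A :: "('k::field, 'a) module"
  assumes W: "W \<in> cpxs A" and X: "X \<in> cpxs A" and Y: "Y \<in> cpxs A"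
    and g: "g \<in> chain_maps A W Y" and sq: "s \<in> quasi_isos A W X"
  obtains Y' s' g' where "Y' \<in> cpxs A" "s' \<in> quasi_isos A Y Y'" "g' \<in> chain_maps A X Y'"
    "homotopic A W Y' (s' \<circ>\<^sub>c g) (g' \<circ>\<^sub>c s)"
proof -
  note s = quasi_iso_chain[OF sq]
  note [simp] = cpxs_dims[OF X] cpxs_dims[OF W] cpxs_dims[OF Y] chain_map_dims[OF g] chain_map_dims[OF s]
  define C where "C = cone W X s"
  have C: "C \<in> cpxs A" unfolding C_def by (rule cone_cpxs[OF W X s])
  have Cs [simp]: "cobj C i = sum_mod (cobj W (i + 1)) (cobj X i)"
    "cdif C i = four_block_mat (- cdif W (i + 1)) (0\<^sub>m (cdim W (i + 2)) (cdim X i)) (s (i + 1)) (cdif X i)" for i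
    by (simp_all add: C_def cone_def)
  have Ca: "acyclic_cpx C" unfolding C_def using acyclic_cone_iff[OF W X s] sq by simp
  define w where "w = (\<lambda>i. rowb (g (i + 1)) (0\<^sub>m (cdim Y (i + 1)) (cdim X i)))"
  have tw: "twist A C Y w"
  proof (rule twistI[OF C Y])
    fix i
    have "w i \<in> mod_hom A (sum_mod (cobj W (i + 1)) (cobj X i)) (cobj Y (i + 1))"
      unfolding w_def by (intro mod_hom_rowb mod_hom_zero cpxs_mod[OF X] cpxs_mod[OF W] cpxs_mod[OF Y] chain_map_mod[OF g])
    then show "w i \<in> mod_hom A (cobj C i) (cobj Y (i + 1))" by simp
    show "cdif Y (i + 1) * w i = - (w (i + 1) * cdif C i)"
      by (simp add: w_def block_mult block_add mat_ring chain_map_comm[OF g] add.commute[of 2 i] add.commute[of 1 i])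
  qed
  define Y' where "Y' = tw C Y w"
  have Y': "Y' \<in> cpxs A" unfolding Y'_def by (rule tw_cpxs[OF tw])
  define g' :: "int \<Rightarrow> 'k mat" where "g' = (\<lambda>i. colb (colb (0\<^sub>m (cdim W (i + 1)) (cdim X i)) (- 1\<^sub>m (cdim X i))) (0\<^sub>m (cdim Y i) (cdim X i)))"
  have g': "g' \<in> chain_maps A X Y'"
  proof (rule chain_mapsI)
    fix i
    have "g' i \<in> mod_hom A (cobj X i) (sum_mod (sum_mod (cobj W (i + 1)) (cobj X i)) (cobj Y i))"
      unfolding g'_def by (intro mod_hom_colb mod_hom_zero mod_hom_one mod_hom_uminus right_module_sum_mod cpxs_mod[OF X] cpxs_mod[OF W] cpxs_mod[OF Y])
    then show "g' i \<in> mod_hom A (cobj X i) (cobj Y' i)" by (simp add: Y'_def)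
    show "cdif Y' i * g' i = g' (i + 1) * cdif X i"
      by (simp add: Y'_def g'_def w_def block_mult mat_ring block_zero add.commute[of 2 i] add.commute[of 1 i])
  qed
  have s': "tw_in C Y \<in> quasi_isos A Y Y'"
    unfolding Y'_def by (rule tw_in_quasi_iso[OF tw Ca])
  have "homotopic A W Y' (tw_in C Y \<circ>\<^sub>c g) (g' \<circ>\<^sub>c s)"
  proof (rule homotopicI)
    fix i
    let ?k = "\<lambda>i. colb (colb (1\<^sub>m (cdim W i)) (0\<^sub>m (cdim X (i - 1)) (cdim W i))) (0\<^sub>m (cdim Y (i - 1)) (cdim W i)) :: 'k mat"
    have "?k i \<in> mod_hom A (cobj W i) (sum_mod (sum_mod (cobj W i) (cobj X (i - 1))) (cobj Y (i - 1)))"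
      by (intro mod_hom_colb mod_hom_zero mod_hom_one right_module_sum_mod cpxs_mod[OF X] cpxs_mod[OF W] cpxs_mod[OF Y])
    then show "?k i \<in> mod_hom A (cobj W i) (cobj Y' (i - 1))" by (simp add: Y'_def)
    show "(tw_in C Y \<circ>\<^sub>c g) i - (g' \<circ>\<^sub>c s) i = cdif Y' (i - 1) * ?k i + ?k (i + 1) * cdif W i"
      by (simp add: Y'_def chain_comp_def tw_in_def g'_def w_def block_mult block_add mat_ring block_zero add.commute[of 2 i] add.commute[of 1 i])
  qed
  then show ?thesis using that Y' s' g' by blast
qed

text \<open>If \<open>t\<close> is a quasi-isomorphism, then \<open>t f \<simeq> t g\<close> lets \<open>f - g\<close> factor through the acyclic fibre
  of \<open>t\<close>, and a map into an acyclic complex dies on its own fibre.\<close>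

theorem cancel_left:
  fixes A :: "('k::field, 'a) module"
  assumes W: "W \<in> cpxs A" and X: "X \<in> cpxs A" and Y: "Y \<in> cpxs A"
    and f: "f \<in> chain_maps A W X" and g: "g \<in> chain_maps A W X" and tq: "t \<in> quasi_isos A X Y"
    and hh: "homotopic A W Y (t \<circ>\<^sub>c f) (t \<circ>\<^sub>c g)"
  obtains U u where "U \<in> cpxs A" "u \<in> quasi_isos A U W" "homotopic A U X (f \<circ>\<^sub>c u) (g \<circ>\<^sub>c u)"
proof -
  note t = quasi_iso_chain[OF tq]
  note [simp] = cpxs_dims[OF X] cpxs_dims[OF W] cpxs_dims[OF Y] chain_map_dims[OF f] chain_map_dims[OF g] chain_map_dims[OF t]
  from homotopicE[OF hh] obtain h where h: "\<And>i. h i \<in> mod_hom A (cobj W i) (cobj Y (i - 1))"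
    "\<And>i. (t \<circ>\<^sub>c f) i - (t \<circ>\<^sub>c g) i = cdif Y (i - 1) * h i + h (i + 1) * cdif W i"
    and [simp]: "\<And>i. dim_row (h i) = cdim Y (i - 1)" "\<And>i. dim_col (h i) = cdim W i" by blast
  define F where "F = fib X Y t"
  have F: "F \<in> cpxs A" unfolding F_def by (rule fib_cpxs[OF X Y t])
  have Fs [simp]: "cobj F i = sum_mod (cobj X i) (cobj Y (i - 1))"
    "cdif F i = four_block_mat (cdif X i) (0\<^sub>m (cdim X (i + 1)) (cdim Y (i - 1))) (- t i) (- cdif Y (i - 1))" for i
    by (simp_all add: F_def fib_def)
  have Fa: "acyclic_cpx F" unfolding F_def using acyclic_fib_iff[OF X Y t] tq by simp
  define p where "p = (\<lambda>i. colb (f i + - g i) (- h i))"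
  have d: "(\<lambda>i. f i + - g i) \<in> chain_maps A W X"
  proof (rule chain_mapsI)
    fix i
    show "f i + - g i \<in> mod_hom A (cobj W i) (cobj X i)"
      by (intro mod_hom_add mod_hom_uminus cpxs_mod[OF X] cpxs_mod[OF W] chain_map_mod[OF f] chain_map_mod[OF g])
    show "cdif X i * (f i + - g i) = (f (i + 1) + - g (i + 1)) * cdif W i"
      by (simp add: mat_distrib mat_uminus(1,2) chain_map_comm[OF f] chain_map_comm[OF g])
  qed
  have p: "p \<in> chain_maps A W F"
    unfolding p_def F_def
  proof (rule fib_map[OF W X Y d t h(1)])
    fix i
    show "t i * (f i + - g i) = cdif Y (i - 1) * h i + h (i + 1) * cdif W i"
      using h(2)[of i] by (simp add: chain_comp_def mat_distrib mat_uminus(2,6))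
  qed
  note [simp] = chain_map_dims[OF p]
  define U where "U = fib W F p"
  have U: "U \<in> cpxs A" unfolding U_def by (rule fib_cpxs[OF W F p])
  have Us [simp]: "cobj U i = sum_mod (cobj W i) (cobj F (i - 1))"
    "cdif U i = four_block_mat (cdif W i) (0\<^sub>m (cdim W (i + 1)) (cdim F (i - 1))) (- p i) (- cdif F (i - 1))" for i
    by (simp_all add: U_def fib_def)
  define u where "u = tw_out W (shift (- 1) F)"
  have u: "u \<in> quasi_isos A U W"
    unfolding u_def U_def fib_def
    by (rule tw_out_quasi_iso[OF twist_fib[OF W F p]]) (simp add: acyclic_shift[OF F] Fa)
  have "homotopic A U X (f \<circ>\<^sub>c u) (g \<circ>\<^sub>c u)"
  proof (rule homotopicI)
    fix i
    let ?k = "\<lambda>i. rowb (0\<^sub>m (cdim X (i - 1)) (cdim W i)) (rowb (- 1\<^sub>m (cdim X (i - 1))) (0\<^sub>m (cdim X (i - 1)) (cdim Y (i - 2)))) :: 'k mat"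
    have "?k i \<in> mod_hom A (sum_mod (cobj W i) (sum_mod (cobj X (i - 1)) (cobj Y (i - 2)))) (cobj X (i - 1))"
      by (intro mod_hom_rowb mod_hom_zero mod_hom_one mod_hom_uminus right_module_sum_mod cpxs_mod[OF X] cpxs_mod[OF W] cpxs_mod[OF Y])
    then show "?k i \<in> mod_hom A (cobj U i) (cobj X (i - 1))" by simp
    show "(f \<circ>\<^sub>c u) i - (g \<circ>\<^sub>c u) i = cdif X (i - 1) * ?k i + ?k (i + 1) * cdif U i"
      by (simp add: u_def chain_comp_def tw_out_def p_def block_mult block_add mat_ring block_zero)
  qed
  then show ?thesis using that U u by blast
qed

text \<open>Dually, a null-homotopy of \<open>g u\<close> extends \<open>g\<close> to the acyclic cone of \<open>u\<close>, and a map out of an acyclic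
  complex dies in its own cone.\<close>

theorem cancel_right:
  fixes A :: "('k::field, 'a) module"
  assumes W: "W \<in> cpxs A" and X: "X \<in> cpxs A" and Y: "Y \<in> cpxs A"
    and uq: "u \<in> quasi_isos A W X" and g: "g \<in> chain_maps A X Y"
    and hh: "homotopic A W Y (g \<circ>\<^sub>c u) (chain_zero W Y)"
  obtains Y' v where "Y' \<in> cpxs A" "v \<in> quasi_isos A Y Y'" "homotopic A X Y' (v \<circ>\<^sub>c g) (chain_zero X Y')"
proof -
  note u = quasi_iso_chain[OF uq]
  note [simp] = cpxs_dims[OF X] cpxs_dims[OF W] cpxs_dims[OF Y] chain_map_dims[OF g] chain_map_dims[OF u]
  note gu = chain_comp_chain_map[OF W X Y u g]
  from homotopic_zeroE[OF Y gu hh] obtain h where h: "\<And>i. h i \<in> mod_hom A (cobj W i) (cobj Y (i - 1))"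
    "\<And>i. (g \<circ>\<^sub>c u) i = cdif Y (i - 1) * h i + h (i + 1) * cdif W i"
    and [simp]: "\<And>i. dim_row (h i) = cdim Y (i - 1)" "\<And>i. dim_col (h i) = cdim W i" by blast
  define C where "C = cone W X u"
  have C: "C \<in> cpxs A" unfolding C_def by (rule cone_cpxs[OF W X u])
  have Cs [simp]: "cobj C i = sum_mod (cobj W (i + 1)) (cobj X i)"
    "cdif C i = four_block_mat (- cdif W (i + 1)) (0\<^sub>m (cdim W (i + 2)) (cdim X i)) (u (i + 1)) (cdif X i)" for i
    by (simp_all add: C_def cone_def)
  have Ca: "acyclic_cpx C" unfolding C_def using acyclic_cone_iff[OF W X u] uq by simp
  define e where "e = (\<lambda>i. rowb (h (i + 1)) (g i))"
  have e: "e \<in> chain_maps A C Y"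
    unfolding e_def C_def
    by (rule cone_map[OF W X Y u g h(1)]) (use h(2) in \<open>simp add: chain_comp_def\<close>)
  note [simp] = chain_map_dims[OF e]
  define Y' where "Y' = cone C Y e"
  have Y': "Y' \<in> cpxs A" unfolding Y'_def by (rule cone_cpxs[OF C Y e])
  have Ys [simp]: "cobj Y' i = sum_mod (cobj C (i + 1)) (cobj Y i)"
    "cdif Y' i = four_block_mat (- cdif C (i + 1)) (0\<^sub>m (cdim C (i + 2)) (cdim Y i)) (e (i + 1)) (cdif Y i)" for i
    by (simp_all add: Y'_def cone_def)
  define v where "v = tw_in (shift 1 C) Y"
  have v: "v \<in> quasi_isos A Y Y'"
    unfolding v_def Y'_def cone_eq_tw
    by (rule tw_in_quasi_iso[OF twist_cone[OF C Y e]]) (simp add: acyclic_shift[OF C] Ca)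
  have "homotopic A X Y' (v \<circ>\<^sub>c g) (chain_zero X Y')"
  proof (rule homotopic_zeroI)
    show "v \<circ>\<^sub>c g \<in> chain_maps A X Y'" by (rule chain_comp_chain_map[OF X Y Y' g quasi_iso_chain[OF v]])
    fix i
    let ?k = "\<lambda>i. colb (colb (0\<^sub>m (cdim W (i + 1)) (cdim X i)) (1\<^sub>m (cdim X i))) (0\<^sub>m (cdim Y (i - 1)) (cdim X i)) :: 'k mat"
    have "?k i \<in> mod_hom A (cobj X i) (sum_mod (sum_mod (cobj W (i + 1)) (cobj X i)) (cobj Y (i - 1)))"
      by (intro mod_hom_colb mod_hom_zero mod_hom_one right_module_sum_mod cpxs_mod[OF X] cpxs_mod[OF W] cpxs_mod[OF Y])
    then show "?k i \<in> mod_hom A (cobj X i) (cobj Y' (i - 1))" by simp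
    show "(v \<circ>\<^sub>c g) i = cdif Y' (i - 1) * ?k i + ?k (i + 1) * cdif X i"
      by (simp add: v_def chain_comp_def tw_in_def e_def block_mult block_add mat_ring block_zero add.commute[of 2 i] add.commute[of 1 i])
  qed
  then show ?thesis using that Y' v by blast
qed

lemma rowb_split:
  fixes m :: "'k::comm_ring_1 mat"
  assumes "dim_col m = n + k"
  shows "m = rowb (m * colb (1\<^sub>m n) (0\<^sub>m k n)) (m * colb (0\<^sub>m n k) (1\<^sub>m k))"
proof -
  have "rowb (colb (1\<^sub>m n) (0\<^sub>m k n)) (colb (0\<^sub>m n k) (1\<^sub>m k)) = (1\<^sub>m (n + k) :: 'k mat)"
    by (auto intro!: eq_matI simp: rowb_def colb_def)
  then have "m = m * rowb (colb (1\<^sub>m n) (0\<^sub>m k n)) (colb (0\<^sub>m n k) (1\<^sub>m k))" using assms by simp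
  then show ?thesis using assms by (simp add: block_mult)
qed

text \<open>Exactness at the middle term of \<open>Hom(P[1], Y) \<rightarrow> Hom(cone f, Y) \<rightarrow> Hom(B, Y)\<close>, up to homotopy.\<close>

theorem cone_factor:
  fixes A :: "('k::field, 'a) module"
  assumes P: "P \<in> cpxs A" and B: "B \<in> cpxs A" and Y: "Y \<in> cpxs A"
    and f: "f \<in> chain_maps A P B" and g: "g \<in> chain_maps A (cone P B f) Y"
    and hh: "homotopic A B Y (g \<circ>\<^sub>c tw_in (shift 1 P) B) (chain_zero B Y)"
  obtains e where "e \<in> chain_maps A (shift 1 P) Y"
    "homotopic A (cone P B f) Y g (e \<circ>\<^sub>c tw_out (shift 1 P) B)"
proof -
  note t = twist_cone[OF P B f]
  note C = cone_cpxs[OF P B f]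
  note P1 = shift_cpxs[OF P, of 1]
  note inc = tw_in_chain_map[OF t, folded cone_eq_tw]
  note [simp] = cpxs_dims[OF P] cpxs_dims[OF B] cpxs_dims[OF Y] chain_map_dims[OF f]
  have Cs [simp]: "cobj (cone P B f) i = sum_mod (cobj P (i + 1)) (cobj B i)"
    "cdif (cone P B f) i = four_block_mat (- cdif P (i + 1)) (0\<^sub>m (cdim P (i + 2)) (cdim B i)) (f (i + 1)) (cdif B i)" for i
    by (simp_all add: cone_def)
  have gd [simp]: "dim_row (g i) = cdim Y i" "dim_col (g i) = cdim P (i + 1) + cdim B i" for i
    using chain_map_dims[OF g, of i] by simp_all
  from homotopic_zeroE[OF Y chain_comp_chain_map[OF B C Y inc g] hh]
  obtain h where h: "\<And>i. h i \<in> mod_hom A (cobj B i) (cobj Y (i - 1))"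
    "\<And>i. (g \<circ>\<^sub>c tw_in (shift 1 P) B) i = cdif Y (i - 1) * h i + h (i + 1) * cdif B i"
    and [simp]: "\<And>i. dim_row (h i) = cdim Y (i - 1)" "\<And>i. dim_col (h i) = cdim B i" by blast
  define g1 where "g1 = (\<lambda>i. g i * colb (1\<^sub>m (cdim P (i + 1))) (0\<^sub>m (cdim B i) (cdim P (i + 1))))"
  define g2 where "g2 = (\<lambda>i. g i * colb (0\<^sub>m (cdim P (i + 1)) (cdim B i)) (1\<^sub>m (cdim B i)))"
  have gs: "g i = rowb (g1 i) (g2 i)" for i unfolding g1_def g2_def by (rule rowb_split) simp
  have gdim [simp]: "dim_row (g1 i) = cdim Y i" "dim_col (g1 i) = cdim P (i + 1)"
      "dim_row (g2 i) = cdim Y i" "dim_col (g2 i) = cdim B i" for i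
    by (simp_all add: g1_def g2_def)
  have g2: "g2 i = cdif Y (i - 1) * h i + h (i + 1) * cdif B i" for i
    using h(2)[of i] by (simp add: g2_def tw_in_def chain_comp_def)
  have g1m: "g1 i \<in> mod_hom A (cobj P (i + 1)) (cobj Y i)" for i
  proof -
    have "g i \<in> mod_hom A (sum_mod (cobj P (i + 1)) (cobj B i)) (cobj Y i)"
      using chain_map_mod[OF g, of i] by simp
    moreover have "colb (1\<^sub>m (cdim P (i + 1))) (0\<^sub>m (cdim B i) (cdim P (i + 1)))
        \<in> mod_hom A (cobj P (i + 1)) (sum_mod (cobj P (i + 1)) (cobj B i))"
      by (intro mod_hom_colb mod_hom_one mod_hom_zero cpxs_mod[OF P] cpxs_mod[OF B])
    ultimately show ?thesis unfolding g1_def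
      by (rule mod_hom_mult[OF cpxs_mod[OF P] right_module_sum_mod[OF cpxs_mod[OF P] cpxs_mod[OF B]] cpxs_mod[OF Y], rotated])
  qed
  have "rowb (cdif Y i * g1 i) (cdif Y i * g2 i) = rowb (- (g1 (i + 1) * cdif P (i + 1)) + g2 (i + 1) * f (i + 1)) (g2 (i + 1) * cdif B i)" for i
    using chain_map_comm[OF g, of i] by (simp add: gs block_mult mat_ring add.commute[of 2 i] add.commute[of 1 i])
  then have g1c: "cdif Y i * g1 i = - (g1 (i + 1) * cdif P (i + 1)) + g2 (i + 1) * f (i + 1)" for i
    by (simp add: block_eq add.commute[of 2 i] add.commute[of 1 i])
  define e where "e = (\<lambda>i. g1 i + - (h (i + 1) * f (i + 1)))"
  have hf: "h i * f i \<in> mod_hom A (cobj P i) (cobj Y (i - 1))" for i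
    by (rule mod_hom_mult[OF cpxs_mod[OF P] cpxs_mod[OF B] cpxs_mod[OF Y] chain_map_mod[OF f] h(1)])
  have e: "e \<in> chain_maps A (shift 1 P) Y"
  proof (rule chain_mapsI)
    fix i
    have "h (i + 1) * f (i + 1) \<in> mod_hom A (cobj P (i + 1)) (cobj Y i)" using hf[of "i + 1"] by simp
    then have "e i \<in> mod_hom A (cobj P (i + 1)) (cobj Y i)"
      unfolding e_def by (intro mod_hom_add mod_hom_uminus cpxs_mod[OF P] cpxs_mod[OF Y] g1m)
    then show "e i \<in> mod_hom A (cobj (shift 1 P) i) (cobj Y i)" by simp
    have fc: "cdif B (i + 1) * f (i + 1) = f (i + 2) * cdif P (i + 1)"
      using chain_map_comm[OF f, of "i + 1"] by (simp add: add.commute[of 2 i] add.commute[of 1 i])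
    have "cdif Y i * e i = cdif Y i * g1 i + - (cdif Y i * (h (i + 1) * f (i + 1)))"
      by (simp add: e_def mat_ring)
    also have "\<dots> = - (g1 (i + 1) * cdif P (i + 1)) + h (i + 2) * (cdif B (i + 1) * f (i + 1))"
      by (simp add: g1c g2 mat_ring_r mat_cancel_far add.commute[of 2 i] add.commute[of 1 i])
    also have "\<dots> = e (i + 1) * cdif (shift 1 P) i"
      by (simp add: e_def fc mat_ring_r add.commute[of 2 i] add.commute[of 1 i])
    finally show "cdif Y i * e i = e (i + 1) * cdif (shift 1 P) i" .
  qed
  have "homotopic A (cone P B f) Y g (e \<circ>\<^sub>c tw_out (shift 1 P) B)"
  proof (rule homotopicI)
    fix i
    let ?k = "\<lambda>i. rowb (0\<^sub>m (cdim Y (i - 1)) (cdim P (i + 1))) (h i) :: 'k mat"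
    have "?k i \<in> mod_hom A (sum_mod (cobj P (i + 1)) (cobj B i)) (cobj Y (i - 1))"
      by (intro mod_hom_rowb mod_hom_zero cpxs_mod[OF P] cpxs_mod[OF B] cpxs_mod[OF Y] h)
    then show "?k i \<in> mod_hom A (cobj (cone P B f) i) (cobj Y (i - 1))" by simp
    show "g i - (e \<circ>\<^sub>c tw_out (shift 1 P) B) i = cdif Y (i - 1) * ?k i + ?k (i + 1) * cdif (cone P B f) i"
      by (simp add: gs e_def g2 chain_comp_def tw_out_def block_mult block_add mat_ring block_zero add.commute[of 2 i] add.commute[of 1 i])
  qed
  then show ?thesis using that e by blast
qed

section \<open>Morphisms and isomorphisms of the derived category\<close>

text \<open>Homotopy together with all typing information, so that chains of homotopies can be composed.\<close>

definition heq :: "('k::field, 'a) module \<Rightarrow> ('a, 'k) cpx \<Rightarrow> ('a, 'k) cpx \<Rightarrow>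
    (int \<Rightarrow> 'k mat) \<Rightarrow> (int \<Rightarrow> 'k mat) \<Rightarrow> bool" where
  "heq A X Y f g \<longleftrightarrow> X \<in> cpxs A \<and> Y \<in> cpxs A \<and> f \<in> chain_maps A X Y \<and> g \<in> chain_maps A X Y \<and>
     homotopic A X Y f g"

lemma heqD:
  assumes "heq A X Y f g"
  shows "X \<in> cpxs A" "Y \<in> cpxs A" "f \<in> chain_maps A X Y" "g \<in> chain_maps A X Y" "homotopic A X Y f g"
  using assms by (simp_all add: heq_def)

lemma heq_refl: "X \<in> cpxs A \<Longrightarrow> Y \<in> cpxs A \<Longrightarrow> f \<in> chain_maps A X Y \<Longrightarrow> heq A X Y f f"
  by (simp add: heq_def homotopic_refl)

lemma heq_sym: "heq A X Y f g \<Longrightarrow> heq A X Y g f"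
  by (auto simp: heq_def intro: homotopic_sym)

lemma heq_trans [trans]: "heq A X Y f g \<Longrightarrow> heq A X Y g h \<Longrightarrow> heq A X Y f h"
  unfolding heq_def using homotopic_trans by blast

lemma heq_left: "heq A X Y f f' \<Longrightarrow> Z \<in> cpxs A \<Longrightarrow> g \<in> chain_maps A Y Z \<Longrightarrow> heq A X Z (g \<circ>\<^sub>c f) (g \<circ>\<^sub>c f')"
  unfolding heq_def using homotopic_comp_left chain_comp_chain_map by blast

lemma heq_right: "heq A Y Z g g' \<Longrightarrow> X \<in> cpxs A \<Longrightarrow> f \<in> chain_maps A X Y \<Longrightarrow> heq A X Z (g \<circ>\<^sub>c f) (g' \<circ>\<^sub>c f)"
  unfolding heq_def using homotopic_comp_right chain_comp_chain_map by blast

lemma heq_assoc: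
  assumes "f \<in> chain_maps A X Y" "g \<in> chain_maps A Y Z" "h \<in> chain_maps A Z W"
    and "X \<in> cpxs A" "Y \<in> cpxs A" "Z \<in> cpxs A" "W \<in> cpxs A"
  shows "heq A X W ((h \<circ>\<^sub>c g) \<circ>\<^sub>c f) (h \<circ>\<^sub>c (g \<circ>\<^sub>c f))"
  using chain_comp_assoc[OF assms(1-3)] assms by (simp add: heq_refl chain_comp_chain_map)

lemma heq_quasi: "heq A X Y f g \<Longrightarrow> f \<in> quasi_isos A X Y \<Longrightarrow> g \<in> quasi_isos A X Y"
  using quasi_iso_homotopic unfolding heq_def by blast

text \<open>A commutative square may be inserted into a composite: from \<open>s u \<simeq> s' u'\<close> and \<open>u' a \<simeq> v b\<close>
  pass to \<open>s (u a) \<simeq> s' (v b)\<close>.\<close>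

lemma heq_square:
  assumes 1: "heq A W X (s \<circ>\<^sub>c u) (s' \<circ>\<^sub>c u')" and 2: "heq A T Z' (u' \<circ>\<^sub>c a) (v \<circ>\<^sub>c b)"
    and m: "s \<in> chain_maps A Z X" "u \<in> chain_maps A W Z" "s' \<in> chain_maps A Z' X" "u' \<in> chain_maps A W Z'"
      "a \<in> chain_maps A T W" "v \<in> chain_maps A W' Z'" "b \<in> chain_maps A T W'"
    and c: "Z \<in> cpxs A" "W' \<in> cpxs A"
  shows "heq A T X (s \<circ>\<^sub>c (u \<circ>\<^sub>c a)) (s' \<circ>\<^sub>c (v \<circ>\<^sub>c b))"
proof -
  note T = heqD(1)[OF 2] and Z' = heqD(2)[OF 2] and W = heqD(1)[OF 1] and X = heqD(2)[OF 1]
  have "heq A T X (s \<circ>\<^sub>c (u \<circ>\<^sub>c a)) ((s \<circ>\<^sub>c u) \<circ>\<^sub>c a)"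
    by (rule heq_sym[OF heq_assoc[OF m(5,2,1) T W c(1) X]])
  also have "heq A T X ((s \<circ>\<^sub>c u) \<circ>\<^sub>c a) ((s' \<circ>\<^sub>c u') \<circ>\<^sub>c a)" by (rule heq_right[OF 1 T m(5)])
  also have "heq A T X ((s' \<circ>\<^sub>c u') \<circ>\<^sub>c a) (s' \<circ>\<^sub>c (u' \<circ>\<^sub>c a))" by (rule heq_assoc[OF m(5,4,3) T W Z' X])
  also have "heq A T X (s' \<circ>\<^sub>c (u' \<circ>\<^sub>c a)) (s' \<circ>\<^sub>c (v \<circ>\<^sub>c b))" by (rule heq_left[OF 2 X m(3)])
  finally show ?thesis .
qed

lemma ore_right_heq:
  assumes "Z \<in> cpxs A" "W \<in> cpxs A" "Y \<in> cpxs A" "f \<in> chain_maps A Z Y" "t \<in> quasi_isos A W Y"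
  obtains U t' f' where "U \<in> cpxs A" "t' \<in> quasi_isos A U Z" "f' \<in> chain_maps A U W"
    "heq A U Y (f \<circ>\<^sub>c t') (t \<circ>\<^sub>c f')"
proof -
  obtain U t' f' where U: "U \<in> cpxs A" "t' \<in> quasi_isos A U Z" "f' \<in> chain_maps A U W"
    "homotopic A U Y (f \<circ>\<^sub>c t') (t \<circ>\<^sub>c f')" by (rule ore_right[OF assms])
  have "heq A U Y (f \<circ>\<^sub>c t') (t \<circ>\<^sub>c f')"
    unfolding heq_def
    using U assms(3) chain_comp_chain_map[OF U(1) assms(1,3) quasi_iso_chain[OF U(2)] assms(4)]
      chain_comp_chain_map[OF U(1) assms(2,3) U(3) quasi_iso_chain[OF assms(5)]] by simp
  then show ?thesis by (rule that[OF U(1-3)])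
qed

lemma roof_rel_iff:
  "((Z, s, f), (Z', s', f')) \<in> roof_rel A X Y \<longleftrightarrow>
     (Z, s, f) \<in> roofs A X Y \<and> (Z', s', f') \<in> roofs A X Y \<and>
     (\<exists>W\<in>cpxs A. \<exists>u\<in>chain_maps A W Z. \<exists>u'\<in>chain_maps A W Z'.
        s \<circ>\<^sub>c u \<in> quasi_isos A W X \<and>
        homotopic A W X (s \<circ>\<^sub>c u) (s' \<circ>\<^sub>c u') \<and>
        homotopic A W Y (f \<circ>\<^sub>c u) (f' \<circ>\<^sub>c u'))"
  by (simp add: roof_rel_def)

lemma roofs_iff: "(Z, s, f) \<in> roofs A X Y \<longleftrightarrow> Z \<in> cpxs A \<and> s \<in> quasi_isos A Z X \<and> f \<in> chain_maps A Z Y"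
  by (simp add: roofs_def)

text \<open>Equivalence of roofs requires only \<open>s u\<close> to be a quasi-isomorphism; by two out of three, and since
  \<open>s u \<simeq> s' u'\<close>, both \<open>u\<close> and \<open>u'\<close> are quasi-isomorphisms.\<close>

lemma roof_relE:
  assumes X: "X \<in> cpxs A" and Y: "Y \<in> cpxs A" and r: "((Z, s, f), (Z', s', f')) \<in> roof_rel A X Y"
  obtains W u u' where "W \<in> cpxs A" "u \<in> quasi_isos A W Z" "u' \<in> quasi_isos A W Z'"
    "heq A W X (s \<circ>\<^sub>c u) (s' \<circ>\<^sub>c u')" "heq A W Y (f \<circ>\<^sub>c u) (f' \<circ>\<^sub>c u')"
    "Z \<in> cpxs A" "Z' \<in> cpxs A" "s \<in> quasi_isos A Z X" "s' \<in> quasi_isos A Z' X"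
    "f \<in> chain_maps A Z Y" "f' \<in> chain_maps A Z' Y"
proof -
  obtain W u u' where W: "W \<in> cpxs A" and u: "u \<in> chain_maps A W Z" and u': "u' \<in> chain_maps A W Z'"
    and q: "s \<circ>\<^sub>c u \<in> quasi_isos A W X" and h: "homotopic A W X (s \<circ>\<^sub>c u) (s' \<circ>\<^sub>c u')"
        "homotopic A W Y (f \<circ>\<^sub>c u) (f' \<circ>\<^sub>c u')"
    using r unfolding roof_rel_iff by blast
  have Z: "Z \<in> cpxs A" "s \<in> quasi_isos A Z X" "f \<in> chain_maps A Z Y"
    and Z': "Z' \<in> cpxs A" "s' \<in> quasi_isos A Z' X" "f' \<in> chain_maps A Z' Y"
    using r unfolding roof_rel_iff roofs_iff by blast+
  have 1: "heq A W X (s \<circ>\<^sub>c u) (s' \<circ>\<^sub>c u')" and 2: "heq A W Y (f \<circ>\<^sub>c u) (f' \<circ>\<^sub>c u')"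
    unfolding heq_def
    using W X Y h chain_comp_chain_map[OF W Z(1) X u quasi_iso_chain[OF Z(2)]]
      chain_comp_chain_map[OF W Z'(1) X u' quasi_iso_chain[OF Z'(2)]]
      chain_comp_chain_map[OF W Z(1) Y u Z(3)] chain_comp_chain_map[OF W Z'(1) Y u' Z'(3)] by blast+
  have "u \<in> quasi_isos A W Z" by (rule quasi_iso_cancel_left[OF W Z(1) X u Z(2) q])
  moreover have "u' \<in> quasi_isos A W Z'"
    by (rule quasi_iso_cancel_left[OF W Z'(1) X u' Z'(2) heq_quasi[OF 1 q]])
  ultimately show ?thesis using that W 1 2 Z Z' by blast
qed

lemma roof_relI:
  assumes "W \<in> cpxs A" "u \<in> quasi_isos A W Z" "u' \<in> chain_maps A W Z'"
    "heq A W X (s \<circ>\<^sub>c u) (s' \<circ>\<^sub>c u')" "heq A W Y (f \<circ>\<^sub>c u) (f' \<circ>\<^sub>c u')"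
    "Z \<in> cpxs A" "Z' \<in> cpxs A" "s \<in> quasi_isos A Z X" "s' \<in> quasi_isos A Z' X"
    "f \<in> chain_maps A Z Y" "f' \<in> chain_maps A Z' Y"
  shows "((Z, s, f), (Z', s', f')) \<in> roof_rel A X Y"
  unfolding roof_rel_iff roofs_iff
  using assms quasi_iso_comp[OF assms(1,6) heqD(2)[OF assms(4)] assms(2,8)] heqD(5)[OF assms(4)] heqD(5)[OF assms(5)]
    quasi_iso_chain[OF assms(2)] by blast

text \<open>For transitivity the two dominating roofs are themselves dominated over the middle roof by an Ore square.\<close>

lemma equiv_roof_rel:
  assumes X: "X \<in> cpxs A" and Y: "Y \<in> cpxs A"
  shows "equiv (roofs A X Y) (roof_rel A X Y)"
proof (rule equivI)
  show "roof_rel A X Y \<subseteq> roofs A X Y \<times> roofs A X Y"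
    by (auto simp: roof_rel_def)
  show "refl_on (roofs A X Y) (roof_rel A X Y)"
  proof (rule refl_onI)
    fix r assume r: "r \<in> roofs A X Y"
    obtain Z s f where e: "r = (Z, s, f)" by (cases r)
    have Z: "Z \<in> cpxs A" "s \<in> quasi_isos A Z X" "f \<in> chain_maps A Z Y" using r by (auto simp: e roofs_iff)
    note c = chain_comp_chain_map[OF Z(1) Z(1) _ chain_id_chain_map[OF Z(1)]]
    show "(r, r) \<in> roof_rel A X Y"
      unfolding e
      by (rule roof_relI[OF Z(1) quasi_iso_id[OF Z(1)] chain_id_chain_map[OF Z(1)]])
        (use Z X Y c[OF X quasi_iso_chain[OF Z(2)]] c[OF Y Z(3)] in \<open>simp_all add: heq_refl\<close>)
  qed
  show "sym (roof_rel A X Y)"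
  proof (rule symI)
    fix r r' assume rr: "(r, r') \<in> roof_rel A X Y"
    obtain Z s f Z' s' f' where e: "r = (Z, s, f)" "r' = (Z', s', f')" by (cases r, cases r')
    show "(r', r) \<in> roof_rel A X Y"
      using rr unfolding e
      by (rule roof_relE[OF X Y]) (rule roof_relI, auto intro: heq_sym quasi_iso_chain)
  qed
  show "trans (roof_rel A X Y)"
  proof (rule transI)
    fix r1 r2 r3 assume rr: "(r1, r2) \<in> roof_rel A X Y" "(r2, r3) \<in> roof_rel A X Y"
    obtain Z1 s1 f1 Z2 s2 f2 Z3 s3 f3 where e: "r1 = (Z1, s1, f1)" "r2 = (Z2, s2, f2)" "r3 = (Z3, s3, f3)"
      by (cases r1, cases r2, cases r3)
    obtain W u u' where 1: "W \<in> cpxs A" "u \<in> quasi_isos A W Z1" "u' \<in> quasi_isos A W Z2"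
      "heq A W X (s1 \<circ>\<^sub>c u) (s2 \<circ>\<^sub>c u')" "heq A W Y (f1 \<circ>\<^sub>c u) (f2 \<circ>\<^sub>c u')"
      "Z1 \<in> cpxs A" "Z2 \<in> cpxs A" "s1 \<in> quasi_isos A Z1 X" "s2 \<in> quasi_isos A Z2 X"
      "f1 \<in> chain_maps A Z1 Y" "f2 \<in> chain_maps A Z2 Y"
      by (rule roof_relE[OF X Y rr(1)[unfolded e]])
    obtain W' v v' where 2: "W' \<in> cpxs A" "v \<in> quasi_isos A W' Z2" "v' \<in> quasi_isos A W' Z3"
      "heq A W' X (s2 \<circ>\<^sub>c v) (s3 \<circ>\<^sub>c v')" "heq A W' Y (f2 \<circ>\<^sub>c v) (f3 \<circ>\<^sub>c v')"
      "Z3 \<in> cpxs A" "s3 \<in> quasi_isos A Z3 X" "f3 \<in> chain_maps A Z3 Y"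
      by (rule roof_relE[OF X Y rr(2)[unfolded e]])
    note q = quasi_iso_chain
    obtain T a b where T: "T \<in> cpxs A" "a \<in> quasi_isos A T W" "b \<in> chain_maps A T W'"
      "heq A T Z2 (u' \<circ>\<^sub>c a) (v \<circ>\<^sub>c b)"
      by (rule ore_right_heq[OF 1(1) 2(1) 1(7) q[OF 1(3)] 2(2)])
    have sq: "heq A T V (m1 \<circ>\<^sub>c (u \<circ>\<^sub>c a)) (m3 \<circ>\<^sub>c (v' \<circ>\<^sub>c b))"
      if m: "heq A W V (m1 \<circ>\<^sub>c u) (m2 \<circ>\<^sub>c u')" "heq A W' V (m2 \<circ>\<^sub>c v) (m3 \<circ>\<^sub>c v')"
        "m1 \<in> chain_maps A Z1 V" "m2 \<in> chain_maps A Z2 V" "m3 \<in> chain_maps A Z3 V" for V m1 m2 m3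
    proof -
      have V: "V \<in> cpxs A" using heqD(2)[OF m(1)] .
      have "heq A T V (m1 \<circ>\<^sub>c (u \<circ>\<^sub>c a)) (m2 \<circ>\<^sub>c (v \<circ>\<^sub>c b))"
        by (rule heq_square[OF m(1) T(4) m(3) q[OF 1(2)] m(4) q[OF 1(3)] q[OF T(2)] q[OF 2(2)] T(3) 1(6) 2(1)])
      also have "heq A T V (m2 \<circ>\<^sub>c (v \<circ>\<^sub>c b)) ((m2 \<circ>\<^sub>c v) \<circ>\<^sub>c b)"
        by (rule heq_sym[OF heq_assoc[OF T(3) q[OF 2(2)] m(4) T(1) 2(1) 1(7) V]])
      also have "heq A T V ((m2 \<circ>\<^sub>c v) \<circ>\<^sub>c b) ((m3 \<circ>\<^sub>c v') \<circ>\<^sub>c b)" by (rule heq_right[OF m(2) T(1,3)])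
      also have "heq A T V ((m3 \<circ>\<^sub>c v') \<circ>\<^sub>c b) (m3 \<circ>\<^sub>c (v' \<circ>\<^sub>c b))"
        by (rule heq_assoc[OF T(3) q[OF 2(3)] m(5) T(1) 2(1) 2(6) V])
      finally show ?thesis .
    qed
    show "(r1, r3) \<in> roof_rel A X Y"
      unfolding e
      by (rule roof_relI[OF T(1) quasi_iso_comp[OF T(1) 1(1) 1(6) T(2) 1(2)]
            chain_comp_chain_map[OF T(1) 2(1) 2(6) T(3) q[OF 2(3)]]
            sq[OF 1(4) 2(4) q[OF 1(8)] q[OF 1(9)] q[OF 2(7)]]
            sq[OF 1(5) 2(5) 1(10) 1(11) 2(8)] 1(6) 2(6) 1(8) 2(7) 1(10) 2(8)])
  qed
qed

text \<open>Objects joined by a roof of two quasi-isomorphisms; by the lemma \<open>isomorphic_iff\<close> below these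
  are exactly the isomorphic objects of the derived category.\<close>

definition qi_equiv :: "('k::field, 'a) module \<Rightarrow> ('a, 'k) cpx \<Rightarrow> ('a, 'k) cpx \<Rightarrow> bool" where
  "qi_equiv A X Y \<longleftrightarrow> X \<in> cpxs A \<and> Y \<in> cpxs A \<and>
     (\<exists>Z\<in>cpxs A. \<exists>s\<in>quasi_isos A Z X. \<exists>f\<in>quasi_isos A Z Y. True)"

lemma qi_equivE:
  assumes "qi_equiv A X Y"
  obtains Z s f where "X \<in> cpxs A" "Y \<in> cpxs A" "Z \<in> cpxs A" "s \<in> quasi_isos A Z X" "f \<in> quasi_isos A Z Y"
  using assms unfolding qi_equiv_def by blast

lemma qi_equivI:
  assumes "X \<in> cpxs A" "Y \<in> cpxs A" "f \<in> quasi_isos A X Y"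
  shows "qi_equiv A X Y"
  unfolding qi_equiv_def using assms quasi_iso_id by blast

lemma qi_equiv_sym: "qi_equiv A X Y \<Longrightarrow> qi_equiv A Y X"
  unfolding qi_equiv_def by blast

lemma qi_equiv_refl: "X \<in> cpxs A \<Longrightarrow> qi_equiv A X X"
  by (rule qi_equivI[OF _ _ quasi_iso_id])

lemma qi_equiv_trans:
  assumes "qi_equiv A X Y" "qi_equiv A Y V"
  shows "qi_equiv A X V"
proof -
  obtain Z s f where 1: "X \<in> cpxs A" "Y \<in> cpxs A" "Z \<in> cpxs A" "s \<in> quasi_isos A Z X" "f \<in> quasi_isos A Z Y"
    by (rule qi_equivE[OF assms(1)])
  obtain W t g where 2: "V \<in> cpxs A" "W \<in> cpxs A" "t \<in> quasi_isos A W Y" "g \<in> quasi_isos A W V"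
    by (rule qi_equivE[OF assms(2)])
  obtain U a b where U: "U \<in> cpxs A" "a \<in> quasi_isos A U Z" "b \<in> chain_maps A U W" "heq A U Y (f \<circ>\<^sub>c a) (t \<circ>\<^sub>c b)"
    by (rule ore_right_heq[OF 1(3) 2(2) 1(2) quasi_iso_chain[OF 1(5)] 2(3)])
  have "t \<circ>\<^sub>c b \<in> quasi_isos A U Y"
    by (rule heq_quasi[OF U(4) quasi_iso_comp[OF U(1) 1(3) 1(2) U(2) 1(5)]])
  then have "b \<in> quasi_isos A U W" by (rule quasi_iso_cancel_left[OF U(1) 2(2) 1(2) U(3) 2(3)])
  then have "s \<circ>\<^sub>c a \<in> quasi_isos A U X" "g \<circ>\<^sub>c b \<in> quasi_isos A U V"
    using quasi_iso_comp[OF U(1) 1(3) 1(1) U(2) 1(4)] quasi_iso_comp[OF U(1) 2(2) 2(1) _ 2(4)] by auto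
  then show ?thesis unfolding qi_equiv_def using 1(1) 2(1) U(1) by blast
qed

text \<open>For equivalent representatives of \<open>F\<close> and of its inverse, every composite represents the
  identity: the two legs of the composite agree after a further quasi-isomorphism.\<close>

lemma composite_legs_agree:
  fixes A :: "('k::field, 'a) module"
  assumes X: "X \<in> cpxs A" and Y: "Y \<in> cpxs A" and fq: "f \<in> quasi_isos A Z Y"
    and r1: "((Z, s, f), (Z1, s1, f1)) \<in> roof_rel A X Y"
    and r2: "((Z, f, s), (W1, t1, g1)) \<in> roof_rel A Y X"
    and U: "U \<in> cpxs A" and t': "t' \<in> quasi_isos A U Z1" and f': "f' \<in> chain_maps A U W1"
    and h: "homotopic A U Y (f1 \<circ>\<^sub>c t') (t1 \<circ>\<^sub>c f')"
  obtains T n where "T \<in> cpxs A" "n \<in> quasi_isos A T U" "heq A T X ((s1 \<circ>\<^sub>c t') \<circ>\<^sub>c n) ((g1 \<circ>\<^sub>c f') \<circ>\<^sub>c n)"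
proof -
  note q = quasi_iso_chain
  \<comment> \<open>All representatives are compared on a common source \<open>T4\<close> over \<open>U\<close>; there the two maps to \<open>Z\<close> agree after \<open>f\<close>,
    which can be cancelled.\<close>
  obtain T1 a a1 where 1: "T1 \<in> cpxs A" "a \<in> quasi_isos A T1 Z" "a1 \<in> quasi_isos A T1 Z1"
    "heq A T1 X (s \<circ>\<^sub>c a) (s1 \<circ>\<^sub>c a1)" "heq A T1 Y (f \<circ>\<^sub>c a) (f1 \<circ>\<^sub>c a1)"
    "Z \<in> cpxs A" "Z1 \<in> cpxs A" "s \<in> quasi_isos A Z X" "s1 \<in> quasi_isos A Z1 X" "f1 \<in> chain_maps A Z1 Y"
    by (rule roof_relE[OF X Y r1])
  obtain T2 b b1 where 2: "T2 \<in> cpxs A" "b \<in> quasi_isos A T2 Z" "b1 \<in> quasi_isos A T2 W1"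
    "heq A T2 Y (f \<circ>\<^sub>c b) (t1 \<circ>\<^sub>c b1)" "heq A T2 X (s \<circ>\<^sub>c b) (g1 \<circ>\<^sub>c b1)"
    "W1 \<in> cpxs A" "t1 \<in> quasi_isos A W1 Y" "g1 \<in> chain_maps A W1 X"
    by (rule roof_relE[OF Y X r2])
  obtain T3 c c1 where 3: "T3 \<in> cpxs A" "c \<in> quasi_isos A T3 U" "c1 \<in> chain_maps A T3 T1"
    "heq A T3 Z1 (t' \<circ>\<^sub>c c) (a1 \<circ>\<^sub>c c1)"
    by (rule ore_right_heq[OF U 1(1) 1(7) q[OF t'] 1(3)])
  have fc: "f' \<circ>\<^sub>c c \<in> chain_maps A T3 W1" by (rule chain_comp_chain_map[OF 3(1) U 2(6) q[OF 3(2)] f'])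
  obtain T4 e e2 where 4: "T4 \<in> cpxs A" "e \<in> quasi_isos A T4 T3" "e2 \<in> chain_maps A T4 T2"
    "heq A T4 W1 ((f' \<circ>\<^sub>c c) \<circ>\<^sub>c e) (b1 \<circ>\<^sub>c e2)"
    by (rule ore_right_heq[OF 3(1) 2(1) 2(6) fc 2(3)])
  note ch = q[OF 1(2)] q[OF 1(3)] q[OF 1(8)] q[OF 1(9)] 1(10) q[OF 2(2)] q[OF 2(3)] q[OF 2(7)] 2(8)
    q[OF 3(2)] 3(3) q[OF 4(2)] 4(3) q[OF t'] f' q[OF fq]
  note [simp] = ch[THEN chain_map_dims(1)] ch[THEN chain_map_dims(2)]
  have assoc: "(h \<circ>\<^sub>c g) \<circ>\<^sub>c k = h \<circ>\<^sub>c (g \<circ>\<^sub>c k)"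
    if "\<And>i. dim_col (h i) = dim_row (g i)" "\<And>i. dim_col (g i) = dim_row (k i)" for h g k :: "int \<Rightarrow> 'k mat"
    using that by (simp add: chain_comp_def mat_assoc)
  have dims: "dim_row ((h \<circ>\<^sub>c g) i) = dim_row (h i)" "dim_col ((h \<circ>\<^sub>c g) i) = dim_col (g i)" for h g :: "int \<Rightarrow> 'k mat" and i
    by (simp_all add: chain_comp_def)
  have C1: "c1 \<circ>\<^sub>c e \<in> chain_maps A T4 T1" by (rule chain_comp_chain_map[OF 4(1) 3(1) 1(1) ch(12,11)])
  have C2: "c \<circ>\<^sub>c e \<in> chain_maps A T4 U" by (rule chain_comp_chain_map[OF 4(1) 3(1) U ch(12,10)])
  have sq1: "heq A T4 Z1 (t' \<circ>\<^sub>c (c \<circ>\<^sub>c e)) (a1 \<circ>\<^sub>c (c1 \<circ>\<^sub>c e))"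
    using heq_right[OF 3(4) 4(1) ch(12)] by (simp add: assoc dims)
  have sq2: "heq A T4 W1 (f' \<circ>\<^sub>c (c \<circ>\<^sub>c e)) (b1 \<circ>\<^sub>c e2)"
    using 4(4) by (simp add: assoc dims)
  have hh: "heq A U Y (f1 \<circ>\<^sub>c t') (t1 \<circ>\<^sub>c f')"
    unfolding heq_def using h U Y chain_comp_chain_map[OF U 1(7) Y ch(14,5)] chain_comp_chain_map[OF U 2(6) Y f' ch(8)] by simp
  have "heq A T4 Y (f \<circ>\<^sub>c (a \<circ>\<^sub>c (c1 \<circ>\<^sub>c e))) (f1 \<circ>\<^sub>c (a1 \<circ>\<^sub>c (c1 \<circ>\<^sub>c e)))"
    using heq_right[OF 1(5) 4(1) C1] by (simp add: assoc dims)
  also have "heq A T4 Y (f1 \<circ>\<^sub>c (a1 \<circ>\<^sub>c (c1 \<circ>\<^sub>c e))) (f1 \<circ>\<^sub>c (t' \<circ>\<^sub>c (c \<circ>\<^sub>c e)))"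
    by (rule heq_left[OF heq_sym[OF sq1] Y 1(10)])
  also have "heq A T4 Y (f1 \<circ>\<^sub>c (t' \<circ>\<^sub>c (c \<circ>\<^sub>c e))) (t1 \<circ>\<^sub>c (f' \<circ>\<^sub>c (c \<circ>\<^sub>c e)))"
    using heq_right[OF hh 4(1) C2] by (simp add: assoc dims)
  also have "heq A T4 Y (t1 \<circ>\<^sub>c (f' \<circ>\<^sub>c (c \<circ>\<^sub>c e))) (t1 \<circ>\<^sub>c (b1 \<circ>\<^sub>c e2))"
    by (rule heq_left[OF sq2 Y ch(8)])
  also have "heq A T4 Y (t1 \<circ>\<^sub>c (b1 \<circ>\<^sub>c e2)) (f \<circ>\<^sub>c (b \<circ>\<^sub>c e2))"
    using heq_sym[OF heq_right[OF 2(4) 4(1,3)]] by (simp add: assoc dims)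
  finally have k: "heq A T4 Y (f \<circ>\<^sub>c (a \<circ>\<^sub>c (c1 \<circ>\<^sub>c e))) (f \<circ>\<^sub>c (b \<circ>\<^sub>c e2))" .
  have L1: "a \<circ>\<^sub>c (c1 \<circ>\<^sub>c e) \<in> chain_maps A T4 Z" by (rule chain_comp_chain_map[OF 4(1) 1(1) 1(6) C1 ch(1)])
  have L2: "b \<circ>\<^sub>c e2 \<in> chain_maps A T4 Z" by (rule chain_comp_chain_map[OF 4(1) 2(1) 1(6) ch(13,6)])
  obtain T m where T: "T \<in> cpxs A" "m \<in> quasi_isos A T T4"
    "homotopic A T Z ((a \<circ>\<^sub>c (c1 \<circ>\<^sub>c e)) \<circ>\<^sub>c m) ((b \<circ>\<^sub>c e2) \<circ>\<^sub>c m)"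
    by (rule cancel_left[OF 4(1) 1(6) Y L1 L2 fq heqD(5)[OF k]])
  have m: "m \<in> chain_maps A T T4" by (rule q[OF T(2)])
  note [simp] = chain_map_dims[OF m]
  have km: "heq A T Z (a \<circ>\<^sub>c (c1 \<circ>\<^sub>c (e \<circ>\<^sub>c m))) (b \<circ>\<^sub>c (e2 \<circ>\<^sub>c m))"
    using T chain_comp_chain_map[OF T(1) 4(1) 1(6) m L1] chain_comp_chain_map[OF T(1) 4(1) 1(6) m L2] 1(6)
    by (simp add: heq_def assoc dims)
  have M1: "c1 \<circ>\<^sub>c (e \<circ>\<^sub>c m) \<in> chain_maps A T T1"
    using chain_comp_chain_map[OF T(1) 4(1) 1(1) m C1] by (simp add: assoc dims)
  have M2: "e2 \<circ>\<^sub>c m \<in> chain_maps A T T2"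
    by (rule chain_comp_chain_map[OF T(1) 4(1) 2(1) m ch(13)])
  let ?n = "c \<circ>\<^sub>c (e \<circ>\<^sub>c m)"
  have n: "?n \<in> quasi_isos A T U"
    by (intro quasi_iso_comp[OF T(1) 3(1) U] quasi_iso_comp[OF T(1) 4(1) 3(1)] T(2) 4(2) 3(2))
  have sq1m: "heq A T Z1 (t' \<circ>\<^sub>c ?n) (a1 \<circ>\<^sub>c (c1 \<circ>\<^sub>c (e \<circ>\<^sub>c m)))"
    using heq_right[OF sq1 T(1) m] by (simp add: assoc dims)
  have sq2m: "heq A T W1 (f' \<circ>\<^sub>c ?n) (b1 \<circ>\<^sub>c (e2 \<circ>\<^sub>c m))"
    using heq_right[OF sq2 T(1) m] by (simp add: assoc dims)
  have "heq A T X (s1 \<circ>\<^sub>c (t' \<circ>\<^sub>c ?n)) (s1 \<circ>\<^sub>c (a1 \<circ>\<^sub>c (c1 \<circ>\<^sub>c (e \<circ>\<^sub>c m))))"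
    by (rule heq_left[OF sq1m X ch(4)])
  also have "heq A T X (s1 \<circ>\<^sub>c (a1 \<circ>\<^sub>c (c1 \<circ>\<^sub>c (e \<circ>\<^sub>c m)))) (s \<circ>\<^sub>c (a \<circ>\<^sub>c (c1 \<circ>\<^sub>c (e \<circ>\<^sub>c m))))"
    using heq_sym[OF heq_right[OF 1(4) T(1) M1]] by (simp add: assoc dims)
  also have "heq A T X (s \<circ>\<^sub>c (a \<circ>\<^sub>c (c1 \<circ>\<^sub>c (e \<circ>\<^sub>c m)))) (s \<circ>\<^sub>c (b \<circ>\<^sub>c (e2 \<circ>\<^sub>c m)))"
    by (rule heq_left[OF km X ch(3)])
  also have "heq A T X (s \<circ>\<^sub>c (b \<circ>\<^sub>c (e2 \<circ>\<^sub>c m))) (g1 \<circ>\<^sub>c (b1 \<circ>\<^sub>c (e2 \<circ>\<^sub>c m)))"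
    using heq_right[OF 2(5) T(1) M2] by (simp add: assoc dims)
  also have "heq A T X (g1 \<circ>\<^sub>c (b1 \<circ>\<^sub>c (e2 \<circ>\<^sub>c m))) (g1 \<circ>\<^sub>c (f' \<circ>\<^sub>c ?n))"
    by (rule heq_left[OF heq_sym[OF sq2m] X ch(9)])
  finally have "heq A T X ((s1 \<circ>\<^sub>c t') \<circ>\<^sub>c ?n) ((g1 \<circ>\<^sub>c f') \<circ>\<^sub>c ?n)"
    by (simp add: assoc dims)
  then show ?thesis using that T(1) n by blast
qed

text \<open>Since \<open>dcomp\<close> is a union over all representatives and all completing squares, it has to be checked that each
  choice contributes the class of the identity, and that there is at least one choice.\<close>

lemma dcomp_inverse_roof:
  assumes X: "X \<in> cpxs A" and Y: "Y \<in> cpxs A" and Z: "Z \<in> cpxs A"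
    and s: "s \<in> quasi_isos A Z X" and f: "f \<in> quasi_isos A Z Y"
  shows "dcomp A X Y X (roof_rel A Y X `` {(Z, f, s)}) (roof_rel A X Y `` {(Z, s, f)}) = did A X"
proof -
  note q = quasi_iso_chain
  note eqX = equiv_roof_rel[OF X X]
  have one: "roof_rel A X X `` {(U, s1 \<circ>\<^sub>c t', g1 \<circ>\<^sub>c f')} = did A X"
    if r1: "((Z, s, f), (Z1, s1, f1)) \<in> roof_rel A X Y" and r2: "((Z, f, s), (W1, t1, g1)) \<in> roof_rel A Y X"
      and U: "U \<in> cpxs A" and t': "t' \<in> quasi_isos A U Z1" and f': "f' \<in> chain_maps A U W1"
      and h: "homotopic A U Y (f1 \<circ>\<^sub>c t') (t1 \<circ>\<^sub>c f')" for U s1 t' g1 f' Z1 f1 W1 t1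
  proof -
    obtain T n where T: "T \<in> cpxs A" "n \<in> quasi_isos A T U" "heq A T X ((s1 \<circ>\<^sub>c t') \<circ>\<^sub>c n) ((g1 \<circ>\<^sub>c f') \<circ>\<^sub>c n)"
      by (rule composite_legs_agree[OF X Y f r1 r2 U t' f' h])
    have Z1: "Z1 \<in> cpxs A" "s1 \<in> quasi_isos A Z1 X" and W1: "W1 \<in> cpxs A" "g1 \<in> chain_maps A W1 X"
      using r1 r2 unfolding roof_rel_iff roofs_iff by blast+
    have st: "s1 \<circ>\<^sub>c t' \<in> quasi_isos A U X" by (rule quasi_iso_comp[OF U Z1(1) X t' Z1(2)])
    have stn: "(s1 \<circ>\<^sub>c t') \<circ>\<^sub>c n \<in> chain_maps A T X" by (rule chain_comp_chain_map[OF T(1) U X q[OF T(2)] q[OF st]])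
    have gf: "g1 \<circ>\<^sub>c f' \<in> chain_maps A U X" by (rule chain_comp_chain_map[OF U W1(1) X f' W1(2)])
    have "((U, s1 \<circ>\<^sub>c t', g1 \<circ>\<^sub>c f'), (X, chain_id X, chain_id X)) \<in> roof_rel A X X"
      by (rule roof_relI[OF T(1,2) stn])
        (simp_all add: chain_comp_simps[OF stn] heq_sym[OF T(3)] heq_refl[OF T(1) X stn] U X st gf
           quasi_iso_id chain_id_chain_map)
    then show ?thesis unfolding did_def loc_def by (rule equiv_class_eq[OF eqX])
  qed
  have rXY: "(Z, s, f) \<in> roofs A X Y" and rYX: "(Z, f, s) \<in> roofs A Y X" using Z s f q by (auto simp: roofs_iff)
  have r0: "((Z, s, f), (Z, s, f)) \<in> roof_rel A X Y" "((Z, f, s), (Z, f, s)) \<in> roof_rel A Y X"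
    using equiv_class_self[OF equiv_roof_rel[OF X Y] rXY] equiv_class_self[OF equiv_roof_rel[OF Y X] rYX] by simp_all
  have h0: "homotopic A Z Y (f \<circ>\<^sub>c chain_id Z) (f \<circ>\<^sub>c chain_id Z)"
    by (simp add: chain_comp_simps[OF q[OF f]] homotopic_refl[OF Z Y q[OF f]])
  let ?S = "{roof_rel A X X `` {(U, s1 \<circ>\<^sub>c t', g1 \<circ>\<^sub>c f')} | Z1 s1 f1 W1 t1 g1 U t' f'.
     (Z1, s1, f1) \<in> roof_rel A X Y `` {(Z, s, f)} \<and> (W1, t1, g1) \<in> roof_rel A Y X `` {(Z, f, s)} \<and> U \<in> cpxs A \<and>
     t' \<in> quasi_isos A U Z1 \<and> f' \<in> chain_maps A U W1 \<and> homotopic A U Y (f1 \<circ>\<^sub>c t') (t1 \<circ>\<^sub>c f')}"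
  have "?S \<subseteq> {did A X}" using one by blast
  moreover have "roof_rel A X X `` {(Z, s \<circ>\<^sub>c chain_id Z, s \<circ>\<^sub>c chain_id Z)} \<in> ?S"
    using r0 Z quasi_iso_id[OF Z] chain_id_chain_map[OF Z] h0 by blast
  ultimately have "?S = {did A X}" by blast
  then show ?thesis unfolding dcomp_def by simp
qed

lemma qi_equiv_isomorphic:
  assumes "qi_equiv A X Y"
  shows "isomorphic A X Y"
proof -
  obtain Z s f where 1: "X \<in> cpxs A" "Y \<in> cpxs A" "Z \<in> cpxs A" "s \<in> quasi_isos A Z X" "f \<in> quasi_isos A Z Y"
    by (rule qi_equivE[OF assms])
  have "roof_rel A X Y `` {(Z, s, f)} \<in> dhom A X Y" "roof_rel A Y X `` {(Z, f, s)} \<in> dhom A Y X"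
    using 1 quasi_iso_chain by (auto simp: dhom_def roofs_iff intro!: quotientI)
  then have "diso A X Y (roof_rel A X Y `` {(Z, s, f)})"
    unfolding diso_def using dcomp_inverse_roof[OF 1] dcomp_inverse_roof[OF 1(2,1,3,5,4)] by blast
  then show ?thesis unfolding isomorphic_def using 1 by blast
qed

text \<open>Any one completing square gives a roof in the composite class.  If the composite is the identity, comparing
  this roof with the identity roof shows that its right leg is a quasi-isomorphism.\<close>

lemma dcomp_did:
  assumes X: "X \<in> cpxs A" and Y: "Y \<in> cpxs A" and F: "(Z, s, f) \<in> roofs A X Y" and G: "(W, t, g) \<in> roofs A Y X"
    and c: "dcomp A X Y X (roof_rel A Y X `` {(W, t, g)}) (roof_rel A X Y `` {(Z, s, f)}) = did A X"
  obtains U t' f' where "U \<in> cpxs A" "t' \<in> quasi_isos A U Z" "f' \<in> chain_maps A U W"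
    "heq A U Y (f \<circ>\<^sub>c t') (t \<circ>\<^sub>c f')" "g \<circ>\<^sub>c f' \<in> quasi_isos A U X"
proof -
  note q = quasi_iso_chain
  have Z: "Z \<in> cpxs A" "s \<in> quasi_isos A Z X" "f \<in> chain_maps A Z Y"
    and W: "W \<in> cpxs A" "t \<in> quasi_isos A W Y" "g \<in> chain_maps A W X" using F G by (auto simp: roofs_iff)
  obtain U t' f' where U: "U \<in> cpxs A" "t' \<in> quasi_isos A U Z" "f' \<in> chain_maps A U W"
    "heq A U Y (f \<circ>\<^sub>c t') (t \<circ>\<^sub>c f')"
    by (rule ore_right_heq[OF Z(1) W(1) Y Z(3) W(2)])
  have st: "s \<circ>\<^sub>c t' \<in> quasi_isos A U X" by (rule quasi_iso_comp[OF U(1) Z(1) X U(2) Z(2)])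
  have gf: "g \<circ>\<^sub>c f' \<in> chain_maps A U X" by (rule chain_comp_chain_map[OF U(1) W(1) X U(3) W(3)])
  have "(U, s \<circ>\<^sub>c t', g \<circ>\<^sub>c f') \<in> roof_rel A X X `` {(U, s \<circ>\<^sub>c t', g \<circ>\<^sub>c f')}"
    by (rule equiv_class_self[OF equiv_roof_rel[OF X X]]) (simp add: roofs_iff U st gf)
  moreover have "roof_rel A X X `` {(U, s \<circ>\<^sub>c t', g \<circ>\<^sub>c f')} \<subseteq>
      dcomp A X Y X (roof_rel A Y X `` {(W, t, g)}) (roof_rel A X Y `` {(Z, s, f)})"
    unfolding dcomp_def
    using equiv_class_self[OF equiv_roof_rel[OF X Y] F] equiv_class_self[OF equiv_roof_rel[OF Y X] G] U heqD(5)[OF U(4)]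
    by blast
  ultimately have "((X, chain_id X, chain_id X), (U, s \<circ>\<^sub>c t', g \<circ>\<^sub>c f')) \<in> roof_rel A X X"
    unfolding c did_def loc_def by blast
  then obtain T u u' where T: "T \<in> cpxs A" "u \<in> quasi_isos A T X" "u' \<in> quasi_isos A T U"
    "heq A T X (chain_id X \<circ>\<^sub>c u) ((g \<circ>\<^sub>c f') \<circ>\<^sub>c u')"
    by (rule roof_relE[OF X X])
  have "(g \<circ>\<^sub>c f') \<circ>\<^sub>c u' \<in> quasi_isos A T X"
    using heq_quasi[OF T(4)] T(2) by (simp add: chain_comp_simps[OF q[OF T(2)]])
  then have "g \<circ>\<^sub>c f' \<in> quasi_isos A U X" by (rule quasi_iso_cancel_right[OF T(1) U(1) X T(3) gf])
  then show ?thesis using that U by blast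
qed

theorem isomorphic_iff: "isomorphic A X Y \<longleftrightarrow> qi_equiv A X Y"
proof
  assume "isomorphic A X Y"
  then obtain F G where X: "X \<in> cpxs A" and Y: "Y \<in> cpxs A" and F: "F \<in> dhom A X Y" and G: "G \<in> dhom A Y X"
    and c: "dcomp A X Y X G F = did A X" "dcomp A Y X Y F G = did A Y"
    unfolding isomorphic_def diso_def by blast
  note q = quasi_iso_chain
  obtain Z s f where F': "F = roof_rel A X Y `` {(Z, s, f)}" "(Z, s, f) \<in> roofs A X Y"
    using F unfolding dhom_def by (auto elim: quotientE)
  obtain W t g where G': "G = roof_rel A Y X `` {(W, t, g)}" "(W, t, g) \<in> roofs A Y X"
    using G unfolding dhom_def by (auto elim: quotientE)
  have Z: "Z \<in> cpxs A" "s \<in> quasi_isos A Z X" "f \<in> chain_maps A Z Y"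
    and W: "W \<in> cpxs A" "t \<in> quasi_isos A W Y" "g \<in> chain_maps A W X" using F'(2) G'(2) by (auto simp: roofs_iff)
  obtain U t' f' where U: "U \<in> cpxs A" "t' \<in> quasi_isos A U Z" "f' \<in> chain_maps A U W"
    "heq A U Y (f \<circ>\<^sub>c t') (t \<circ>\<^sub>c f')" "g \<circ>\<^sub>c f' \<in> quasi_isos A U X"
    by (rule dcomp_did[OF X Y F'(2) G'(2) c(1)[unfolded F'(1) G'(1)]])
  obtain U2 s2 f2 where U2: "U2 \<in> cpxs A" "s2 \<in> quasi_isos A U2 W" "f2 \<in> chain_maps A U2 Z"
    "f \<circ>\<^sub>c f2 \<in> quasi_isos A U2 Y"
    by (rule dcomp_did[OF Y X G'(2) F'(2) c(2)[unfolded F'(1) G'(1)]])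
  \<comment> \<open>The composite in one order shows that \<open>f\<close> is injective on cohomology, the other one that it is surjective.\<close>
  have "coh_inj U W f'" using coh_comp(3)[OF U(1) W(1) X U(3) W(3)] U(5) by (simp add: quasi_isos_iff)
  then have "coh_inj U Y (t \<circ>\<^sub>c f')" using coh_comp(1)[OF U(1) W(1) Y U(3) q[OF W(2)]] W(2) by (simp add: quasi_isos_iff)
  then have "coh_inj U Y (f \<circ>\<^sub>c t')"
    using coh_homotopic(1)[OF heqD[OF heq_sym[OF U(4)]]] by blast
  then have i: "coh_inj Z Y f" using coh_comp(5)[OF U(1) Z(1) Y q[OF U(2)] Z(3)] U(2) by (simp add: quasi_isos_iff)
  have "coh_surj Z Y f" using coh_comp(4)[OF U2(1) Z(1) Y U2(3) Z(3)] U2(4) by (simp add: quasi_isos_iff)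
  then have "f \<in> quasi_isos A Z Y" using i Z(3) by (simp add: quasi_isos_iff)
  then show "qi_equiv A X Y" unfolding qi_equiv_def using X Y Z by blast
qed (rule qi_equiv_isomorphic)

subsection \<open>Vanishing of morphisms\<close>

text \<open>There is no nonzero morphism \<open>X \<rightarrow> Y\<close>, expressed by roofs and by coroofs.  The second form
  is convenient for maps out of a cone.\<close>

definition roofs_vanish :: "('k::field, 'a) module \<Rightarrow> ('a, 'k) cpx \<Rightarrow> ('a, 'k) cpx \<Rightarrow> bool" where
  "roofs_vanish A X Y \<longleftrightarrow> (\<forall>W s g. W \<in> cpxs A \<and> s \<in> quasi_isos A W X \<and> g \<in> chain_maps A W Y \<longrightarrow>
     (\<exists>U\<in>cpxs A. \<exists>u\<in>quasi_isos A U W. homotopic A U Y (g \<circ>\<^sub>c u) (chain_zero U Y)))"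

definition coroofs_vanish :: "('k::field, 'a) module \<Rightarrow> ('a, 'k) cpx \<Rightarrow> ('a, 'k) cpx \<Rightarrow> bool" where
  "coroofs_vanish A X Y \<longleftrightarrow> (\<forall>W s g. W \<in> cpxs A \<and> s \<in> quasi_isos A Y W \<and> g \<in> chain_maps A X W \<longrightarrow>
     (\<exists>U\<in>cpxs A. \<exists>u\<in>quasi_isos A W U. homotopic A X U (u \<circ>\<^sub>c g) (chain_zero X U)))"

lemma roofs_vanishE:
  assumes "roofs_vanish A X Y" "W \<in> cpxs A" "s \<in> quasi_isos A W X" "g \<in> chain_maps A W Y" "Y \<in> cpxs A"
  obtains U u where "U \<in> cpxs A" "u \<in> quasi_isos A U W" "heq A U Y (g \<circ>\<^sub>c u) (chain_zero U Y)"
proof -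
  obtain U u where U: "U \<in> cpxs A" "u \<in> quasi_isos A U W" "homotopic A U Y (g \<circ>\<^sub>c u) (chain_zero U Y)"
    using assms(1-4) unfolding roofs_vanish_def by blast
  have "heq A U Y (g \<circ>\<^sub>c u) (chain_zero U Y)"
    unfolding heq_def
    using U assms(5) chain_comp_chain_map[OF U(1) assms(2,5) quasi_iso_chain[OF U(2)] assms(4)]
      chain_zero_chain_map[OF U(1) assms(5)] by simp
  then show ?thesis by (rule that[OF U(1,2)])
qed

lemma coroofs_vanishE:
  assumes "coroofs_vanish A X Y" "W \<in> cpxs A" "s \<in> quasi_isos A Y W" "g \<in> chain_maps A X W" "X \<in> cpxs A"
  obtains U u where "U \<in> cpxs A" "u \<in> quasi_isos A W U" "heq A X U (u \<circ>\<^sub>c g) (chain_zero X U)"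
proof -
  obtain U u where U: "U \<in> cpxs A" "u \<in> quasi_isos A W U" "homotopic A X U (u \<circ>\<^sub>c g) (chain_zero X U)"
    using assms(1-4) unfolding coroofs_vanish_def by blast
  have "heq A X U (u \<circ>\<^sub>c g) (chain_zero X U)"
    unfolding heq_def
    using U assms(5) chain_comp_chain_map[OF assms(5,2) U(1) assms(4) quasi_iso_chain[OF U(2)]]
      chain_zero_chain_map[OF assms(5) U(1)] by simp
  then show ?thesis by (rule that[OF U(1,2)])
qed

text \<open>A class of roofs is zero iff its right leg becomes null-homotopic after a quasi-isomorphism.\<close>

lemma hom_vanishes_iff:
  assumes X: "X \<in> cpxs A" and Y: "Y \<in> cpxs A"
  shows "hom_vanishes A X Y \<longleftrightarrow> roofs_vanish A X Y"
proof
  note q = quasi_iso_chain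
  note zer = chain_zero_chain_map
  note E = equiv_roof_rel[OF X Y]
  assume v: "hom_vanishes A X Y"
  show "roofs_vanish A X Y"
    unfolding roofs_vanish_def
  proof (intro allI impI, elim conjE)
    fix W s g assume W: "W \<in> cpxs A" "s \<in> quasi_isos A W X" "g \<in> chain_maps A W Y"
    then have r: "(W, s, g) \<in> roofs A X Y" by (simp add: roofs_iff)
    then have "roof_rel A X Y `` {(W, s, g)} = dzero A X Y"
      using v quotientI[OF r, of "roof_rel A X Y"] unfolding hom_vanishes_def dhom_def by blast
    then have "((X, chain_id X, chain_zero X Y), (W, s, g)) \<in> roof_rel A X Y"
      using equiv_class_self[OF E r] unfolding dzero_def loc_def by blast
    then obtain U u u' where U: "U \<in> cpxs A" "u \<in> quasi_isos A U X" "u' \<in> quasi_isos A U W"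
      "heq A U Y (chain_zero X Y \<circ>\<^sub>c u) (g \<circ>\<^sub>c u')"
      by (rule roof_relE[OF X Y])
    have "heq A U Y (g \<circ>\<^sub>c u') (chain_zero U Y)"
      using heq_sym[OF U(4)] by (simp add: chain_comp_simps(3)[OF q[OF U(2)]])
    then show "\<exists>U\<in>cpxs A. \<exists>u\<in>quasi_isos A U W. homotopic A U Y (g \<circ>\<^sub>c u) (chain_zero U Y)"
      using U heqD(5) by blast
  qed
next
  note q = quasi_iso_chain
  note zer = chain_zero_chain_map
  note E = equiv_roof_rel[OF X Y]
  assume v: "roofs_vanish A X Y"
  have one: "roof_rel A X Y `` {(W, s, g)} = dzero A X Y" if r: "(W, s, g) \<in> roofs A X Y" for W s g
  proof -
    have W: "W \<in> cpxs A" "s \<in> quasi_isos A W X" "g \<in> chain_maps A W Y" using r by (auto simp: roofs_iff)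
    obtain U u where U: "U \<in> cpxs A" "u \<in> quasi_isos A U W" "heq A U Y (g \<circ>\<^sub>c u) (chain_zero U Y)"
      by (rule roofs_vanishE[OF v W Y])
    have su: "s \<circ>\<^sub>c u \<in> chain_maps A U X" by (rule chain_comp_chain_map[OF U(1) W(1) X q[OF U(2)] q[OF W(2)]])
    have "((W, s, g), (X, chain_id X, chain_zero X Y)) \<in> roof_rel A X Y"
      by (rule roof_relI[OF U(1,2) su])
        (simp_all add: chain_comp_simps(1,3)[OF su] heq_refl[OF U(1) X su] U(3) W X quasi_iso_id[OF X] zer[OF X Y])
    then show ?thesis unfolding dzero_def loc_def by (rule equiv_class_eq[OF E])
  qed
  have "dzero A X Y \<in> dhom A X Y"
    unfolding dzero_def loc_def dhom_def
    by (rule quotientI) (simp add: roofs_iff X quasi_iso_id zer[OF X Y])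
  moreover have "F = dzero A X Y" if F: "F \<in> dhom A X Y" for F
  proof -
    obtain r where r: "r \<in> roofs A X Y" "F = roof_rel A X Y `` {r}"
      using F unfolding dhom_def by (rule quotientE)
    obtain W s g where "r = (W, s, g)" by (cases r)
    then show ?thesis using one[of W s g] r by simp
  qed
  ultimately show "hom_vanishes A X Y"
    unfolding hom_vanishes_def by blast
qed

lemma heq_zero_left:
  assumes "heq A X Y f (chain_zero X Y)" "Z \<in> cpxs A" "g \<in> chain_maps A Y Z"
  shows "heq A X Z (g \<circ>\<^sub>c f) (chain_zero X Z)"
  using heq_left[OF assms] by (simp add: chain_comp_simps[OF assms(3)])

lemma heq_zero_right:
  assumes "heq A Y Z g (chain_zero Y Z)" "X \<in> cpxs A" "f \<in> chain_maps A X Y"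
  shows "heq A X Z (g \<circ>\<^sub>c f) (chain_zero X Z)"
  using heq_right[OF assms] by (simp add: chain_comp_simps[OF assms(3)])

text \<open>An Ore square turns a coroof into a roof; the vanishing is carried back by cancelling the
  quasi-isomorphism on the other side of the square.\<close>

lemma roofs_vanish_coroofs:
  assumes X: "X \<in> cpxs A" and Y: "Y \<in> cpxs A" and v: "roofs_vanish A X Y"
  shows "coroofs_vanish A X Y"
  unfolding coroofs_vanish_def
proof (intro allI impI, elim conjE)
  note q = quasi_iso_chain
  fix W s g assume W: "W \<in> cpxs A" and s: "s \<in> quasi_isos A Y W" and g: "g \<in> chain_maps A X W"
  obtain U t' g' where U: "U \<in> cpxs A" "t' \<in> quasi_isos A U X" "g' \<in> chain_maps A U Y" "heq A U W (g \<circ>\<^sub>c t') (s \<circ>\<^sub>c g')"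
    by (rule ore_right_heq[OF X Y W g s])
  obtain V u where V: "V \<in> cpxs A" "u \<in> quasi_isos A V U" "heq A V Y (g' \<circ>\<^sub>c u) (chain_zero V Y)"
    by (rule roofs_vanishE[OF v U(1-3) Y])
  have tu: "t' \<circ>\<^sub>c u \<in> quasi_isos A V X" by (rule quasi_iso_comp[OF V(1) U(1) X V(2) U(2)])
  have "heq A V W (g \<circ>\<^sub>c (t' \<circ>\<^sub>c u)) ((g \<circ>\<^sub>c t') \<circ>\<^sub>c u)"
    by (rule heq_sym[OF heq_assoc[OF q[OF V(2)] q[OF U(2)] g V(1) U(1) X W]])
  also have "heq A V W ((g \<circ>\<^sub>c t') \<circ>\<^sub>c u) ((s \<circ>\<^sub>c g') \<circ>\<^sub>c u)" by (rule heq_right[OF U(4) V(1) q[OF V(2)]])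
  also have "heq A V W ((s \<circ>\<^sub>c g') \<circ>\<^sub>c u) (s \<circ>\<^sub>c (g' \<circ>\<^sub>c u))"
    by (rule heq_assoc[OF q[OF V(2)] U(3) q[OF s] V(1) U(1) Y W])
  also have "heq A V W (s \<circ>\<^sub>c (g' \<circ>\<^sub>c u)) (chain_zero V W)" by (rule heq_zero_left[OF V(3) W q[OF s]])
  finally have "homotopic A V W (g \<circ>\<^sub>c (t' \<circ>\<^sub>c u)) (chain_zero V W)" by (rule heqD(5))
  from cancel_right[OF V(1) X W tu g this]
  show "\<exists>U\<in>cpxs A. \<exists>u\<in>quasi_isos A W U. homotopic A X U (u \<circ>\<^sub>c g) (chain_zero X U)" by blast
qed

lemma coroofs_vanish_roofs:
  assumes X: "X \<in> cpxs A" and Y: "Y \<in> cpxs A" and v: "coroofs_vanish A X Y"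
  shows "roofs_vanish A X Y"
  unfolding roofs_vanish_def
proof (intro allI impI, elim conjE)
  note q = quasi_iso_chain
  fix W s g assume W: "W \<in> cpxs A" and s: "s \<in> quasi_isos A W X" and g: "g \<in> chain_maps A W Y"
  obtain Y' s' g' where Y': "Y' \<in> cpxs A" "s' \<in> quasi_isos A Y Y'" "g' \<in> chain_maps A X Y'"
    "homotopic A W Y' (s' \<circ>\<^sub>c g) (g' \<circ>\<^sub>c s)"
    by (rule ore_left[OF W X Y g s])
  have h: "heq A W Y' (s' \<circ>\<^sub>c g) (g' \<circ>\<^sub>c s)"
    unfolding heq_def using Y' W chain_comp_chain_map[OF W Y Y'(1) g q[OF Y'(2)]] chain_comp_chain_map[OF W X Y'(1) q[OF s] Y'(3)] by simp
  obtain V u where V: "V \<in> cpxs A" "u \<in> quasi_isos A Y' V" "heq A X V (u \<circ>\<^sub>c g') (chain_zero X V)"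
    by (rule coroofs_vanishE[OF v Y'(1-3) X])
  have us: "u \<circ>\<^sub>c s' \<in> quasi_isos A Y V" by (rule quasi_iso_comp[OF Y Y'(1) V(1) Y'(2) V(2)])
  have z: "chain_zero W Y \<in> chain_maps A W Y" by (rule chain_zero_chain_map[OF W Y])
  have "heq A W V ((u \<circ>\<^sub>c s') \<circ>\<^sub>c g) (u \<circ>\<^sub>c (s' \<circ>\<^sub>c g))"
    by (rule heq_assoc[OF g q[OF Y'(2)] q[OF V(2)] W Y Y'(1) V(1)])
  also have "heq A W V (u \<circ>\<^sub>c (s' \<circ>\<^sub>c g)) (u \<circ>\<^sub>c (g' \<circ>\<^sub>c s))" by (rule heq_left[OF h V(1) q[OF V(2)]])
  also have "heq A W V (u \<circ>\<^sub>c (g' \<circ>\<^sub>c s)) ((u \<circ>\<^sub>c g') \<circ>\<^sub>c s)"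
    by (rule heq_sym[OF heq_assoc[OF q[OF s] Y'(3) q[OF V(2)] W X Y'(1) V(1)]])
  also have "heq A W V ((u \<circ>\<^sub>c g') \<circ>\<^sub>c s) (chain_zero W V)" by (rule heq_zero_right[OF V(3) W q[OF s]])
  finally have "heq A W V ((u \<circ>\<^sub>c s') \<circ>\<^sub>c g) ((u \<circ>\<^sub>c s') \<circ>\<^sub>c chain_zero W Y)"
    by (simp add: chain_comp_simps[OF q[OF us]])
  from cancel_left[OF W Y V(1) g z us heqD(5)[OF this]]
  obtain U c where U: "U \<in> cpxs A" "c \<in> quasi_isos A U W" "homotopic A U Y (g \<circ>\<^sub>c c) (chain_zero W Y \<circ>\<^sub>c c)" by blast
  then show "\<exists>U\<in>cpxs A. \<exists>u\<in>quasi_isos A U W. homotopic A U Y (g \<circ>\<^sub>c u) (chain_zero U Y)"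
    using chain_comp_simps(3)[OF q[OF U(2)]] by metis
qed

lemma hom_vanishes_coroofs:
  assumes "X \<in> cpxs A" "Y \<in> cpxs A"
  shows "hom_vanishes A X Y \<longleftrightarrow> coroofs_vanish A X Y"
  using hom_vanishes_iff[OF assms] roofs_vanish_coroofs[OF assms] coroofs_vanish_roofs[OF assms] by blast

lemma roofs_vanish_quasi_source:
  assumes X: "X \<in> cpxs A" and Y: "Y \<in> cpxs A" and Z: "Z \<in> cpxs A" and s: "s \<in> quasi_isos A Z X"
  shows "roofs_vanish A X Y \<longleftrightarrow> roofs_vanish A Z Y"
proof
  note q = quasi_iso_chain
  show "roofs_vanish A Z Y" if "roofs_vanish A X Y"
    using that unfolding roofs_vanish_def using quasi_iso_comp[OF _ Z X _ s] by blast
  assume v: "roofs_vanish A Z Y"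
  show "roofs_vanish A X Y"
    unfolding roofs_vanish_def
  proof (intro allI impI, elim conjE)
    fix W t g assume W: "W \<in> cpxs A" and t: "t \<in> quasi_isos A W X" and g: "g \<in> chain_maps A W Y"
    obtain U a b where U: "U \<in> cpxs A" "a \<in> quasi_isos A U W" "b \<in> chain_maps A U Z" "heq A U X (t \<circ>\<^sub>c a) (s \<circ>\<^sub>c b)"
      by (rule ore_right_heq[OF W Z X q[OF t] s])
    have "b \<in> quasi_isos A U Z"
      by (rule quasi_iso_cancel_left[OF U(1) Z X U(3) s heq_quasi[OF U(4) quasi_iso_comp[OF U(1) W X U(2) t]]])
    then obtain V u where V: "V \<in> cpxs A" "u \<in> quasi_isos A V U" "heq A V Y ((g \<circ>\<^sub>c a) \<circ>\<^sub>c u) (chain_zero V Y)"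
      by (rule roofs_vanishE[OF v U(1) _ chain_comp_chain_map[OF U(1) W Y q[OF U(2)] g] Y])
    have "heq A V Y (g \<circ>\<^sub>c (a \<circ>\<^sub>c u)) (chain_zero V Y)"
      using V(3) chain_comp_assoc[OF q[OF V(2)] q[OF U(2)] g] by simp
    then show "\<exists>U\<in>cpxs A. \<exists>u\<in>quasi_isos A U W. homotopic A U Y (g \<circ>\<^sub>c u) (chain_zero U Y)"
      using V(1) quasi_iso_comp[OF V(1) U(1) W V(2) U(2)] heqD(5) by blast
  qed
qed

lemma coroofs_vanish_quasi_target:
  assumes X: "X \<in> cpxs A" and Y: "Y \<in> cpxs A" and Z: "Z \<in> cpxs A" and s: "s \<in> quasi_isos A Z Y"
  shows "roofs_vanish A X Y \<longleftrightarrow> roofs_vanish A X Z"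
proof
  note q = quasi_iso_chain
  show "roofs_vanish A X Y" if "roofs_vanish A X Z"
  proof -
    have "coroofs_vanish A X Z" using roofs_vanish_coroofs[OF X Z that] .
    then have "coroofs_vanish A X Y"
      unfolding coroofs_vanish_def using quasi_iso_comp[OF Z Y _ s] by blast
    then show ?thesis by (rule coroofs_vanish_roofs[OF X Y])
  qed
  assume v: "roofs_vanish A X Y"
  show "roofs_vanish A X Z"
    unfolding roofs_vanish_def
  proof (intro allI impI, elim conjE)
    fix W t g assume W: "W \<in> cpxs A" and t: "t \<in> quasi_isos A W X" and g: "g \<in> chain_maps A W Z"
    obtain U u where U: "U \<in> cpxs A" "u \<in> quasi_isos A U W" "heq A U Y ((s \<circ>\<^sub>c g) \<circ>\<^sub>c u) (chain_zero U Y)"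
      by (rule roofs_vanishE[OF v W t chain_comp_chain_map[OF W Z Y g q[OF s]] Y])
    have gu: "g \<circ>\<^sub>c u \<in> chain_maps A U Z" by (rule chain_comp_chain_map[OF U(1) W Z q[OF U(2)] g])
    have z: "chain_zero U Z \<in> chain_maps A U Z" by (rule chain_zero_chain_map[OF U(1) Z])
    have "homotopic A U Y (s \<circ>\<^sub>c (g \<circ>\<^sub>c u)) (s \<circ>\<^sub>c chain_zero U Z)"
      using heqD(5)[OF U(3)] chain_comp_assoc[OF q[OF U(2)] g q[OF s]] by (simp add: chain_comp_simps[OF q[OF s]])
    from cancel_left[OF U(1) Z Y gu z s this]
    obtain V c where V: "V \<in> cpxs A" "c \<in> quasi_isos A V U" "homotopic A V Z ((g \<circ>\<^sub>c u) \<circ>\<^sub>c c) (chain_zero U Z \<circ>\<^sub>c c)" by blast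
    have "homotopic A V Z (g \<circ>\<^sub>c (u \<circ>\<^sub>c c)) (chain_zero V Z)"
      using V(3) chain_comp_assoc[OF q[OF V(2)] q[OF U(2)] g] by (simp add: chain_comp_simps[OF q[OF V(2)]])
    then show "\<exists>U\<in>cpxs A. \<exists>u\<in>quasi_isos A U W. homotopic A U Z (g \<circ>\<^sub>c u) (chain_zero U Z)"
      using V(1) quasi_iso_comp[OF V(1) U(1) W V(2) U(2)] by blast
  qed
qed

lemma hom_vanishes_qi_equiv:
  assumes "qi_equiv A X X'" "qi_equiv A Y Y'"
  shows "hom_vanishes A X Y \<longleftrightarrow> hom_vanishes A X' Y'"
proof -
  obtain Z s f where 1: "X \<in> cpxs A" "X' \<in> cpxs A" "Z \<in> cpxs A" "s \<in> quasi_isos A Z X" "f \<in> quasi_isos A Z X'"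
    by (rule qi_equivE[OF assms(1)])
  obtain W t g where 2: "Y \<in> cpxs A" "Y' \<in> cpxs A" "W \<in> cpxs A" "t \<in> quasi_isos A W Y" "g \<in> quasi_isos A W Y'"
    by (rule qi_equivE[OF assms(2)])
  show ?thesis
    using roofs_vanish_quasi_source[OF 1(1) 2(1) 1(3,4)] roofs_vanish_quasi_source[OF 1(2) 2(1) 1(3,5)]
      coroofs_vanish_quasi_target[OF 1(2) 2(1) 2(3,4)] coroofs_vanish_quasi_target[OF 1(2) 2(2) 2(3,5)]
    by (simp add: hom_vanishes_iff 1 2)
qed

text \<open>A morphism out of the cone dies on \<open>B\<close>, hence factors through \<open>P[1]\<close> by \<open>cone_factor\<close>, and dies there.  For
  coroofs each step only enlarges the target, so that the cone itself is never replaced.\<close>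

lemma hom_vanishes_cone:
  assumes P: "P \<in> cpxs A" and B: "B \<in> cpxs A" and Y: "Y \<in> cpxs A" and f: "f \<in> chain_maps A P B"
    and v: "hom_vanishes A (shift 1 P) Y" "hom_vanishes A B Y"
  shows "hom_vanishes A (cone P B f) Y"
proof -
  note q = quasi_iso_chain
  note P1 = shift_cpxs[OF P, of 1]
  note C = cone_cpxs[OF P B f]
  note t = twist_cone[OF P B f]
  note inc = tw_in_chain_map[OF t, folded cone_eq_tw] and out = tw_out_chain_map[OF t, folded cone_eq_tw]
  have v1: "coroofs_vanish A (shift 1 P) Y" and v2: "coroofs_vanish A B Y"
    using v by (simp_all add: hom_vanishes_coroofs P1 B Y)
  have "coroofs_vanish A (cone P B f) Y"
    unfolding coroofs_vanish_def
  proof (intro allI impI, elim conjE)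
    fix W s g assume W: "W \<in> cpxs A" and s: "s \<in> quasi_isos A Y W" and g: "g \<in> chain_maps A (cone P B f) W"
    obtain U u where U: "U \<in> cpxs A" "u \<in> quasi_isos A W U"
      "heq A B U (u \<circ>\<^sub>c (g \<circ>\<^sub>c tw_in (shift 1 P) B)) (chain_zero B U)"
      by (rule coroofs_vanishE[OF v2 W s chain_comp_chain_map[OF B C W inc g] B])
    have ug: "u \<circ>\<^sub>c g \<in> chain_maps A (cone P B f) U" by (rule chain_comp_chain_map[OF C W U(1) g q[OF U(2)]])
    have "homotopic A B U ((u \<circ>\<^sub>c g) \<circ>\<^sub>c tw_in (shift 1 P) B) (chain_zero B U)"
      using heqD(5)[OF U(3)] chain_comp_assoc[OF inc g q[OF U(2)]] by simp
    from cone_factor[OF P B U(1) f ug this] obtain e where e: "e \<in> chain_maps A (shift 1 P) U"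
      "homotopic A (cone P B f) U (u \<circ>\<^sub>c g) (e \<circ>\<^sub>c tw_out (shift 1 P) B)" by blast
    have us: "u \<circ>\<^sub>c s \<in> quasi_isos A Y U" by (rule quasi_iso_comp[OF Y W U(1) s U(2)])
    obtain V c where V: "V \<in> cpxs A" "c \<in> quasi_isos A U V" "heq A (shift 1 P) V (c \<circ>\<^sub>c e) (chain_zero (shift 1 P) V)"
      by (rule coroofs_vanishE[OF v1 U(1) us e(1) P1])
    have he: "heq A (cone P B f) U (u \<circ>\<^sub>c g) (e \<circ>\<^sub>c tw_out (shift 1 P) B)"
      unfolding heq_def using C U(1) ug e(2) chain_comp_chain_map[OF C P1 U(1) out e(1)] by simp
    have "heq A (cone P B f) V ((c \<circ>\<^sub>c u) \<circ>\<^sub>c g) (c \<circ>\<^sub>c (u \<circ>\<^sub>c g))"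
      by (rule heq_assoc[OF g q[OF U(2)] q[OF V(2)] C W U(1) V(1)])
    also have "heq A (cone P B f) V (c \<circ>\<^sub>c (u \<circ>\<^sub>c g)) (c \<circ>\<^sub>c (e \<circ>\<^sub>c tw_out (shift 1 P) B))"
      by (rule heq_left[OF he V(1) q[OF V(2)]])
    also have "heq A (cone P B f) V (c \<circ>\<^sub>c (e \<circ>\<^sub>c tw_out (shift 1 P) B)) ((c \<circ>\<^sub>c e) \<circ>\<^sub>c tw_out (shift 1 P) B)"
      by (rule heq_sym[OF heq_assoc[OF out e(1) q[OF V(2)] C P1 U(1) V(1)]])
    also have "heq A (cone P B f) V ((c \<circ>\<^sub>c e) \<circ>\<^sub>c tw_out (shift 1 P) B) (chain_zero (cone P B f) V)"
      by (rule heq_zero_right[OF V(3) C out])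
    finally show "\<exists>U\<in>cpxs A. \<exists>u\<in>quasi_isos A W U. homotopic A (cone P B f) U (u \<circ>\<^sub>c g) (chain_zero (cone P B f) U)"
      using V(1) quasi_iso_comp[OF W U(1) V(1) U(2) V(2)] heqD(5) by blast
  qed
  then show ?thesis by (simp add: hom_vanishes_coroofs C Y)
qed

lemma hom_vanishes_self:
  assumes X: "X \<in> cpxs A" and v: "hom_vanishes A X X"
  shows "acyclic_cpx X"
proof -
  note q = quasi_iso_chain
  have "roofs_vanish A X X" using v by (simp add: hom_vanishes_iff X)
  then obtain U u where U: "U \<in> cpxs A" "u \<in> quasi_isos A U X" "heq A U X (chain_id X \<circ>\<^sub>c u) (chain_zero U X)"
    by (rule roofs_vanishE[OF _ X quasi_iso_id[OF X] chain_id_chain_map[OF X] X])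
  have z: "chain_zero U X \<in> quasi_isos A U X"
    using heq_quasi[OF U(3)] U(2) by (simp add: chain_comp_simps[OF q[OF U(2)]])
  show ?thesis
    unfolding acyclic_cpx_iff[OF X]
  proof (intro allI subsetI)
    fix i w assume w: "w \<in> cocycles X i"
    then obtain y where "y \<in> cocycles U i" "w - chain_zero U X i *\<^sub>v y \<in> coboundaries X i"
      using z by (auto simp: quasi_isos_iff coh_surj_def)
    then show "w \<in> coboundaries X i" using w by (simp add: chain_zero_def cocycles_iff vec_ring)
  qed
qed

text \<open>The zero map of an acyclic complex is a quasi-isomorphism, so it may be cancelled from \<open>0 g = 0 0\<close>.\<close>

lemma hom_vanishes_acyclic:
  assumes X: "X \<in> cpxs A" and Y: "Y \<in> cpxs A" and a: "acyclic_cpx Y"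
  shows "hom_vanishes A X Y"
proof -
  have "roofs_vanish A X Y"
    unfolding roofs_vanish_def
  proof (intro allI impI, elim conjE)
    fix W s g assume W: "W \<in> cpxs A" and s: "s \<in> quasi_isos A W X" and g: "g \<in> chain_maps A W Y"
    have sub: "\<And>i. cocycles Y i \<subseteq> coboundaries Y i" using a by (simp add: acyclic_cpx_iff[OF Y])
    have "w - chain_zero Y Y i *\<^sub>v w \<in> coboundaries Y i" if "w \<in> cocycles Y i" for i w
    proof -
      have "w - chain_zero Y Y i *\<^sub>v w = w" using that by (simp add: chain_zero_def cocycles_iff vec_ring)
      then show ?thesis using that sub by auto
    qed
    then have "coh_surj Y Y (chain_zero Y Y)" unfolding coh_surj_def by blast
    moreover have "coh_inj Y Y (chain_zero Y Y)" unfolding coh_inj_def using sub by blast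
    ultimately have z: "chain_zero Y Y \<in> quasi_isos A Y Y"
      using chain_zero_chain_map[OF Y Y] by (simp add: quasi_isos_iff)
    have h: "homotopic A W Y (chain_zero Y Y \<circ>\<^sub>c g) (chain_zero Y Y \<circ>\<^sub>c chain_zero W Y)"
      using homotopic_refl[OF W Y chain_zero_chain_map[OF W Y]]
      by (simp add: chain_comp_simps(3)[OF g] chain_comp_simps(3)[OF chain_zero_chain_map[OF W Y]])
    obtain U u where U: "U \<in> cpxs A" "u \<in> quasi_isos A U W" "homotopic A U Y (g \<circ>\<^sub>c u) (chain_zero W Y \<circ>\<^sub>c u)"
      by (rule cancel_left[OF W Y Y g chain_zero_chain_map[OF W Y] z h])
    then show "\<exists>U\<in>cpxs A. \<exists>u\<in>quasi_isos A U W. homotopic A U Y (g \<circ>\<^sub>c u) (chain_zero U Y)"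
      using chain_comp_simps(3)[OF quasi_iso_chain[OF U(2)]] by metis
  qed
  then show ?thesis by (simp add: hom_vanishes_iff X Y)
qed

section \<open>Zero objects, shifts and direct summands\<close>

lemma cohomology_zero_iff: "X \<in> cpxs A \<Longrightarrow> cohomology_zero X i \<longleftrightarrow> cocycles X i \<subseteq> coboundaries X i"
  using coboundary_is_cocycle[of X A] unfolding cohomology_zero_def by blast

lemma quasi_iso_cohomology_zero:
  assumes X: "X \<in> cpxs A" and Y: "Y \<in> cpxs A" and f: "f \<in> quasi_isos A X Y"
  shows "cohomology_zero X i \<longleftrightarrow> cohomology_zero Y i"
proof
  note fc = quasi_iso_chain[OF f]
  show "cohomology_zero X i" if "cohomology_zero Y i"
    using that f chain_map_cocycle[OF X Y fc]
    unfolding cohomology_zero_iff[OF X] cohomology_zero_iff[OF Y] quasi_isos_iff coh_inj_def by blast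
  assume a: "cohomology_zero X i"
  show "cohomology_zero Y i"
    unfolding cohomology_zero_iff[OF Y]
  proof (intro subsetI)
    fix w assume w: "w \<in> cocycles Y i"
    then obtain z where z: "z \<in> cocycles X i" "w - f i *\<^sub>v z \<in> coboundaries Y i"
      using f by (auto simp: quasi_isos_iff coh_surj_def)
    have "z \<in> coboundaries X i" using z(1) a by (auto simp: cohomology_zero_iff[OF X])
    then have "(w - f i *\<^sub>v z) + f i *\<^sub>v z \<in> coboundaries Y i"
      by (intro coboundary_add[OF Y z(2)] chain_map_coboundary[OF X Y fc])
    moreover have "(w - f i *\<^sub>v z) + f i *\<^sub>v z = w"
      using w by (simp add: cocycles_iff vec_ring chain_map_dims[OF fc])
    ultimately show "w \<in> coboundaries Y i" by simp
  qed
qed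

lemma qi_equiv_cohomology_zero: "qi_equiv A X Y \<Longrightarrow> cohomology_zero X i \<longleftrightarrow> cohomology_zero Y i"
  by (elim qi_equivE) (metis quasi_iso_cohomology_zero)

lemma qi_equiv_acyclic: "qi_equiv A X Y \<Longrightarrow> acyclic_cpx X \<longleftrightarrow> acyclic_cpx Y"
  by (simp only: acyclic_cpx_def qi_equiv_cohomology_zero)

lemma acyclic_qi_equiv:
  assumes X: "X \<in> cpxs A" and Y: "Y \<in> cpxs A" and a: "acyclic_cpx X" and b: "acyclic_cpx Y"
  shows "qi_equiv A X Y"
proof (rule qi_equivI[OF X Y])
  have x: "\<And>i. cocycles X i \<subseteq> coboundaries X i" and y: "\<And>i. cocycles Y i \<subseteq> coboundaries Y i"
    using a b by (simp_all add: acyclic_cpx_iff[OF X] acyclic_cpx_iff[OF Y])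
  have "coh_surj X Y (chain_zero X Y)"
    unfolding coh_surj_def
  proof (intro allI ballI)
    fix i w assume w: "w \<in> cocycles Y i"
    have "w - chain_zero X Y i *\<^sub>v 0\<^sub>v (cdim X i) = w" using w by (simp add: chain_zero_def cocycles_iff vec_ring)
    then have "w - chain_zero X Y i *\<^sub>v 0\<^sub>v (cdim X i) \<in> coboundaries Y i" using w y by auto
    moreover have "0\<^sub>v (cdim X i) \<in> cocycles X i" by (rule coboundary_is_cocycle[OF X coboundary_zero[OF X]])
    ultimately show "\<exists>z\<in>cocycles X i. w - chain_zero X Y i *\<^sub>v z \<in> coboundaries Y i" by blast
  qed
  moreover have "coh_inj X Y (chain_zero X Y)" unfolding coh_inj_def using x by blast
  ultimately show "chain_zero X Y \<in> quasi_isos A X Y"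
    using chain_zero_chain_map[OF X Y] by (simp add: quasi_isos_iff)
qed

lemma zero_cpx_simps [simp]: "cobj zero_cpx i = zero_mod" "cdif zero_cpx i = 0\<^sub>m 0 0"
  by (simp_all add: zero_cpx_def)

lemma zero_cpx_cpxs: "zero_cpx \<in> cpxs A"
  using mod_hom_zero[of A zero_mod zero_mod] by (intro cpxsI) simp_all

lemma acyclic_zero_cpx: "acyclic_cpx zero_cpx"
  unfolding acyclic_cpx_def cohomology_zero_def
  by (auto simp: set_eq_iff cocycles_iff coboundaries_iff intro!: eq_vecI)

lemma zero_object_iff: "zero_object A X \<longleftrightarrow> X \<in> cpxs A \<and> acyclic_cpx X"
proof
  assume "zero_object A X"
  then have e: "qi_equiv A X zero_cpx" by (simp add: zero_object_def isomorphic_iff)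
  then show "X \<in> cpxs A \<and> acyclic_cpx X"
    using qi_equiv_acyclic[OF e] acyclic_zero_cpx by (auto simp: qi_equiv_def)
next
  assume "X \<in> cpxs A \<and> acyclic_cpx X"
  then show "zero_object A X"
    by (simp add: zero_object_def isomorphic_iff acyclic_qi_equiv zero_cpx_cpxs acyclic_zero_cpx)
qed

lemma indecomposable_qi_equiv:
  assumes e: "qi_equiv A X Y" and i: "indecomposable A X"
  shows "indecomposable A Y"
proof -
  have X: "X \<in> cpxs A" "Y \<in> cpxs A" using e by (auto simp: qi_equiv_def)
  show ?thesis
    using i X qi_equiv_acyclic[OF e] qi_equiv_trans[OF e]
    unfolding indecomposable_def zero_object_iff isomorphic_iff by blast
qed

lemma shift_chain_map:
  assumes X: "X \<in> cpxs A" and Y: "Y \<in> cpxs A" and f: "f \<in> chain_maps A X Y"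
  shows "(\<lambda>i. f (i + n)) \<in> chain_maps A (shift n X) (shift n Y)"
proof (rule chain_mapsI)
  fix i
  show "f (i + n) \<in> mod_hom A (cobj (shift n X) i) (cobj (shift n Y) i)" by (simp add: chain_map_mod[OF f])
  have e: "i + 1 + n = i + n + 1" by simp
  show "cdif (shift n Y) i * f (i + n) = f (i + 1 + n) * cdif (shift n X) i"
    unfolding e by (simp add: mat_uminus chain_map_comm[OF f] chain_map_dims[OF f] cpxs_dims[OF X] cpxs_dims[OF Y])
qed

lemma shift_quasi_iso:
  assumes X: "X \<in> cpxs A" and Y: "Y \<in> cpxs A" and f: "f \<in> quasi_isos A X Y"
  shows "(\<lambda>i. f (i + n)) \<in> quasi_isos A (shift n X) (shift n Y)"
  using f shift_chain_map[OF X Y quasi_iso_chain[OF f], of n]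
  unfolding quasi_isos_iff coh_inj_def coh_surj_def cohomology_shift[OF X] cohomology_shift[OF Y] by blast

lemma qi_equiv_shift: "qi_equiv A X Y \<Longrightarrow> qi_equiv A (shift n X) (shift n Y)"
  unfolding qi_equiv_def using shift_quasi_iso shift_cpxs by blast

text \<open>If \<open>C \<rightarrow> X \<rightarrow> D\<close> composes to a quasi-isomorphism, then \<open>H(C) \<rightarrow> H(X)\<close> is a split injection, so the
  cohomology of its cone is the complement of \<open>H(C)\<close>, and \<open>X \<rightarrow> D\<close> together with the inclusion of \<open>X\<close> into the
  cone is a quasi-isomorphism to the direct sum.\<close>

lemma split_off_summand:
  assumes C: "C \<in> cpxs A" and X: "X \<in> cpxs A" and D: "D \<in> cpxs A"
    and f: "f \<in> chain_maps A C X" and g: "g \<in> chain_maps A X D" and gfq: "g \<circ>\<^sub>c f \<in> quasi_isos A C D"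
  shows "qi_equiv A X (sum_cpx D (cone C X f))"
proof -
  note gfc = quasi_iso_chain[OF gfq]
  note [simp] = cpxs_dims[OF C] cpxs_dims[OF X] cpxs_dims[OF D] chain_map_dims[OF f] chain_map_dims[OF g]
  define E where "E = cone C X f"
  have E: "E \<in> cpxs A" unfolding E_def by (rule cone_cpxs[OF C X f])
  note t = twist_cone[OF C X f]
  note t0 = twist_zero[OF D E]
  note [simp] = cpxs_dims[OF E]
  have Ed: "cdim E i = cdim C (i + 1) + cdim X i" for i by (simp add: E_def cone_def)
  define S where "S = tw D E (\<lambda>i. 0\<^sub>m (cdim E (i + 1)) (cdim D i))"
  have S: "S \<in> cpxs A" unfolding S_def by (rule tw_cpxs[OF t0])
  note inc = tw_in_chain_map[OF t, folded cone_eq_tw, folded E_def]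
  define p where "p = (\<lambda>i. colb (g i) (tw_in (shift 1 C) X i))"
  note [simp] = chain_map_dims[OF inc]
  have p: "p \<in> chain_maps A X S"
  proof (rule chain_mapsI)
    fix i
    show "p i \<in> mod_hom A (cobj X i) (cobj S i)"
      unfolding p_def S_def tw_simps
      by (rule mod_hom_colb[OF cpxs_mod[OF X] cpxs_mod[OF D] cpxs_mod[OF E] chain_map_mod[OF g] chain_map_mod[OF inc]])
    show "cdif S i * p i = p (i + 1) * cdif X i"
      by (simp add: S_def p_def block_mult mat_cancel chain_map_comm[OF g] chain_map_comm[OF inc])
  qed
  have pv: "p i *\<^sub>v x = (g i *\<^sub>v x) @\<^sub>v (0\<^sub>v (cdim C (i + 1)) @\<^sub>v x)" if "dim_vec x = cdim X i" for i x
    using that by (simp add: p_def block_vec) (simp add: tw_in_def block_vec vec_ring)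
  have gfv: "(g \<circ>\<^sub>c f) i *\<^sub>v c = g i *\<^sub>v (f i *\<^sub>v c)" if "dim_vec c = cdim C i" for i c
    using that by (simp add: chain_comp_def mat_vec_assoc)
  have inj: "coh_inj X S p"
    unfolding coh_inj_def
  proof (intro allI ballI impI)
    fix i x assume x: "x \<in> cocycles X i" and b: "p i *\<^sub>v x \<in> coboundaries S i"
    have [simp]: "dim_vec x = cdim X i" using x by (simp add: cocycles_iff)
    have b': "(g i *\<^sub>v x) @\<^sub>v (0\<^sub>v (cdim C (i + 1)) @\<^sub>v x) \<in> coboundaries S i" using b by (simp add: pv)
    obtain e v where ev: "dim_vec e = cdim D (i - 1)" "dim_vec v = cdim E (i - 1)"
      "g i *\<^sub>v x = cdif D (i - 1) *\<^sub>v e"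
      "0\<^sub>v (cdim C (i + 1)) @\<^sub>v x = 0\<^sub>m (cdim E (i - 1 + 1)) (cdim D (i - 1)) *\<^sub>v e + cdif E (i - 1) *\<^sub>v v"
      by (rule tw_coboundaryE[OF t0 b'[unfolded S_def]]) simp_all
    have "0\<^sub>v (cdim C (i + 1)) @\<^sub>v x = cdif E (i - 1) *\<^sub>v v" using ev(1,2) by (subst ev(4)) (simp add: vec_ring)
    then have "0\<^sub>v (cdim C (i + 1)) @\<^sub>v x \<in> coboundaries E i" using ev(2) by (auto simp: coboundaries_iff)
    then obtain c x' where c: "dim_vec c = cdim C i" "dim_vec x' = cdim X (i - 1)"
      "0\<^sub>v (cdim C (i + 1)) = - cdif C i *\<^sub>v c" "x = f i *\<^sub>v c + cdif X (i - 1) *\<^sub>v x'"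
      unfolding E_def cone_eq_tw by (rule tw_coboundaryE[OF t]) simp_all
    note [simp] = c(1,2) ev(1)
    have "cdif C i *\<^sub>v c = - (- cdif C i *\<^sub>v c)" by (simp add: vec_ring)
    also have "\<dots> = 0\<^sub>v (cdim C (i + 1))" unfolding c(3)[symmetric] by (simp add: mat_vec_uminus)
    finally have cc: "c \<in> cocycles C i" by (simp add: cocycles_iff)
    have "(g \<circ>\<^sub>c f) i *\<^sub>v c = g i *\<^sub>v x - g i *\<^sub>v (cdif X (i - 1) *\<^sub>v x')"
      by (simp add: gfv c(4) vec_ring)
    also have "\<dots> \<in> coboundaries D i"
      by (intro coboundary_diff[OF D] chain_map_coboundary[OF X D g] coboundariesI[OF ev(1,3)] coboundariesI[OF c(2)]) simp
    finally have "c \<in> coboundaries C i" using cc gfq by (auto simp: quasi_isos_iff coh_inj_def)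
    then show "x \<in> coboundaries X i"
      unfolding c(4) by (intro coboundary_add[OF X] chain_map_coboundary[OF C X f] coboundariesI[OF c(2)]) simp_all
  qed
  have surj: "coh_surj X S p"
    unfolding coh_surj_def
  proof (intro allI ballI)
    fix i u assume u: "u \<in> cocycles S i"
    then have "dim_vec u = cdim D i + (cdim C (i + 1) + cdim X i)" by (simp add: cocycles_iff S_def Ed)
    then obtain e v where uev: "u = e @\<^sub>v v" and [simp]: "dim_vec e = cdim D i" and v: "dim_vec v = cdim C (i + 1) + cdim X i"
      by (rule vec_appendE)
    obtain c x where vcx: "v = c @\<^sub>v x" and [simp]: "dim_vec c = cdim C (i + 1)" "dim_vec x = cdim X i"
      using v by (rule vec_appendE)
    have e: "cdif D i *\<^sub>v e = 0\<^sub>v (cdim D (i + 1))"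
      and "0\<^sub>m (cdim E (i + 1)) (cdim D i) *\<^sub>v e + cdif E i *\<^sub>v v = 0\<^sub>v (cdim E (i + 1))"
      using u tw_cocycle[OF t0, of e i v] unfolding uev S_def by (simp_all add: Ed v)
    then have "v \<in> cocycles E i" by (simp add: cocycles_iff vec_ring v Ed)
    then have cx: "- cdif C (i + 1) *\<^sub>v c = 0\<^sub>v (cdim C (i + 2))" "f (i + 1) *\<^sub>v c + cdif X i *\<^sub>v x = 0\<^sub>v (cdim X (i + 1))"
      using tw_cocycle[OF t, of c i x] unfolding vcx E_def cone_eq_tw by (simp_all add: add.commute[of 2 i])
    have "cdif C (i + 1) *\<^sub>v c = - (- cdif C (i + 1) *\<^sub>v c)" by (simp add: vec_ring)
    also have "\<dots> = 0\<^sub>v (cdim C (i + 2))" unfolding cx(1) by (simp add: mat_vec_uminus)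
    finally have c: "c \<in> cocycles C (i + 1)" by (simp add: cocycles_iff add.commute[of 2 i])
    have "f (i + 1) *\<^sub>v c = (f (i + 1) *\<^sub>v c + cdif X i *\<^sub>v x) + cdif X i *\<^sub>v (- x)" by (simp add: vec_ring)
    also have "\<dots> = cdif X i *\<^sub>v (- x)" unfolding cx(2) by (simp add: vec_ring)
    finally have fc: "f (i + 1) *\<^sub>v c = cdif X i *\<^sub>v (- x)" .
    have "(g \<circ>\<^sub>c f) (i + 1) *\<^sub>v c \<in> coboundaries D (i + 1)"
      by (simp add: gfv fc) (rule chain_map_coboundary[OF X D g], rule coboundariesI[of "- x"], simp_all)
    then have "c \<in> coboundaries C (i + 1)" using c gfq by (auto simp: quasi_isos_iff coh_inj_def)
    then obtain c' where [simp]: "dim_vec c' = cdim C i" and c': "c = cdif C i *\<^sub>v c'"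
      by (auto simp: coboundaries_iff)
    have xc: "x + f i *\<^sub>v c' \<in> cocycles X i"
      using fc by (simp add: cocycles_iff vec_ring chain_map_comm'(2)[OF f C X] c')
    have "e - g i *\<^sub>v (x + f i *\<^sub>v c') \<in> cocycles D i"
      by (intro cocycle_diff[OF D] chain_map_cocycle[OF X D g xc]) (simp add: cocycles_iff e)
    then obtain z where z: "z \<in> cocycles C i" "e - g i *\<^sub>v (x + f i *\<^sub>v c') - (g \<circ>\<^sub>c f) i *\<^sub>v z \<in> coboundaries D i"
      using gfq by (auto simp: quasi_isos_iff coh_surj_def)
    have [simp]: "dim_vec z = cdim C i" and dz: "cdif C i *\<^sub>v z = 0\<^sub>v (cdim C (i + 1))" using z(1) by (auto simp: cocycles_iff)
    obtain e' where [simp]: "dim_vec e' = cdim D (i - 1)"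
      and e': "e - g i *\<^sub>v (x + f i *\<^sub>v c') - (g \<circ>\<^sub>c f) i *\<^sub>v z = cdif D (i - 1) *\<^sub>v e'"
      using z(2) by (auto simp: coboundaries_iff)
    define x0 where "x0 = (x + f i *\<^sub>v c') + f i *\<^sub>v z"
    have x0d [simp]: "dim_vec x0 = cdim X i" by (simp add: x0_def)
    have x0: "x0 \<in> cocycles X i" unfolding x0_def
      by (intro cocycle_diff(2)[OF X] xc chain_map_cocycle[OF C X f] z)
    have "e - g i *\<^sub>v x0 = cdif D (i - 1) *\<^sub>v e'"
      using e' by (simp add: x0_def gfv vec_ring)
    moreover have "c @\<^sub>v (x - x0) \<in> coboundaries E i"
      unfolding E_def cone_eq_tw
      by (rule tw_coboundaryI[OF t, of "- (c' + z)" i "0\<^sub>v (cdim X (i - 1))"])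
        (simp_all add: x0_def c' dz vec_ring)
    then obtain v' where [simp]: "dim_vec v' = cdim E (i - 1)" and "c @\<^sub>v (x - x0) = cdif E (i - 1) *\<^sub>v v'"
      by (auto simp: coboundaries_iff)
    ultimately have "(e - g i *\<^sub>v x0) @\<^sub>v (c @\<^sub>v (x - x0)) \<in> coboundaries S i"
      unfolding S_def by (intro tw_coboundaryI[OF t0, of e' i v']) (simp_all add: vec_ring)
    moreover have "u - p i *\<^sub>v x0 = (e - g i *\<^sub>v x0) @\<^sub>v (c @\<^sub>v (x - x0))"
      by (simp add: uev vcx pv append_vec_simps(4)) (simp add: vec_ring)
    ultimately have "u - p i *\<^sub>v x0 \<in> coboundaries S i" by simp
    then show "\<exists>z\<in>cocycles X i. u - p i *\<^sub>v z \<in> coboundaries S i" using x0 by blast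
  qed
  have "p \<in> quasi_isos A X S" using p inj surj by (simp add: quasi_isos_iff)
  then show ?thesis
    unfolding sum_cpx_eq_tw E_def[symmetric] S_def[symmetric] by (rule qi_equivI[OF X S])
qed

lemma indecomposable_retract:
  assumes C: "C \<in> cpxs A" and X: "indecomposable A X" and D: "D \<in> cpxs A" "\<not> acyclic_cpx D"
    and f: "f \<in> chain_maps A C X" and g: "g \<in> chain_maps A X D" and gf: "g \<circ>\<^sub>c f \<in> quasi_isos A C D"
  shows "qi_equiv A X C"
proof -
  have X': "X \<in> cpxs A" using X by (simp add: indecomposable_def)
  have "isomorphic A X (sum_cpx D (cone C X f))"
    unfolding isomorphic_iff by (rule split_off_summand[OF C X' D(1) f g gf])
  then have "acyclic_cpx (cone C X f)"
    using X D cone_cpxs[OF C X' f] unfolding indecomposable_def zero_object_iff by blast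
  then have "f \<in> quasi_isos A C X" by (simp add: acyclic_cone_iff[OF C X' f])
  then show ?thesis by (rule qi_equiv_sym[OF qi_equivI[OF C X']])
qed

subsection \<open>Complexes with uniform cohomology\<close>

text \<open>The total cohomology is concentrated in one degree and is a uniform module: any two nonzero
  elements have a common nonzero multiple.  This passes along quasi-isomorphisms and fails for
  proper direct sums, hence forces indecomposability.\<close>

definition uniform_coh :: "('k::field, 'a) module \<Rightarrow> ('a, 'k) cpx \<Rightarrow> bool" where
  "uniform_coh A X \<longleftrightarrow> (\<forall>i j x y. x \<in> cocycles X i \<and> x \<notin> coboundaries X i \<and> y \<in> cocycles X j \<and> y \<notin> coboundaries X j \<longrightarrow>
     i = j \<and> (\<exists>a\<in>carrier A. \<exists>b\<in>carrier A.
       act (cobj X i) a *\<^sub>v x - act (cobj X i) b *\<^sub>v y \<in> coboundaries X i \<and>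
       act (cobj X i) a *\<^sub>v x \<notin> coboundaries X i))"

lemma mod_hom_vec:
  assumes "right_module A M" "right_module A N" "f \<in> mod_hom A M N" "a \<in> carrier A" "dim_vec x = mdim M"
  shows "f *\<^sub>v (act M a *\<^sub>v x) = act N a *\<^sub>v (f *\<^sub>v x)"
proof -
  note [simp] = right_module_dims[OF assms(1,4)] right_module_dims[OF assms(2,4)] mod_hom_dims[OF assms(3)] assms(5)
  show ?thesis by (simp add: mat_vec_assoc[symmetric] mod_hom_comm[OF assms(3,4)])
qed

lemma act_cocycle:
  assumes X: "X \<in> cpxs A" and a: "a \<in> carrier A"
  shows "x \<in> cocycles X i \<Longrightarrow> act (cobj X i) a *\<^sub>v x \<in> cocycles X i"
    and "x \<in> coboundaries X i \<Longrightarrow> act (cobj X i) a *\<^sub>v x \<in> coboundaries X i"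
proof -
  note m = cpxs_mod[OF X]
  note [simp] = cpxs_dims[OF X] right_module_dims[OF m a]
  show "act (cobj X i) a *\<^sub>v x \<in> cocycles X i" if "x \<in> cocycles X i"
    using that mod_hom_vec[OF m m cpxs_dif[OF X] a, of x i] by (simp add: cocycles_iff vec_ring)
  show "act (cobj X i) a *\<^sub>v x \<in> coboundaries X i" if x: "x \<in> coboundaries X i"
  proof -
    obtain y where y: "dim_vec y = cdim X (i - 1)" "x = cdif X (i - 1) *\<^sub>v y" using x by (auto simp: coboundaries_iff)
    show ?thesis
      by (rule coboundariesI[of "act (cobj X (i - 1)) a *\<^sub>v y"])
        (use mod_hom_vec[OF m m cpxs_dif[OF X] a y(1)] y in simp_all)
  qed
qed

lemma uniform_coh_quasi_iso:
  fixes A :: "('k::field, 'a) module"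
  assumes Z: "Z \<in> cpxs A" and X: "X \<in> cpxs A" and f: "f \<in> quasi_isos A Z X"
  shows "uniform_coh A Z \<longleftrightarrow> uniform_coh A X"
proof
  note fc = quasi_iso_chain[OF f]
  note m = cpxs_mod[OF X] and m' = cpxs_mod[OF Z]
  note [simp] = cpxs_dims[OF X] cpxs_dims[OF Z] chain_map_dims[OF fc] right_module_dims[OF m] right_module_dims[OF m']
  have fx: "f i *\<^sub>v x \<in> cocycles X i" if "x \<in> cocycles Z i" for i x by (rule chain_map_cocycle[OF Z X fc that])
  have fb: "f i *\<^sub>v x \<in> coboundaries X i \<longleftrightarrow> x \<in> coboundaries Z i" if "x \<in> cocycles Z i" for i x
    using that f chain_map_coboundary[OF Z X fc] by (auto simp: quasi_isos_iff coh_inj_def)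
  have fa: "f i *\<^sub>v (act (cobj Z i) a *\<^sub>v x) = act (cobj X i) a *\<^sub>v (f i *\<^sub>v x)"
    if "a \<in> carrier A" "dim_vec x = cdim Z i" for i a x
    by (rule mod_hom_vec[OF m' m chain_map_mod[OF fc] that])
  {
    assume u: "uniform_coh A X"
    show "uniform_coh A Z"
      unfolding uniform_coh_def
    proof (intro allI impI, elim conjE)
      fix i j x y assume x: "x \<in> cocycles Z i" "x \<notin> coboundaries Z i" and y: "y \<in> cocycles Z j" "y \<notin> coboundaries Z j"
      have d: "dim_vec x = cdim Z i" "dim_vec y = cdim Z j" using x y by (auto simp: cocycles_iff)
      have "i = j \<and> (\<exists>a\<in>carrier A. \<exists>b\<in>carrier A.
         act (cobj X i) a *\<^sub>v (f i *\<^sub>v x) - act (cobj X i) b *\<^sub>v (f j *\<^sub>v y) \<in> coboundaries X i \<and>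
         act (cobj X i) a *\<^sub>v (f i *\<^sub>v x) \<notin> coboundaries X i)"
        using u fx[OF x(1)] fx[OF y(1)] fb[OF x(1)] fb[OF y(1)] x(2) y(2) unfolding uniform_coh_def by blast
      then obtain a b where ij: "i = j" and a: "a \<in> carrier A" and b: "b \<in> carrier A"
        and 1: "act (cobj X i) a *\<^sub>v (f i *\<^sub>v x) - act (cobj X i) b *\<^sub>v (f j *\<^sub>v y) \<in> coboundaries X i"
        and 2: "act (cobj X i) a *\<^sub>v (f i *\<^sub>v x) \<notin> coboundaries X i" by blast
      have ax: "act (cobj Z i) a *\<^sub>v x \<in> cocycles Z i" by (rule act_cocycle(1)[OF Z a x(1)])
      have yb: "act (cobj Z i) b *\<^sub>v y \<in> cocycles Z i" using act_cocycle(1)[OF Z b y(1)] ij by simp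
      have "f i *\<^sub>v (act (cobj Z i) a *\<^sub>v x - act (cobj Z i) b *\<^sub>v y) \<in> coboundaries X i"
        using 1 a b d ij by (simp add: vec_ring fa)
      then have "act (cobj Z i) a *\<^sub>v x - act (cobj Z i) b *\<^sub>v y \<in> coboundaries Z i"
        by (simp add: fb[OF cocycle_diff(1)[OF Z ax yb]])
      moreover have "act (cobj Z i) a *\<^sub>v x \<notin> coboundaries Z i"
        using 2 fb[OF ax] fa[OF a d(1)] by simp
      ultimately show "i = j \<and> (\<exists>a\<in>carrier A. \<exists>b\<in>carrier A.
         act (cobj Z i) a *\<^sub>v x - act (cobj Z i) b *\<^sub>v y \<in> coboundaries Z i \<and> act (cobj Z i) a *\<^sub>v x \<notin> coboundaries Z i)"
        using ij a b by blast
    qed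
  }
  assume u: "uniform_coh A Z"
  show "uniform_coh A X"
    unfolding uniform_coh_def
  proof (intro allI impI, elim conjE)
    fix i j x y assume x: "x \<in> cocycles X i" "x \<notin> coboundaries X i" and y: "y \<in> cocycles X j" "y \<notin> coboundaries X j"
    obtain x' where x': "x' \<in> cocycles Z i" "x - f i *\<^sub>v x' \<in> coboundaries X i"
      using f x(1) by (auto simp: quasi_isos_iff coh_surj_def)
    obtain y' where y': "y' \<in> cocycles Z j" "y - f j *\<^sub>v y' \<in> coboundaries X j"
      using f y(1) by (auto simp: quasi_isos_iff coh_surj_def)
    have d: "dim_vec x = cdim X i" "dim_vec y = cdim X j" "dim_vec x' = cdim Z i" "dim_vec y' = cdim Z j"
      using x y x' y' by (auto simp: cocycles_iff)
    have nz: "z' \<notin> coboundaries Z k" if "z \<notin> coboundaries X k" "z - f k *\<^sub>v z' \<in> coboundaries X k"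
      "dim_vec z = cdim X k" "dim_vec z' = cdim Z k" for z z' k
    proof
      assume "z' \<in> coboundaries Z k"
      then have "(z - f k *\<^sub>v z') + f k *\<^sub>v z' \<in> coboundaries X k"
        by (intro coboundary_add[OF X that(2)] chain_map_coboundary[OF Z X fc])
      moreover have "(z - f k *\<^sub>v z') + f k *\<^sub>v z' = z" using that(3,4) by (simp add: vec_ring)
      ultimately show False using that(1) by simp
    qed
    have "x' \<notin> coboundaries Z i" "y' \<notin> coboundaries Z j" using nz x y x' y' d by blast+
    then have "i = j \<and> (\<exists>a\<in>carrier A. \<exists>b\<in>carrier A.
         act (cobj Z i) a *\<^sub>v x' - act (cobj Z i) b *\<^sub>v y' \<in> coboundaries Z i \<and>
         act (cobj Z i) a *\<^sub>v x' \<notin> coboundaries Z i)"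
      using u x'(1) y'(1) unfolding uniform_coh_def by blast
    then obtain a b where ij: "i = j" and a: "a \<in> carrier A" and b: "b \<in> carrier A"
      and 1: "act (cobj Z i) a *\<^sub>v x' - act (cobj Z i) b *\<^sub>v y' \<in> coboundaries Z i"
      and 2: "act (cobj Z i) a *\<^sub>v x' \<notin> coboundaries Z i" by blast
    note dd = d[folded ij]
    have 3: "act (cobj X i) a *\<^sub>v (x - f i *\<^sub>v x') \<in> coboundaries X i"
      "act (cobj X i) b *\<^sub>v (y - f i *\<^sub>v y') \<in> coboundaries X i"
      using act_cocycle(2)[OF X a x'(2)] act_cocycle(2)[OF X b y'(2)] ij by auto
    have "(act (cobj X i) a *\<^sub>v (x - f i *\<^sub>v x') - act (cobj X i) b *\<^sub>v (y - f i *\<^sub>v y')) +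
        f i *\<^sub>v (act (cobj Z i) a *\<^sub>v x' - act (cobj Z i) b *\<^sub>v y') \<in> coboundaries X i"
      by (intro coboundary_add[OF X] coboundary_diff[OF X] 3 chain_map_coboundary[OF Z X fc] 1)
    moreover have "f i *\<^sub>v (act (cobj Z i) a *\<^sub>v x' - act (cobj Z i) b *\<^sub>v y') =
        act (cobj X i) a *\<^sub>v (f i *\<^sub>v x') - act (cobj X i) b *\<^sub>v (f i *\<^sub>v y')"
      using a b dd by (simp add: vec_ring fa)
    moreover have "act (cobj X i) a *\<^sub>v (x - f i *\<^sub>v x') = act (cobj X i) a *\<^sub>v x - act (cobj X i) a *\<^sub>v (f i *\<^sub>v x')"
      "act (cobj X i) b *\<^sub>v (y - f i *\<^sub>v y') = act (cobj X i) b *\<^sub>v y - act (cobj X i) b *\<^sub>v (f i *\<^sub>v y')"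
      using a b dd by (simp_all add: vec_ring)
    moreover have "(u1 - w1 - (u2 - w2)) + (w1 - w2) = u1 - u2"
      if "dim_vec u1 = n" "dim_vec u2 = n" "dim_vec w1 = n" "dim_vec w2 = n" for u1 u2 w1 w2 :: "'k vec" and n
      using that by (auto intro!: eq_vecI)
    note this[of "act (cobj X i) a *\<^sub>v x" "cdim X i" "act (cobj X i) b *\<^sub>v y"
        "act (cobj X i) a *\<^sub>v (f i *\<^sub>v x')" "act (cobj X i) b *\<^sub>v (f i *\<^sub>v y')"]
    ultimately have A: "act (cobj X i) a *\<^sub>v x - act (cobj X i) b *\<^sub>v y \<in> coboundaries X i"
      using a b by simp
    have "act (cobj X i) a *\<^sub>v x \<notin> coboundaries X i"
    proof
      assume "act (cobj X i) a *\<^sub>v x \<in> coboundaries X i"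
      then have "act (cobj X i) a *\<^sub>v x - act (cobj X i) a *\<^sub>v (x - f i *\<^sub>v x') \<in> coboundaries X i"
        by (rule coboundary_diff[OF X _ 3(1)])
      moreover have "act (cobj X i) a *\<^sub>v x - act (cobj X i) a *\<^sub>v (x - f i *\<^sub>v x') = f i *\<^sub>v (act (cobj Z i) a *\<^sub>v x')"
        using a dd by (simp add: vec_ring fa)
      ultimately show False using 2 fb[OF act_cocycle(1)[OF Z a x'(1)]] by simp
    qed
    then show "i = j \<and> (\<exists>a\<in>carrier A. \<exists>b\<in>carrier A.
         act (cobj X i) a *\<^sub>v x - act (cobj X i) b *\<^sub>v y \<in> coboundaries X i \<and> act (cobj X i) a *\<^sub>v x \<notin> coboundaries X i)"
      using ij a b A by blast
  qed
qed

text \<open>Nonzero classes \<open>(y, 0)\<close> and \<open>(0, z)\<close> of a direct sum have no common nonzero multiple.\<close>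

lemma uniform_coh_sum:
  assumes Y: "Y \<in> cpxs A" and Z: "Z \<in> cpxs A" and u: "uniform_coh A (sum_cpx Y Z)"
  shows "acyclic_cpx Y \<or> acyclic_cpx Z"
proof (rule ccontr)
  assume "\<not> (acyclic_cpx Y \<or> acyclic_cpx Z)"
  then obtain i j y z where y: "y \<in> cocycles Y i" "y \<notin> coboundaries Y i" and z: "z \<in> cocycles Z j" "z \<notin> coboundaries Z j"
    by (auto simp: acyclic_cpx_iff[OF Y] acyclic_cpx_iff[OF Z])
  note t = twist_zero[OF Y Z]
  note my = cpxs_mod[OF Y] and mz = cpxs_mod[OF Z]
  note [simp] = cpxs_dims[OF Y] cpxs_dims[OF Z] right_module_dims[OF my] right_module_dims[OF mz]
  have [simp]: "dim_vec y = cdim Y i" "dim_vec z = cdim Z j" using y z by (auto simp: cocycles_iff)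
  let ?S = "sum_cpx Y Z"
  let ?x = "y @\<^sub>v 0\<^sub>v (cdim Z i)" and ?w = "0\<^sub>v (cdim Y j) @\<^sub>v z"
  have S: "cobj ?S i = sum_mod (cobj Y i) (cobj Z i)" for i by (simp add: sum_cpx_eq_tw)
  have c: "?x \<in> cocycles ?S i" "?w \<in> cocycles ?S j"
    unfolding sum_cpx_eq_tw using y(1) z(1)
    by (subst tw_cocycle[OF t]; simp add: cocycles_iff vec_ring)+
  have b1: "v \<in> coboundaries Y k" if "v @\<^sub>v v' \<in> coboundaries ?S k" "dim_vec v = cdim Y k" for v v' k
    using that unfolding sum_cpx_eq_tw by (elim tw_coboundaryE[OF t]) (auto simp: coboundaries_iff)
  have b2: "v' \<in> coboundaries Z k" if vb: "v @\<^sub>v v' \<in> coboundaries ?S k" "dim_vec v = cdim Y k" for v v' k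
  proof -
    obtain p q where "dim_vec p = cdim Y (k - 1)" "dim_vec q = cdim Z (k - 1)"
      "v' = 0\<^sub>m (cdim Z (k - 1 + 1)) (cdim Y (k - 1)) *\<^sub>v p + cdif Z (k - 1) *\<^sub>v q"
      by (rule tw_coboundaryE[OF t vb[unfolded sum_cpx_eq_tw]])
    then show ?thesis by (intro coboundariesI[of q]) (simp_all add: vec_ring)
  qed
  have "?x \<notin> coboundaries ?S i" "?w \<notin> coboundaries ?S j" using y(2) z(2) b1[of y] b2[of "0\<^sub>v (cdim Y j)"] by auto
  then have "i = j \<and> (\<exists>a\<in>carrier A. \<exists>b\<in>carrier A.
         act (cobj ?S i) a *\<^sub>v ?x - act (cobj ?S i) b *\<^sub>v ?w \<in> coboundaries ?S i \<and>
         act (cobj ?S i) a *\<^sub>v ?x \<notin> coboundaries ?S i)"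
    using u c unfolding uniform_coh_def by blast
  then obtain a b where ij: "j = i" and a: "a \<in> carrier A" and b: "b \<in> carrier A"
    and 1: "act (cobj ?S i) a *\<^sub>v ?x - act (cobj ?S i) b *\<^sub>v ?w \<in> coboundaries ?S i"
    and 2: "act (cobj ?S i) a *\<^sub>v ?x \<notin> coboundaries ?S i" by blast
  have ax: "act (cobj ?S i) a *\<^sub>v ?x = (act (cobj Y i) a *\<^sub>v y) @\<^sub>v 0\<^sub>v (cdim Z i)"
    using a by (simp add: S sum_mod_def block_vec vec_ring)
  have bw: "act (cobj ?S i) b *\<^sub>v ?w = 0\<^sub>v (cdim Y i) @\<^sub>v (act (cobj Z i) b *\<^sub>v z)"
    using b ij by (simp add: S sum_mod_def block_vec vec_ring)
  have "act (cobj ?S i) a *\<^sub>v ?x - act (cobj ?S i) b *\<^sub>v ?w = (act (cobj Y i) a *\<^sub>v y) @\<^sub>v - (act (cobj Z i) b *\<^sub>v z)"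
    using a b ij unfolding ax bw by (simp add: append_vec_simps(2,3) mat_vec_uminus vec_cancel)
  then have "act (cobj Y i) a *\<^sub>v y \<in> coboundaries Y i" using 1 a by (intro b1) simp_all
  then obtain y' where "dim_vec y' = cdim Y (i - 1)" "act (cobj Y i) a *\<^sub>v y = cdif Y (i - 1) *\<^sub>v y'"
    by (auto simp: coboundaries_iff)
  then have "(act (cobj Y i) a *\<^sub>v y) @\<^sub>v 0\<^sub>v (cdim Z i) \<in> coboundaries ?S i"
    unfolding sum_cpx_eq_tw
    by (intro tw_coboundaryI[OF t, of y' i "0\<^sub>v (cdim Z (i - 1))"]) (simp_all add: vec_ring)
  then show False using 2 unfolding ax by simp
qed

lemma uniform_coh_indecomposable:
  assumes X: "X \<in> cpxs A" and n: "\<not> acyclic_cpx X" and u: "uniform_coh A X"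
  shows "indecomposable A X"
  unfolding indecomposable_def zero_object_iff
proof (intro conjI ballI impI X)
  show "\<not> (X \<in> cpxs A \<and> acyclic_cpx X)" using n by simp
  fix Y Z assume Y: "Y \<in> cpxs A" and Z: "Z \<in> cpxs A" and "isomorphic A X (sum_cpx Y Z)"
  then have "qi_equiv A X (sum_cpx Y Z)" by (simp add: isomorphic_iff)
  then obtain W s f where W: "W \<in> cpxs A" "s \<in> quasi_isos A W X" "f \<in> quasi_isos A W (sum_cpx Y Z)"
    by (rule qi_equivE)
  have "uniform_coh A (sum_cpx Y Z)"
    using u uniform_coh_quasi_iso[OF W(1) X W(2)] uniform_coh_quasi_iso[OF W(1) sum_cpxs[OF Y Z] W(3)] by simp
  then show "Y \<in> cpxs A \<and> acyclic_cpx Y \<or> Z \<in> cpxs A \<and> acyclic_cpx Z"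
    using uniform_coh_sum[OF Y Z] Y Z by blast
qed

section \<open>Closure properties of aisles\<close>

lemma t_structureD:
  assumes t: "t_structure A U V"
  shows "strict_subcat A U" "strict_subcat A V" "U \<subseteq> shift (- 1) ` U"
    "X \<in> U \<Longrightarrow> Y \<in> shift (- 1) ` V \<Longrightarrow> hom_vanishes A X Y"
    "Z \<in> cpxs A \<Longrightarrow> \<exists>X\<in>U. \<exists>Y\<in>shift (- 1) ` V. \<exists>F G H. triangle A X Z Y F G H"
proof -
  note c = t[unfolded t_structure_def]
  show "strict_subcat A U" by (rule c[THEN conjunct1])
  show "strict_subcat A V" by (rule c[THEN conjunct2, THEN conjunct1])
  show "U \<subseteq> shift (- 1) ` U" by (rule c[THEN conjunct2, THEN conjunct2, THEN conjunct1])
  note c' = c[THEN conjunct2, THEN conjunct2, THEN conjunct2, THEN conjunct2]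
  show "hom_vanishes A X Y" if "X \<in> U" "Y \<in> shift (- 1) ` V"
    by (rule bspec[OF bspec[OF c'[THEN conjunct1] that(1)] that(2)])
  show "\<exists>X\<in>U. \<exists>Y\<in>shift (- 1) ` V. \<exists>F G H. triangle A X Z Y F G H" if "Z \<in> cpxs A"
    by (rule bspec[OF c'[THEN conjunct2] that])
qed

lemma t_structure_aisle:
  assumes t: "t_structure A U V"
  shows t_iso: "X \<in> U \<Longrightarrow> qi_equiv A X Y \<Longrightarrow> Y \<in> U"
    and t_cpx: "X \<in> U \<Longrightarrow> X \<in> cpxs A"
    and t_shift: "X \<in> U \<Longrightarrow> shift 1 X \<in> U"
proof -
  have s: "U \<subseteq> cpxs A" "\<forall>X\<in>U. \<forall>Y. isomorphic A X Y \<longrightarrow> Y \<in> U"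
    using t_structureD(1)[OF t] by (simp_all add: strict_subcat_def)
  show "Y \<in> U" if "X \<in> U" "qi_equiv A X Y"
    using s(2) that(1) that(2)[folded isomorphic_iff] by blast
  show "X \<in> U \<Longrightarrow> X \<in> cpxs A" using s(1) by (rule subsetD)
  assume "X \<in> U"
  then have "X \<in> shift (- 1) ` U" by (rule subsetD[OF t_structureD(3)[OF t]])
  then obtain X' where X': "X' \<in> U" "X = shift (- 1) X'" by (rule imageE)
  have "shift 1 X = X'" unfolding X'(2) shift_shift by (simp add: shift_0)
  then show "shift 1 X \<in> U" using X'(1) by simp
qed

text \<open>The truncation triangle \<open>X \<rightarrow> Z \<rightarrow> Y\<close> of an object \<open>Z\<close> with no morphisms to \<open>Y\<close>: both neighbours
  of \<open>Y\<close> in the triangle have no morphisms to \<open>Y\<close>, hence neither has \<open>Y\<close> itself, so \<open>Y\<close> vanishes and \<open>Z\<close>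
  is isomorphic to \<open>X\<close>.  So an object \<open>Z\<close> belongs to the aisle as soon as nothing maps from \<open>Z\<close> to its truncation \<open>Y\<close>.\<close>

lemma aisle_truncation:
  assumes t: "t_structure A U V" and Z: "Z \<in> cpxs A"
  obtains Y where "Y \<in> cpxs A" "\<And>W. W \<in> U \<Longrightarrow> hom_vanishes A W Y" "hom_vanishes A Z Y \<Longrightarrow> Z \<in> U"
proof -
  obtain X Y F G H where X: "X \<in> U" and Y: "Y \<in> shift (- 1) ` V" and tri: "triangle A X Z Y F G H"
    using t_structureD(5)[OF t Z] by (elim bexE exE)
  have V: "V \<subseteq> cpxs A" using t_structureD(2)[OF t] by (simp add: strict_subcat_def)
  obtain Y0 where "Y0 \<in> V" "Y = shift (- 1) Y0" using Y by (rule imageE)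
  then have Yc: "Y \<in> cpxs A" using shift_cpxs[OF subsetD[OF V]] by simp
  have van: "\<And>W. W \<in> U \<Longrightarrow> hom_vanishes A W Y" using t_structureD(4)[OF t _ Y] .
  have Xc: "X \<in> cpxs A" by (rule t_cpx[OF t X])
  obtain X' Y' f where X': "X' \<in> cpxs A" and Y': "Y' \<in> cpxs A" and f: "f \<in> chain_maps A X' Y'"
    and d: "\<exists>\<alpha>. diso A X X' \<alpha>" "\<exists>\<beta>. diso A Z Y' \<beta>" "\<exists>\<gamma>. diso A Y (cone X' Y' f) \<gamma>"
    using tri unfolding triangle_def by (elim conjE bexE exE) (rule that; (assumption | rule exI))
  note C = cone_cpxs[OF X' Y' f]
  have e: "qi_equiv A X X'" "qi_equiv A Z Y'" "qi_equiv A Y (cone X' Y' f)"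
    unfolding isomorphic_iff[symmetric] isomorphic_def using d Xc X' Z Y' Yc C by blast+
  have "Z \<in> U" if "hom_vanishes A Z Y"
  proof -
    have "hom_vanishes A Y' (cone X' Y' f)" using that hom_vanishes_qi_equiv[OF e(2,3)] by simp
    moreover have "hom_vanishes A (shift 1 X') (cone X' Y' f)"
      using van[OF t_shift[OF t X]] hom_vanishes_qi_equiv[OF qi_equiv_shift[OF e(1)] e(3)] by simp
    ultimately have "hom_vanishes A (cone X' Y' f) (cone X' Y' f)"
      by (intro hom_vanishes_cone[OF X' Y' C f])
    then have "acyclic_cpx (cone X' Y' f)" by (rule hom_vanishes_self[OF C])
    then have "f \<in> quasi_isos A X' Y'" by (simp add: acyclic_cone_iff[OF X' Y' f])
    then have "qi_equiv A X Z"
      by (rule qi_equiv_trans[OF qi_equiv_trans[OF e(1) qi_equivI[OF X' Y']] qi_equiv_sym[OF e(2)]])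
    then show ?thesis by (rule t_iso[OF t X])
  qed
  then show ?thesis using that Yc van by blast
qed

text \<open>Aisles are closed under extensions: nothing maps from the ends of the triangle to the truncation of the
  middle term, hence nothing from the middle term.\<close>

lemma aisle_cone:
  assumes t: "t_structure A U V" and P: "P \<in> cpxs A" and f: "f \<in> chain_maps A P B"
    and u: "shift 1 P \<in> U" "B \<in> U"
  shows "cone P B f \<in> U"
proof -
  have B: "B \<in> cpxs A" by (rule t_cpx[OF t u(2)])
  obtain Y where Y: "Y \<in> cpxs A" "\<And>W. W \<in> U \<Longrightarrow> hom_vanishes A W Y" "hom_vanishes A (cone P B f) Y \<Longrightarrow> cone P B f \<in> U"
    using aisle_truncation[OF t cone_cpxs[OF P B f]] by blast
  show ?thesis by (rule Y(3)[OF hom_vanishes_cone[OF P B Y(1) f Y(2)[OF u(1)] Y(2)[OF u(2)]]])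
qed

text \<open>The rotation axiom for mapping cones; it recovers an end of a triangle in an aisle from the other two
  terms.\<close>

lemma cone_rotation:
  fixes A :: "('k::field, 'a) module"
  assumes P: "P \<in> cpxs A" and B: "B \<in> cpxs A" and f: "f \<in> chain_maps A P B"
  shows "qi_equiv A (cone B (cone P B f) (tw_in (shift 1 P) B)) (shift 1 P)"
proof -
  define C where "C = cone P B f"
  have C: "C \<in> cpxs A" unfolding C_def by (rule cone_cpxs[OF P B f])
  note t = twist_cone[OF P B f]
  note inc = tw_in_chain_map[OF t, folded cone_eq_tw, folded C_def]
  note [simp] = cpxs_dims[OF P] cpxs_dims[OF B] chain_map_dims[OF f]
  have Cs [simp]: "cobj C i = sum_mod (cobj P (i + 1)) (cobj B i)"
    "cdif C i = four_block_mat (- cdif P (i + 1)) (0\<^sub>m (cdim P (i + 2)) (cdim B i)) (f (i + 1)) (cdif B i)" for i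
    by (simp_all add: C_def cone_def)
  define E where "E = cone B C (tw_in (shift 1 P) B)"
  have E: "E \<in> cpxs A" unfolding E_def by (rule cone_cpxs[OF B C inc])
  note tE = twist_cone[OF B C inc]
  have Es [simp]: "cobj E i = sum_mod (cobj B (i + 1)) (cobj C i)"
    "cdif E i = four_block_mat (- cdif B (i + 1)) (0\<^sub>m (cdim B (i + 2)) (cdim C i)) (tw_in (shift 1 P) B (i + 1)) (cdif C i)" for i
    by (simp_all add: E_def cone_def)
  have [simp]: "dim_row (tw_in (shift 1 P) B i) = cdim P (i + 1) + cdim B i" "dim_col (tw_in (shift 1 P) B i) = cdim B i" for i
    by (simp_all add: tw_in_def)
  have inv: "tw_in (shift 1 P) B i *\<^sub>v b = 0\<^sub>v (cdim P (i + 1)) @\<^sub>v b" if "dim_vec b = cdim B i" for i b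
    using that by (simp add: tw_in_def block_vec vec_ring)
  define r :: "int \<Rightarrow> 'k mat" where "r = (\<lambda>i. rowb (0\<^sub>m (cdim P (i + 1)) (cdim B (i + 1)))
      (rowb (1\<^sub>m (cdim P (i + 1))) (0\<^sub>m (cdim P (i + 1)) (cdim B i))))"
  have P1: "shift 1 P \<in> cpxs A" by (rule shift_cpxs[OF P])
  have r: "r \<in> chain_maps A E (shift 1 P)"
  proof (rule chain_mapsI)
    fix i
    have "r i \<in> mod_hom A (sum_mod (cobj B (i + 1)) (sum_mod (cobj P (i + 1)) (cobj B i))) (cobj P (i + 1))"
      unfolding r_def by (intro mod_hom_rowb mod_hom_zero mod_hom_one right_module_sum_mod cpxs_mod[OF P] cpxs_mod[OF B])
    then show "r i \<in> mod_hom A (cobj E i) (cobj (shift 1 P) i)" by simp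
    show "cdif (shift 1 P) i * r i = r (i + 1) * cdif E i"
      by (simp add: r_def tw_in_def block_mult mat_ring block_zero add.commute[of 2 i])
  qed
  have rv: "r i *\<^sub>v (b' @\<^sub>v (a @\<^sub>v b)) = a"
    if "dim_vec b' = cdim B (i + 1)" "dim_vec a = cdim P (i + 1)" "dim_vec b = cdim B i" for i b' a b
    using that by (simp add: r_def block_vec vec_ring)
  have coc: "b' @\<^sub>v (a @\<^sub>v b) \<in> cocycles E i \<longleftrightarrow>
      cdif B (i + 1) *\<^sub>v b' = 0\<^sub>v (cdim B (i + 2)) \<and> cdif P (i + 1) *\<^sub>v a = 0\<^sub>v (cdim P (i + 2)) \<and>
      b' + (f (i + 1) *\<^sub>v a + cdif B i *\<^sub>v b) = 0\<^sub>v (cdim B (i + 1))"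
    if [simp]: "dim_vec b' = cdim B (i + 1)" "dim_vec a = cdim P (i + 1)" "dim_vec b = cdim B i" for i b' a b
  proof -
    have neg: "- v = 0\<^sub>v n \<longleftrightarrow> v = 0\<^sub>v n" for v :: "'k vec" and n by (metis mat_vec_uminus(5,6))
    show ?thesis
      by (simp add: cocycles_iff block_vec vec_ring inv append_vec_simps neg add.commute[of 2 i])
  qed
  have "coh_inj E (shift 1 P) r"
    unfolding coh_inj_def
  proof (intro allI ballI impI)
    fix i u assume u: "u \<in> cocycles E i" "r i *\<^sub>v u \<in> coboundaries (shift 1 P) i"
    have "dim_vec u = cdim B (i + 1) + (cdim P (i + 1) + cdim B i)" using u(1) by (simp add: cocycles_iff)
    then obtain b' v where uv: "u = b' @\<^sub>v v" and [simp]: "dim_vec b' = cdim B (i + 1)" and v: "dim_vec v = cdim P (i + 1) + cdim B i"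
      by (rule vec_appendE)
    obtain a b where vab: "v = a @\<^sub>v b" and [simp]: "dim_vec a = cdim P (i + 1)" "dim_vec b = cdim B i"
      using v by (rule vec_appendE)
    have e: "b' + (f (i + 1) *\<^sub>v a + cdif B i *\<^sub>v b) = 0\<^sub>v (cdim B (i + 1))"
      using u(1) unfolding uv vab by (simp add: coc)
    have "b' = (b' + (f (i + 1) *\<^sub>v a + cdif B i *\<^sub>v b)) - (f (i + 1) *\<^sub>v a + cdif B i *\<^sub>v b)"
      by (auto intro!: eq_vecI)
    then have b': "b' = - (f (i + 1) *\<^sub>v a + cdif B i *\<^sub>v b)" unfolding e by (simp add: vec_ring)
    have "a \<in> coboundaries P (i + 1)" using u(2) unfolding uv vab by (simp add: rv cohomology_shift[OF P])
    then obtain a0 where [simp]: "dim_vec a0 = cdim P i" and a0: "a = cdif P i *\<^sub>v a0" by (auto simp: coboundaries_iff)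
    show "u \<in> coboundaries E i"
      unfolding uv vab
      by (rule coboundariesI[of "(b + f i *\<^sub>v a0) @\<^sub>v (- a0 @\<^sub>v 0\<^sub>v (cdim B (i - 1)))"])
        (simp_all add: block_vec vec_ring inv append_vec_simps b' a0 chain_map_comm'(2)[OF f P B] add.commute[of 1 i])
  qed
  moreover have "coh_surj E (shift 1 P) r"
    unfolding coh_surj_def
  proof (intro allI ballI)
    fix i a assume a: "a \<in> cocycles (shift 1 P) i"
    have [simp]: "dim_vec a = cdim P (i + 1)" and da: "cdif P (i + 1) *\<^sub>v a = 0\<^sub>v (cdim P (i + 2))"
      using a by (auto simp: cohomology_shift[OF P] cocycles_iff add.commute[of 2 i])
    have "cdif B (i + 1) *\<^sub>v (f (i + 1) *\<^sub>v a) = 0\<^sub>v (cdim B (i + 2))"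
      using chain_map_comm'(2)[OF f P B, of a "i + 1"] by (simp add: da vec_ring add.commute[of 2 i])
    then have "(- (f (i + 1) *\<^sub>v a)) @\<^sub>v (a @\<^sub>v 0\<^sub>v (cdim B i)) \<in> cocycles E i"
      by (subst coc) (simp_all add: da vec_ring)
    moreover have "a - r i *\<^sub>v ((- (f (i + 1) *\<^sub>v a)) @\<^sub>v (a @\<^sub>v 0\<^sub>v (cdim B i))) \<in> coboundaries (shift 1 P) i"
      using coboundary_zero[OF P1, of i] by (simp add: rv vec_ring)
    ultimately show "\<exists>z\<in>cocycles E i. a - r i *\<^sub>v z \<in> coboundaries (shift 1 P) i" by blast
  qed
  ultimately have "r \<in> quasi_isos A E (shift 1 P)" using r by (simp add: quasi_isos_iff)
  then show ?thesis using qi_equivI[OF E P1] unfolding E_def C_def by blast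
qed

lemma aisle_cone_rotated:
  assumes t: "t_structure A U V" and P: "P \<in> cpxs A" and B: "B \<in> cpxs A" and f: "f \<in> chain_maps A P B"
    and u: "shift 1 B \<in> U" "cone P B f \<in> U"
  shows "shift 1 P \<in> U"
proof -
  have "tw_in (shift 1 P) B \<in> chain_maps A B (cone P B f)"
    unfolding cone_eq_tw by (rule tw_in_chain_map[OF twist_cone[OF P B f]])
  then have "cone B (cone P B f) (tw_in (shift 1 P) B) \<in> U" by (rule aisle_cone[OF t B _ u])
  then show ?thesis using t_iso[OF t _ cone_rotation[OF P B f]] by blast
qed

section \<open>Short exact sequences of complexes\<close>

definition short_exact :: "('a, 'k::field) cpx \<Rightarrow> ('a, 'k) cpx \<Rightarrow> ('a, 'k) cpx \<Rightarrow> (int \<Rightarrow> 'k mat) \<Rightarrow> (int \<Rightarrow> 'k mat) \<Rightarrow> bool" where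
  "short_exact P B S f g \<longleftrightarrow>
     (\<forall>i x. dim_vec x = cdim P i \<and> f i *\<^sub>v x = 0\<^sub>v (cdim B i) \<longrightarrow> x = 0\<^sub>v (cdim P i)) \<and>
     (\<forall>i y. dim_vec y = cdim B i \<and> g i *\<^sub>v y = 0\<^sub>v (cdim S i) \<longrightarrow> (\<exists>x. dim_vec x = cdim P i \<and> y = f i *\<^sub>v x)) \<and>
     (\<forall>i z. dim_vec z = cdim S i \<longrightarrow> (\<exists>y. dim_vec y = cdim B i \<and> z = g i *\<^sub>v y))"

lemma short_exactE:
  assumes "short_exact P B S f g"
  shows "dim_vec x = cdim P i \<Longrightarrow> f i *\<^sub>v x = 0\<^sub>v (cdim B i) \<Longrightarrow> x = 0\<^sub>v (cdim P i)"
    and "dim_vec y = cdim B i \<Longrightarrow> g i *\<^sub>v y = 0\<^sub>v (cdim S i) \<Longrightarrow> \<exists>x. dim_vec x = cdim P i \<and> y = f i *\<^sub>v x"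
    and "dim_vec z = cdim S i \<Longrightarrow> \<exists>y. dim_vec y = cdim B i \<and> z = g i *\<^sub>v y"
  using assms unfolding short_exact_def by blast+

lemma short_exact_inj:
  assumes s: "short_exact P B S f g" and f: "f \<in> chain_maps A P B" and d: "dim_vec x = cdim P i" "dim_vec y = cdim P i"
    and e: "f i *\<^sub>v x = f i *\<^sub>v y"
  shows "x = y"
proof -
  have "f i *\<^sub>v (x - y) = f i *\<^sub>v x - f i *\<^sub>v y" using d by (simp add: vec_ring chain_map_dims[OF f])
  also have "\<dots> = 0\<^sub>v (cdim B i)" unfolding e using d by (simp add: vec_ring chain_map_dims[OF f])
  finally have z: "x - y = 0\<^sub>v (cdim P i)" using short_exactE(1)[OF s, of "x - y" i] d by simp
  have "x = y + (x - y)" using d by (simp add: vec_ring)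
  then show ?thesis unfolding z using d by (simp add: vec_ring)
qed

text \<open>The cone of the injection is quasi-isomorphic to the cokernel, the fibre of the surjection to the
  kernel.\<close>

lemma short_exact_cone_quasi_iso:
  assumes P: "P \<in> cpxs A" and B: "B \<in> cpxs A" and S: "S \<in> cpxs A"
    and f: "f \<in> chain_maps A P B" and g: "g \<in> chain_maps A B S" and s: "short_exact P B S f g"
    and r: "r \<in> chain_maps A (cone P B f) S"
    and re: "\<And>i. r i = rowb (0\<^sub>m (cdim S i) (cdim P (i + 1))) (g i)"
  shows "r \<in> quasi_isos A (cone P B f) S"
proof -
  note C = cone_cpxs[OF P B f]
  note t = twist_cone[OF P B f]
  note [simp] = cpxs_dims[OF P] cpxs_dims[OF B] cpxs_dims[OF S] chain_map_dims[OF f] chain_map_dims[OF g]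
  have rv: "r i *\<^sub>v (a @\<^sub>v b) = g i *\<^sub>v b" if "dim_vec a = cdim P (i + 1)" "dim_vec b = cdim B i" for i a b
    using that by (simp add: re block_vec vec_ring)
  have coc: "a @\<^sub>v b \<in> cocycles (cone P B f) i \<longleftrightarrow>
      cdif P (i + 1) *\<^sub>v a = 0\<^sub>v (cdim P (i + 2)) \<and> f (i + 1) *\<^sub>v a + cdif B i *\<^sub>v b = 0\<^sub>v (cdim B (i + 1))"
    if [simp]: "dim_vec a = cdim P (i + 1)" "dim_vec b = cdim B i" for i a b
  proof -
    have neg: "- v = 0\<^sub>v n \<longleftrightarrow> v = 0\<^sub>v n" for v :: "'b vec" and n by (metis mat_vec_uminus(5,6))
    show ?thesis unfolding cone_eq_tw by (subst tw_cocycle[OF t]) (simp_all add: mat_vec_uminus neg add.commute[of 2 i])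
  qed
  have "coh_inj (cone P B f) S r"
    unfolding coh_inj_def
  proof (intro allI ballI impI)
    fix i u assume u: "u \<in> cocycles (cone P B f) i" "r i *\<^sub>v u \<in> coboundaries S i"
    have "dim_vec u = cdim P (i + 1) + cdim B i" using u(1) by (simp add: cocycles_iff cone_def)
    then obtain a b where uab: "u = a @\<^sub>v b" and [simp]: "dim_vec a = cdim P (i + 1)" "dim_vec b = cdim B i"
      by (rule vec_appendE)
    have c: "f (i + 1) *\<^sub>v a + cdif B i *\<^sub>v b = 0\<^sub>v (cdim B (i + 1))" using u(1) unfolding uab by (simp add: coc)
    obtain s0 where [simp]: "dim_vec s0 = cdim S (i - 1)" and s0: "g i *\<^sub>v b = cdif S (i - 1) *\<^sub>v s0"
      using u(2) unfolding uab by (auto simp: rv coboundaries_iff)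
    obtain b0 where [simp]: "dim_vec b0 = cdim B (i - 1)" and b0: "s0 = g (i - 1) *\<^sub>v b0"
      using short_exactE(3)[OF s, of s0 "i - 1"] by auto
    have "g i *\<^sub>v (b - cdif B (i - 1) *\<^sub>v b0) = 0\<^sub>v (cdim S i)"
      by (simp add: vec_ring s0 b0 chain_map_comm'(3)[OF g B S])
    then obtain a0 where [simp]: "dim_vec a0 = cdim P i" and a0: "b - cdif B (i - 1) *\<^sub>v b0 = f i *\<^sub>v a0"
      using short_exactE(2)[OF s, of "b - cdif B (i - 1) *\<^sub>v b0" i] by auto
    have "b = (b - cdif B (i - 1) *\<^sub>v b0) + cdif B (i - 1) *\<^sub>v b0" by (simp add: vec_ring)
    then have b: "b = f i *\<^sub>v a0 + cdif B (i - 1) *\<^sub>v b0" unfolding a0 .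
    have "cdif B i *\<^sub>v b = f (i + 1) *\<^sub>v (cdif P i *\<^sub>v a0)"
      by (simp add: b vec_ring chain_map_comm'(2)[OF f P B] cpxs_dd(5)[OF B])
    then have c': "f (i + 1) *\<^sub>v (a + cdif P i *\<^sub>v a0) = 0\<^sub>v (cdim B (i + 1))"
      using c by (simp add: vec_ring)
    have "a + cdif P i *\<^sub>v a0 = 0\<^sub>v (cdim P (i + 1))" by (rule short_exactE(1)[OF s _ c']) simp
    moreover have "a = (a + cdif P i *\<^sub>v a0) - cdif P i *\<^sub>v a0" by (auto intro!: eq_vecI)
    ultimately have a: "a = - (cdif P i *\<^sub>v a0)" by (simp add: vec_ring)
    show "u \<in> coboundaries (cone P B f) i"
      unfolding uab cone_eq_tw
      by (rule tw_coboundaryI[OF t, of a0 i b0]) (simp_all add: a b mat_vec_uminus)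
  qed
  moreover have "coh_surj (cone P B f) S r"
    unfolding coh_surj_def
  proof (intro allI ballI)
    fix i z assume z: "z \<in> cocycles S i"
    have [simp]: "dim_vec z = cdim S i" and dz: "cdif S i *\<^sub>v z = 0\<^sub>v (cdim S (i + 1))" using z by (auto simp: cocycles_iff)
    obtain b where [simp]: "dim_vec b = cdim B i" and b: "z = g i *\<^sub>v b" using short_exactE(3)[OF s, of z i] by auto
    have "g (i + 1) *\<^sub>v (cdif B i *\<^sub>v b) = 0\<^sub>v (cdim S (i + 1))"
      using dz by (simp add: b chain_map_comm'(2)[OF g B S])
    then obtain a where [simp]: "dim_vec a = cdim P (i + 1)" and a: "cdif B i *\<^sub>v b = f (i + 1) *\<^sub>v a"
      using short_exactE(2)[OF s, of "cdif B i *\<^sub>v b" "i + 1"] by auto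
    have "f (i + 2) *\<^sub>v (cdif P (i + 1) *\<^sub>v a) = cdif B (i + 1) *\<^sub>v (cdif B i *\<^sub>v b)"
      using chain_map_comm'(2)[OF f P B, of a "i + 1"] by (simp add: a add.commute[of 2 i])
    also have "\<dots> = 0\<^sub>v (cdim B (i + 2))" by (simp add: cpxs_dd(4)[OF B])
    finally have "cdif P (i + 1) *\<^sub>v a = 0\<^sub>v (cdim P (i + 2))"
      by (intro short_exactE(1)[OF s]) (simp_all add: add.commute[of 2 i])
    then have "(- a) @\<^sub>v b \<in> cocycles (cone P B f) i" by (simp add: coc vec_ring a)
    moreover have "z - r i *\<^sub>v ((- a) @\<^sub>v b) \<in> coboundaries S i"
      using coboundary_zero[OF S, of i] by (simp add: rv b vec_ring)
    ultimately show "\<exists>u\<in>cocycles (cone P B f) i. z - r i *\<^sub>v u \<in> coboundaries S i" by blast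
  qed
  ultimately show ?thesis using r by (simp add: quasi_isos_iff)
qed

lemma short_exact_fib_quasi_iso:
  assumes P: "P \<in> cpxs A" and B: "B \<in> cpxs A" and S: "S \<in> cpxs A"
    and f: "f \<in> chain_maps A P B" and g: "g \<in> chain_maps A B S" and s: "short_exact P B S f g"
    and r: "r \<in> chain_maps A P (fib B S g)"
    and re: "\<And>i. r i = colb (f i) (0\<^sub>m (cdim S (i - 1)) (cdim P i))"
  shows "r \<in> quasi_isos A P (fib B S g)"
proof -
  note F = fib_cpxs[OF B S g]
  note t = twist_fib[OF B S g]
  note [simp] = cpxs_dims[OF P] cpxs_dims[OF B] cpxs_dims[OF S] chain_map_dims[OF f] chain_map_dims[OF g]
  have rv: "r i *\<^sub>v a = (f i *\<^sub>v a) @\<^sub>v 0\<^sub>v (cdim S (i - 1))" if "dim_vec a = cdim P i" for i a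
    using that by (simp add: re block_vec vec_ring)
  have "coh_inj P (fib B S g) r"
    unfolding coh_inj_def
  proof (intro allI ballI impI)
    fix i a assume a: "a \<in> cocycles P i" "r i *\<^sub>v a \<in> coboundaries (fib B S g) i"
    have [simp]: "dim_vec a = cdim P i" using a(1) by (simp add: cocycles_iff)
    have "(f i *\<^sub>v a) @\<^sub>v 0\<^sub>v (cdim S (i - 1)) \<in> coboundaries (fib B S g) i" using a(2) by (simp add: rv)
    then obtain b0 s0 where [simp]: "dim_vec b0 = cdim B (i - 1)" "dim_vec s0 = cdim S (i - 2)"
      and b0: "f i *\<^sub>v a = cdif B (i - 1) *\<^sub>v b0" and s0: "0\<^sub>v (cdim S (i - 1)) = - g (i - 1) *\<^sub>v b0 + - cdif S (i - 2) *\<^sub>v s0"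
      unfolding fib_def by (rule tw_coboundaryE[OF t]) simp_all
    have "\<exists>b1. dim_vec b1 = cdim B (i - 2) \<and> s0 = g (i - 2) *\<^sub>v b1" by (rule short_exactE(3)[OF s]) simp
    then obtain b1 where [simp]: "dim_vec b1 = cdim B (i - 2)" and b1: "s0 = g (i - 2) *\<^sub>v b1" by blast
    have gb: "cdif S (i - 2) *\<^sub>v s0 = g (i - 1) *\<^sub>v (cdif B (i - 2) *\<^sub>v b1)"
      using chain_map_comm'(2)[OF g B S, of b1 "i - 2"] by (simp add: b1)
    have "g (i - 1) *\<^sub>v (b0 + cdif B (i - 2) *\<^sub>v b1) = - (- g (i - 1) *\<^sub>v b0 + - cdif S (i - 2) *\<^sub>v s0)"
      by (simp add: vec_ring gb)
    also have "\<dots> = 0\<^sub>v (cdim S (i - 1))" unfolding s0[symmetric] by (simp add: mat_vec_uminus)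
    finally have gz: "g (i - 1) *\<^sub>v (b0 + cdif B (i - 2) *\<^sub>v b1) = 0\<^sub>v (cdim S (i - 1))" .
    have "\<exists>a0. dim_vec a0 = cdim P (i - 1) \<and> b0 + cdif B (i - 2) *\<^sub>v b1 = f (i - 1) *\<^sub>v a0"
      by (rule short_exactE(2)[OF s _ gz]) simp
    then obtain a0 where [simp]: "dim_vec a0 = cdim P (i - 1)" and a0: "b0 + cdif B (i - 2) *\<^sub>v b1 = f (i - 1) *\<^sub>v a0"
      by blast
    have "f i *\<^sub>v (cdif P (i - 1) *\<^sub>v a0) = cdif B (i - 1) *\<^sub>v (b0 + cdif B (i - 2) *\<^sub>v b1)"
      by (simp add: a0 chain_map_comm'(3)[OF f P B])
    also have "\<dots> = f i *\<^sub>v a" using cpxs_dd(4)[OF B, of b1 "i - 2"] by (simp add: vec_ring b0)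
    finally have "f i *\<^sub>v (cdif P (i - 1) *\<^sub>v a0) = f i *\<^sub>v a" .
    then have "cdif P (i - 1) *\<^sub>v a0 = a" by (rule short_exact_inj[OF s f, rotated 2]) simp_all
    then show "a \<in> coboundaries P i" by (intro coboundariesI[of a0]) simp_all
  qed
  moreover have "coh_surj P (fib B S g) r"
    unfolding coh_surj_def
  proof (intro allI ballI)
    fix i u assume u: "u \<in> cocycles (fib B S g) i"
    then have "dim_vec u = cdim B i + cdim S (i - 1)" by (simp add: cocycles_iff fib_def)
    then obtain b z where ubz: "u = b @\<^sub>v z" and [simp]: "dim_vec b = cdim B i" "dim_vec z = cdim S (i - 1)"
      by (rule vec_appendE)
    have c: "cdif B i *\<^sub>v b = 0\<^sub>v (cdim B (i + 1))" "- g i *\<^sub>v b + - cdif S (i - 1) *\<^sub>v z = 0\<^sub>v (cdim S i)"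
      using u tw_cocycle[OF t, of b i z] unfolding ubz fib_def by simp_all
    obtain b0 where [simp]: "dim_vec b0 = cdim B (i - 1)" and b0: "z = g (i - 1) *\<^sub>v b0"
      using short_exactE(3)[OF s, of z "i - 1"] by auto
    have gb: "cdif S (i - 1) *\<^sub>v z = g i *\<^sub>v (cdif B (i - 1) *\<^sub>v b0)"
      by (simp add: b0 chain_map_comm'(3)[OF g B S])
    have "g i *\<^sub>v (b + cdif B (i - 1) *\<^sub>v b0) = - (- g i *\<^sub>v b + - cdif S (i - 1) *\<^sub>v z)"
      by (simp add: vec_ring gb)
    also have "\<dots> = 0\<^sub>v (cdim S i)" unfolding c(2) by (simp add: mat_vec_uminus)
    finally have gz: "g i *\<^sub>v (b + cdif B (i - 1) *\<^sub>v b0) = 0\<^sub>v (cdim S i)" .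
    have "\<exists>a. dim_vec a = cdim P i \<and> b + cdif B (i - 1) *\<^sub>v b0 = f i *\<^sub>v a"
      by (rule short_exactE(2)[OF s _ gz]) simp
    then obtain a where [simp]: "dim_vec a = cdim P i" and a: "b + cdif B (i - 1) *\<^sub>v b0 = f i *\<^sub>v a"
      by blast
    have "f (i + 1) *\<^sub>v (cdif P i *\<^sub>v a) = cdif B i *\<^sub>v (b + cdif B (i - 1) *\<^sub>v b0)"
      by (simp add: a chain_map_comm'(2)[OF f P B])
    also have "\<dots> = 0\<^sub>v (cdim B (i + 1))" by (simp add: vec_ring c(1) cpxs_dd(5)[OF B])
    finally have "cdif P i *\<^sub>v a = 0\<^sub>v (cdim P (i + 1))" by (rule short_exactE(1)[OF s, rotated]) simp_all
    then have "a \<in> cocycles P i" by (simp add: cocycles_iff)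
    moreover have "u - r i *\<^sub>v a \<in> coboundaries (fib B S g) i"
    proof -
      have "u - r i *\<^sub>v a = (b - f i *\<^sub>v a) @\<^sub>v z"
        by (simp add: ubz rv append_vec_simps(4)) (simp add: vec_ring)
      moreover have "(b - f i *\<^sub>v a) @\<^sub>v z \<in> coboundaries (fib B S g) i"
        unfolding fib_def a[symmetric]
        by (rule tw_coboundaryI[OF t, of "- b0" i "0\<^sub>v (cdim S (i - 2))"]) (simp_all add: vec_ring b0)
      ultimately show ?thesis by (simp only:)
    qed
    ultimately show "\<exists>z\<in>cocycles P i. u - r i *\<^sub>v z \<in> coboundaries (fib B S g) i" by blast
  qed
  ultimately show ?thesis using r by (simp add: quasi_isos_iff)
qed

section \<open>Linear functionals\<close>

text \<open>The Fredholm alternative, by induction on the number of columns.  In the last case \<open>q\<close> detects the new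
  column \<open>a\<close> and \<open>s\<close> detects \<open>y\<close> modulo \<open>a\<close>; then \<open>s\<close> is corrected by a multiple of \<open>q\<close> so as to vanish on \<open>a\<close>.\<close>

lemma fredholm_alternative:
  fixes y :: "'k::field mat"
  assumes "dim_row y = dim_row M" "dim_col y = 1"
  obtains v where "dim_row v = dim_col M" "dim_col v = 1" "y = M * v"
  | p where "dim_row p = 1" "dim_col p = dim_row M" "p * M = 0\<^sub>m 1 (dim_col M)" "p * y = 1\<^sub>m 1"
proof -
  have "(\<exists>v. dim_row v = dim_col M \<and> dim_col v = 1 \<and> y = M * v) \<or>
    (\<exists>p. dim_row p = 1 \<and> dim_col p = dim_row M \<and> p * M = 0\<^sub>m 1 (dim_col M) \<and> p * y = 1\<^sub>m 1)"
    if "dim_col M = m" for m using that assms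
  proof (induction m arbitrary: M y)
    case 0
    note d [simp] = 0(2,3)
    show ?case
    proof (cases "y = 0\<^sub>m (dim_row M) 1")
      case True
      then have "y = M * 0\<^sub>m 0 1" using 0(1) by simp
      then show ?thesis using 0(1) by (intro disjI1 exI[of _ "0\<^sub>m 0 1"]) simp
    next
      case False
      then obtain r where r: "r < dim_row M" "y $$ (r, 0) \<noteq> 0" by (auto simp: mat_eq_iff)
      define p where "p = mat 1 (dim_row M) (\<lambda>(_, j). if j = r then inverse (y $$ (r, 0)) else 0)"
      have row: "row p 0 = inverse (y $$ (r, 0)) \<cdot>\<^sub>v unit_vec (dim_row M) r"
        using r(1) by (intro eq_vecI) (auto simp: p_def)
      have "p * y = 1\<^sub>m 1"
      proof (rule eq_matI)
        fix i j assume ij: "i < dim_row (1\<^sub>m 1 :: 'k mat)" "j < dim_col (1\<^sub>m 1 :: 'k mat)"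
        have "(p * y) $$ (0, 0) = row p 0 \<bullet> col y 0" by (simp add: p_def)
        also have "\<dots> = inverse (y $$ (r, 0)) * (unit_vec (dim_row M) r \<bullet> col y 0)"
          unfolding row by (rule smult_scalar_prod_distrib[of _ "dim_row M"]) (simp_all add: carrier_vecI)
        also have "unit_vec (dim_row M) r \<bullet> col y 0 = y $$ (r, 0)"
          using r by (subst scalar_prod_left_unit) (simp_all add: carrier_vecI)
        finally show "(p * y) $$ (i, j) = 1\<^sub>m 1 $$ (i, j)" using ij r by simp
      qed (simp_all add: p_def)
      moreover have "p * M = 0\<^sub>m 1 (dim_col M)" using 0(1) by (auto intro!: eq_matI simp: p_def)
      ultimately show ?thesis by (intro disjI2 exI[of _ p]) (simp add: p_def)
    qed
  next
    case (Suc m)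
    define M' where "M' = M * colb (1\<^sub>m m) (0\<^sub>m 1 m)"
    define a where "a = M * colb (0\<^sub>m m 1) (1\<^sub>m 1)"
    have Mb: "M = rowb M' a" unfolding M'_def a_def by (rule rowb_split) (simp add: Suc.prems)
    have [simp]: "dim_row M' = dim_row M" "dim_col M' = m" "dim_row a = dim_row M" "dim_col a = 1"
      by (simp_all add: M'_def a_def)
    have ad: "dim_row a = dim_row M" "dim_col a = 1" by simp_all
    note [simp] = Suc.prems(2,3)
    have step: "(\<exists>v. dim_row v = m \<and> dim_col v = 1 \<and> x = M' * v) \<or>
        (\<exists>p. dim_row p = 1 \<and> dim_col p = dim_row M \<and> p * M' = 0\<^sub>m 1 m \<and> p * x = 1\<^sub>m 1)"
      if "dim_row x = dim_row M" "dim_col x = 1" for x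
      using Suc.IH[of M' x] that by simp
    have R: "M * colb v w = M' * v + a * w" if "dim_row v = m" "dim_col v = 1" "dim_row w = 1" "dim_col w = 1" for v w
      unfolding Mb using that by (simp add: block_mult)
    have L: "p * M = rowb (p * M') (p * a)" if "dim_col p = dim_row M" for p
      unfolding Mb using that by (simp add: block_mult)
    have Lz: "p * M = 0\<^sub>m 1 (dim_col M)" if "dim_col p = dim_row M" "p * M' = 0\<^sub>m 1 m" "p * a = 0\<^sub>m 1 1" for p
      using L[OF that(1)] that(2,3) Suc.prems(1) by (simp add: block_zero)
    from step[OF Suc.prems(2,3)] show ?case
    proof (elim disjE exE conjE)
      fix v assume v: "dim_row v = m" "dim_col v = 1" "y = M' * v"
      have "y = M * colb v (0\<^sub>m 1 1)" using v by (simp add: R mat_cancel)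
      then show ?thesis using v Suc.prems(1) by (intro disjI1 exI[of _ "colb v (0\<^sub>m 1 1)"]) simp
    next
      fix p assume p: "dim_row p = 1" "dim_col p = dim_row M" "p * M' = 0\<^sub>m 1 m" "p * y = 1\<^sub>m 1"
      from step[OF ad] show ?thesis
      proof (elim disjE exE conjE)
        fix v assume v: "dim_row v = m" "dim_col v = 1" "a = M' * v"
        have "p * a = (p * M') * v" unfolding v(3) by (rule mat_assoc[symmetric]) (use v p in simp_all)
        also have "\<dots> = 0\<^sub>m 1 1" using v by (simp add: p(3))
        finally have "p * M = 0\<^sub>m 1 (dim_col M)" by (rule Lz[OF p(2,3)])
        then show ?thesis using p by (intro disjI2 exI[of _ p]) simp
      next
        fix q assume q: "dim_row q = 1" "dim_col q = dim_row M" "q * M' = 0\<^sub>m 1 m" "q * a = 1\<^sub>m 1"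
        note [simp] = q(1,2)
        have "dim_row (y - a * (q * y)) = dim_row M" "dim_col (y - a * (q * y)) = 1" by simp_all
        from step[OF this] show ?thesis
        proof (elim disjE exE conjE)
          fix v assume v: "dim_row v = m" "dim_col v = 1" "y - a * (q * y) = M' * v"
          have "y = (y - a * (q * y)) + a * (q * y)" by (simp add: mat_uminus mat_add_ac mat_cancel)
          then have "y = M * colb v (q * y)" using v by (simp add: R)
          then show ?thesis using v Suc.prems(1) by (intro disjI1 exI[of _ "colb v (q * y)"]) simp
        next
          fix s assume s: "dim_row s = 1" "dim_col s = dim_row M" "s * M' = 0\<^sub>m 1 m" "s * (y - a * (q * y)) = 1\<^sub>m 1"
          note [simp] = s(1,2)
          let ?p = "s + - ((s * a) * q)"
          have "?p * M' = s * M' + - ((s * a) * (q * M'))" by (simp add: mat_distrib mat_uminus(1) mat_assoc)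
          then have 1: "?p * M' = 0\<^sub>m 1 m" by (simp add: s(3) q(3) mat_cancel mat_uminus)
          have "?p * a = s * a + - ((s * a) * (q * a))" by (simp add: mat_distrib mat_uminus(1) mat_assoc)
          then have 2: "?p * a = 0\<^sub>m 1 1" by (simp add: q(4) mat_cancel)
          have "?p * y = s * (y - a * (q * y))" by (simp add: mat_distrib mat_uminus mat_assoc)
          then have 3: "?p * y = 1\<^sub>m 1" by (simp only: s(4))
          have "?p * M = 0\<^sub>m 1 (dim_col M)" by (rule Lz[OF _ 1 2]) simp
          then show ?thesis using 3 by (intro disjI2 exI[of _ ?p]) simp
        qed
      qed
    qed
  qed
  then show thesis using that by blast
qed

section \<open>Modules over the path algebra\<close>

lemma carrier_A2 [simp]: "a \<in> carrier A2"
  by (simp add: A2_def)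

abbreviation e1 :: "'k::field a2" where "e1 \<equiv> path_elem E1"
abbreviation e2 :: "'k::field a2" where "e2 \<equiv> path_elem E2"
abbreviation al :: "'k::field a2" where "al \<equiv> path_elem Alpha"

lemma a2_eqI: "a E1 = b E1 \<Longrightarrow> a E2 = b E2 \<Longrightarrow> a Alpha = b Alpha \<Longrightarrow> a = (b :: 'k a2)"
  by (rule ext, case_tac x) auto

lemma path_elem_mult:
  "e1 \<otimes>\<^bsub>A2\<^esub> e1 = e1" "e2 \<otimes>\<^bsub>A2\<^esub> e2 = e2" "e2 \<otimes>\<^bsub>A2\<^esub> al = al" "al \<otimes>\<^bsub>A2\<^esub> e1 = al"
  "e1 \<otimes>\<^bsub>A2\<^esub> e2 = (\<lambda>_. 0)" "e2 \<otimes>\<^bsub>A2\<^esub> e1 = (\<lambda>_. 0)" "al \<otimes>\<^bsub>A2\<^esub> al = (\<lambda>_. 0)"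
  "e1 \<otimes>\<^bsub>A2\<^esub> al = (\<lambda>_. 0)" "al \<otimes>\<^bsub>A2\<^esub> e2 = (\<lambda>_. 0)"
  by (rule a2_eqI; simp only: A2_mult; simp add: path_elem_def)+

lemma A2_ops:
  "a \<oplus>\<^bsub>A2\<^esub> b = (\<lambda>p. a p + b p)" "c \<odot>\<^bsub>A2\<^esub> a = (\<lambda>p. c * a p)" "\<one>\<^bsub>A2\<^esub> = (\<lambda>p. if p \<in> {E1, E2} then 1 else 0)"
  by (simp_all add: A2_def)

lemma act_zero:
  assumes M: "right_module A2 M"
  shows "act M (\<lambda>_. 0) = 0\<^sub>m (mdim M) (mdim M)"
proof -
  have "act M (0 \<odot>\<^bsub>A2\<^esub> e1) = 0 \<cdot>\<^sub>m act M e1" using M by (simp add: right_module_def)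
  then show ?thesis using right_module_dims[OF M, of e1] by (auto simp: A2_ops intro!: eq_matI)
qed

lemma act_mult: "right_module A2 M \<Longrightarrow> act M b * act M a = act M (a \<otimes>\<^bsub>A2\<^esub> b)"
  by (simp add: right_module_def)

text \<open>On a right module products act in the reverse order: the relation \<open>\<alpha> = e\<^sub>2 \<alpha> e\<^sub>1\<close> says that \<open>\<alpha>\<close> maps the part at
  the vertex 2 to the part at the vertex 1.\<close>

lemma act_rel:
  fixes M :: "('k::field a2, 'k) rmod"
  assumes M: "right_module A2 M"
  shows "act M e1 * act M e1 = act M e1" "act M e2 * act M e2 = act M e2" "act M al * act M e2 = act M al"
    "act M e1 * act M al = act M al"
    "act M e2 * act M e1 = 0\<^sub>m (mdim M) (mdim M)" "act M e1 * act M e2 = 0\<^sub>m (mdim M) (mdim M)"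
    "act M al * act M al = 0\<^sub>m (mdim M) (mdim M)" "act M al * act M e1 = 0\<^sub>m (mdim M) (mdim M)"
    "act M e2 * act M al = 0\<^sub>m (mdim M) (mdim M)"
    "act M e1 + act M e2 = 1\<^sub>m (mdim M)"
proof -
  note m = act_mult[OF M] and z = act_zero[OF M]
  show "act M e1 * act M e1 = act M e1" "act M e2 * act M e2 = act M e2" "act M al * act M e2 = act M al"
    "act M e1 * act M al = act M al"
    "act M e2 * act M e1 = 0\<^sub>m (mdim M) (mdim M)" "act M e1 * act M e2 = 0\<^sub>m (mdim M) (mdim M)"
    "act M al * act M al = 0\<^sub>m (mdim M) (mdim M)" "act M al * act M e1 = 0\<^sub>m (mdim M) (mdim M)"
    "act M e2 * act M al = 0\<^sub>m (mdim M) (mdim M)"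
    by (simp_all only: m path_elem_mult z)
  have "act M (e1 \<oplus>\<^bsub>A2\<^esub> e2) = act M e1 + act M e2" using M by (simp add: right_module_def)
  moreover have "e1 \<oplus>\<^bsub>A2\<^esub> e2 = (\<one>\<^bsub>A2\<^esub> :: 'k a2)" by (rule a2_eqI) (simp_all add: A2_ops path_elem_def)
  ultimately show "act M e1 + act M e2 = 1\<^sub>m (mdim M)" using M by (simp add: right_module_def)
qed

lemma act_decomp:
  assumes M: "right_module A2 M"
  shows "act M a = a E1 \<cdot>\<^sub>m act M e1 + (a E2 \<cdot>\<^sub>m act M e2 + a Alpha \<cdot>\<^sub>m act M al)"
proof -
  have "a = (a E1 \<odot>\<^bsub>A2\<^esub> e1) \<oplus>\<^bsub>A2\<^esub> ((a E2 \<odot>\<^bsub>A2\<^esub> e2) \<oplus>\<^bsub>A2\<^esub> (a Alpha \<odot>\<^bsub>A2\<^esub> al))"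
    by (rule a2_eqI) (simp_all add: A2_ops path_elem_def)
  then have "act M a = act M ((a E1 \<odot>\<^bsub>A2\<^esub> e1) \<oplus>\<^bsub>A2\<^esub> ((a E2 \<odot>\<^bsub>A2\<^esub> e2) \<oplus>\<^bsub>A2\<^esub> (a Alpha \<odot>\<^bsub>A2\<^esub> al)))" by simp
  then show ?thesis using M unfolding right_module_def by simp
qed

lemma mod_hom_A2I:
  assumes M: "right_module A2 M" and N: "right_module A2 N" and f: "dim_row f = mdim N" "dim_col f = mdim M"
    and c: "f * act M e1 = act N e1 * f" "f * act M e2 = act N e2 * f" "f * act M al = act N al * f"
  shows "f \<in> mod_hom A2 M N"
proof (rule mod_homI[OF f])
  fix a :: "'a a2"
  note [simp] = right_module_dims[OF M carrier_A2] right_module_dims[OF N carrier_A2] f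
  have s: "f * (x \<cdot>\<^sub>m m) = x \<cdot>\<^sub>m (f * m)" if "dim_col f = dim_row m" for x :: 'a and m
    by (rule mult_smult_distrib[OF carrier_matI[OF refl refl] carrier_matI[OF that[symmetric] refl]])
  have s': "(x \<cdot>\<^sub>m m) * f = x \<cdot>\<^sub>m (m * f)" if "dim_row f = dim_col m" for x :: 'a and m
    by (rule mult_smult_assoc_mat[OF carrier_matI[OF refl refl] carrier_matI[OF that refl]])
  show "f * act M a = act N a * f"
    unfolding act_decomp[OF M, of a] act_decomp[OF N, of a] by (simp add: mat_distrib s s' c)
qed

text \<open>A scalar as a 1-by-1 matrix; these are the blocks of the three indecomposable modules.\<close>

definition sc :: "'k::field \<Rightarrow> 'k mat" where "sc c = mat 1 1 (\<lambda>_. c)"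

lemma sc_dims [simp]: "dim_row (sc c) = 1" "dim_col (sc c) = 1" "i < 1 \<Longrightarrow> j < 1 \<Longrightarrow> sc c $$ (i, j) = c"
  by (simp_all add: sc_def)

lemma path_module_act:
  "act (path_module [E1]) a = sc (a E1)" "act (path_module [E2]) a = sc (a E2)"
  "act (path_module [E2, Alpha]) a = four_block_mat (sc (a E2)) (0\<^sub>m 1 1) (sc (a Alpha)) (sc (a E1))"
proof -
  have 1: "(e1 \<otimes>\<^bsub>A2\<^esub> a) E1 = a E1" "(e2 \<otimes>\<^bsub>A2\<^esub> a) E2 = a E2" "(e2 \<otimes>\<^bsub>A2\<^esub> a) Alpha = a Alpha"
     "(al \<otimes>\<^bsub>A2\<^esub> a) E2 = 0" "(al \<otimes>\<^bsub>A2\<^esub> a) Alpha = a E1"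
    by (simp_all add: A2_mult path_elem_def)
  show "act (path_module [E1]) a = sc (a E1)" "act (path_module [E2]) a = sc (a E2)"
    by (auto simp: path_module_def 1 sc_def intro!: eq_matI)
  show "act (path_module [E2, Alpha]) a = four_block_mat (sc (a E2)) (0\<^sub>m 1 1) (sc (a Alpha)) (sc (a E1))"
    by (rule eq_matI) (auto simp: path_module_def 1 less_Suc_eq sc_def)
qed

lemma path_module_dim [simp]: "mdim (path_module ps) = length ps"
  by (simp add: path_module_def)

lemma sc_simps:
  "sc a * sc b = sc (a * b)" "sc a + sc b = sc (a + b)" "c \<cdot>\<^sub>m sc a = sc (c * a)"
  "0\<^sub>m 1 1 = sc 0" "1\<^sub>m 1 = sc 1" "0\<^sub>m (Suc 0) (Suc 0) = sc 0" "1\<^sub>m (Suc 0) = sc 1"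
  by (auto intro!: eq_matI simp: scalar_prod_def sc_def)

lemma right_module_path_modules:
  "right_module A2 (path_module [E1] :: ('k::field a2, 'k) rmod)"
  "right_module A2 (path_module [E2] :: ('k::field a2, 'k) rmod)"
  "right_module A2 (path_module [E2, Alpha] :: ('k::field a2, 'k) rmod)"
proof -
  have sm: "c \<cdot>\<^sub>m four_block_mat (sc x) (sc y) (sc z) (sc w) = four_block_mat (sc (c * x)) (sc (c * y)) (sc (c * z)) (sc (c * w))"
    for c x y z w :: 'k by (auto intro!: eq_matI simp: sc_def)
  have one: "four_block_mat (sc 1) (sc 0) (sc 0) (sc 1) = (1\<^sub>m 2 :: 'k mat)"
    by (auto intro!: eq_matI simp: less_Suc_eq numeral_2_eq_2 sc_def)
  show "right_module A2 (path_module [E1] :: ('k::field a2, 'k) rmod)"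
    "right_module A2 (path_module [E2] :: ('k::field a2, 'k) rmod)"
    unfolding right_module_def path_module_act
    by (auto simp: A2_mult A2_ops sc_simps mult.commute intro!: carrier_matI)
  show "right_module A2 (path_module [E2, Alpha] :: ('k::field a2, 'k) rmod)"
    unfolding right_module_def path_module_act
    by (auto simp: A2_mult A2_ops sc_simps four_block_mult block_add sm one[symmetric] mult.commute add.commute
        distrib_left intro!: carrier_matI)
qed

section \<open>Stalk complexes\<close>

lemma stalk_simps:
  "cobj (shift k (stalk M)) i = (if i + k = 0 then M else zero_mod)"
  "cdif (shift k (stalk M)) i = 0\<^sub>m (cdim (shift k (stalk M)) (i + 1)) (cdim (shift k (stalk M)) i)"
proof -
  show "cobj (shift k (stalk M)) i = (if i + k = 0 then M else zero_mod)" by (simp add: stalk_def)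
  have "i + k + 1 = 0 \<longleftrightarrow> i + 1 + k = 0" by auto
  then show "cdif (shift k (stalk M)) i = 0\<^sub>m (cdim (shift k (stalk M)) (i + 1)) (cdim (shift k (stalk M)) i)"
    by (simp add: stalk_def mat_uminus)
qed

lemma stalk_cpxs:
  assumes "right_module A M"
  shows "shift k (stalk M) \<in> cpxs A"
proof (rule cpxsI)
  fix i
  show m: "right_module A (cobj (shift k (stalk M)) j)" for j unfolding stalk_simps using assms by simp
  show "cdif (shift k (stalk M)) i \<in> mod_hom A (cobj (shift k (stalk M)) i) (cobj (shift k (stalk M)) (i + 1))"
    unfolding stalk_simps(2) by (rule mod_hom_zero[OF m m])
  have e: "i + 1 + 1 = i + 2" by simp
  show "cdif (shift k (stalk M)) (i + 1) * cdif (shift k (stalk M)) i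
      = 0\<^sub>m (cdim (shift k (stalk M)) (i + 2)) (cdim (shift k (stalk M)) i)"
    unfolding stalk_simps(2) e by (rule left_mult_zero_mat'[THEN trans]) simp_all
  show "\<exists>N. \<forall>i. \<bar>i\<bar> > N \<longrightarrow> cdim (shift k (stalk M)) i = 0"
    by (rule exI[of _ "\<bar>k\<bar>"]) (auto simp: stalk_simps(1) simp del: shift_simps)
qed

lemma stalk_coh:
  assumes "right_module A M"
  shows "cocycles (shift k (stalk M)) i = {x. dim_vec x = cdim (shift k (stalk M)) i}"
    and "coboundaries (shift k (stalk M)) i = {0\<^sub>v (cdim (shift k (stalk M)) i)}"
proof -
  show "cocycles (shift k (stalk M)) i = {x. dim_vec x = cdim (shift k (stalk M)) i}"
    unfolding set_eq_iff cocycles_iff stalk_simps(2) by (auto simp del: shift_simps simp: mat_vec_zero)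
  have e: "i - 1 + 1 = i" by simp
  have z: "0\<^sub>v (cdim (shift k (stalk M)) i) \<in> coboundaries (shift k (stalk M)) i"
    by (rule coboundary_zero[OF stalk_cpxs[OF assms]])
  moreover have "b = 0\<^sub>v (cdim (shift k (stalk M)) i)" if "b \<in> coboundaries (shift k (stalk M)) i" for b
    using that unfolding coboundaries_iff stalk_simps(2) e by (auto simp del: shift_simps simp: mat_vec_zero)
  ultimately show "coboundaries (shift k (stalk M)) i = {0\<^sub>v (cdim (shift k (stalk M)) i)}" by blast
qed

lemma stalk_cohomology_zero:
  fixes A :: "('k::field, 'a) module"
  assumes "right_module A M" "mdim M \<noteq> 0"
  shows "cohomology_zero (shift k (stalk M)) i \<longleftrightarrow> i + k \<noteq> 0"
proof
  assume "i + k \<noteq> 0"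
  then have "cdim (shift k (stalk M)) i = 0" by (simp add: stalk_simps(1) del: shift_simps)
  then show "cohomology_zero (shift k (stalk M)) i"
    unfolding cohomology_zero_def stalk_coh[OF assms(1)] by (auto intro!: eq_vecI)
next
  assume z: "cohomology_zero (shift k (stalk M)) i"
  show "i + k \<noteq> 0"
  proof
    assume "i + k = 0"
    then have d: "cdim (shift k (stalk M)) i = mdim M" by (simp add: stalk_simps(1) del: shift_simps)
    have "(unit_vec (mdim M) 0 :: 'k vec) \<in> cocycles (shift k (stalk M)) i" unfolding stalk_coh[OF assms(1)] d by simp
    then have "(unit_vec (mdim M) 0 :: 'k vec) = 0\<^sub>v (mdim M)"
      using z unfolding cohomology_zero_def stalk_coh(2)[OF assms(1)] d by simp
    then have "(unit_vec (mdim M) 0 :: 'k vec) $ 0 = 0\<^sub>v (mdim M) $ 0" by (rule arg_cong)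
    then show False using assms(2) by simp
  qed
qed

lemma stalk_not_acyclic: "right_module A M \<Longrightarrow> mdim M \<noteq> 0 \<Longrightarrow> \<not> acyclic_cpx (shift k (stalk M))"
  unfolding acyclic_cpx_def using stalk_cohomology_zero[of A M k "- k"] by auto

text \<open>If every nonzero vector of \<open>M\<close> generates \<open>v\<close>, then \<open>v\<close> is a common multiple of any two nonzero vectors.\<close>

lemma stalk_indecomposable:
  fixes A :: "('k::field, 'a) module"
  assumes M: "right_module A M" and v: "dim_vec v = mdim M" "v \<noteq> 0\<^sub>v (mdim M)"
    and u: "\<And>x. dim_vec x = mdim M \<Longrightarrow> x \<noteq> 0\<^sub>v (mdim M) \<Longrightarrow> \<exists>a\<in>carrier A. act M a *\<^sub>v x = v"
  shows "indecomposable A (shift k (stalk M))"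
proof (rule uniform_coh_indecomposable[OF stalk_cpxs[OF M]])
  have n: "mdim M \<noteq> 0" using v by (auto intro!: eq_vecI)
  show "\<not> acyclic_cpx (shift k (stalk M))" by (rule stalk_not_acyclic[OF M n])
  have d: "i + k = 0" if "dim_vec x = cdim (shift k (stalk M)) i" "x \<noteq> 0\<^sub>v (cdim (shift k (stalk M)) i)" for x :: "'k vec" and i
  proof (rule ccontr)
    assume "i + k \<noteq> 0"
    then have "cdim (shift k (stalk M)) i = 0" by (simp add: stalk_simps(1) del: shift_simps)
    then show False using that by (auto intro!: eq_vecI)
  qed
  show "uniform_coh A (shift k (stalk M))"
    unfolding uniform_coh_def stalk_coh[OF M]
  proof (intro allI impI, elim conjE, goal_cases)
    case (1 i j x y)
    have ij: "i + k = 0" "j + k = 0" using d[of x i] d[of y j] 1 by auto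
    then have o: "cobj (shift k (stalk M)) i = M" "cobj (shift k (stalk M)) j = M"
      by (simp_all add: stalk_simps(1) del: shift_simps)
    obtain a where a: "a \<in> carrier A" "act M a *\<^sub>v x = v" using u[of x] 1 o by auto
    obtain b where b: "b \<in> carrier A" "act M b *\<^sub>v y = v" using u[of y] 1 o by auto
    have "v - v = 0\<^sub>v (mdim M)" using v(1) by (simp add: vec_ring)
    then have "i = j \<and> act M a *\<^sub>v x - act M b *\<^sub>v y \<in> {0\<^sub>v (mdim M)} \<and> act M a *\<^sub>v x \<notin> {0\<^sub>v (mdim M)}"
      unfolding a(2) b(2) using ij v(2) by simp
    then show ?case unfolding o using a(1) b(1) by blast
  qed
qed

lemma from_stalk_chain_map:
  assumes M: "right_module A M" and X: "X \<in> cpxs A" and h: "h \<in> mod_hom A M (cobj X (- k))"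
    and z: "cdif X (- k) * h = 0\<^sub>m (cdim X (1 - k)) (mdim M)"
  shows "(\<lambda>i. if i + k = 0 then h else 0\<^sub>m (cdim X i) 0) \<in> chain_maps A (shift k (stalk M)) X"
proof (rule chain_mapsI)
  fix i
  note [simp] = cpxs_dims[OF X] mod_hom_dims[OF h]
  have m: "0\<^sub>m (cdim X i) 0 \<in> mod_hom A zero_mod (cobj X i)"
    using mod_hom_zero[OF right_module_zero_mod cpxs_mod[OF X], of i] by simp
  have e: "cdim X (- k) = cdim X j" if "j + k = 0" for j
  proof -
    have "- k = j" using that by simp
    then show ?thesis by simp
  qed
  have ik: "i = - k" if "i + k = 0" for i using that by simp
  show "(if i + k = 0 then h else 0\<^sub>m (cdim X i) 0) \<in> mod_hom A (cobj (shift k (stalk M)) i) (cobj X i)"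
    unfolding stalk_simps(1) using h m by (auto dest: ik)
  have "cdif X i * (if i + k = 0 then h else 0\<^sub>m (cdim X i) 0) = 0\<^sub>m (cdim X (i + 1)) (cdim (shift k (stalk M)) i)"
    unfolding stalk_simps(1) using z by (auto dest!: ik)
  moreover have "dim_col (if i + 1 + k = 0 then h else 0\<^sub>m (cdim X (i + 1)) 0) = cdim (shift k (stalk M)) (i + 1)"
    "dim_row (if i + 1 + k = 0 then h else 0\<^sub>m (cdim X (i + 1)) 0) = cdim X (i + 1)"
    unfolding stalk_simps(1) using e[of "i + 1"] by auto
  ultimately show "cdif X i * (if i + k = 0 then h else 0\<^sub>m (cdim X i) 0) =
      (if i + 1 + k = 0 then h else 0\<^sub>m (cdim X (i + 1)) 0) * cdif (shift k (stalk M)) i"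
    unfolding stalk_simps(2) by (simp only: right_mult_zero_mat')
qed

lemma to_stalk_chain_map:
  assumes N: "right_module A N" and X: "X \<in> cpxs A" and h: "h \<in> mod_hom A (cobj X (- k)) N"
    and z: "h * cdif X (- k - 1) = 0\<^sub>m (mdim N) (cdim X (- k - 1))"
  shows "(\<lambda>i. if i + k = 0 then h else 0\<^sub>m 0 (cdim X i)) \<in> chain_maps A X (shift k (stalk N))"
proof (rule chain_mapsI)
  fix i
  note [simp] = cpxs_dims[OF X] mod_hom_dims[OF h]
  have m: "0\<^sub>m 0 (cdim X i) \<in> mod_hom A (cobj X i) zero_mod"
    using mod_hom_zero[OF cpxs_mod[OF X] right_module_zero_mod, of i] by simp
  have e: "cdim X (- k) = cdim X j" if "j + k = 0" for j
  proof -
    have "- k = j" using that by simp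
    then show ?thesis by simp
  qed
  have ik: "i = - k" if "i + k = 0" for i using that by simp
  show "(if i + k = 0 then h else 0\<^sub>m 0 (cdim X i)) \<in> mod_hom A (cobj X i) (cobj (shift k (stalk N)) i)"
    unfolding stalk_simps(1) using h m by (auto dest: ik)
  have "(if i + 1 + k = 0 then h else 0\<^sub>m 0 (cdim X (i + 1))) * cdif X i = 0\<^sub>m (cdim (shift k (stalk N)) (i + 1)) (cdim X i)"
  proof (cases "i + 1 + k = 0")
    case True
    then have "i = - k - 1" by simp
    then show ?thesis unfolding stalk_simps(1) using z by simp
  qed (simp add: stalk_simps(1) del: shift_simps)
  moreover have "dim_row (if i + k = 0 then h else 0\<^sub>m 0 (cdim X i)) = cdim (shift k (stalk N)) i"
    "dim_col (if i + k = 0 then h else 0\<^sub>m 0 (cdim X i)) = cdim X i"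
    unfolding stalk_simps(1) using e[of i] by auto
  ultimately show "cdif (shift k (stalk N)) i * (if i + k = 0 then h else 0\<^sub>m 0 (cdim X i)) =
      (if i + 1 + k = 0 then h else 0\<^sub>m 0 (cdim X (i + 1))) * cdif X i"
    unfolding stalk_simps(2) by (simp only: left_mult_zero_mat')
qed

section \<open>The exact triangles relating the three modules\<close>

text \<open>The inclusion \<open>P\<^sub>1[k] \<rightarrow> P\<^sub>2[k]\<close> and the projection \<open>P\<^sub>2[k] \<rightarrow> S\<^sub>2[k]\<close>, as matrices with respect to the basis
  \<open>e\<^sub>2, \<alpha>\<close> of \<open>P\<^sub>2\<close>: the inclusion sends \<open>e\<^sub>1\<close> to \<open>\<alpha>\<close>, the projection kills \<open>\<alpha>\<close>.\<close>

definition inc :: "int \<Rightarrow> int \<Rightarrow> 'k::field mat" where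
  "inc k = (\<lambda>i. if i + k = 0 then colb (sc 0) (sc 1) else 0\<^sub>m 0 0)"

definition prj :: "int \<Rightarrow> int \<Rightarrow> 'k::field mat" where
  "prj k = (\<lambda>i. if i + k = 0 then rowb (sc 1) (sc 0) else 0\<^sub>m 0 0)"

lemma P_cpxs:
  "shift k P1 \<in> cpxs (A2 :: ('k::field, 'k a2) module)" "shift k P2 \<in> cpxs (A2 :: ('k, 'k a2) module)"
  "shift k S2 \<in> cpxs (A2 :: ('k, 'k a2) module)"
  unfolding P1_def P2_def S2_def by (simp_all only: stalk_cpxs[OF right_module_path_modules(1)]
    stalk_cpxs[OF right_module_path_modules(2)] stalk_cpxs[OF right_module_path_modules(3)])

lemma P_simps:
  "cobj (shift k P1) i = (if i + k = 0 then path_module [E1] else zero_mod)"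
  "cobj (shift k P2) i = (if i + k = 0 then path_module [E2, Alpha] else zero_mod)"
  "cobj (shift k S2) i = (if i + k = 0 then path_module [E2] else zero_mod)"
  unfolding P1_def P2_def S2_def by (simp_all only: stalk_simps(1))

lemma inc_mod_hom: "colb (sc 0) (sc 1) \<in> mod_hom A2 (path_module [E1]) (path_module [E2, Alpha] :: ('k::field a2, 'k) rmod)"
  by (rule mod_homI) (simp_all add: path_module_act block_mult sc_simps)

lemma prj_mod_hom: "rowb (sc 1) (sc 0) \<in> mod_hom A2 (path_module [E2, Alpha]) (path_module [E2] :: ('k::field a2, 'k) rmod)"
  by (rule mod_homI) (simp_all add: path_module_act block_mult sc_simps)

lemma inc_chain_map: "inc k \<in> chain_maps A2 (shift k P1) (shift k (P2 :: ('k::field a2, 'k) cpx))"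
proof -
  have c: "cobj (shift k (P2 :: ('k a2, 'k) cpx)) (- k) = path_module [E2, Alpha]" by (simp add: P_simps(2) del: shift_simps)
  have d: "cdif (shift k (P2 :: ('k a2, 'k) cpx)) (- k) = 0\<^sub>m (cdim (shift k (P2 :: ('k a2, 'k) cpx)) (1 - k)) 2"
    unfolding P2_def stalk_simps(2) by (simp add: stalk_simps(1) numeral_2_eq_2 del: shift_simps)
  have "(\<lambda>i. if i + k = 0 then colb (sc 0) (sc 1 :: 'k mat) else 0\<^sub>m (cdim (shift k (P2 :: ('k a2, 'k) cpx)) i) 0)
      \<in> chain_maps A2 (shift k (stalk (path_module [E1]))) (shift k P2)"
    by (rule from_stalk_chain_map[OF right_module_path_modules(1) P_cpxs(2)])
      (simp_all add: c d inc_mod_hom del: shift_simps)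
  moreover have "(\<lambda>i. if i + k = 0 then colb (sc 0) (sc 1 :: 'k mat) else 0\<^sub>m (cdim (shift k (P2 :: ('k a2, 'k) cpx)) i) 0) = inc k"
    by (rule ext) (simp add: inc_def P_simps(2) del: shift_simps)
  ultimately show ?thesis unfolding P1_def by simp
qed

lemma prj_chain_map: "prj k \<in> chain_maps A2 (shift k P2) (shift k (S2 :: ('k::field a2, 'k) cpx))"
proof -
  have c: "cobj (shift k (P2 :: ('k a2, 'k) cpx)) (- k) = path_module [E2, Alpha]" by (simp add: P_simps(2) del: shift_simps)
  have d: "cdif (shift k (P2 :: ('k a2, 'k) cpx)) (- k - 1) = 0\<^sub>m 2 (cdim (shift k (P2 :: ('k a2, 'k) cpx)) (- k - 1))"
    unfolding P2_def stalk_simps(2) by (simp add: stalk_simps(1) numeral_2_eq_2 del: shift_simps)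
  have "(\<lambda>i. if i + k = 0 then rowb (sc 1) (sc 0 :: 'k mat) else 0\<^sub>m 0 (cdim (shift k (P2 :: ('k a2, 'k) cpx)) i))
      \<in> chain_maps A2 (shift k P2) (shift k (stalk (path_module [E2])))"
    by (rule to_stalk_chain_map[OF right_module_path_modules(2) P_cpxs(2)])
      (simp_all add: c d prj_mod_hom del: shift_simps)
  moreover have "(\<lambda>i. if i + k = 0 then rowb (sc 1) (sc 0 :: 'k mat) else 0\<^sub>m 0 (cdim (shift k (P2 :: ('k a2, 'k) cpx)) i)) = prj k"
    by (rule ext) (simp add: prj_def P_simps(2) del: shift_simps)
  ultimately show ?thesis unfolding S2_def by simp
qed

lemma sc_vec: "dim_vec v = 1 \<Longrightarrow> sc 1 *\<^sub>v v = v" "dim_vec v = 1 \<Longrightarrow> sc 0 *\<^sub>v v = 0\<^sub>v 1"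
  unfolding sc_simps(4,5)[symmetric] by (simp_all add: mat_vec_zero)

lemma short_exact_inc_prj: "short_exact (shift k P1) (shift k P2) (shift k (S2 :: ('k::field a2, 'k) cpx)) (inc k) (prj k)"
proof -
  have d: "cdim (shift k (P1 :: ('k a2, 'k) cpx)) i = (if i + k = 0 then 1 else 0)"
    "cdim (shift k (P2 :: ('k a2, 'k) cpx)) i = (if i + k = 0 then 1 + 1 else 0)"
    "cdim (shift k (S2 :: ('k a2, 'k) cpx)) i = (if i + k = 0 then 1 else 0)" for i
    by (simp_all add: P_simps del: shift_simps)
  have v0: "v = w" if "dim_vec v = 0" "dim_vec w = 0" for v w :: "'k vec" using that by (auto intro!: eq_vecI)
  have i1: "inc k i *\<^sub>v x = 0\<^sub>v 1 @\<^sub>v x" if "i + k = 0" "dim_vec x = 1" for i and x :: "'k vec"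
    using that by (simp add: inc_def block_vec sc_vec)
  have p1: "prj k i *\<^sub>v (x @\<^sub>v y) = x" if "i + k = 0" "dim_vec x = 1" "dim_vec y = 1" for i and x y :: "'k vec"
    using that by (simp add: prj_def block_vec sc_vec vec_ring)
  show ?thesis
    unfolding short_exact_def d
  proof (intro conjI allI impI; (elim conjE)?)
    fix i and x :: "'k vec"
    assume x: "dim_vec x = (if i + k = 0 then 1 else 0)" "inc k i *\<^sub>v x = 0\<^sub>v (if i + k = 0 then 1 + 1 else 0)"
    show "x = 0\<^sub>v (if i + k = 0 then 1 else 0)"
    proof (cases "i + k = 0")
      case True
      have "0\<^sub>v 1 @\<^sub>v x = 0\<^sub>v (1 + 1)" using x True i1[OF True, of x] by simp
      then have "0\<^sub>v 1 @\<^sub>v x = 0\<^sub>v 1 @\<^sub>v 0\<^sub>v 1" unfolding append_vec_simps(5) .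
      then have "x = 0\<^sub>v 1" by (simp only: append_vec_simps(1) index_zero_vec(2))
      then show ?thesis using True by simp
    next
      case False
      then show ?thesis using x by (intro v0) simp_all
    qed
  next
    fix i and y :: "'k vec"
    assume y: "dim_vec y = (if i + k = 0 then 1 + 1 else 0)" "prj k i *\<^sub>v y = 0\<^sub>v (if i + k = 0 then 1 else 0)"
    show "\<exists>x. dim_vec x = (if i + k = 0 then 1 else 0) \<and> y = inc k i *\<^sub>v x"
    proof (cases "i + k = 0")
      case True
      then have "dim_vec y = 1 + 1" using y by simp
      then obtain a b where ab: "y = a @\<^sub>v b" "dim_vec a = 1" "dim_vec b = 1" by (rule vec_appendE)
      have "a = 0\<^sub>v 1" using y(2) True p1[OF True ab(2,3)] unfolding ab(1) by simp
      then have "y = inc k i *\<^sub>v b" using i1[OF True ab(3)] ab(1) by simp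
      then show ?thesis using ab(3) True by auto
    next
      case False
      then show ?thesis using y by (intro exI[of _ "0\<^sub>v 0"] conjI v0) (simp_all add: inc_def)
    qed
  next
    fix i and z :: "'k vec"
    assume z: "dim_vec z = (if i + k = 0 then 1 else 0)"
    show "\<exists>y. dim_vec y = (if i + k = 0 then 1 + 1 else 0) \<and> z = prj k i *\<^sub>v y"
    proof (cases "i + k = 0")
      case True
      then have "z = prj k i *\<^sub>v (z @\<^sub>v 0\<^sub>v 1)" using z p1[OF True, of z "0\<^sub>v 1"] by simp
      then show ?thesis using z True by (intro exI[of _ "z @\<^sub>v 0\<^sub>v 1"]) simp
    next
      case False
      then show ?thesis using z by (intro exI[of _ "0\<^sub>v 0"] conjI v0) (simp_all add: prj_def)
    qed
  qed
qed

lemma prj_inc: "(prj k i * inc k i :: 'k mat) = 0\<^sub>m (cdim (shift k (S2 :: ('k::field a2, 'k) cpx)) i) (cdim (shift k (P1 :: ('k a2, 'k) cpx)) i)"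
  by (simp add: prj_def inc_def P_simps block_mult sc_simps del: shift_simps)

text \<open>A map out of \<open>cone (P\<^sub>1 \<rightarrow> P\<^sub>2)\<close> that restricts to the projection on \<open>P\<^sub>2\<close> is a quasi-isomorphism,
  whatever it does on \<open>P\<^sub>1\<close>, which sits in another degree than \<open>S\<^sub>2\<close>; dually for fibres.\<close>

lemma cone_inc_quasi_iso:
  assumes r: "r \<in> chain_maps A2 (cone (shift k P1) (shift k P2) (inc k)) (shift k (S2 :: ('k::field a2, 'k) cpx))"
    and e: "\<And>i. r i = rowb (u i) (prj k i)" and u: "\<And>i. dim_row (u i) = cdim (shift k (S2 :: ('k a2, 'k) cpx)) i"
      "\<And>i. dim_col (u i) = cdim (shift k (P1 :: ('k a2, 'k) cpx)) (i + 1)"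
  shows "r \<in> quasi_isos A2 (cone (shift k P1) (shift k P2) (inc k)) (shift k S2)"
proof (rule short_exact_cone_quasi_iso[OF P_cpxs inc_chain_map prj_chain_map short_exact_inc_prj r])
  fix i
  have "cdim (shift k (S2 :: ('k a2, 'k) cpx)) i = 0 \<or> cdim (shift k (P1 :: ('k a2, 'k) cpx)) (i + 1) = 0"
    by (simp add: P_simps del: shift_simps)
  then have "u i = 0\<^sub>m (cdim (shift k (S2 :: ('k a2, 'k) cpx)) i) (cdim (shift k (P1 :: ('k a2, 'k) cpx)) (i + 1))"
    by (intro eq_matI) (simp_all only: u index_zero_mat, auto)
  then show "r i = rowb (0\<^sub>m (cdim (shift k (S2 :: ('k a2, 'k) cpx)) i) (cdim (shift k (P1 :: ('k a2, 'k) cpx)) (i + 1))) (prj k i)"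
    using e by simp
qed

lemma fib_prj_quasi_iso:
  assumes r: "r \<in> chain_maps A2 (shift k (P1 :: ('k::field a2, 'k) cpx)) (fib (shift k P2) (shift k S2) (prj k))"
    and e: "\<And>i. r i = colb (inc k i) (u i)" and u: "\<And>i. dim_row (u i) = cdim (shift k (S2 :: ('k a2, 'k) cpx)) (i - 1)"
      "\<And>i. dim_col (u i) = cdim (shift k (P1 :: ('k a2, 'k) cpx)) i"
  shows "r \<in> quasi_isos A2 (shift k P1) (fib (shift k P2) (shift k S2) (prj k))"
proof (rule short_exact_fib_quasi_iso[OF P_cpxs inc_chain_map prj_chain_map short_exact_inc_prj r])
  fix i
  have "cdim (shift k (S2 :: ('k a2, 'k) cpx)) (i - 1) = 0 \<or> cdim (shift k (P1 :: ('k a2, 'k) cpx)) i = 0"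
    by (simp add: P_simps del: shift_simps)
  then have "u i = 0\<^sub>m (cdim (shift k (S2 :: ('k a2, 'k) cpx)) (i - 1)) (cdim (shift k (P1 :: ('k a2, 'k) cpx)) i)"
    by (intro eq_matI) (simp_all only: u index_zero_mat, auto)
  then show "r i = colb (inc k i) (0\<^sub>m (cdim (shift k (S2 :: ('k a2, 'k) cpx)) (i - 1)) (cdim (shift k (P1 :: ('k a2, 'k) cpx)) i))"
    using e by simp
qed

lemma inc_dims:
  "dim_row (inc k i) = cdim (shift k (P2 :: ('k::field a2, 'k) cpx)) i"
  "dim_col (inc k i) = cdim (shift k (P1 :: ('k::field a2, 'k) cpx)) i"
  and prj_dims: "dim_row (prj k i) = cdim (shift k (S2 :: ('k::field a2, 'k) cpx)) i"
  "dim_col (prj k i) = cdim (shift k (P2 :: ('k::field a2, 'k) cpx)) i"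
  by (simp_all add: inc_def prj_def P_simps del: shift_simps)

lemma cone_inc: "qi_equiv A2 (cone (shift k P1) (shift k P2) (inc k)) (shift k (S2 :: ('k::field a2, 'k) cpx))"
proof -
  let ?P = "shift k (P1 :: ('k a2, 'k) cpx)" and ?S = "shift k (S2 :: ('k a2, 'k) cpx)"
  let ?h = "\<lambda>i. 0\<^sub>m (cdim ?S (i - 1)) (cdim ?P i) :: 'k mat"
  have "(\<lambda>i. rowb (?h (i + 1)) (prj k i)) \<in> chain_maps A2 (cone ?P (shift k P2) (inc k)) ?S"
  proof (rule cone_map[OF P_cpxs inc_chain_map prj_chain_map])
    fix i
    show "?h i \<in> mod_hom A2 (cobj ?P i) (cobj ?S (i - 1))" by (rule mod_hom_zero[OF cpxs_mod[OF P_cpxs(1)] cpxs_mod[OF P_cpxs(3)]])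
    have e: "i - 1 + 1 = i" "i + 1 - 1 = i" by simp_all
    show "prj k i * inc k i = cdif ?S (i - 1) * ?h i + ?h (i + 1) * cdif ?P i"
      unfolding prj_inc e using cpxs_dims[OF P_cpxs(1)[where 'k='k], of k i] cpxs_dims[OF P_cpxs(3)[where 'k='k], of k "i - 1"]
      by (simp add: mat_cancel del: shift_simps)
  qed
  then have "(\<lambda>i. rowb (?h (i + 1)) (prj k i)) \<in> quasi_isos A2 (cone ?P (shift k P2) (inc k)) ?S"
    by (rule cone_inc_quasi_iso) (rule refl, simp_all del: shift_simps)
  then show ?thesis by (rule qi_equivI[OF cone_cpxs[OF P_cpxs(1,2) inc_chain_map] P_cpxs(3)])
qed

lemma fib_prj: "qi_equiv A2 (shift k (P1 :: ('k::field a2, 'k) cpx)) (fib (shift k P2) (shift k S2) (prj k))"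
proof -
  let ?P = "shift k (P1 :: ('k a2, 'k) cpx)" and ?S = "shift k (S2 :: ('k a2, 'k) cpx)"
  let ?h = "\<lambda>i. 0\<^sub>m (cdim ?S (i - 1)) (cdim ?P i) :: 'k mat"
  have "(\<lambda>i. colb (inc k i) (- ?h i)) \<in> chain_maps A2 ?P (fib (shift k P2) ?S (prj k))"
  proof (rule fib_map[OF P_cpxs inc_chain_map prj_chain_map])
    fix i
    show "?h i \<in> mod_hom A2 (cobj ?P i) (cobj ?S (i - 1))" by (rule mod_hom_zero[OF cpxs_mod[OF P_cpxs(1)] cpxs_mod[OF P_cpxs(3)]])
    have e: "i - 1 + 1 = i" "i + 1 - 1 = i" by simp_all
    show "prj k i * inc k i = cdif ?S (i - 1) * ?h i + ?h (i + 1) * cdif ?P i"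
      unfolding prj_inc e using cpxs_dims[OF P_cpxs(1)[where 'k='k], of k i] cpxs_dims[OF P_cpxs(3)[where 'k='k], of k "i - 1"]
      by (simp add: mat_cancel del: shift_simps)
  qed
  then have "(\<lambda>i. colb (inc k i) (- ?h i)) \<in> quasi_isos A2 ?P (fib (shift k P2) ?S (prj k))"
    by (rule fib_prj_quasi_iso) (rule refl, simp_all del: shift_simps)
  then show ?thesis by (rule qi_equivI[OF P_cpxs(1) fib_cpxs[OF P_cpxs(2,3) prj_chain_map]])
qed

lemma cone_prj: "qi_equiv A2 (cone (shift k P2) (shift k S2) (prj k)) (shift (k + 1) (P1 :: ('k::field a2, 'k) cpx))"
  using qi_equiv_sym[OF qi_equiv_shift[OF fib_prj, of 1 k]]
  by (simp add: shift_fib[OF P_cpxs(2,3) prj_chain_map] shift_shift add.commute)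

text \<open>On the line \<open>\<dots>, P\<^sub>1, P\<^sub>2, S\<^sub>2, P\<^sub>1[1], P\<^sub>2[1], \<dots>\<close> every object is an extension
  of its two neighbours: \<open>S\<^sub>2\<close> is the cone of \<open>inc\<close>, \<open>P\<^sub>1[1]\<close> is the cone of \<open>prj\<close>, and \<open>P\<^sub>2\<close> is reached from the
  latter by a rotation.\<close>

lemma aisle_between:
  assumes t: "t_structure A2 U V"
  shows "shift k P2 \<in> U \<Longrightarrow> shift (k + 1) P1 \<in> U \<Longrightarrow> shift k S2 \<in> U"
    and "shift k S2 \<in> U \<Longrightarrow> shift (k + 1) P2 \<in> U \<Longrightarrow> shift (k + 1) P1 \<in> U"
    and "shift k P1 \<in> U \<Longrightarrow> shift k S2 \<in> U \<Longrightarrow> shift k P2 \<in> U"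
proof -
  have s: "shift 1 (shift k X) = shift (k + 1) X" "shift 1 (shift (k - 1) X) = shift k X" for X :: "('a a2, 'a) cpx"
    by (simp_all add: shift_shift add.commute)
  show "shift k S2 \<in> U" if "shift k P2 \<in> U" "shift (k + 1) P1 \<in> U"
    by (rule t_iso[OF t _ cone_inc]) (rule aisle_cone[OF t P_cpxs(1) inc_chain_map], simp_all only: s that)
  show "shift (k + 1) P1 \<in> U" if "shift k S2 \<in> U" "shift (k + 1) P2 \<in> U"
    by (rule t_iso[OF t _ cone_prj]) (rule aisle_cone[OF t P_cpxs(2) prj_chain_map], simp_all only: s that)
  show "shift k P2 \<in> U" if "shift k P1 \<in> U" "shift k S2 \<in> U"
  proof -
    have "cone (shift (k - 1) P2) (shift (k - 1) S2) (prj (k - 1)) \<in> U"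
      using t_iso[OF t that(1) qi_equiv_sym[of A2 _ "shift k P1"]] cone_prj[of "k - 1"] by simp
    then have "shift 1 (shift (k - 1) P2) \<in> U"
      by (intro aisle_cone_rotated[OF t P_cpxs(2,3) prj_chain_map]) (simp_all only: s that)
    then show ?thesis by (simp only: s)
  qed
qed

section \<open>Splitting off an indecomposable summand\<close>

text \<open>A nonzero object \<open>C\<close> that is a direct summand of \<open>X\<close> in the derived category.  The splitting may go
  through any complex \<open>D\<close> quasi-isomorphic to \<open>C\<close>; below, \<open>C\<close> consists of projective and \<open>D\<close> of injective
  modules, so that both maps are given by elements and functionals.\<close>

definition nonzero_summand :: "('k::field, 'a) module \<Rightarrow> ('a, 'k) cpx \<Rightarrow> ('a, 'k) cpx \<Rightarrow> bool" where
  "nonzero_summand A C X \<longleftrightarrow> C \<in> cpxs A \<and> (\<exists>D f g. D \<in> cpxs A \<and> \<not> acyclic_cpx D \<and>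
     f \<in> chain_maps A C X \<and> g \<in> chain_maps A X D \<and> g \<circ>\<^sub>c f \<in> quasi_isos A C D)"

lemma nonzero_summandI:
  assumes "C \<in> cpxs A" "D \<in> cpxs A" "\<not> acyclic_cpx D" "f \<in> chain_maps A C X" "g \<in> chain_maps A X D"
    "g \<circ>\<^sub>c f \<in> quasi_isos A C D"
  shows "nonzero_summand A C X"
  unfolding nonzero_summand_def using assms by blast

lemma nonzero_summand_indecomposable:
  assumes "nonzero_summand A C X" "indecomposable A X"
  shows "qi_equiv A X C"
  using assms(1) unfolding nonzero_summand_def by (elim conjE exE) (rule indecomposable_retract[OF _ assms(2)])

text \<open>If the inclusion of the summand vanished, so would a quasi-isomorphism to an object with nonzero
  cohomology.\<close>

lemma nonzero_summand_hom:
  assumes X: "X \<in> cpxs A" and s: "nonzero_summand A C X"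
  shows "\<not> hom_vanishes A C X"
proof
  note q = quasi_iso_chain
  assume v: "hom_vanishes A C X"
  obtain D f g where C: "C \<in> cpxs A" and D: "D \<in> cpxs A" "\<not> acyclic_cpx D" and f: "f \<in> chain_maps A C X"
    and g: "g \<in> chain_maps A X D" and gf: "g \<circ>\<^sub>c f \<in> quasi_isos A C D"
    using s unfolding nonzero_summand_def by (elim conjE exE)
  have "roofs_vanish A C X" using v by (simp add: hom_vanishes_iff C X)
  then obtain U u where U: "U \<in> cpxs A" "u \<in> quasi_isos A U C" "heq A U X (f \<circ>\<^sub>c u) (chain_zero U X)"
    by (rule roofs_vanishE[OF _ C quasi_iso_id[OF C] f X])
  have "heq A U D (g \<circ>\<^sub>c (f \<circ>\<^sub>c u)) (chain_zero U D)" by (rule heq_zero_left[OF U(3) D(1) g])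
  then have h: "heq A U D ((g \<circ>\<^sub>c f) \<circ>\<^sub>c u) (chain_zero U D)" by (simp only: chain_comp_assoc[OF q[OF U(2)] f g])
  have z: "chain_zero U D \<in> quasi_isos A U D"
    by (rule heq_quasi[OF h quasi_iso_comp[OF U(1) C D(1) U(2) gf]])
  have "w \<in> coboundaries D i" if w: "w \<in> cocycles D i" for i w
  proof -
    obtain y where "y \<in> cocycles U i" "w - chain_zero U D i *\<^sub>v y \<in> coboundaries D i"
      using z w by (auto simp: quasi_isos_iff coh_surj_def)
    then show ?thesis using w by (simp add: chain_zero_def cocycles_iff vec_ring)
  qed
  then show False using D by (auto simp: acyclic_cpx_iff)
qed

lemma P_not_acyclic:
  "\<not> acyclic_cpx (shift k (P1 :: ('k::field a2, 'k) cpx))" "\<not> acyclic_cpx (shift k (P2 :: ('k a2, 'k) cpx))"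
  "\<not> acyclic_cpx (shift k (S2 :: ('k a2, 'k) cpx))"
  unfolding P1_def P2_def S2_def
  by (rule stalk_not_acyclic[OF right_module_path_modules(1)], simp,
      rule stalk_not_acyclic[OF right_module_path_modules(3)], simp,
      rule stalk_not_acyclic[OF right_module_path_modules(2)], simp)

lemma path_module_generators:
  "act (path_module [E1]) e1 = (1\<^sub>m 1 :: 'k::field mat)" "act (path_module [E1]) e2 = (0\<^sub>m 1 1 :: 'k mat)"
  "act (path_module [E1]) al = (0\<^sub>m 1 1 :: 'k mat)"
  "act (path_module [E2]) e1 = (0\<^sub>m 1 1 :: 'k mat)" "act (path_module [E2]) e2 = (1\<^sub>m 1 :: 'k mat)"
  "act (path_module [E2]) al = (0\<^sub>m 1 1 :: 'k mat)"
  "act (path_module [E2, Alpha]) e1 = four_block_mat (0\<^sub>m 1 1) (0\<^sub>m 1 1) (0\<^sub>m 1 1) (1\<^sub>m 1 :: 'k mat)"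
  "act (path_module [E2, Alpha]) e2 = four_block_mat (1\<^sub>m 1) (0\<^sub>m 1 1) (0\<^sub>m 1 1) (0\<^sub>m 1 1 :: 'k mat)"
  "act (path_module [E2, Alpha]) al = four_block_mat (0\<^sub>m 1 1) (0\<^sub>m 1 1) (1\<^sub>m 1) (0\<^sub>m 1 1 :: 'k mat)"
  unfolding path_module_act sc_simps(4,5) by (simp_all add: path_elem_def)

lemma act_column:
  fixes M :: "('k::field a2, 'k) rmod"
  assumes M: "right_module A2 M" and x: "dim_row x = mdim M"
  shows "act M e1 * (act M al * x) = act M al * x" "act M e2 * (act M al * x) = 0\<^sub>m (mdim M) (dim_col x)"
    "act M al * (act M al * x) = 0\<^sub>m (mdim M) (dim_col x)"
    "act M al * (act M e2 * x) = act M al * x" "act M e1 * (act M e1 * x) = act M e1 * x"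
    "act M e2 * (act M e2 * x) = act M e2 * x"
    "act M e1 * (act M e2 * x) = 0\<^sub>m (mdim M) (dim_col x)" "act M e2 * (act M e1 * x) = 0\<^sub>m (mdim M) (dim_col x)"
    "act M al * (act M e1 * x) = 0\<^sub>m (mdim M) (dim_col x)" "act M e1 * x + act M e2 * x = x"
proof -
  note [simp] = right_module_dims[OF M carrier_A2] x
  note a = mat_assoc[symmetric] and r = act_rel[OF M]
  show "act M e1 * (act M al * x) = act M al * x" "act M e2 * (act M al * x) = 0\<^sub>m (mdim M) (dim_col x)"
    "act M al * (act M al * x) = 0\<^sub>m (mdim M) (dim_col x)"
    "act M al * (act M e2 * x) = act M al * x" "act M e1 * (act M e1 * x) = act M e1 * x"
    "act M e2 * (act M e2 * x) = act M e2 * x"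
    "act M e1 * (act M e2 * x) = 0\<^sub>m (mdim M) (dim_col x)" "act M e2 * (act M e1 * x) = 0\<^sub>m (mdim M) (dim_col x)"
    "act M al * (act M e1 * x) = 0\<^sub>m (mdim M) (dim_col x)"
    by (simp_all add: a r)
  have "act M e1 * x + act M e2 * x = (act M e1 + act M e2) * x" by (simp add: mat_distrib)
  then show "act M e1 * x + act M e2 * x = x" by (simp add: r)
qed

lemma act_row:
  fixes M :: "('k::field a2, 'k) rmod"
  assumes M: "right_module A2 M" and p: "dim_col p = mdim M"
  shows "(p * act M al) * act M e1 = 0\<^sub>m (dim_row p) (mdim M)" "(p * act M al) * act M e2 = p * act M al"
    "(p * act M al) * act M al = 0\<^sub>m (dim_row p) (mdim M)"
    "(p * act M e1) * act M e1 = p * act M e1" "(p * act M e1) * act M e2 = 0\<^sub>m (dim_row p) (mdim M)"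
    "(p * act M e1) * act M al = p * act M al"
    "(p * act M e2) * act M e1 = 0\<^sub>m (dim_row p) (mdim M)" "(p * act M e2) * act M e2 = p * act M e2"
    "(p * act M e2) * act M al = 0\<^sub>m (dim_row p) (mdim M)"
proof -
  note [simp] = right_module_dims[OF M carrier_A2] p
  show "(p * act M al) * act M e1 = 0\<^sub>m (dim_row p) (mdim M)" "(p * act M al) * act M e2 = p * act M al"
    "(p * act M al) * act M al = 0\<^sub>m (dim_row p) (mdim M)"
    "(p * act M e1) * act M e1 = p * act M e1" "(p * act M e1) * act M e2 = 0\<^sub>m (dim_row p) (mdim M)"
    "(p * act M e1) * act M al = p * act M al"
    "(p * act M e2) * act M e1 = 0\<^sub>m (dim_row p) (mdim M)" "(p * act M e2) * act M e2 = p * act M e2"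
    "(p * act M e2) * act M al = 0\<^sub>m (dim_row p) (mdim M)"
    by (simp_all add: mat_assoc act_rel[OF M])
qed

text \<open>Elements of a module, as columns, and functionals on it, as rows, define homomorphisms from projective
  and to injective modules: \<open>P\<^sub>2\<close> is the injective hull of \<open>P\<^sub>1\<close>, and \<open>S\<^sub>2\<close> is injective.\<close>

lemma element_hom:
  fixes M :: "('k::field a2, 'k) rmod"
  assumes M: "right_module A2 M" and x: "dim_row x = mdim M" "dim_col x = 1"
  shows "act M e2 * x = x \<Longrightarrow> rowb x (act M al * x) \<in> mod_hom A2 (path_module [E2, Alpha]) M"
    and "act M e1 * x = x \<Longrightarrow> x \<in> mod_hom A2 (path_module [E1]) M"
proof -
  note [simp] = right_module_dims[OF M carrier_A2] x
  note c = act_column[OF M x(1)]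
  show "rowb x (act M al * x) \<in> mod_hom A2 (path_module [E2, Alpha]) M" if e: "act M e2 * x = x"
  proof -
    have z: "act M e1 * x = 0\<^sub>m (mdim M) 1" using c(7) e by simp
    show ?thesis
      by (rule mod_hom_A2I[OF right_module_path_modules(3) M])
        (simp_all add: path_module_generators block_mult mat_cancel c e z)
  qed
  show "x \<in> mod_hom A2 (path_module [E1]) M" if e: "act M e1 * x = x"
  proof -
    have z: "act M e2 * x = 0\<^sub>m (mdim M) 1" "act M al * x = 0\<^sub>m (mdim M) 1" using c(8,9) e by simp_all
    show ?thesis
      by (rule mod_hom_A2I[OF right_module_path_modules(1) M])
        (simp_all add: path_module_generators e z)
  qed
qed

lemma functional_hom:
  fixes M :: "('k::field a2, 'k) rmod"
  assumes M: "right_module A2 M" and p: "dim_row p = 1" "dim_col p = mdim M"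
  shows "colb (p * act M al) (p * act M e1) \<in> mod_hom A2 M (path_module [E2, Alpha])"
    and "p * act M e2 \<in> mod_hom A2 M (path_module [E2])"
proof -
  note [simp] = right_module_dims[OF M carrier_A2] p
  note c = act_row[OF M p(2)]
  show "colb (p * act M al) (p * act M e1) \<in> mod_hom A2 M (path_module [E2, Alpha])"
    by (rule mod_hom_A2I[OF M right_module_path_modules(3)])
      (simp_all add: path_module_generators block_mult mat_cancel c)
  show "p * act M e2 \<in> mod_hom A2 M (path_module [E2])"
    by (rule mod_hom_A2I[OF M right_module_path_modules(2)]) (simp_all add: path_module_generators c)
qed

lemma dif_act:
  fixes X :: "('k::field a2, 'k) cpx"
  assumes X: "X \<in> cpxs A2"
  shows "cdif X i * act (cobj X i) a = act (cobj X (i + 1)) a * cdif X i"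
    and "cdif X (i - 1) * act (cobj X (i - 1)) a = act (cobj X i) a * cdif X (i - 1)"
  using mod_hom_comm[OF cpxs_dif[OF X] carrier_A2, of i a] mod_hom_comm[OF cpxs_dif[OF X] carrier_A2, of "i - 1" a]
  by simp_all

lemma dif_act_column:
  fixes X :: "('k::field a2, 'k) cpx"
  assumes X: "X \<in> cpxs A2"
  shows "dim_row x = cdim X i \<Longrightarrow> cdif X i * (act (cobj X i) a * x) = act (cobj X (i + 1)) a * (cdif X i * x)"
    and "dim_row y = cdim X (i - 1) \<Longrightarrow>
      cdif X (i - 1) * (act (cobj X (i - 1)) a * y) = act (cobj X i) a * (cdif X (i - 1) * y)"
proof -
  note [simp] = cpxs_dims[OF X] right_module_dims[OF cpxs_mod[OF X] carrier_A2]
  show "dim_row x = cdim X i \<Longrightarrow> cdif X i * (act (cobj X i) a * x) = act (cobj X (i + 1)) a * (cdif X i * x)"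
    by (simp add: mat_assoc[symmetric] dif_act(1)[OF X])
  show "dim_row y = cdim X (i - 1) \<Longrightarrow>
      cdif X (i - 1) * (act (cobj X (i - 1)) a * y) = act (cobj X i) a * (cdif X (i - 1) * y)"
    by (simp add: mat_assoc[symmetric] dif_act(2)[OF X])
qed

lemma element_chain_map:
  fixes X :: "('k::field a2, 'k) cpx"
  assumes X: "X \<in> cpxs A2" and x: "dim_row x = cdim X i" "dim_col x = 1" and dx: "cdif X i * x = 0\<^sub>m (cdim X (i + 1)) 1"
  shows "act (cobj X i) e2 * x = x \<Longrightarrow>
      (\<lambda>j. if j + - i = 0 then rowb x (act (cobj X i) al * x) else 0\<^sub>m (cdim X j) 0) \<in> chain_maps A2 (shift (- i) P2) X"
    and "act (cobj X i) e1 * x = x \<Longrightarrow>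
      (\<lambda>j. if j + - i = 0 then x else 0\<^sub>m (cdim X j) 0) \<in> chain_maps A2 (shift (- i) P1) X"
proof -
  note M = cpxs_mod[OF X, of i]
  note [simp] = cpxs_dims[OF X] right_module_dims[OF cpxs_mod[OF X] carrier_A2] x
  have z: "cdif X i * rowb x (act (cobj X i) al * x) = 0\<^sub>m (cdim X (i + 1)) (1 + 1)"
    by (simp add: block_mult dif_act_column[OF X] dx block_zero del: One_nat_def)
  have z': "cdif X (- (- i)) * rowb x (act (cobj X i) al * x) = 0\<^sub>m (cdim X (1 - - i)) (mdim (path_module [E2, Alpha]))"
    using z by (simp add: add.commute)
  have d': "cdif X (- (- i)) * x = 0\<^sub>m (cdim X (1 - - i)) (mdim (path_module [E1]))"
    using dx by (simp add: add.commute)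
  show "(\<lambda>j. if j + - i = 0 then rowb x (act (cobj X i) al * x) else 0\<^sub>m (cdim X j) 0) \<in> chain_maps A2 (shift (- i) P2) X"
    if "act (cobj X i) e2 * x = x"
    unfolding P2_def by (rule from_stalk_chain_map[OF right_module_path_modules(3) X _ z']) (use element_hom(1)[OF M x that] in simp)
  show "(\<lambda>j. if j + - i = 0 then x else 0\<^sub>m (cdim X j) 0) \<in> chain_maps A2 (shift (- i) P1) X"
    if "act (cobj X i) e1 * x = x"
    unfolding P1_def by (rule from_stalk_chain_map[OF right_module_path_modules(1) X _ d']) (use element_hom(2)[OF M x that] in simp)
qed

lemma functional_chain_map:
  fixes X :: "('k::field a2, 'k) cpx"
  assumes X: "X \<in> cpxs A2" and p: "dim_row p = 1" "dim_col p = cdim X i"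
    and dp: "p * cdif X (i - 1) = 0\<^sub>m 1 (cdim X (i - 1))"
  shows "(\<lambda>j. if j + - i = 0 then colb (p * act (cobj X i) al) (p * act (cobj X i) e1) else 0\<^sub>m 0 (cdim X j))
      \<in> chain_maps A2 X (shift (- i) P2)"
    and "(\<lambda>j. if j + - i = 0 then p * act (cobj X i) e2 else 0\<^sub>m 0 (cdim X j)) \<in> chain_maps A2 X (shift (- i) S2)"
proof -
  note M = cpxs_mod[OF X, of i]
  note [simp] = cpxs_dims[OF X] right_module_dims[OF cpxs_mod[OF X] carrier_A2] p
  have r: "(p * act (cobj X i) a) * cdif X (i - 1) = 0\<^sub>m 1 (cdim X (i - 1))" for a
  proof -
    have "(p * act (cobj X i) a) * cdif X (i - 1) = p * (cdif X (i - 1) * act (cobj X (i - 1)) a)"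
      by (simp add: mat_assoc dif_act(2)[OF X])
    also have "\<dots> = (p * cdif X (i - 1)) * act (cobj X (i - 1)) a" by (simp add: mat_assoc)
    finally show ?thesis by (simp add: dp)
  qed
  have z: "colb (p * act (cobj X i) al) (p * act (cobj X i) e1) * cdif X (- (- i) - 1)
      = 0\<^sub>m (mdim (path_module [E2, Alpha])) (cdim X (- (- i) - 1))"
    by (simp add: block_mult r block_zero)
  have z': "(p * act (cobj X i) e2) * cdif X (- (- i) - 1) = 0\<^sub>m (mdim (path_module [E2])) (cdim X (- (- i) - 1))"
    by (simp add: r)
  show "(\<lambda>j. if j + - i = 0 then colb (p * act (cobj X i) al) (p * act (cobj X i) e1) else 0\<^sub>m 0 (cdim X j))
      \<in> chain_maps A2 X (shift (- i) P2)"
    unfolding P2_def by (rule to_stalk_chain_map[OF right_module_path_modules(3) X _ z]) (use functional_hom(1)[OF M p] in simp)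
  show "(\<lambda>j. if j + - i = 0 then p * act (cobj X i) e2 else 0\<^sub>m 0 (cdim X j)) \<in> chain_maps A2 X (shift (- i) S2)"
    unfolding S2_def by (rule to_stalk_chain_map[OF right_module_path_modules(2) X _ z']) (use functional_hom(2)[OF M p] in simp)
qed

text \<open>The first case: a cocycle \<open>x\<close> at the vertex 2 whose image under the arrow is not a coboundary.  A functional
  detecting the image defines a map to the injective module \<open>P\<^sub>2\<close>, which is a retraction of the map from \<open>P\<^sub>2\<close>
  defined by \<open>x\<close>.\<close>

lemma summand_P2:
  fixes X :: "('k::field a2, 'k) cpx"
  assumes X: "X \<in> cpxs A2" and x: "dim_row x = cdim X i" "dim_col x = 1" and dx: "cdif X i * x = 0\<^sub>m (cdim X (i + 1)) 1"
    and ex: "act (cobj X i) e2 * x = x"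
    and n: "\<And>v. dim_row v = cdim X (i - 1) \<Longrightarrow> dim_col v = 1 \<Longrightarrow> act (cobj X i) al * x \<noteq> cdif X (i - 1) * v"
  shows "nonzero_summand A2 (shift (- i) P2) X"
proof -
  note M = cpxs_mod[OF X, of i]
  note [simp] = cpxs_dims[OF X] right_module_dims[OF cpxs_mod[OF X] carrier_A2] x
  have ld: "dim_row (act (cobj X i) al * x) = dim_row (cdif X (i - 1))" "dim_col (act (cobj X i) al * x) = 1" by simp_all
  obtain p where p: "dim_row p = 1" "dim_col p = cdim X i" "p * cdif X (i - 1) = 0\<^sub>m 1 (cdim X (i - 1))"
      "p * (act (cobj X i) al * x) = 1\<^sub>m 1"
    using fredholm_alternative[OF ld] n by (metis cpxs_dims[OF X] diff_add_cancel)
  note [simp] = p(1,2)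
  let ?f = "\<lambda>j. if j + - i = 0 then rowb x (act (cobj X i) al * x) else 0\<^sub>m (cdim X j) 0"
  let ?g = "\<lambda>j. if j + - i = 0 then colb (p * act (cobj X i) al) (p * act (cobj X i) e1) else 0\<^sub>m 0 (cdim X j)"
  note c = act_column[OF M x(1)]
  have z: "act (cobj X i) e1 * x = 0\<^sub>m (cdim X i) 1" using c(7) ex by simp
  have one: "colb (p * act (cobj X i) al) (p * act (cobj X i) e1) * rowb x (act (cobj X i) al * x) = 1\<^sub>m (1 + 1)"
    by (simp only: block_mult(6) dim_rowb dim_colb index_mult_mat p x right_module_dims[OF M carrier_A2] mat_assoc c z
        right_mult_zero_mat' block_zero(4))
  have "?g \<circ>\<^sub>c ?f = chain_id (shift (- i) P2)"
  proof
    fix j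
    show "(?g \<circ>\<^sub>c ?f) j = chain_id (shift (- i) P2) j"
      using one by (auto simp: chain_comp_def chain_id_def P_simps simp del: shift_simps intro!: eq_matI)
  qed
  then show ?thesis
    using quasi_iso_id[OF P_cpxs(2)]
    by (intro nonzero_summandI[OF P_cpxs(2) P_cpxs(2) P_not_acyclic(2) element_chain_map(1)[OF X x dx ex]
          functional_chain_map(1)[OF X p(1-3)]]) simp
qed

text \<open>The second case: \<open>x\<close> at the vertex 2 is not a coboundary, but its image under the arrow is.  Then \<open>x\<close>
  and a cochain bounding its image define a map from the projective resolution of \<open>S\<^sub>2\<close>.\<close>

lemma summand_S2:
  fixes X :: "('k::field a2, 'k) cpx"
  assumes X: "X \<in> cpxs A2" and x: "dim_row x = cdim X i" "dim_col x = 1" and dx: "cdif X i * x = 0\<^sub>m (cdim X (i + 1)) 1"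
    and ex: "act (cobj X i) e2 * x = x"
    and n: "\<And>v. dim_row v = cdim X (i - 1) \<Longrightarrow> dim_col v = 1 \<Longrightarrow> x \<noteq> cdif X (i - 1) * v"
    and y0: "dim_row y0 = cdim X (i - 1)" "dim_col y0 = 1" "act (cobj X i) al * x = cdif X (i - 1) * y0"
  shows "nonzero_summand A2 (cone (shift (- i) P1) (shift (- i) P2) (inc (- i))) X"
proof -
  note M = cpxs_mod[OF X, of i]
  note [simp] = cpxs_dims[OF X] right_module_dims[OF cpxs_mod[OF X] carrier_A2] x y0(1,2)
  note c = act_column[OF M x(1)]
  have xd: "dim_row x = dim_row (cdif X (i - 1))" by simp
  obtain p where p: "dim_row p = 1" "dim_col p = cdim X i" "p * cdif X (i - 1) = 0\<^sub>m 1 (cdim X (i - 1))"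
      "p * x = 1\<^sub>m 1"
    using fredholm_alternative[OF xd x(2)] n by (metis cpxs_dims[OF X] diff_add_cancel)
  note [simp] = p(1,2)
  define y where "y = act (cobj X (i - 1)) e1 * y0"
  have y: "dim_row y = cdim X (i - 1)" "dim_col y = 1" by (simp_all add: y_def)
  have ey: "act (cobj X (i - 1)) e1 * y = y" unfolding y_def by (rule act_column(5)[OF cpxs_mod[OF X] y0(1)])
  have dy: "cdif X (i - 1) * y = act (cobj X i) al * x"
    unfolding y_def by (simp add: dif_act_column(2)[OF X] y0(3)[symmetric] c)
  let ?P = "shift (- i) (P1 :: ('k a2, 'k) cpx)" and ?S = "shift (- i) (S2 :: ('k a2, 'k) cpx)"
  let ?f = "\<lambda>j. if j + - i = 0 then rowb x (act (cobj X i) al * x) else 0\<^sub>m (cdim X j) 0"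
  let ?g = "\<lambda>j. if j + - i = 0 then p * act (cobj X i) e2 else 0\<^sub>m 0 (cdim X j)"
  let ?h = "\<lambda>j. if j + - i = 0 then y else 0\<^sub>m (cdim X (j - 1)) 0"
  have f: "?f \<in> chain_maps A2 (shift (- i) P2) X" by (rule element_chain_map(1)[OF X x dx ex])
  have g: "?g \<in> chain_maps A2 X ?S" by (rule functional_chain_map(2)[OF X p(1-3)])
  have hm: "?h j \<in> mod_hom A2 (cobj ?P j) (cobj X (j - 1))" for j
  proof (cases "j + - i = 0")
    case True
    then have "j = i" by simp
    then show ?thesis using element_hom(2)[OF cpxs_mod[OF X] y ey] by (simp add: P_simps del: shift_simps)
  next
    case False
    then show ?thesis using mod_hom_zero[OF right_module_zero_mod cpxs_mod[OF X], of "j - 1"]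
      by (simp add: P_simps del: shift_simps)
  qed
  note hd = mod_hom_dims[OF hm]
  have Pd: "m * cdif ?P j = 0\<^sub>m (dim_row m) (cdim ?P j)" if "dim_col m = cdim ?P (j + 1)" for m j
    unfolding P1_def stalk_simps(2) by (rule right_mult_zero_mat') (simp add: that P1_def)
  have e: "?f j * inc (- i) j = cdif X (j - 1) * ?h j + ?h (j + 1) * cdif ?P j" for j
  proof (cases "j + - i = 0")
    case True
    then have j: "j = i" by simp
    have "?h (j + 1) * cdif ?P j = 0\<^sub>m (cdim X j) 1" using hd[of "j + 1"] j by (subst Pd) (simp_all add: P_simps del: shift_simps)
    moreover have "?f j * inc (- i) j = act (cobj X i) al * x"
      using j by (simp add: inc_def block_mult sc_simps(4,5)[symmetric] mat_cancel del: One_nat_def)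
    ultimately show ?thesis using j dy by (simp add: mat_cancel)
  next
    case False
    have "?h (j + 1) * cdif ?P j = 0\<^sub>m (cdim X j) 0" using hd[of "j + 1"] False by (subst Pd) (simp_all add: P_simps del: shift_simps)
    then show ?thesis using False by (simp add: inc_def mat_cancel)
  qed
  let ?F = "\<lambda>j. rowb (?h (j + 1)) (?f j)"
  have F: "?F \<in> chain_maps A2 (cone ?P (shift (- i) P2) (inc (- i))) X"
    by (rule cone_map[OF P_cpxs(1,2) X inc_chain_map f hm e])
  have C: "cone ?P (shift (- i) P2) (inc (- i)) \<in> cpxs A2" by (rule cone_cpxs[OF P_cpxs(1,2) inc_chain_map])
  have gf: "?g j * ?f j = prj (- i) j" for j
  proof (cases "j + - i = 0")
    case True
    have "(p * act (cobj X i) e2) * rowb x (act (cobj X i) al * x) = rowb (1\<^sub>m 1) (0\<^sub>m 1 1)"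
      by (simp only: block_mult(3) index_mult_mat p x right_module_dims[OF M carrier_A2] mat_assoc c ex right_mult_zero_mat')
    then show ?thesis using True by (simp add: prj_def sc_simps(4,5)[symmetric] del: One_nat_def)
  qed (simp add: prj_def)
  have "?g \<circ>\<^sub>c ?F \<in> quasi_isos A2 (cone ?P (shift (- i) P2) (inc (- i))) ?S"
  proof (rule cone_inc_quasi_iso[OF chain_comp_chain_map[OF C X P_cpxs(3) F g]])
    fix j
    have "dim_row (?h (j + 1)) = cdim X j" using hd(1)[of "j + 1"] by simp
    then show "(?g \<circ>\<^sub>c ?F) j = rowb (?g j * ?h (j + 1)) (prj (- i) j)"
      unfolding chain_comp_def gf[symmetric] by (intro block_mult(3)) (auto simp: chain_map_dims[OF g] chain_map_dims[OF f])
    show "dim_row (?g j * ?h (j + 1)) = cdim ?S j" "dim_col (?g j * ?h (j + 1)) = cdim ?P (j + 1)"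
      using chain_map_dims(1)[OF g, of j] hd(2)[of "j + 1"] by (simp_all del: shift_simps)
  qed
  then show ?thesis by (rule nonzero_summandI[OF C P_cpxs(3) P_not_acyclic(3) F g])
qed

lemma colb_split:
  fixes m :: "'k::comm_ring_1 mat"
  assumes "dim_row m = n + k"
  shows "m = colb (rowb (1\<^sub>m n) (0\<^sub>m n k) * m) (rowb (0\<^sub>m k n) (1\<^sub>m k) * m)"
proof -
  have "colb (rowb (1\<^sub>m n) (0\<^sub>m n k)) (rowb (0\<^sub>m k n) (1\<^sub>m k)) = (1\<^sub>m (n + k) :: 'k mat)"
    by (auto intro!: eq_matI simp: rowb_def colb_def)
  then have "m = colb (rowb (1\<^sub>m n) (0\<^sub>m n k)) (rowb (0\<^sub>m k n) (1\<^sub>m k)) * m" using assms by simp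
  then show ?thesis using assms by (simp add: block_mult)
qed

text \<open>The third case: \<open>y\<close> at the vertex 1 is not a coboundary modulo the image of the cocycles at the
  vertex 2.  Then a functional detecting \<open>y\<close> extends to a map into the injective resolution of \<open>P\<^sub>1\<close>.\<close>

lemma summand_P1:
  fixes X :: "('k::field a2, 'k) cpx"
  assumes X: "X \<in> cpxs A2" and y: "dim_row y = cdim X i" "dim_col y = 1" and dy: "cdif X i * y = 0\<^sub>m (cdim X (i + 1)) 1"
    and ey: "act (cobj X i) e1 * y = y"
    and n: "\<And>v z. dim_row v = cdim X (i - 1) \<Longrightarrow> dim_col v = 1 \<Longrightarrow> dim_row z = cdim X i \<Longrightarrow> dim_col z = 1 \<Longrightarrow>
      cdif X i * z = 0\<^sub>m (cdim X (i + 1)) 1 \<Longrightarrow> y \<noteq> cdif X (i - 1) * v + act (cobj X i) al * z"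
  shows "nonzero_summand A2 (shift (- i) P1) X"
proof -
  note M = cpxs_mod[OF X, of i]
  note [simp] = cpxs_dims[OF X] right_module_dims[OF cpxs_mod[OF X] carrier_A2] y
  let ?L = "act (cobj X i) al" and ?E = "act (cobj X (i + 1)) e2"
  let ?m = "cdim X (i - 1)" and ?n = "cdim X i" and ?n' = "cdim X (i + 1)"
  \<comment> \<open>Solvability of \<open>M (v, z) = (y, 0)\<close> means \<open>y = d v + \<alpha> z\<close> where \<open>e\<^sub>2 z\<close> is a cocycle, and \<open>\<alpha> z = \<alpha> e\<^sub>2 z\<close>.\<close>
  let ?M = "four_block_mat (cdif X (i - 1)) ?L (0\<^sub>m ?n' ?m) (?E * cdif X i)"
  have Md: "dim_row ?M = ?n + ?n'" "dim_col ?M = ?m + ?n" by simp_all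
  have yd: "dim_row (colb y (0\<^sub>m ?n' 1)) = dim_row ?M" "dim_col (colb y (0\<^sub>m ?n' 1)) = 1" by simp_all
  obtain p where p: "dim_row p = 1" "dim_col p = ?n + ?n'" "p * ?M = 0\<^sub>m 1 (?m + ?n)" "p * colb y (0\<^sub>m ?n' 1) = 1\<^sub>m 1"
  proof (rule fredholm_alternative[OF yd])
    fix v assume v: "dim_row v = dim_col ?M" "dim_col v = 1" "colb y (0\<^sub>m ?n' 1) = ?M * v"
    define v1 where "v1 = rowb (1\<^sub>m ?m) (0\<^sub>m ?m ?n) * v"
    define v2 where "v2 = rowb (0\<^sub>m ?n ?m) (1\<^sub>m ?n) * v"
    have vs: "v = colb v1 v2" unfolding v1_def v2_def by (rule colb_split) (simp add: v(1))
    have [simp]: "dim_row v1 = ?m" "dim_col v1 = 1" "dim_row v2 = ?n" "dim_col v2 = 1" by (simp_all add: v1_def v2_def v(2))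
    have "?M * v = colb (cdif X (i - 1) * v1 + ?L * v2) (?E * (cdif X i * v2))"
      unfolding vs by (simp add: block_mult mat_cancel mat_assoc)
    then have "colb y (0\<^sub>m ?n' 1) = colb (cdif X (i - 1) * v1 + ?L * v2) (?E * (cdif X i * v2))" using v(3) by simp
    then have 1: "y = cdif X (i - 1) * v1 + ?L * v2" and 2: "0\<^sub>m ?n' 1 = ?E * (cdif X i * v2)"
      by (simp_all add: block_eq)
    have "cdif X i * (act (cobj X i) e2 * v2) = 0\<^sub>m ?n' 1" by (simp add: dif_act_column(1)[OF X] 2[symmetric])
    moreover have "?L * (act (cobj X i) e2 * v2) = ?L * v2" by (rule act_column(4)[OF M]) simp
    ultimately show thesis using n[of v1 "act (cobj X i) e2 * v2"] 1 by simp
  next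
    fix p assume "dim_row p = 1" "dim_col p = dim_row ?M" "p * ?M = 0\<^sub>m 1 (dim_col ?M)" "p * colb y (0\<^sub>m ?n' 1) = 1\<^sub>m 1"
    then show thesis using that unfolding Md by blast
  qed
  define q where "q = p * colb (1\<^sub>m ?n) (0\<^sub>m ?n' ?n)"
  define s where "s = p * colb (0\<^sub>m ?n ?n') (1\<^sub>m ?n')"
  have ps: "p = rowb q s" unfolding q_def s_def by (rule rowb_split) (simp add: p(2))
  have q: "dim_row q = 1" "dim_col q = ?n" and sd: "dim_row s = 1" "dim_col s = ?n'" by (simp_all add: q_def s_def p)
  note [simp] = q sd
  have "rowb (q * cdif X (i - 1)) (q * ?L + s * (?E * cdif X i)) = rowb (0\<^sub>m 1 ?m) (0\<^sub>m 1 ?n)"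
    using p(3) unfolding ps by (simp add: block_mult mat_cancel block_zero)
  then have qd: "q * cdif X (i - 1) = 0\<^sub>m 1 ?m" and qs: "q * ?L + s * (?E * cdif X i) = 0\<^sub>m 1 ?n"
    by (simp_all add: block_eq)
  have qy: "q * y = 1\<^sub>m 1" using p(4) unfolding ps by (simp add: block_mult mat_cancel)
  have "q * ?L = (q * ?L + s * (?E * cdif X i)) + - (s * (?E * cdif X i))" by (simp add: mat_add_ac mat_cancel)
  then have qL: "q * ?L = - (s * ?E) * cdif X i" unfolding qs by (simp add: mat_cancel mat_uminus mat_assoc)
  let ?P = "shift (- i) (P1 :: ('k a2, 'k) cpx)" and ?S = "shift (- i) (S2 :: ('k a2, 'k) cpx)"
  let ?f = "\<lambda>j. if j + - i = 0 then y else 0\<^sub>m (cdim X j) 0"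
  let ?g = "\<lambda>j. if j + - i = 0 then colb (q * ?L) (q * act (cobj X i) e1) else 0\<^sub>m 0 (cdim X j)"
  let ?h = "\<lambda>j. if j - 1 + - i = 0 then - (s * ?E) else 0\<^sub>m 0 (cdim X j)"
  have f: "?f \<in> chain_maps A2 ?P X" by (rule element_chain_map(2)[OF X y dy ey])
  have g: "?g \<in> chain_maps A2 X (shift (- i) P2)" by (rule functional_chain_map(1)[OF X q qd])
  have hm: "?h j \<in> mod_hom A2 (cobj X j) (cobj ?S (j - 1))" for j
  proof (cases "j - 1 + - i = 0")
    case True
    then have j: "j = i + 1" by simp
    have "- (s * ?E) \<in> mod_hom A2 (cobj X (i + 1)) (path_module [E2])"
      by (rule mod_hom_uminus[OF cpxs_mod[OF X] right_module_path_modules(2) functional_hom(2)[OF cpxs_mod[OF X] sd]])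
    then show ?thesis using j by (simp add: P_simps del: shift_simps)
  next
    case False
    then show ?thesis using mod_hom_zero[OF cpxs_mod[OF X, of j] right_module_zero_mod]
      by (simp add: P_simps del: shift_simps)
  qed
  note hd = mod_hom_dims[OF hm]
  have Sd: "cdif ?S j * m = 0\<^sub>m (cdim ?S (j + 1)) (dim_col m)" if "dim_row m = cdim ?S j" for m j
    unfolding S2_def stalk_simps(2) by (rule left_mult_zero_mat') (simp add: that S2_def)
  have e: "prj (- i) j * ?g j = cdif ?S (j - 1) * ?h j + ?h (j + 1) * cdif X j" for j
  proof -
    have S0: "cdif ?S (j - 1) * ?h j = 0\<^sub>m (cdim ?S j) (cdim X j)"
      using Sd[of "?h j" "j - 1"] hd[of j] by simp
    have 1: "?h (j + 1) * cdif X j = prj (- i) j * ?g j"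
    proof (cases "j + - i = 0")
      case True
      then have j: "j = i" by simp
      have "prj (- i) j * ?g j = q * ?L"
        using j by (simp add: prj_def block_mult sc_simps(4,5)[symmetric] mat_cancel del: One_nat_def)
      then show ?thesis using j qL by simp
    qed (simp add: prj_def)
    have "dim_row (prj (- i) j * ?g j) = cdim ?S j" "dim_col (prj (- i) j * ?g j) = cdim X j"
      by (auto simp: prj_dims(1) chain_map_dims(2)[OF g] simp del: shift_simps)
    then show ?thesis unfolding S0 1 by (simp add: mat_cancel del: shift_simps)
  qed
  let ?G = "\<lambda>j. colb (?g j) (- ?h j)"
  have G: "?G \<in> chain_maps A2 X (fib (shift (- i) P2) ?S (prj (- i)))"
    by (rule fib_map[OF X P_cpxs(2,3) g prj_chain_map hm e])
  have D: "fib (shift (- i) P2) ?S (prj (- i)) \<in> cpxs A2" by (rule fib_cpxs[OF P_cpxs(2,3) prj_chain_map])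
  have gf: "?g j * ?f j = inc (- i) j" for j
  proof (cases "j + - i = 0")
    case True
    have "colb (q * ?L) (q * act (cobj X i) e1) * y = colb (0\<^sub>m 1 1) (1\<^sub>m 1)"
    proof -
      have "?L * y = 0\<^sub>m ?n 1" using act_column(9)[OF M y(1)] ey by simp
      then show ?thesis by (simp add: block_mult mat_assoc ey qy)
    qed
    then show ?thesis using True by (simp add: inc_def sc_simps(4,5)[symmetric] del: One_nat_def)
  qed (simp add: inc_def)
  have "?G \<circ>\<^sub>c ?f \<in> quasi_isos A2 ?P (fib (shift (- i) P2) ?S (prj (- i)))"
  proof (rule fib_prj_quasi_iso[OF chain_comp_chain_map[OF P_cpxs(1) X D f G]])
    fix j
    show "(?G \<circ>\<^sub>c ?f) j = colb (inc (- i) j) (- ?h j * ?f j)"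
      unfolding chain_comp_def gf[symmetric]
      by (intro block_mult(2)) (auto simp: chain_map_dims[OF g] chain_map_dims(1)[OF f] hd(2))
    show "dim_row (- ?h j * ?f j) = cdim ?S (j - 1)" "dim_col (- ?h j * ?f j) = cdim ?P j"
      using hd(1)[of j] chain_map_dims(2)[OF f, of j] by (simp_all del: shift_simps)
  qed
  moreover have "\<not> acyclic_cpx (fib (shift (- i) P2) ?S (prj (- i)))"
    using qi_equiv_acyclic[OF fib_prj] P_not_acyclic(1) by blast
  ultimately show ?thesis by (intro nonzero_summandI[OF P_cpxs(1) D _ f G])
qed

lemma not_acyclic_column:
  fixes A :: "('k::field, 'a) module"
  assumes X: "X \<in> cpxs A" and a: "\<not> acyclic_cpx X"
  obtains i x where "dim_row x = cdim X i" "dim_col x = 1" "cdif X i * x = 0\<^sub>m (cdim X (i + 1)) 1"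
    "\<And>v. dim_row v = cdim X (i - 1) \<Longrightarrow> dim_col v = 1 \<Longrightarrow> x \<noteq> cdif X (i - 1) * v"
proof -
  note [simp] = cpxs_dims[OF X]
  obtain i z where z: "z \<in> cocycles X i" "z \<notin> coboundaries X i" using a by (auto simp: acyclic_cpx_iff[OF X])
  have zd: "dim_vec z = cdim X i" and dz: "cdif X i *\<^sub>v z = 0\<^sub>v (cdim X (i + 1))" using z(1) by (auto simp: cocycles_iff)
  define x where "x = mat (cdim X i) 1 (\<lambda>(r, _). z $ r)"
  have c: "col x 0 = z" using zd by (auto simp: x_def intro!: eq_vecI)
  have [simp]: "dim_row x = cdim X i" "dim_col x = 1" by (simp_all add: x_def)
  have m: "col (m * y) 0 = m *\<^sub>v col y 0" if "dim_col y = 1" for m y :: "'k mat"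
    using that by (auto intro!: eq_vecI)
  have "col (cdif X i * x) 0 = 0\<^sub>v (cdim X (i + 1))" by (simp only: m[OF \<open>dim_col x = 1\<close>] c dz)
  then have "(cdif X i * x) $$ (r, 0) = 0" if "r < cdim X (i + 1)" for r
    using that index_col[of r "cdif X i * x" 0] by simp
  then have "cdif X i * x = 0\<^sub>m (cdim X (i + 1)) 1" by (intro eq_matI) (simp_all del: index_mult_mat(1))
  moreover have "x \<noteq> cdif X (i - 1) * v" if v: "dim_row v = cdim X (i - 1)" "dim_col v = 1" for v
  proof
    assume "x = cdif X (i - 1) * v"
    then have "z = cdif X (i - 1) *\<^sub>v col v 0" using m[OF v(2)] c by metis
    then show False using z(2) coboundariesI[of "col v 0" X i z] v(1) by simp
  qed
  ultimately show ?thesis by (intro that[of x i]) simp_all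
qed

text \<open>Let \<open>x\<close> be a cocycle that is not a coboundary.  If its part at the vertex 2 is not a coboundary, it generates a
  summand \<open>P\<^sub>2\<close> or \<open>S\<^sub>2\<close>, depending on its image under the arrow.  Otherwise its part at the vertex 1 is not
  a coboundary, and it either gives a summand \<open>P\<^sub>1\<close>, or is cohomologous to the image under the arrow of a
  cocycle, which then generates a summand \<open>P\<^sub>2\<close>.\<close>

theorem A2_summand:
  fixes X :: "('k::field a2, 'k) cpx"
  assumes X: "X \<in> cpxs A2" and a: "\<not> acyclic_cpx X"
  obtains C k where "nonzero_summand A2 C X"
    "qi_equiv A2 C (shift k P1) \<or> qi_equiv A2 C (shift k P2) \<or> qi_equiv A2 C (shift k S2)"
proof -
  note [simp] = cpxs_dims[OF X] right_module_dims[OF cpxs_mod[OF X] carrier_A2]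
  obtain i x where x: "dim_row x = cdim X i" "dim_col x = 1" and dx: "cdif X i * x = 0\<^sub>m (cdim X (i + 1)) 1"
    and nx: "\<And>v. dim_row v = cdim X (i - 1) \<Longrightarrow> dim_col v = 1 \<Longrightarrow> x \<noteq> cdif X (i - 1) * v"
    by (rule not_acyclic_column[OF X a]) blast
  note M = cpxs_mod[OF X, of i]
  let ?E1 = "act (cobj X i) e1" and ?E2 = "act (cobj X i) e2" and ?L = "act (cobj X i) al"
  let ?bd = "\<lambda>y. \<exists>v. dim_row v = cdim X (i - 1) \<and> dim_col v = 1 \<and> y = cdif X (i - 1) * v"
  have d: "cdif X i * (act (cobj X i) e * z) = 0\<^sub>m (cdim X (i + 1)) 1"
    if "dim_row z = cdim X i" "cdif X i * z = 0\<^sub>m (cdim X (i + 1)) 1" for e z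
    using that by (simp add: dif_act_column(1)[OF X])
  note found = that
  have generator_P2: thesis if z: "dim_row z = cdim X i" "dim_col z = 1" "cdif X i * z = 0\<^sub>m (cdim X (i + 1)) 1" "\<not> ?bd (?L * z)" for z
  proof -
    have "nonzero_summand A2 (shift (- i) P2) X"
      by (rule summand_P2[OF X, of "?E2 * z"])
        (use z d[OF z(1,3)] act_column[OF M z(1)] in auto)
    then show thesis using found[of "shift (- i) P2" "- i"] qi_equiv_refl[OF P_cpxs(2)] by blast
  qed
  show thesis
  proof (cases "?bd (?E2 * x)")
    case False
    show thesis
    proof (cases "?bd (?L * x)")
      case True
      then obtain y0 where y0: "dim_row y0 = cdim X (i - 1)" "dim_col y0 = 1" "?L * x = cdif X (i - 1) * y0" by blast
      have "nonzero_summand A2 (cone (shift (- i) P1) (shift (- i) P2) (inc (- i))) X"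
        by (rule summand_S2[OF X, of "?E2 * x" i y0])
          (use x False y0 d[OF x(1) dx] act_column[OF M x(1)] in auto)
      then show thesis using that cone_inc[of "- i"] by blast
    qed (rule generator_P2[OF x dx])
  next
    case True
    then obtain v where v: "dim_row v = cdim X (i - 1)" "dim_col v = 1" "?E2 * x = cdif X (i - 1) * v" by blast
    have nb: "\<not> ?bd (?E1 * x)"
    proof
      assume "?bd (?E1 * x)"
      then obtain w where w: "dim_row w = cdim X (i - 1)" "dim_col w = 1" "?E1 * x = cdif X (i - 1) * w" by blast
      have "x = cdif X (i - 1) * w + cdif X (i - 1) * v" using act_column(10)[OF M x(1)] v(3) w(3) by simp
      then have "x = cdif X (i - 1) * (w + v)" using v w by (simp add: mat_distrib)
      then show False using nx[of "w + v"] v w by simp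
    qed
    show thesis
    proof (cases "\<exists>v z. dim_row v = cdim X (i - 1) \<and> dim_col v = 1 \<and> dim_row z = cdim X i \<and> dim_col z = 1 \<and>
        cdif X i * z = 0\<^sub>m (cdim X (i + 1)) 1 \<and> ?E1 * x = cdif X (i - 1) * v + ?L * z")
      case True
      then obtain v z where vz: "dim_row v = cdim X (i - 1)" "dim_col v = 1" "dim_row z = cdim X i" "dim_col z = 1"
        "cdif X i * z = 0\<^sub>m (cdim X (i + 1)) 1" "?E1 * x = cdif X (i - 1) * v + ?L * z" by blast
      have "\<not> ?bd (?L * z)"
      proof
        assume "?bd (?L * z)"
        then obtain w where w: "dim_row w = cdim X (i - 1)" "dim_col w = 1" "?L * z = cdif X (i - 1) * w" by blast
        then have "?E1 * x = cdif X (i - 1) * (v + w)" using vz by (simp add: mat_distrib)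
        then have "?bd (?E1 * x)" using vz(1,2) w(1,2) by (intro exI[of _ "v + w"]) simp
        then show False using nb by simp
      qed
      then show thesis by (rule generator_P2[OF vz(3-5)])
    next
      case False
      have "nonzero_summand A2 (shift (- i) P1) X"
        by (rule summand_P1[OF X, of "?E1 * x"]) (use x d[OF x(1) dx] act_column[OF M x(1)] False in auto)
      then show thesis using that[of "shift (- i) P1" "- i"] qi_equiv_refl[OF P_cpxs(1)] by blast
    qed
  qed
qed

section \<open>The indecomposable objects\<close>

lemma sc_mult_vec: "dim_vec x = 1 \<Longrightarrow> sc c *\<^sub>v x = vec 1 (\<lambda>_. c * x $ 0)"
  by (auto intro!: eq_vecI simp: sc_def scalar_prod_def)

lemma vec_1_nonzero: "dim_vec x = 1 \<Longrightarrow> x \<noteq> 0\<^sub>v 1 \<Longrightarrow> x $ 0 \<noteq> 0"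
  by (auto intro!: eq_vecI)

text \<open>Each of the three modules has a simple socle of dimension one, and every nonzero vector generates
  a submodule containing it.\<close>

lemma P_indecomposable:
  "indecomposable A2 (shift k (P1 :: ('k::field a2, 'k) cpx))" "indecomposable A2 (shift k (P2 :: ('k a2, 'k) cpx))"
  "indecomposable A2 (shift k (S2 :: ('k a2, 'k) cpx))"
proof -
  let ?v = "vec 1 (\<lambda>_. 1) :: 'k vec"
  have v0: "?v \<noteq> 0\<^sub>v 1"
  proof
    assume "?v = 0\<^sub>v 1"
    then have "?v $ 0 = 0\<^sub>v 1 $ 0" by (rule arg_cong)
    then show False by simp
  qed
  have g: "sc (inverse (x $ 0)) *\<^sub>v x = ?v" if "dim_vec x = 1" "x \<noteq> 0\<^sub>v 1" for x :: "'k vec"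
    using vec_1_nonzero[OF that] by (simp only: sc_mult_vec[OF that(1)]) simp
  show "indecomposable A2 (shift k (P1 :: ('k a2, 'k) cpx))"
    unfolding P1_def
  proof (rule stalk_indecomposable[OF right_module_path_modules(1), where v="?v"])
    fix x :: "'k vec" assume x: "dim_vec x = mdim (path_module [E1] :: ('k a2, 'k) rmod)" "x \<noteq> 0\<^sub>v (mdim (path_module [E1] :: ('k a2, 'k) rmod))"
    show "\<exists>a\<in>carrier A2. act (path_module [E1]) a *\<^sub>v x = ?v"
      using g[of x] x by (intro bexI[of _ "\<lambda>_. inverse (x $ 0)"]) (simp_all add: path_module_act)
  qed (use v0 in simp_all)
  show "indecomposable A2 (shift k (S2 :: ('k a2, 'k) cpx))"
    unfolding S2_def
  proof (rule stalk_indecomposable[OF right_module_path_modules(2), where v="?v"])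
    fix x :: "'k vec" assume x: "dim_vec x = mdim (path_module [E2] :: ('k a2, 'k) rmod)" "x \<noteq> 0\<^sub>v (mdim (path_module [E2] :: ('k a2, 'k) rmod))"
    show "\<exists>a\<in>carrier A2. act (path_module [E2]) a *\<^sub>v x = ?v"
      using g[of x] x by (intro bexI[of _ "\<lambda>_. inverse (x $ 0)"]) (simp_all add: path_module_act)
  qed (use v0 in simp_all)
  show "indecomposable A2 (shift k (P2 :: ('k a2, 'k) cpx))"
    unfolding P2_def
  proof (rule stalk_indecomposable[OF right_module_path_modules(3), where v="0\<^sub>v 1 @\<^sub>v ?v"])
    have "(0\<^sub>v 1 @\<^sub>v ?v) $ 1 = 1" by simp
    moreover have "0\<^sub>v (1 + 1) $ 1 = (0 :: 'k)" by simp
    ultimately have "0\<^sub>v 1 @\<^sub>v ?v \<noteq> 0\<^sub>v (1 + 1)" by (metis zero_neq_one)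
    then show "0\<^sub>v 1 @\<^sub>v ?v \<noteq> 0\<^sub>v (mdim (path_module [E2, Alpha] :: ('k a2, 'k) rmod))" by simp
    fix x :: "'k vec" assume x: "dim_vec x = mdim (path_module [E2, Alpha] :: ('k a2, 'k) rmod)"
      "x \<noteq> 0\<^sub>v (mdim (path_module [E2, Alpha] :: ('k a2, 'k) rmod))"
    then have "dim_vec x = 1 + 1" by simp
    then obtain y z where x': "x = y @\<^sub>v z" and d: "dim_vec y = 1" "dim_vec z = 1" by (rule vec_appendE)
    have m: "act (path_module [E2, Alpha]) a *\<^sub>v x = (sc (a E2) *\<^sub>v y) @\<^sub>v (sc (a Alpha) *\<^sub>v y + sc (a E1) *\<^sub>v z)" for a :: "'k a2"
      unfolding path_module_act x' by (simp add: block_vec d vec_ring mat_vec_zero)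
    show "\<exists>a\<in>carrier A2. act (path_module [E2, Alpha]) a *\<^sub>v x = 0\<^sub>v 1 @\<^sub>v ?v"
    proof (cases "y = 0\<^sub>v 1")
      case False
      have "act (path_module [E2, Alpha]) (\<lambda>p. if p = Alpha then inverse (y $ 0) else 0) *\<^sub>v x = 0\<^sub>v 1 @\<^sub>v ?v"
        unfolding m using g[OF d(1) False] d by (simp add: sc_vec vec_ring)
      then show ?thesis by (intro bexI) simp_all
    next
      case True
      have "z \<noteq> 0\<^sub>v 1"
      proof
        assume "z = 0\<^sub>v 1"
        then have "x = 0\<^sub>v (1 + 1)" unfolding x' True by (simp only: append_vec_simps)
        then show False using x(2) by simp
      qed
      have "act (path_module [E2, Alpha]) (\<lambda>p. if p = E1 then inverse (z $ 0) else 0) *\<^sub>v x = 0\<^sub>v 1 @\<^sub>v ?v"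
        unfolding m using g[OF d(2) \<open>z \<noteq> 0\<^sub>v 1\<close>] d by (simp add: sc_vec vec_ring)
      then show ?thesis by (intro bexI) simp_all
    qed
  qed simp
qed

lemma A2_indecomposable:
  fixes X :: "('k::field a2, 'k) cpx"
  assumes i: "indecomposable A2 X"
  shows "\<exists>k. qi_equiv A2 X (shift k P1) \<or> qi_equiv A2 X (shift k P2) \<or> qi_equiv A2 X (shift k S2)"
proof -
  have X: "X \<in> cpxs A2" "\<not> acyclic_cpx X" using i unfolding indecomposable_def zero_object_iff by simp_all
  obtain C k where C: "nonzero_summand A2 C X"
    "qi_equiv A2 C (shift k P1) \<or> qi_equiv A2 C (shift k P2) \<or> qi_equiv A2 C (shift k S2)"
    by (rule A2_summand[OF X])
  have XC: "qi_equiv A2 X C" by (rule nonzero_summand_indecomposable[OF C(1) i])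
  show ?thesis
    using C(2) by (elim disjE) (blast dest: qi_equiv_trans[OF XC])+
qed

lemma mem_shifts_of: "X \<in> shifts_of A M K \<longleftrightarrow> (\<exists>k\<in>K. qi_equiv A X (shift k M))"
  by (simp only: shifts_of_def isomorphic_iff mem_Collect_eq)

lemma indecs_A2:
  fixes U :: "('k::field a2, 'k) cpx set"
  assumes iso: "\<And>X Y. X \<in> U \<Longrightarrow> qi_equiv A2 X Y \<Longrightarrow> Y \<in> U"
  shows "indecs A2 U = shifts_of A2 P1 {k. shift k P1 \<in> U} \<union> shifts_of A2 P2 {k. shift k P2 \<in> U} \<union>
    shifts_of A2 S2 {k. shift k S2 \<in> U}"
proof (rule equalityI)
  show "indecs A2 U \<subseteq> shifts_of A2 P1 {k. shift k P1 \<in> U} \<union> shifts_of A2 P2 {k. shift k P2 \<in> U} \<union>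
    shifts_of A2 S2 {k. shift k S2 \<in> U}"
  proof (rule subsetI)
    fix X assume "X \<in> indecs A2 U"
    then have X: "X \<in> U" "indecomposable A2 X" by (simp_all add: indecs_def)
    have m: "X \<in> shifts_of A2 M {k. shift k M \<in> U}" if "qi_equiv A2 X (shift k M)" for k and M :: "('k a2, 'k) cpx"
      unfolding mem_shifts_of by (rule bexI[of _ k], rule that, rule CollectI, rule iso[OF X(1) that])
    obtain k where "qi_equiv A2 X (shift k P1) \<or> qi_equiv A2 X (shift k P2) \<or> qi_equiv A2 X (shift k S2)"
      using A2_indecomposable[OF X(2)] by (rule exE)
    then show "X \<in> shifts_of A2 P1 {k. shift k P1 \<in> U} \<union> shifts_of A2 P2 {k. shift k P2 \<in> U} \<union>
        shifts_of A2 S2 {k. shift k S2 \<in> U}"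
    proof (elim disjE)
      assume "qi_equiv A2 X (shift k P1)"
      from m[OF this] show "X \<in> shifts_of A2 P1 {k. shift k P1 \<in> U} \<union> shifts_of A2 P2 {k. shift k P2 \<in> U} \<union>
        shifts_of A2 S2 {k. shift k S2 \<in> U}" by (rule UnI1[OF UnI1])
    next
      assume "qi_equiv A2 X (shift k P2)"
      from m[OF this] show "X \<in> shifts_of A2 P1 {k. shift k P1 \<in> U} \<union> shifts_of A2 P2 {k. shift k P2 \<in> U} \<union>
        shifts_of A2 S2 {k. shift k S2 \<in> U}" by (rule UnI1[OF UnI2])
    next
      assume "qi_equiv A2 X (shift k S2)"
      from m[OF this] show "X \<in> shifts_of A2 P1 {k. shift k P1 \<in> U} \<union> shifts_of A2 P2 {k. shift k P2 \<in> U} \<union>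
        shifts_of A2 S2 {k. shift k S2 \<in> U}" by (rule UnI2)
    qed
  qed
next
  have m: "X \<in> indecs A2 U" if x: "X \<in> shifts_of A2 M {k. shift k M \<in> U}" and i: "\<And>k. indecomposable A2 (shift k M)"
    for X M :: "('k a2, 'k) cpx"
  proof -
    have "\<exists>k. shift k M \<in> U \<and> qi_equiv A2 X (shift k M)"
      using x unfolding mem_shifts_of Bex_def mem_Collect_eq .
    then obtain k where k: "shift k M \<in> U" "qi_equiv A2 X (shift k M)" by (elim exE conjE)
    have e: "qi_equiv A2 (shift k M) X" by (rule qi_equiv_sym[OF k(2)])
    show ?thesis unfolding indecs_def by (intro CollectI conjI iso[OF k(1) e] indecomposable_qi_equiv[OF e i])
  qed
  have "shifts_of A2 P1 {k. shift k P1 \<in> U} \<subseteq> indecs A2 U" by (rule subsetI, rule m[where M=P1]) (assumption, rule P_indecomposable(1))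
  moreover have "shifts_of A2 P2 {k. shift k P2 \<in> U} \<subseteq> indecs A2 U" by (rule subsetI, rule m[where M=P2]) (assumption, rule P_indecomposable(2))
  moreover have "shifts_of A2 S2 {k. shift k S2 \<in> U} \<subseteq> indecs A2 U" by (rule subsetI, rule m[where M=S2]) (assumption, rule P_indecomposable(3))
  ultimately show "shifts_of A2 P1 {k. shift k P1 \<in> U} \<union> shifts_of A2 P2 {k. shift k P2 \<in> U} \<union>
      shifts_of A2 S2 {k. shift k S2 \<in> U} \<subseteq> indecs A2 U" by (intro Un_least)
qed

section \<open>Shifts of the standard aisle\<close>

lemma shift_standard_aisle:
  "X \<in> shift n ` standard_aisle A \<longleftrightarrow> X \<in> cpxs A \<and> (\<forall>i>- n. cohomology_zero X i)"
proof
  assume "X \<in> shift n ` standard_aisle A"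
  then obtain Y where Y: "Y \<in> cpxs A" "\<forall>i>0. cohomology_zero Y i" "X = shift n Y" by (auto simp: standard_aisle_def)
  then show "X \<in> cpxs A \<and> (\<forall>i>- n. cohomology_zero X i)"
    by (simp add: shift_cpxs cohomology_zero_def cohomology_shift[OF Y(1)])
next
  assume X: "X \<in> cpxs A \<and> (\<forall>i>- n. cohomology_zero X i)"
  then have "shift (- n) X \<in> standard_aisle A"
    by (simp add: standard_aisle_def shift_cpxs cohomology_zero_def cohomology_shift[of X A])
  moreover have "X = shift n (shift (- n) X)" by (simp add: shift_shift shift_0)
  ultimately show "X \<in> shift n ` standard_aisle A" by blast
qed

lemma P_standard_aisle:
  "shift k P1 \<in> shift n ` (standard_aisle A2 :: ('k::field a2, 'k) cpx set) \<longleftrightarrow> n \<le> k"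
  "shift k P2 \<in> shift n ` (standard_aisle A2 :: ('k::field a2, 'k) cpx set) \<longleftrightarrow> n \<le> k"
  "shift k S2 \<in> shift n ` (standard_aisle A2 :: ('k::field a2, 'k) cpx set) \<longleftrightarrow> n \<le> k"
proof -
  have e: "(\<forall>i>- n. i + k \<noteq> 0) \<longleftrightarrow> n \<le> k"
  proof
    assume "\<forall>i>- n. i + k \<noteq> 0"
    then show "n \<le> k" by (auto dest: spec[of _ "- k"])
  qed auto
  have z: "cohomology_zero (shift k P1 :: ('k a2, 'k) cpx) i \<longleftrightarrow> i + k \<noteq> 0"
    "cohomology_zero (shift k P2 :: ('k a2, 'k) cpx) i \<longleftrightarrow> i + k \<noteq> 0"
    "cohomology_zero (shift k S2 :: ('k a2, 'k) cpx) i \<longleftrightarrow> i + k \<noteq> 0" for i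
    unfolding P1_def P2_def S2_def
    by (rule stalk_cohomology_zero[OF right_module_path_modules(1)], simp,
      rule stalk_cohomology_zero[OF right_module_path_modules(3)], simp,
      rule stalk_cohomology_zero[OF right_module_path_modules(2)], simp)
  show "shift k P1 \<in> shift n ` (standard_aisle A2 :: ('k a2, 'k) cpx set) \<longleftrightarrow> n \<le> k"
    "shift k P2 \<in> shift n ` (standard_aisle A2 :: ('k a2, 'k) cpx set) \<longleftrightarrow> n \<le> k"
    "shift k S2 \<in> shift n ` (standard_aisle A2 :: ('k a2, 'k) cpx set) \<longleftrightarrow> n \<le> k"
    unfolding shift_standard_aisle z e by (simp_all only: P_cpxs simp_thms)
qed

lemma indecs_shift_standard_aisle:
  "indecs A2 (shift n ` (standard_aisle A2 :: ('k::field a2, 'k) cpx set)) =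
    shifts_of A2 P1 {n..} \<union> shifts_of A2 P2 {n..} \<union> shifts_of A2 S2 {n..}"
proof -
  have "Y \<in> shift n ` standard_aisle A2" if "X \<in> shift n ` standard_aisle A2" "qi_equiv A2 X Y" for X Y :: "('k a2, 'k) cpx"
    using that(1) qi_equiv_cohomology_zero[OF that(2)] that(2) unfolding shift_standard_aisle by (auto simp: qi_equiv_def)
  from indecs_A2[OF this] show ?thesis by (simp only: P_standard_aisle atLeast_def)
qed

section \<open>Classification of the aisles\<close>

text \<open>Nothing maps from the aisle to the truncation \<open>Y\<close> of an object; but if \<open>Y\<close> were nonzero, one of its
  summands would lie in the aisle.\<close>

lemma all_indecomposables_in_aisle:
  fixes U :: "('k::field a2, 'k) cpx set"
  assumes t: "t_structure A2 U V" and a: "\<And>k. shift k P1 \<in> U" "\<And>k. shift k P2 \<in> U" "\<And>k. shift k S2 \<in> U"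
  shows "U = cpxs A2"
proof (intro equalityI subsetI)
  show "X \<in> cpxs A2" if "X \<in> U" for X by (rule t_cpx[OF t that])
  fix Z assume Z: "Z \<in> cpxs (A2 :: ('k, 'k a2) module)"
  obtain Y where Y: "Y \<in> cpxs A2" "\<And>W. W \<in> U \<Longrightarrow> hom_vanishes A2 W Y" "hom_vanishes A2 Z Y \<Longrightarrow> Z \<in> U"
    by (rule aisle_truncation[OF t Z]) blast
  have "acyclic_cpx Y"
  proof (rule ccontr)
    assume "\<not> acyclic_cpx Y"
    then obtain C k where C: "nonzero_summand A2 C Y"
      "qi_equiv A2 C (shift k P1) \<or> qi_equiv A2 C (shift k P2) \<or> qi_equiv A2 C (shift k S2)"
      by (rule A2_summand[OF Y(1)])
    have "C \<in> U" using C(2) t_iso[OF t a(1) qi_equiv_sym] t_iso[OF t a(2) qi_equiv_sym] t_iso[OF t a(3) qi_equiv_sym] by blast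
    then show False using nonzero_summand_hom[OF Y(1) C(1)] Y(2) by blast
  qed
  then show "Z \<in> U" by (rule Y(3)[OF hom_vanishes_acyclic[OF Z Y(1)]])
qed

lemma up_closed_int:
  fixes K :: "int set"
  assumes "\<And>k. k \<in> K \<Longrightarrow> k + 1 \<in> K"
  shows "K = {} \<or> K = UNIV \<or> (\<exists>n. K = {n..})"
proof -
  have up: "l \<in> K" if "k \<in> K" "k \<le> l" for k l
    using that(2,1) by (induction rule: int_ge_induct) (auto intro: assms)
  show ?thesis
  proof (cases "\<exists>l. \<forall>k\<in>K. l \<le> k")
    case True
    then obtain l where l: "\<And>k. k \<in> K \<Longrightarrow> l \<le> k" by blast
    show ?thesis
    proof (cases "K = {}")
      case False
      then obtain k where k: "k \<in> K" by blast
      define m where "m = (LEAST m. l + int m \<in> K)"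
      have "l + int (nat (k - l)) \<in> K" using k l[OF k] by simp
      then have m: "l + int m \<in> K" unfolding m_def by (rule LeastI)
      have "l + int m \<le> j" if "j \<in> K" for j
      proof -
        have "l + int (nat (j - l)) \<in> K" using that l[OF that] by simp
        then have "m \<le> nat (j - l)" unfolding m_def by (rule Least_le)
        then show ?thesis using l[OF that] by linarith
      qed
      then have "K = {l + int m..}" using up[OF m] by auto
      then show ?thesis by blast
    qed simp
  next
    case False
    have "l \<in> K" for l
    proof -
      obtain k where "k \<in> K" "k < l" using False by (meson linorder_not_less)
      then show ?thesis using up[of k l] by simp
    qed
    then show ?thesis by blast
  qed
qed

lemma up_closed_int_cases:
  fixes K :: "int set"
  assumes "\<And>k. k \<in> K \<Longrightarrow> k + 1 \<in> K"
  obtains "K = {}" | "K = UNIV" | n where "K = {n..}"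
  using up_closed_int[OF assms] by blast

text \<open>Two nonempty sets force the third to be nonempty.  If all are nonempty, each threshold is bounded by the
  larger of the other two, measured on the line of the indecomposable objects; so the two largest thresholds
  belong to neighbours on the line.\<close>

lemma three_up_closed_sets:
  fixes A B C :: "int set"
  assumes A: "\<And>k. k \<in> A \<Longrightarrow> k + 1 \<in> A" and B: "\<And>k. k \<in> B \<Longrightarrow> k + 1 \<in> B" and C: "\<And>k. k \<in> C \<Longrightarrow> k + 1 \<in> C"
    and b: "\<And>k. k \<in> A \<Longrightarrow> k \<in> C \<Longrightarrow> k \<in> B" and c: "\<And>k. k \<in> B \<Longrightarrow> k + 1 \<in> A \<Longrightarrow> k \<in> C"
    and a: "\<And>k. k \<in> C \<Longrightarrow> k + 1 \<in> B \<Longrightarrow> k + 1 \<in> A"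
  obtains "B = {}" "C = {}" | "A = {}" "C = {}" | "A = {}" "B = {}" | "A = UNIV" "B = UNIV" "C = UNIV"
    | n where "B = {n..}" "C = {n..}" "{n..} \<subseteq> A"
    | n where "A = {n..}" "B = {n..}" "{n..} \<subseteq> C"
    | n where "A = {n..}" "C = {n - 1..}" "{n..} \<subseteq> B"
proof -
  have tail: "\<exists>n. {n..} \<subseteq> K" if "\<And>k. k \<in> K \<Longrightarrow> k + 1 \<in> K" "K \<noteq> {}" for K :: "int set"
    using up_closed_int[OF that(1)] that(2) by blast
  consider "A = {}" | "B = {}" | "C = {}" | "A \<noteq> {}" "B \<noteq> {}" "C \<noteq> {}" by blast
  then show thesis
  proof cases
    case 1
    have "B = {} \<or> C = {}"
    proof (rule ccontr)
      assume "\<not> (B = {} \<or> C = {})"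
      then obtain m n where "{m..} \<subseteq> B" "{n..} \<subseteq> C" using tail[OF B] tail[OF C] by blast
      then have "max m n + 1 \<in> B" "max m n \<in> C" by (auto simp: subset_iff)
      then show False using a 1 by blast
    qed
    then show ?thesis using that(2,3) 1 by blast
  next
    case 2
    have "A = {} \<or> C = {}"
    proof (rule ccontr)
      assume "\<not> (A = {} \<or> C = {})"
      then obtain m n where "{m..} \<subseteq> A" "{n..} \<subseteq> C" using tail[OF A] tail[OF C] by blast
      then have "max m n \<in> A" "max m n \<in> C" by (auto simp: subset_iff)
      then show False using b 2 by blast
    qed
    then show ?thesis using that(1,3) 2 by blast
  next
    case 3
    have "A = {} \<or> B = {}"
    proof (rule ccontr)
      assume "\<not> (A = {} \<or> B = {})"
      then obtain m n where "{m..} \<subseteq> A" "{n..} \<subseteq> B" using tail[OF A] tail[OF B] by blast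
      then have "max m n \<in> B" "max m n + 1 \<in> A" by (auto simp: subset_iff)
      then show False using c 3 by blast
    qed
    then show ?thesis using that(1,2) 3 by blast
  next
    case 4
    show ?thesis
    proof (rule up_closed_int_cases[OF A])
      assume "A = {}"
      then show thesis using 4 by simp
    next
      assume "A = UNIV"
      then have "C = B" using b c by blast
      show thesis
        by (rule up_closed_int_cases[OF B]) (use 4 that(4,5) \<open>A = UNIV\<close> \<open>C = B\<close> in auto)
    next
      fix p assume p: "A = {p..}"
      show thesis
      proof (rule up_closed_int_cases[OF B])
        assume "B = {}"
        then show thesis using 4 by simp
      next
        assume u: "B = UNIV"
        have "C = {p - 1..}" using a c unfolding p u by (auto simp: algebra_simps)
        then show thesis using that(7) p u by blast
      next
        fix q assume q: "B = {q..}"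
        show thesis
        proof (rule up_closed_int_cases[OF C])
          assume "C = {}"
          then show thesis using 4 by simp
        next
          assume u: "C = UNIV"
          have "q \<le> p" using b[of p] p q u by simp
          moreover have "p \<le> q" using a[of "q - 1"] p q u by simp
          ultimately show thesis using that(6) p q u by auto
        next
          fix r assume r: "C = {r..}"
          have "q \<le> max p r" using b[of "max p r"] p q r by simp
          moreover have "r \<le> max q (p - 1)" using c[of "max q (p - 1)"] p q r by simp
          moreover have "p - 1 \<le> max r (q - 1)" using a[of "max r (q - 1)"] unfolding p q r atLeast_iff by linarith
          ultimately consider "q = r" "p \<le> q" | "p = q" "r \<le> p" | "r = p - 1" "q \<le> p" by linarith
          then show thesis using that(5-7) p q r by cases auto
        qed
      qed
    qed
  qed
qed

lemma shifts_of_Un: "shifts_of A M (K \<union> L) = shifts_of A M K \<union> shifts_of A M L"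
  unfolding shifts_of_def by blast

lemma shifts_of_empty [simp]: "shifts_of A M {} = {}"
  by (simp add: shifts_of_def)

lemma shifts_of_absorb: "K \<subseteq> L \<Longrightarrow> shifts_of A M K \<union> shifts_of A M L = shifts_of A M L"
  unfolding shifts_of_Un[symmetric] by (simp add: Un_absorb1)

lemma listed_aisleI:
  fixes U :: "('k::field a2, 'k) cpx set"
  shows "U = cpxs A2 \<Longrightarrow> listed_aisle U"
    and "indecs A2 U = shifts_of A2 P1 K \<Longrightarrow> listed_aisle U"
    and "indecs A2 U = shifts_of A2 S2 K \<Longrightarrow> listed_aisle U"
    and "indecs A2 U = shifts_of A2 P2 K \<Longrightarrow> listed_aisle U"
    and "indecs A2 U = indecs A2 (shift n ` standard_aisle A2) \<union> shifts_of A2 P1 K \<Longrightarrow> listed_aisle U"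
    and "indecs A2 U = indecs A2 (shift n ` standard_aisle A2) \<union> shifts_of A2 S2 K \<Longrightarrow> listed_aisle U"
    and "shift m S2 \<notin> shift n ` (standard_aisle A2 :: ('k a2, 'k) cpx set) \<Longrightarrow>
      indecs A2 U = indecs A2 (shift n ` standard_aisle A2) \<union> shifts_of A2 P2 K \<union> shifts_of A2 S2 {m} \<Longrightarrow>
      listed_aisle U"
  unfolding listed_aisle_def
  by (rule disjI1, erule disjI2,
      rule disjI2[OF disjI2[OF disjI1]], erule exI,
      rule disjI2[OF disjI2[OF disjI2[OF disjI1]]], erule exI,
      rule disjI2[OF disjI2[OF disjI2[OF disjI2[OF disjI1]]]], erule exI,
      rule disjI2[OF disjI2[OF disjI2[OF disjI2[OF disjI2[OF disjI1]]]]], rule exI, erule exI,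
      rule disjI2[OF disjI2[OF disjI2[OF disjI2[OF disjI2[OF disjI2[OF disjI1]]]]]], rule exI, erule exI,
      rule disjI2[OF disjI2[OF disjI2[OF disjI2[OF disjI2[OF disjI2[OF disjI2]]]]]], intro exI conjI, assumption, assumption)

theorem aisle_listed:
  fixes U :: "('k::field a2, 'k) cpx set"
  assumes "aisle A2 U"
  shows "listed_aisle U"
proof -
  obtain V where t: "t_structure A2 U V" using assms unfolding aisle_def by (rule exE)
  have up: "shift (k + 1) X \<in> U" if "shift k X \<in> U" for k and X :: "('k a2, 'k) cpx"
    using t_shift[OF t that] by (simp only: shift_shift add.commute)
  let ?A = "{k. shift k P1 \<in> U}" and ?B = "{k. shift k P2 \<in> U}" and ?C = "{k. shift k S2 \<in> U}"
  have ind: "indecs A2 U = shifts_of A2 P1 ?A \<union> shifts_of A2 P2 ?B \<union> shifts_of A2 S2 ?C"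
    by (rule indecs_A2) (rule t_iso[OF t])
  note std = indecs_shift_standard_aisle[where 'k='k]
  have sets: "a \<union> b = b \<Longrightarrow> x = b \<union> c \<union> d \<Longrightarrow> x = a \<union> c \<union> d \<union> b"
    "a \<union> b = b \<Longrightarrow> x = c \<union> d \<union> b \<Longrightarrow> x = c \<union> d \<union> a \<union> b"
    "a \<union> b = b \<Longrightarrow> x = c \<union> b \<union> (d \<union> y) \<Longrightarrow> x = c \<union> a \<union> d \<union> b \<union> y"
    for a b c d x y :: "('k a2, 'k) cpx set" by blast+
  show ?thesis
  proof (rule three_up_closed_sets[of ?A ?B ?C, unfolded mem_Collect_eq])
    assume "?B = {}" "?C = {}"
    with ind show ?thesis by (intro listed_aisleI(2)) (simp only: shifts_of_empty Un_empty_right)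
  next
    assume "?A = {}" "?C = {}"
    with ind show ?thesis by (intro listed_aisleI(4)) (simp only: shifts_of_empty Un_empty_right Un_empty_left)
  next
    assume "?A = {}" "?B = {}"
    with ind show ?thesis by (intro listed_aisleI(3)) (simp only: shifts_of_empty Un_empty_left)
  next
    assume e: "?A = UNIV" "?B = UNIV" "?C = UNIV"
    have "U = cpxs A2"
      by (rule all_indecomposables_in_aisle[OF t]) (use e[unfolded set_eq_iff] in simp_all)
    then show ?thesis by (rule listed_aisleI(1))
  next
    fix n assume e: "?B = {n..}" "?C = {n..}" "{n..} \<subseteq> ?A"
    show ?thesis
      by (rule listed_aisleI(5)[where n=n], unfold std) (rule sets(1)[OF shifts_of_absorb[OF e(3)] ind[unfolded e(1,2)]])
  next
    fix n assume e: "?A = {n..}" "?B = {n..}" "{n..} \<subseteq> ?C"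
    show ?thesis
      by (rule listed_aisleI(6)[where n=n], unfold std) (rule sets(2)[OF shifts_of_absorb[OF e(3)] ind[unfolded e(1,2)]])
  next
    fix n assume e: "?A = {n..}" "?C = {n - 1..}" "{n..} \<subseteq> ?B"
    have "{n - 1..} = {n..} \<union> {n - 1}" by auto
    then have s: "shifts_of A2 S2 {n - 1..} = shifts_of A2 S2 {n..} \<union> shifts_of A2 (S2 :: ('k a2, 'k) cpx) {n - 1}"
      by (simp only: shifts_of_Un)
    show ?thesis
    proof (rule listed_aisleI(7))
      show "shift (n - 1) S2 \<notin> shift n ` (standard_aisle A2 :: ('k a2, 'k) cpx set)" unfolding P_standard_aisle by simp
      show "indecs A2 U = indecs A2 (shift n ` standard_aisle A2) \<union> shifts_of A2 P2 ?B \<union> shifts_of A2 S2 {n - 1}"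
        unfolding std by (rule sets(3)[OF shifts_of_absorb[OF e(3)] ind[unfolded e(1,2) s]])
    qed
  qed (erule up | erule (1) aisle_between[OF t])+
qed

theorem proposition5p2:
  shows "(\<forall>(U :: ('k::field a2, 'k) cpx set) V.
            t_structure A2 U V \<and>
            (compatible A2 (path_elem E1) U \<or> compatible A2 (path_elem E2) U)
            \<longrightarrow> listed_aisle U)
       \<and> (\<forall>U :: ('k a2, 'k) cpx set. aisle A2 U \<longrightarrow> listed_aisle U)"
proof (intro conjI allI impI)
  fix U V :: "('k a2, 'k) cpx set"
  assume "t_structure A2 U V \<and> (compatible A2 (path_elem E1) U \<or> compatible A2 (path_elem E2) U)"
  then have "aisle A2 U" unfolding aisle_def by blast
  then show "listed_aisle U" by (rule aisle_listed)
qed (rule aisle_listed)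

end
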